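(* In the wavelet/Fourier setting described in the context, for $N\in\mathbb{N}$ let $G_N:\mathcal{H}\to\mathcal{T}_N$ be a sequence of perfect reconstruction methods with sampling ratio $\eta_G\ge 1$. If $\kappa(G_N)\le\theta$ for some $\theta\in(1,\infty)$ and all sufficiently large $N$, then $\eta_G\ge\eta(\theta)$, where $\eta(\theta)$ is the stable sampling ratio for generalized sampling.
   Context: $\mathbb{N}=\{1,2,\dots\}$, $\mathbb{Z}_+=\{0,1,2,\dots\}$. Work in $\mathcal{H}=L^2(\mathbb{R})$ with its usual inner product $\langle\cdot,\cdot\rangle$ and norm $\|\cdot\|$. Wavelets: $\phi$ is a scaling function generating a multiresolution analysis (MRA): closed subspaces $V_j\subset V_{j+1}$ ($j\in\mathbb{Z}$) of $L^2(\mathbb{R})$ with $f\in V_j\iff f(2\cdot)\in V_{j+1}$, $\bigcap_j V_j=\{0\}$, $\overline{\bigcup_j V_j}=L^2(\mathbb{R})$, and $\{\phi(\cdot-k):k\in\mathbb{Z}\}$ an orthonormal basis of $V_0$; $\psi$ is an associated wavelet (so $\{\psi(\cdot-k):k\in\mathbb{Z}\}$ is an orthonormal basis of the orthogonal complement of $V_0$ in $V_1$). It is assumed that $\mathrm{supp}(\phi)=\mathrm{supp}(\psi)=[0,a]$ with $a\ge 1$. Write $\phi_{j,k}=2^{j/2}\phi(2^j\cdot-k)$, $\psi_{j,k}=2^{j/2}\psi(2^j\cdot-k)$. Reconstruction space: $\Omega_a=\{\phi_{0,k}: |k|\le\lceil a\rceil-1\}\cup\{\psi_{j,k}: j\in\mathbb{Z}_+,\,-\lceil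 a\rceil+1\le k\le 2^j\lceil a\rceil-1\}$, enumerated as $\{\varphi_j\}_{j\in\mathbb{N}}$ by listing first the $\phi_{0,k}$ in increasing order of $k$, then the $\psi_{0,k}$ in increasing order of $k$, then the $\psi_{1,k}$ in increasing order of $k$, and so on. $\mathcal{T}=\overline{\mathrm{span}}\,\Omega_a$, $\mathcal{T}_N=\mathrm{span}\{\varphi_1,\dots,\varphi_N\}$. Sampling space: $T_1\ge\lceil a\rceil-1$ and $T_2\ge 2\lceil a\rceil-1$ are fixed, so that $\mathcal{T}\subset L^2[-T_1,T_2]$. For $0<\epsilon\le 1/(T_1+T_2)$ and $l\in\mathbb{Z}$, $$s_l^\epsilon=\sqrt{\epsilon}\,e^{2\pi i l\epsilon\,\cdot}\,\chi_{[-T_1/(\epsilon(T_1+T_2)),\,T_2/(\epsilon(T_1+T_2))]},$$ $\mathcal{S}_M^\epsilon=\mathrm{span}\{s_l^\epsilon: -\lfloor M/2\rfloor\le l\le\lceil M/2\rceil-1\}$, and $P_M=P_M^\epsilon$ is the orthogonal projection of $\mathcal{H}$ onto $\mathcal{S}_M^\epsilon$. The first $M$ samples of $f\in\mathcal{H}$ are $\hat f^{[M]}=(\langle f,s_l^\epsilon\rangle)_{-\lfloor M/2\rfloor\le l\le\lceil M/2\rceil-1}\in\mathbb{C}^M$. Stable sampling: $C_{N,M}=\inf\{\|P_M\varphi\|:\varphi\in\mathcal{T}_N,\|\varphi\|=1\}$; for $\theta\in(1,\infty)$, $\Theta(N;\theta)=\min\{M\in\mathbb{N}:1/C_{N,M}<\theta\}$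 (with $1/0=\infty$), and the stable sampling ratio is $\eta(\theta)=\limsup_{N\to\infty}\Theta(N;\theta)/N$. Methods: for each $N$, $G_N$ is a mapping $\mathcal{H}\to\mathcal{T}_N$ such that $G_N(f)$ depends only on the first $M=\Theta_G(N)$ samples $\hat f^{[M]}$ of $f$, where $\Theta_G(N)\in\mathbb{N}$ and $\Theta_G(N)\ge N$. It is perfect if $G_N(f)=f$ for all $f\in\mathcal{T}_N$. Its sampling ratio is $\eta_G=\limsup_{N\to\infty}\Theta_G(N)/N$, assumed finite. Its condition number is, with $M=\Theta_G(N)$, $$\kappa(G_N)=\sup_{f\in\mathcal{H}}\ \lim_{t\to0^+}\ \sup_{g\in\mathcal{H},\ 0<\|\hat g^{[M]}\|_{\ell^2}\le t}\frac{\|G_N(f+g)-G_N(f)\|}{\|\hat g^{[M]}\|_{\ell^2}} .$$ *)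

theory Defs
  imports "HOL-Analysis.Analysis"
begin

section \<open>The Hilbert space of square-integrable functions on the real line\<close>

definition square_integrable :: "(real \<Rightarrow> complex) \<Rightarrow> bool" where
  "square_integrable f \<longleftrightarrow>
     f \<in> borel_measurable lborel \<and> integrable lborel (\<lambda>x. (cmod (f x))\<^sup>2)"

lemma square_integrable_measurable [measurable_dest]:
  "square_integrable f \<Longrightarrow> f \<in> borel_measurable borel"
  by (simp add: square_integrable_def)

lemma square_integrable_0: "square_integrable (\<lambda>x. 0)"
  by (simp add: square_integrable_def)

lemma square_integrable_add:
  assumes "square_integrable f" "square_integrable g"
  shows "square_integrable (\<lambda>x. f x + g x)"
  unfolding square_integrable_def
proof
  note [measurable] = assms[THEN square_integrable_measurable]
  show "(\<lambda>x. f x + g x) \<in> borel_measurable lborel" by measurable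
  have bound: "(cmod (u + v))\<^sup>2 \<le> 2 * (cmod u)\<^sup>2 + 2 * (cmod v)\<^sup>2" for u v :: complex
  proof -
    have "(cmod (u + v))\<^sup>2 \<le> (cmod u + cmod v)\<^sup>2"
      by (simp add: norm_triangle_ineq power_mono)
    also have "\<dots> \<le> 2 * (cmod u)\<^sup>2 + 2 * (cmod v)\<^sup>2"
      using zero_le_power2[of "cmod u - cmod v"] by (simp add: power2_eq_square algebra_simps)
    finally show ?thesis .
  qed
  show "integrable lborel (\<lambda>x. (cmod (f x + g x))\<^sup>2)"
  proof (rule Bochner_Integration.integrable_bound)
    show "integrable lborel (\<lambda>x. 2 * (cmod (f x))\<^sup>2 + 2 * (cmod (g x))\<^sup>2)"
      using assms by (auto simp: square_integrable_def)
    show "AE x in lborel. norm ((cmod (f x + g x))\<^sup>2)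
            \<le> norm (2 * (cmod (f x))\<^sup>2 + 2 * (cmod (g x))\<^sup>2)"
      using bound by (intro AE_I2) (simp add: order_trans[OF _ abs_ge_self])
  qed measurable
qed

lemma square_integrable_cmult:
  assumes "square_integrable f"
  shows "square_integrable (\<lambda>x. c * f x)"
  using assms by (auto simp: square_integrable_def norm_mult power_mult_distrib)

lemma square_integrable_dyadic:
  assumes "square_integrable f"
  shows "square_integrable (\<lambda>x. f (2 powi j * x - b))"
  unfolding square_integrable_def
proof
  note [measurable] = assms[THEN square_integrable_measurable]
  show "(\<lambda>x. f (2 powi j * x - b)) \<in> borel_measurable lborel" by measurable
  have "integrable lborel (\<lambda>x. (\<lambda>x. (cmod (f x))\<^sup>2) (- b + 2 powi j * x))"
    using assms by (intro lborel_integrable_real_affine) (auto simp: square_integrable_def)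
  then show "integrable lborel (\<lambda>x. (cmod (f (2 powi j * x - b)))\<^sup>2)" by simp
qed

lemma borel_measurable_cnj [measurable]: "cnj \<in> borel_measurable borel"
  by (intro borel_measurable_continuous_onI continuous_intros)

lemma integrable_mult_cnj:
  assumes "square_integrable f" "square_integrable g"
  shows "integrable lborel (\<lambda>x. f x * cnj (g x))"
proof (rule Bochner_Integration.integrable_bound)
  note [measurable] = assms[THEN square_integrable_measurable]
  show "integrable lborel (\<lambda>x. (cmod (f x))\<^sup>2 + (cmod (g x))\<^sup>2)"
    using assms by (auto simp: square_integrable_def)
  have "u * v \<le> u\<^sup>2 + v\<^sup>2" if "u \<ge> 0" "v \<ge> 0" for u v :: real
    using sum_squares_bound[of u v] mult_nonneg_nonneg[OF that] by linarith
  then show "AE x in lborel. norm (f x * cnj (g x)) \<le> norm ((cmod (f x))\<^sup>2 + (cmod (g x))\<^sup>2)"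
    by (simp add: norm_mult)
  show "(\<lambda>x. f x * cnj (g x)) \<in> borel_measurable lborel" by measurable
qed

text \<open>Borel measurable representatives suffice: every Lebesgue measurable function agrees
  almost everywhere with a Borel measurable one.\<close>

quotient_type L2 = "real \<Rightarrow> complex" / partial:
  "\<lambda>f g. square_integrable f \<and> square_integrable g \<and> (AE x in lborel. f x = g x)"
  by (rule part_equivpI)
    (auto intro!: exI[of _ "\<lambda>x. 0"] square_integrable_0 sympI transpI)

lift_definition cscale :: "complex \<Rightarrow> L2 \<Rightarrow> L2" (infixr "*\<^sub>C" 75) is "\<lambda>c f x. c * f x"
  by (auto intro: square_integrable_cmult)

lift_definition cinner :: "L2 \<Rightarrow> L2 \<Rightarrow> complex" is "\<lambda>f g. LINT x|lborel. f x * cnj (g x)"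
  by (intro integral_cong_AE) (auto dest!: square_integrable_measurable)

text \<open>The topology of \<open>L2\<close> comes from the norm; the library's real inner product is the real part
  of \<open>cinner\<close>.\<close>

instantiation L2 :: real_inner
begin

lift_definition zero_L2 :: L2 is "\<lambda>x. 0"
  by (simp add: square_integrable_0)

lift_definition plus_L2 :: "L2 \<Rightarrow> L2 \<Rightarrow> L2" is "\<lambda>f g x. f x + g x"
  by (auto intro: square_integrable_add)

definition uminus_L2 :: "L2 \<Rightarrow> L2" where "- f = (- 1) *\<^sub>C f"
definition minus_L2 :: "L2 \<Rightarrow> L2 \<Rightarrow> L2" where "f - g = f + - (g :: L2)"
definition scaleR_L2 :: "real \<Rightarrow> L2 \<Rightarrow> L2" where "r *\<^sub>R f = complex_of_real r *\<^sub>C f"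

lift_definition norm_L2 :: "L2 \<Rightarrow> real" is "\<lambda>f. sqrt (LINT x|lborel. (cmod (f x))\<^sup>2)"
  by (intro arg_cong[where f = sqrt] integral_cong_AE) (auto dest!: square_integrable_measurable)

definition inner_L2 :: "L2 \<Rightarrow> L2 \<Rightarrow> real" where "f \<bullet> g = Re (cinner f g)"
definition dist_L2 :: "L2 \<Rightarrow> L2 \<Rightarrow> real" where "dist f g = norm (f - g :: L2)"
definition sgn_L2 :: "L2 \<Rightarrow> L2" where "sgn f = inverse (norm f) *\<^sub>R (f :: L2)"
definition uniformity_L2 :: "(L2 \<times> L2) filter" where
  "uniformity = (INF e\<in>{0 <..}. principal {(f, g :: L2). dist f g < e})"
definition open_L2 :: "L2 set \<Rightarrow> bool" where
  "open (U :: L2 set) = (\<forall>f\<in>U. eventually (\<lambda>(f', g). f' = f \<longrightarrow> g \<in> U) uniformity)"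

instance
proof
  fix f g h :: L2 and a b :: real
  show "f + g + h = f + (g + h)"
    by transfer (auto intro: square_integrable_add simp: add.assoc)
  show "f + g = g + f"
    by transfer (auto intro: square_integrable_add simp: add.commute)
  show "0 + f = f"
    by transfer auto
  show "- f + f = 0"
    unfolding uminus_L2_def
    by transfer (auto intro!: square_integrable_add square_integrable_0
        square_integrable_cmult[where c = "-1", simplified])
  show "f - g = f + - g" by (rule minus_L2_def)
  show "a *\<^sub>R (f + g) = a *\<^sub>R f + a *\<^sub>R g"
    unfolding scaleR_L2_def
    by transfer (auto intro!: square_integrable_add square_integrable_cmult simp: ring_distribs)
  show "(a + b) *\<^sub>R f = a *\<^sub>R f + b *\<^sub>R f"
    unfolding scaleR_L2_def
    by transfer (auto intro!: square_integrable_add square_integrable_cmult simp: ring_distribs)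
  show "a *\<^sub>R b *\<^sub>R f = (a * b) *\<^sub>R f"
    unfolding scaleR_L2_def
    by transfer (auto intro!: square_integrable_cmult simp: mult.assoc)
  show "1 *\<^sub>R f = f"
    unfolding scaleR_L2_def by transfer auto
  show "sgn f = inverse (norm f) *\<^sub>R f" by (rule sgn_L2_def)
  show "dist f g = norm (f - g)" by (rule dist_L2_def)
  show "(uniformity :: (L2 \<times> L2) filter) = (INF e\<in>{0 <..}. principal {(f, g). dist f g < e})"
    by (rule uniformity_L2_def)
  show "open U = (\<forall>f\<in>U. eventually (\<lambda>(f', g). f' = f \<longrightarrow> g \<in> U) uniformity)" for U :: "L2 set"
    by (rule open_L2_def)
  show "f \<bullet> g = g \<bullet> f"
    unfolding inner_L2_def
  proof transfer
    fix f g assume "square_integrable f \<and> square_integrable f \<and> (AE x in lborel. f x = f x)"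
      "square_integrable g \<and> square_integrable g \<and> (AE x in lborel. g x = g x)"
    have "(LINT x|lborel. g x * cnj (f x)) = (LINT x|lborel. cnj (f x * cnj (g x)))"
      by (simp add: mult.commute)
    also have "\<dots> = cnj (LINT x|lborel. f x * cnj (g x))"
      by (rule Bochner_Integration.integral_cnj)
    finally show "Re (LINT x|lborel. f x * cnj (g x)) = Re (LINT x|lborel. g x * cnj (f x))"
      by simp
  qed
  show "(f + g) \<bullet> h = f \<bullet> h + g \<bullet> h"
    unfolding inner_L2_def
    by transfer (simp add: ring_distribs integrable_mult_cnj)
  show "(a *\<^sub>R f) \<bullet> g = a * (f \<bullet> g)"
    unfolding inner_L2_def scaleR_L2_def
    by transfer (simp add: mult.assoc)
  have eq: "Re (cinner f f) = (norm f)\<^sup>2"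
    by transfer (simp add: complex_norm_square[symmetric] del: of_real_power)
  show "0 \<le> f \<bullet> f"
    by (simp add: inner_L2_def eq)
  have "norm f \<ge> 0" by transfer simp
  then show "norm f = sqrt (f \<bullet> f)"
    by (simp add: inner_L2_def eq)
  have "norm f = 0 \<longleftrightarrow> f = 0"
  proof transfer
    fix f assume f: "square_integrable f \<and> square_integrable f \<and> (AE x in lborel. f x = f x)"
    have "(LINT x|lborel. (cmod (f x))\<^sup>2) = 0 \<longleftrightarrow> (AE x in lborel. (cmod (f x))\<^sup>2 = 0)"
      using f by (intro integral_nonneg_eq_0_iff_AE) (auto simp: square_integrable_def)
    then show "sqrt (LINT x|lborel. (cmod (f x))\<^sup>2) = 0 \<longleftrightarrow>
        square_integrable f \<and> square_integrable (\<lambda>x. 0) \<and> (AE x in lborel. f x = 0)"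
      using f square_integrable_0 by simp
  qed
  then show "f \<bullet> f = 0 \<longleftrightarrow> f = 0"
    by (simp add: inner_L2_def eq)
qed

end

global_interpretation L2: vector_space cscale
  defines cspan = L2.span and csubspace = L2.subspace
proof
  fix a b :: complex and f g :: L2
  show "a *\<^sub>C (f + g) = a *\<^sub>C f + a *\<^sub>C g"
    by transfer (auto intro!: square_integrable_add square_integrable_cmult simp: ring_distribs)
  show "(a + b) *\<^sub>C f = a *\<^sub>C f + b *\<^sub>C f"
    by transfer (auto intro!: square_integrable_add square_integrable_cmult simp: ring_distribs)
  show "a *\<^sub>C b *\<^sub>C f = (a * b) *\<^sub>C f"
    by transfer (auto intro!: square_integrable_cmult simp: mult.assoc)
  show "1 *\<^sub>C f = f"
    by transfer auto
qed

definition orthonormal_basis :: "('i \<Rightarrow> L2) \<Rightarrow> L2 set \<Rightarrow> bool" where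
  "orthonormal_basis e U \<longleftrightarrow>
     (\<forall>i k. cinner (e i) (e k) = (if i = k then 1 else 0)) \<and> closure (cspan (range e)) = U"

definition orth_proj :: "L2 set \<Rightarrow> L2 \<Rightarrow> L2" where
  "orth_proj U f = (THE p. p \<in> U \<and> (\<forall>u\<in>U. cinner (f - p) u = 0))"

lift_definition dyadic_comp :: "int \<Rightarrow> int \<Rightarrow> L2 \<Rightarrow> L2" is
  "\<lambda>j k f x. f (2 powi j * x - of_int k)"
proof (intro conjI; (elim conjE)?)
  fix j k :: int and f g :: "real \<Rightarrow> complex"
  assume f: "square_integrable f" and g: "square_integrable g" and ae: "AE x in lborel. f x = g x"
  show "square_integrable (\<lambda>x. f (2 powi j * x - of_int k))"
    "square_integrable (\<lambda>x. g (2 powi j * x - of_int k))"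
    using f g by (auto intro: square_integrable_dyadic)
  note [measurable] = f[THEN square_integrable_measurable] g[THEN square_integrable_measurable]
  have "AE x in lborel. f (- of_int k + 2 powi j * x) = g (- of_int k + 2 powi j * x)"
    using ae by (intro AE_borel_affine) auto
  then show "AE x in lborel. f (2 powi j * x - of_int k) = g (2 powi j * x - of_int k)" by simp
qed

text \<open>Essential support: the least closed set off which the function vanishes almost everywhere.\<close>

lift_definition ess_support :: "L2 \<Rightarrow> real set" is
  "\<lambda>f. \<Inter>{C. closed C \<and> (AE x in lborel. x \<notin> C \<longrightarrow> f x = 0)}"
proof -
  fix f g :: "real \<Rightarrow> complex"
  assume "square_integrable f \<and> square_integrable g \<and> (AE x in lborel. f x = g x)"
  then have ae: "AE x in lborel. f x = g x" by simp
  have "(AE x in lborel. x \<notin> C \<longrightarrow> f x = 0) \<longleftrightarrow> (AE x in lborel. x \<notin> C \<longrightarrow> g x = 0)" for C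
  proof
    assume "AE x in lborel. x \<notin> C \<longrightarrow> f x = 0"
    with ae show "AE x in lborel. x \<notin> C \<longrightarrow> g x = 0" by eventually_elim simp
  next
    assume "AE x in lborel. x \<notin> C \<longrightarrow> g x = 0"
    with ae show "AE x in lborel. x \<notin> C \<longrightarrow> f x = 0" by eventually_elim simp
  qed
  then show "\<Inter>{C. closed C \<and> (AE x in lborel. x \<notin> C \<longrightarrow> f x = 0)} =
      \<Inter>{C. closed C \<and> (AE x in lborel. x \<notin> C \<longrightarrow> g x = 0)}" by simp
qed


section \<open>Wavelets and the reconstruction space\<close>

definition multiresolution_analysis :: "(int \<Rightarrow> L2 set) \<Rightarrow> L2 \<Rightarrow> bool" where
  "multiresolution_analysis V \<phi> \<longleftrightarrow>
     (\<forall>j. csubspace (V j) \<and> closed (V j)) \<and>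
     (\<forall>j. V j \<subseteq> V (j + 1)) \<and>
     (\<forall>j f. f \<in> V j \<longleftrightarrow> dyadic_comp 1 0 f \<in> V (j + 1)) \<and>
     (\<Inter>j. V j) = {0} \<and>
     closure (\<Union>j. V j) = UNIV \<and>
     orthonormal_basis (\<lambda>k. dyadic_comp 0 k \<phi>) (V 0)"

definition associated_wavelet :: "(int \<Rightarrow> L2 set) \<Rightarrow> L2 \<Rightarrow> bool" where
  "associated_wavelet V \<psi> \<longleftrightarrow>
     orthonormal_basis (\<lambda>k. dyadic_comp 0 k \<psi>) {f \<in> V 1. \<forall>g\<in>V 0. cinner f g = 0}"

text \<open>\<open>wavelet_atom \<phi> j k\<close> is the function \<open>2\<^sup>j\<^sup>/\<^sup>2 \<phi>(2\<^sup>j \<cdot> - k)\<close>.\<close>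

definition wavelet_atom :: "L2 \<Rightarrow> int \<Rightarrow> int \<Rightarrow> L2" where
  "wavelet_atom \<phi> j k = complex_of_real (2 powr (of_int j / 2)) *\<^sub>C dyadic_comp j k \<phi>"

definition wavelet_system :: "L2 \<Rightarrow> L2 \<Rightarrow> real \<Rightarrow> L2 set" where
  "wavelet_system \<phi> \<psi> a =
     {wavelet_atom \<phi> 0 k | k. \<bar>k\<bar> \<le> \<lceil>a\<rceil> - 1} \<union>
     {wavelet_atom \<psi> (int j) k | j k. - \<lceil>a\<rceil> + 1 \<le> k \<and> k \<le> 2 ^ j * \<lceil>a\<rceil> - 1}"

text \<open>The enumeration of \<open>wavelet_system\<close>: the list of the first \<open>J\<close> wavelet scales is a prefix of
  the list of the first \<open>J + 1\<close> ones, and it has length at least \<open>J\<close>, so that the \<open>n\<close>-th element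
  (counting from 1) can be read off from the list with \<open>J = n\<close>.\<close>

definition wavelet_list :: "L2 \<Rightarrow> L2 \<Rightarrow> real \<Rightarrow> nat \<Rightarrow> L2 list" where
  "wavelet_list \<phi> \<psi> a J =
     map (wavelet_atom \<phi> 0) [- \<lceil>a\<rceil> + 1 .. \<lceil>a\<rceil> - 1] @
     concat (map (\<lambda>j. map (wavelet_atom \<psi> (int j)) [- \<lceil>a\<rceil> + 1 .. 2 ^ j * \<lceil>a\<rceil> - 1]) [0..<J])"

definition wavelet_seq :: "L2 \<Rightarrow> L2 \<Rightarrow> real \<Rightarrow> nat \<Rightarrow> L2" where
  "wavelet_seq \<phi> \<psi> a n = wavelet_list \<phi> \<psi> a n ! (n - 1)"

lemma wavelet_list_append:
  "J \<le> K \<Longrightarrow> \<exists>zs. wavelet_list \<phi> \<psi> a K = wavelet_list \<phi> \<psi> a J @ zs"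
proof (induction K rule: dec_induct)
  case (step K)
  then show ?case by (auto simp: wavelet_list_def)
qed simp

lemma length_wavelet_list:
  assumes "a \<ge> 1"
  shows "J \<le> length (wavelet_list \<phi> \<psi> a J)"
proof (induction J)
  case (Suc J)
  have "1 \<le> \<lceil>a\<rceil>" using assms by linarith
  have "\<lceil>a\<rceil> * 1 \<le> \<lceil>a\<rceil> * 2 ^ J" using \<open>1 \<le> \<lceil>a\<rceil>\<close> by (intro mult_left_mono) auto
  then have "1 \<le> nat (\<lceil>a\<rceil> * 2 ^ J + \<lceil>a\<rceil> - 1)" using \<open>1 \<le> \<lceil>a\<rceil>\<close> by linarith
  then show ?case using Suc by (simp add: wavelet_list_def mult.commute)
qed simp

lemma wavelet_seq_eq:
  assumes "a \<ge> 1" "1 \<le> n" "n \<le> J"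
  shows "wavelet_seq \<phi> \<psi> a n = wavelet_list \<phi> \<psi> a J ! (n - 1)"
proof -
  obtain zs where "wavelet_list \<phi> \<psi> a J = wavelet_list \<phi> \<psi> a n @ zs"
    using wavelet_list_append[OF assms(3)] by blast
  moreover have "n - 1 < length (wavelet_list \<phi> \<psi> a n)"
    using length_wavelet_list[OF assms(1), of n] assms(2) by (meson diff_less le_trans not_le order_less_le_trans zero_less_one)
  ultimately show ?thesis by (simp add: wavelet_seq_def nth_append)
qed

lemma set_wavelet_list: "(\<Union>J. set (wavelet_list \<phi> \<psi> a J)) = wavelet_system \<phi> \<psi> a"
proof -
  have "\<exists>J. j < J" for j :: nat by blast
  then show ?thesis
    unfolding wavelet_list_def wavelet_system_def by (fastforce simp: abs_le_iff)
qed

lemma range_wavelet_seq: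
  assumes "a \<ge> 1"
  shows "wavelet_seq \<phi> \<psi> a ` {1..} = wavelet_system \<phi> \<psi> a"
proof (intro equalityI subsetI)
  fix f assume "f \<in> wavelet_seq \<phi> \<psi> a ` {1..}"
  then obtain n where n: "n \<ge> 1" "f = wavelet_seq \<phi> \<psi> a n" by auto
  have "n - 1 < length (wavelet_list \<phi> \<psi> a n)"
    using length_wavelet_list[OF assms, of n] n(1) by (meson diff_less le_trans not_le order_less_le_trans zero_less_one)
  then have "f \<in> set (wavelet_list \<phi> \<psi> a n)" by (simp add: n(2) wavelet_seq_def)
  then show "f \<in> wavelet_system \<phi> \<psi> a" using set_wavelet_list by blast
next
  fix f assume "f \<in> wavelet_system \<phi> \<psi> a"
  then obtain J where "f \<in> set (wavelet_list \<phi> \<psi> a J)" using set_wavelet_list by blast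
  then obtain i where i: "i < length (wavelet_list \<phi> \<psi> a J)" "f = wavelet_list \<phi> \<psi> a J ! i"
    by (metis in_set_conv_nth)
  define K where "K = max J (Suc i)"
  obtain zs where "wavelet_list \<phi> \<psi> a K = wavelet_list \<phi> \<psi> a J @ zs"
    using wavelet_list_append[of J K \<phi> \<psi> a] max.cobounded1[of J "Suc i"]
    unfolding K_def by blast
  then have "f = wavelet_list \<phi> \<psi> a K ! i" using i by (simp add: nth_append)
  also have "\<dots> = wavelet_seq \<phi> \<psi> a (Suc i)"
    using wavelet_seq_eq[OF assms, of "Suc i" K] by (simp add: K_def)
  finally show "f \<in> wavelet_seq \<phi> \<psi> a ` {1..}" by auto
qed


section \<open>The sampling space\<close>

lemma square_integrable_bounded_interval:
  assumes [measurable]: "g \<in> borel_measurable borel" and "\<And>x. cmod (g x) \<le> B"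
  shows "square_integrable (\<lambda>x. g x * indicator {c..d} x)"
  unfolding square_integrable_def
proof
  show "(\<lambda>x. g x * indicator {c..d} x) \<in> borel_measurable lborel" by measurable
  show "integrable lborel (\<lambda>x. (cmod (g x * indicator {c..d} x))\<^sup>2)"
  proof (rule Bochner_Integration.integrable_bound)
    show "integrable lborel (\<lambda>x. B\<^sup>2 * indicator {c..d} x :: real)"
      by (intro integrable_mult_right integrable_real_indicator) (auto simp: emeasure_lborel_Icc_eq)
    show "AE x in lborel. norm ((cmod (g x * indicator {c..d} x))\<^sup>2) \<le> norm (B\<^sup>2 * indicator {c..d} x :: real)"
      using assms(2) by (auto simp: indicator_def power_mono intro!: AE_I2)
  qed measurable
qed

lift_definition fourier_atom :: "real \<Rightarrow> real \<Rightarrow> real \<Rightarrow> int \<Rightarrow> L2" is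
  "\<lambda>T1 T2 \<epsilon> l x. complex_of_real (sqrt \<epsilon>) * exp (\<i> * complex_of_real (2 * pi * of_int l * \<epsilon> * x)) *
     indicator {- T1 / (\<epsilon> * (T1 + T2)) .. T2 / (\<epsilon> * (T1 + T2))} x"
  by (auto intro!: square_integrable_bounded_interval simp: norm_mult)


section \<open>Generalized sampling\<close>

text \<open>In the sequel \<open>w\<close> is a sequence of reconstruction vectors (the value at 0 is not used) and
  \<open>s\<close> a family of sampling vectors.\<close>

definition recon_space :: "(nat \<Rightarrow> L2) \<Rightarrow> nat \<Rightarrow> L2 set" where
  "recon_space w N = cspan (w ` {1..N})"

definition sample_index :: "nat \<Rightarrow> int set" where
  "sample_index M = {- \<lfloor>real M / 2\<rfloor> .. \<lceil>real M / 2\<rceil> - 1}"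

definition sampling_space :: "(int \<Rightarrow> L2) \<Rightarrow> nat \<Rightarrow> L2 set" where
  "sampling_space s M = cspan (s ` sample_index M)"

definition sample_norm :: "(int \<Rightarrow> L2) \<Rightarrow> nat \<Rightarrow> L2 \<Rightarrow> real" where
  "sample_norm s M f = L2_set (\<lambda>l. cmod (cinner f (s l))) (sample_index M)"

definition subspace_cos :: "(nat \<Rightarrow> L2) \<Rightarrow> (int \<Rightarrow> L2) \<Rightarrow> nat \<Rightarrow> nat \<Rightarrow> real" where
  "subspace_cos w s N M =
     Inf {norm (orth_proj (sampling_space s M) f) | f. f \<in> recon_space w N \<and> norm f = 1}"

definition stable_sampling_rate :: "(nat \<Rightarrow> L2) \<Rightarrow> (int \<Rightarrow> L2) \<Rightarrow> nat \<Rightarrow> real \<Rightarrow> nat" where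
  "stable_sampling_rate w s N \<theta> =
     (LEAST M. M \<ge> 1 \<and> 1 / ereal (subspace_cos w s N M) < ereal \<theta>)"

definition sampling_ratio :: "(nat \<Rightarrow> nat) \<Rightarrow> ereal" where
  "sampling_ratio \<Theta> = limsup (\<lambda>N. ereal (real (\<Theta> N) / real N))"

definition stable_sampling_ratio :: "(nat \<Rightarrow> L2) \<Rightarrow> (int \<Rightarrow> L2) \<Rightarrow> real \<Rightarrow> ereal" where
  "stable_sampling_ratio w s \<theta> = sampling_ratio (\<lambda>N. stable_sampling_rate w s N \<theta>)"

text \<open>\<open>\<Theta> N\<close> is the number of samples that \<open>G N\<close> uses.\<close>

definition reconstruction_method ::
    "(nat \<Rightarrow> L2) \<Rightarrow> (int \<Rightarrow> L2) \<Rightarrow> (nat \<Rightarrow> nat) \<Rightarrow> (nat \<Rightarrow> L2 \<Rightarrow> L2) \<Rightarrow> bool" where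
  "reconstruction_method w s \<Theta> G \<longleftrightarrow>
     (\<forall>N\<ge>1. \<Theta> N \<ge> N \<and>
        (\<forall>f. G N f \<in> recon_space w N) \<and>
        (\<forall>f g. (\<forall>l\<in>sample_index (\<Theta> N). cinner f (s l) = cinner g (s l)) \<longrightarrow> G N f = G N g))"

definition perfect :: "(nat \<Rightarrow> L2) \<Rightarrow> (nat \<Rightarrow> L2 \<Rightarrow> L2) \<Rightarrow> bool" where
  "perfect w G \<longleftrightarrow> (\<forall>N\<ge>1. \<forall>f\<in>recon_space w N. G N f = f)"

definition condition_number :: "(int \<Rightarrow> L2) \<Rightarrow> nat \<Rightarrow> (L2 \<Rightarrow> L2) \<Rightarrow> ereal" where
  "condition_number s M F =
     (SUP f. Lim (at_right 0) (\<lambda>t :: real.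
        SUP g \<in> {g. 0 < sample_norm s M g \<and> sample_norm s M g \<le> t}.
          ereal (norm (F (f + g) - F f) / sample_norm s M g)))"

end

theory Submission
  imports Defs "HOL-Complex_Analysis.Complex_Analysis" "HOL-Real_Asymp.Real_Asymp"
begin

text \<open>A perfect method with condition number at most \<open>\<theta>\<close> forces \<open>norm f \<le> \<theta> * sample_norm s (\<Theta> N) f\<close> on
  the reconstruction space, hence \<open>1 / subspace_cos \<le> \<theta>\<close>; the stable sampling rate asks for the strict
  inequality, so a slightly larger number of samples has to yield a strict gain.

  Write \<open>c = 1 / \<theta>\<^sup>2\<close>. Testing the inequality on modulated sums of fine scaling functions, whose symbols
  are concentrated Dirichlet kernels, gives the pointwise bound \<open>c \<le> Phi K0 \<xi>\<close> for the truncated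
  periodisation \<open>Phi K \<xi>\<close> of the squared Fourier transform of \<open>\<phi>\<close>. As that transform is entire, equality
  holds at finitely many \<open>\<xi>\<close> modulo 1 only, and \<open>Phi\<close> exceeds \<open>c\<close> by a power of the distance to them.

  If \<open>\<epsilon> * (3 * \<lceil>a\<rceil> - 2) < 1\<close>, there is room for a smooth cutoff, which transports the samples to a lattice
  \<open>1 / B\<close>, where the energy is an average of \<open>Phi\<close> over more points than can lie near the exceptional ones;
  the polynomial gain beats the rapidly decaying error. Otherwise the samples themselves are such a lattice,
  and a unit vector without gain has its symbol supported on the exceptional points. Its finest wavelet
  coefficients are then exponential sums with few frequencies that vanish on a long interval outside the
  index range, so they all vanish, and the vector descends to a fixed level, where its sampled energy
  tends to 1. For \<open>\<lceil>a\<rceil> = 1\<close> there is no such interval, but then \<open>\<phi>\<close> is the Haar function and \<open>Phi\<close> is explicit.\<close>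

section \<open>The complex inner product\<close>

text \<open>The limit superior leaves room for a larger slope: stability for
  \<open>M \<ge> \<eta> * N\<close> has to give strictness only for
  \<open>M \<ge> \<eta>' * N\<close> with some \<open>\<eta>' > \<eta>\<close>. All cutoffs
  \<open>K0 < K1 < K2\<close> live in that gap. Their size comes from the worst position of
  \<open>N\<close> within a level. Just above \<open>dimn n\<close>, which is about
  \<open>\<lceil>a\<rceil> * 2 ^ n\<close>, the reconstruction space already contains translates of
  \<open>\<phi>\<close> at scale \<open>Suc n\<close> near the origin, while the samples reach only
  the frequency \<open>\<epsilon> * M / 2\<close>, that is about
  \<open>\<epsilon> * \<eta> * \<lceil>a\<rceil> / 4\<close> in units of \<open>2 ^ Suc n\<close>.
  So the bound on \<open>Phi\<close> holds even for this small cutoff. The obstacle is that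
  \<open>Phi\<close> may touch \<open>c\<close>, which leaves no uniform gain to set against the
  loss of a change of lattice. That \<open>Phi\<close> cannot stay equal to \<open>c\<close> follows
  from Bessel's inequality for the values of the transform of \<open>\<phi>\<close> at the integers.
  The number \<open>3 * \<lceil>a\<rceil> - 2\<close> is the length of the window that carries the
  reconstruction space and \<open>1 / \<epsilon>\<close> that of a sampling period: a cutoff needs
  room between the two.\<close>

lemma cinner_add_left: "cinner (f + g) h = cinner f h + cinner g h"
  by transfer (simp add: ring_distribs integrable_mult_cnj)

lemma cinner_scale_left: "cinner (c *\<^sub>C f) g = c * cinner f g"
  by transfer (simp add: mult.assoc)

lemma cinner_commute: "cinner g f = cnj (cinner f g)"
proof transfer
  fix f g :: "real \<Rightarrow> complex"
  have "(LINT x|lborel. g x * cnj (f x)) = (LINT x|lborel. cnj (f x * cnj (g x)))"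
    by (simp add: mult.commute)
  also have "\<dots> = cnj (LINT x|lborel. f x * cnj (g x))"
    by (rule Bochner_Integration.integral_cnj)
  finally show "(LINT x|lborel. g x * cnj (f x)) = cnj (LINT x|lborel. f x * cnj (g x))" .
qed

lemma cinner_add_right: "cinner h (f + g) = cinner h f + cinner h g"
  unfolding cinner_commute[of h] by (simp add: cinner_add_left)

lemma cinner_scale_right: "cinner f (c *\<^sub>C g) = cnj c * cinner f g"
  unfolding cinner_commute[of f] by (simp add: cinner_scale_left)

lemma cinner_zero [simp]: "cinner 0 f = 0" "cinner f 0 = 0"
  using cinner_add_left[of 0 0 f] cinner_add_right[of f 0 0] by simp_all

lemma cinner_minus_left: "cinner (- f) g = - cinner f g"
  unfolding uminus_L2_def cinner_scale_left by simp

lemma cinner_minus_right: "cinner f (- g) = - cinner f g"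
  unfolding uminus_L2_def cinner_scale_right by simp

lemma cinner_diff_left: "cinner (f - g) h = cinner f h - cinner g h"
  unfolding minus_L2_def cinner_add_left cinner_minus_left by simp

lemma cinner_diff_right: "cinner h (f - g) = cinner h f - cinner h g"
  unfolding minus_L2_def cinner_add_right cinner_minus_right by simp

lemma cinner_sum_left: "cinner (\<Sum>i\<in>F. f i) g = (\<Sum>i\<in>F. cinner (f i) g)"
  by (induction F rule: infinite_finite_induct) (auto simp: cinner_add_left)

lemma cinner_sum_right: "cinner g (\<Sum>i\<in>F. f i) = (\<Sum>i\<in>F. cinner g (f i))"
  by (induction F rule: infinite_finite_induct) (auto simp: cinner_add_right)

lemma cinner_self: "cinner f f = complex_of_real ((norm f)\<^sup>2)"
proof -
  have "Im (cinner f f) = 0"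
    using arg_cong[OF cinner_commute[of f f], of Im] by simp
  moreover have "Re (cinner f f) = (norm f)\<^sup>2"
    using power2_norm_eq_inner[of f] by (simp add: inner_L2_def)
  ultimately show ?thesis by (simp add: complex_eq_iff)
qed

lemma norm_eq_one: "norm f = 1" if "cinner f f = 1"
proof -
  have "complex_of_real ((norm f)\<^sup>2) = complex_of_real 1" using that cinner_self[of f] by simp
  then have "(norm f)\<^sup>2 = 1" by (simp only: of_real_eq_iff)
  then show ?thesis using norm_ge_zero[of f] by (auto simp: power2_eq_1_iff simp del: norm_ge_zero)
qed

lemma mult_cnj_self: "z * cnj z = (complex_of_real (cmod z))\<^sup>2" "cnj z * z = (complex_of_real (cmod z))\<^sup>2"
  using complex_norm_square[of z] by (simp_all add: mult.commute)

lemma norm_cscale: "norm (c *\<^sub>C f) = cmod c * norm f"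
proof -
  have "complex_of_real ((norm (c *\<^sub>C f))\<^sup>2) = complex_of_real ((cmod c * norm f)\<^sup>2)"
    unfolding cinner_self[symmetric] cinner_scale_left cinner_scale_right
    by (simp add: cinner_self power_mult_distrib mult_cnj_self mult_ac)
  then have "(norm (c *\<^sub>C f))\<^sup>2 = (cmod c * norm f)\<^sup>2" by (simp only: of_real_eq_iff)
  then show ?thesis by (rule power2_eq_imp_eq) auto
qed

text \<open>Rotating \<open>f\<close> by the phase \<open>u\<close> makes the inner product real and
  nonnegative, so that the inequality for the real inner product applies.\<close>

lemma cauchy_schwarz: "cmod (cinner f g) \<le> norm f * norm g"
proof (cases "cinner f g = 0")
  case False
  define u where "u = cnj (cinner f g) / cmod (cinner f g)"
  have u: "cmod u = 1" using False by (simp add: u_def norm_divide)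
  have "cinner (u *\<^sub>C f) g = cmod (cinner f g)"
    using False by (simp add: u_def cinner_scale_left complex_norm_square[symmetric] power2_eq_square mult.commute)
  then have "cmod (cinner f g) = (u *\<^sub>C f) \<bullet> g" by (simp add: inner_L2_def)
  also have "\<dots> \<le> norm (u *\<^sub>C f) * norm g" by (rule norm_cauchy_schwarz)
  finally show ?thesis by (simp add: norm_cscale u)
qed auto

lemma bounded_linear_cinner_left: "bounded_linear (\<lambda>f. cinner f g)"
  by (rule bounded_linear_intro[where K = "norm g"])
    (auto simp: cinner_add_left scaleR_L2_def cinner_scale_left cauchy_schwarz scaleR_conv_of_real)

lemma bounded_linear_cscale_right: "bounded_linear (\<lambda>f. c *\<^sub>C f)"
  by (rule bounded_linear_intro[where K = "cmod c"])
    (auto simp: L2.scale_right_distrib scaleR_L2_def norm_cscale mult.commute)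

lemma bounded_bilinear_cscale: "bounded_bilinear cscale"
proof
  show "\<exists>K. \<forall>a b. norm (a *\<^sub>C b) \<le> norm a * norm b * K"
    by (rule exI[of _ 1]) (simp add: norm_cscale)
qed (auto simp: L2.scale_right_distrib L2.scale_left_distrib scaleR_L2_def scaleR_conv_of_real mult.commute)

lemmas tendsto_cinner_left [tendsto_intros] = bounded_linear.tendsto[OF bounded_linear_cinner_left]
lemmas continuous_on_cscale [continuous_intros] = bounded_bilinear.continuous_on[OF bounded_bilinear_cscale]

section \<open>Finite orthonormal systems and the projections onto their spans\<close>

definition orthonormal_on :: "('i \<Rightarrow> L2) \<Rightarrow> 'i set \<Rightarrow> bool" where
  "orthonormal_on e I \<longleftrightarrow> (\<forall>i\<in>I. \<forall>j\<in>I. cinner (e i) (e j) = (if i = j then 1 else 0))"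

lemma cinner_orthonormal_sum:
  assumes "orthonormal_on e F" "finite F" "i \<in> F"
  shows "cinner (\<Sum>k\<in>F. c k *\<^sub>C e k) (e i) = c i"
proof -
  have "cinner (\<Sum>k\<in>F. c k *\<^sub>C e k) (e i) = (\<Sum>k\<in>F. if k = i then c i else 0)"
    unfolding cinner_sum_left cinner_scale_left
    using assms by (intro sum.cong) (auto simp: orthonormal_on_def)
  then show ?thesis using assms by simp
qed

lemma norm_orthonormal_sum:
  assumes "orthonormal_on e F" "finite F"
  shows "(norm (\<Sum>k\<in>F. c k *\<^sub>C e k))\<^sup>2 = (\<Sum>k\<in>F. (cmod (c k))\<^sup>2)"
proof -
  let ?f = "\<Sum>k\<in>F. c k *\<^sub>C e k"
  have "complex_of_real ((norm ?f)\<^sup>2) = (\<Sum>k\<in>F. cnj (c k) * cinner ?f (e k))"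
    unfolding cinner_self[symmetric] cinner_sum_right[of ?f] by (simp add: cinner_scale_right)
  also have "\<dots> = (\<Sum>k\<in>F. complex_of_real ((cmod (c k))\<^sup>2))"
    using assms by (intro sum.cong) (auto simp: cinner_orthonormal_sum mult_cnj_self)
  finally show ?thesis by (metis of_real_sum of_real_eq_iff)
qed

lemma norm_add_orthogonal:
  assumes "cinner f g = 0"
  shows "(norm (f + g))\<^sup>2 = (norm f)\<^sup>2 + (norm g)\<^sup>2"
proof -
  have "cinner g f = 0" using assms cinner_commute[of g f] by simp
  then have "complex_of_real ((norm (f + g))\<^sup>2) = complex_of_real ((norm f)\<^sup>2 + (norm g)\<^sup>2)"
    using assms unfolding of_real_add cinner_self[symmetric] by (simp add: cinner_add_left cinner_add_right)
  then show ?thesis by (simp only: of_real_eq_iff)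
qed

text \<open>An explicit formula for the projection: \<open>orth_proj\<close> is a definite
  description and gets a meaning only once existence and uniqueness are known
  (\<open>orth_proj_eq_onp\<close>).\<close>

definition onp :: "('i \<Rightarrow> L2) \<Rightarrow> 'i set \<Rightarrow> L2 \<Rightarrow> L2" where
  "onp e F f = (\<Sum>k\<in>F. cinner f (e k) *\<^sub>C e k)"

lemma onp_in_span: "onp e F f \<in> cspan (e ` F)"
  unfolding onp_def by (intro L2.span_sum L2.span_scale L2.span_base) auto

lemma cinner_span_zero:
  assumes "\<And>u. u \<in> S \<Longrightarrow> cinner f u = 0" "u \<in> cspan S"
  shows "cinner f u = 0"
  using assms(2)
  by (induction rule: L2.span_induct_alt) (auto simp: cinner_add_right cinner_scale_right assms(1))

lemma cinner_closure_zero: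
  assumes "\<And>u. u \<in> S \<Longrightarrow> cinner f u = 0" "u \<in> closure S"
  shows "cinner f u = 0"
proof -
  obtain x where x: "\<And>n. x n \<in> S" "x \<longlonglongrightarrow> u"
    using assms(2) unfolding closure_sequential by blast
  have "(\<lambda>n. cinner (x n) f) \<longlonglongrightarrow> cinner u f" by (intro tendsto_intros x)
  moreover have "cinner (x n) f = 0" for n
    using assms(1)[OF x(1)] cinner_commute[of "x n" f] by simp
  ultimately have "cinner u f = 0" by (simp add: LIMSEQ_const_iff)
  then show ?thesis using cinner_commute[of f u] by simp
qed

lemma cinner_onp_residual:
  assumes "orthonormal_on e F" "finite F" "u \<in> cspan (e ` F)"
  shows "cinner (f - onp e F f) u = 0"
proof (rule cinner_span_zero[OF _ assms(3)])
  fix u assume "u \<in> e ` F"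
  then obtain k where "k \<in> F" "u = e k" by blast
  then show "cinner (f - onp e F f) u = 0"
    using cinner_orthonormal_sum[OF assms(1,2), of k "\<lambda>k. cinner f (e k)"]
    by (simp add: cinner_diff_left onp_def)
qed

lemma norm_onp:
  assumes "orthonormal_on e F" "finite F"
  shows "(norm (onp e F f))\<^sup>2 = (\<Sum>k\<in>F. (cmod (cinner f (e k)))\<^sup>2)"
  unfolding onp_def by (rule norm_orthonormal_sum[OF assms])

lemma norm_split_onp:
  assumes "orthonormal_on e F" "finite F"
  shows "(norm f)\<^sup>2 = (\<Sum>k\<in>F. (cmod (cinner f (e k)))\<^sup>2) + (norm (f - onp e F f))\<^sup>2"
  using norm_add_orthogonal[OF cinner_onp_residual[OF assms onp_in_span], of f f]
    norm_onp[OF assms, of f] by simp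

lemma bessel:
  assumes "orthonormal_on e F" "finite F"
  shows "(\<Sum>k\<in>F. (cmod (cinner f (e k)))\<^sup>2) \<le> (norm f)\<^sup>2"
  using norm_split_onp[OF assms, of f] by simp

lemma onp_best:
  assumes "orthonormal_on e F" "finite F" "u \<in> cspan (e ` F)"
  shows "norm (f - onp e F f) \<le> norm (f - u)"
proof -
  have "onp e F f - u \<in> cspan (e ` F)"
    using onp_in_span assms(3) by (rule L2.span_diff)
  from norm_add_orthogonal[OF cinner_onp_residual[OF assms(1,2) this, of f]]
  have "(norm (f - u))\<^sup>2 = (norm (f - onp e F f))\<^sup>2 + (norm (onp e F f - u))\<^sup>2"
    by simp
  then have "(norm (f - onp e F f))\<^sup>2 \<le> (norm (f - u))\<^sup>2" by simp
  then show ?thesis by (rule power2_le_imp_le) simp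
qed

lemma onp_span_eq:
  assumes "orthonormal_on e F" "finite F" "f \<in> cspan (e ` F)"
  shows "onp e F f = f"
  using onp_best[OF assms, of f] by simp

lemma orth_proj_eq_onp:
  assumes "orthonormal_on e F" "finite F"
  shows "orth_proj (cspan (e ` F)) f = onp e F f"
  unfolding orth_proj_def
proof (rule the_equality)
  show "onp e F f \<in> cspan (e ` F) \<and> (\<forall>u\<in>cspan (e ` F). cinner (f - onp e F f) u = 0)"
    using onp_in_span cinner_onp_residual[OF assms] by blast
next
  fix p assume p: "p \<in> cspan (e ` F) \<and> (\<forall>u\<in>cspan (e ` F). cinner (f - p) u = 0)"
  have "onp e F f - p \<in> cspan (e ` F)" using onp_in_span p by (blast intro: L2.span_diff)
  then have "cinner (f - p) (onp e F f - p) = 0" "cinner (f - onp e F f) (onp e F f - p) = 0"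
    using p cinner_onp_residual[OF assms] by blast+
  then have "cinner (onp e F f - p) (onp e F f - p) = 0"
    by (simp add: cinner_diff_left)
  then show "p = onp e F f" by (simp add: cinner_self)
qed

lemma norm_orth_proj:
  assumes "orthonormal_on e F" "finite F"
  shows "norm (orth_proj (cspan (e ` F)) f) = L2_set (\<lambda>k. cmod (cinner f (e k))) F"
  unfolding orth_proj_eq_onp[OF assms] L2_set_def norm_onp[OF assms, symmetric] by simp

text \<open>The difference of \<open>f\<close> and the finite sum has only zero coefficients, hence
  is orthogonal to the closed span \<open>U\<close>, to which it belongs itself.\<close>

lemma orthonormal_basis_expand:
  assumes "orthonormal_basis e U" "f \<in> U" "finite F" "\<And>k. k \<notin> F \<Longrightarrow> cinner f (e k) = 0"
  shows "f = onp e F f"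
proof -
  have on: "orthonormal_on e I" for I using assms(1) by (auto simp: orthonormal_on_def orthonormal_basis_def)
  have U: "U = closure (cspan (range e))" using assms(1) by (simp add: orthonormal_basis_def)
  have perp: "cinner (f - onp e F f) (e k) = 0" for k
  proof (cases "k \<in> F")
    case True
    then show ?thesis using cinner_onp_residual[OF on assms(3)] by (simp add: L2.span_base)
  next
    case False
    have "cinner (onp e F f) (e k) = 0"
      unfolding onp_def cinner_sum_left cinner_scale_left
      using False assms(1) by (intro sum.neutral) (auto simp: orthonormal_basis_def)
    then show ?thesis using False assms(4) by (simp add: cinner_diff_left)
  qed
  have 1: "cinner (f - onp e F f) u = 0" if "u \<in> U" for u
  proof (rule cinner_closure_zero[of "cspan (range e)"])
    show "cinner (f - onp e F f) u = 0" if "u \<in> cspan (range e)" for u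
      by (rule cinner_span_zero[OF _ that]) (auto simp: perp)
  qed (use that U in simp)
  have "onp e F f \<in> cspan (range e)" by (rule subsetD[OF L2.span_mono onp_in_span]) auto
  then have "onp e F f \<in> U" unfolding U using closure_subset by blast
  then have "cinner (f - onp e F f) (f - onp e F f) = 0"
    using 1 assms(2) by (simp add: cinner_diff_right)
  then show ?thesis by (simp add: cinner_self)
qed

text \<open>Each new vector contributes the continuous image of a product with a closed disc. The
  compact unit spheres obtained from this provide a minimiser for the infimum in
  \<open>subspace_cos\<close>.\<close>

lemma compact_finite_combinations:
  fixes e :: "'i \<Rightarrow> L2"
  assumes "finite F"
  shows "compact {\<Sum>k\<in>F. c k *\<^sub>C e k | c. \<forall>k\<in>F. cmod (c k) \<le> 1}"
  using assms
proof (induction F)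
  case (insert i F)
  let ?B = "{\<Sum>k\<in>F. c k *\<^sub>C e k | c. \<forall>k\<in>F. cmod (c k) \<le> 1}"
  have "{\<Sum>k\<in>insert i F. c k *\<^sub>C e k | c. \<forall>k\<in>insert i F. cmod (c k) \<le> 1}
      = (\<lambda>(x, b). b *\<^sub>C e i + x) ` (?B \<times> cball 0 1)" (is "?L = ?R")
  proof
    show "?L \<subseteq> ?R"
    proof
      fix y assume "y \<in> ?L"
      then obtain c where c: "\<forall>k\<in>insert i F. cmod (c k) \<le> 1" "y = (\<Sum>k\<in>insert i F. c k *\<^sub>C e k)"
        by blast
      then have "y = (\<lambda>(x, b). b *\<^sub>C e i + x) (\<Sum>k\<in>F. c k *\<^sub>C e k, c i)"
        using insert.hyps by simp
      moreover have "(\<Sum>k\<in>F. c k *\<^sub>C e k, c i) \<in> ?B \<times> cball 0 1" using c(1) by auto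
      ultimately show "y \<in> ?R" by (rule image_eqI)
    qed
    show "?R \<subseteq> ?L"
    proof
      fix y assume "y \<in> ?R"
      then obtain c b where c: "\<forall>k\<in>F. cmod (c k) \<le> 1" "cmod b \<le> 1" "y = b *\<^sub>C e i + (\<Sum>k\<in>F. c k *\<^sub>C e k)"
        by auto
      have "(\<Sum>k\<in>F. (c(i := b)) k *\<^sub>C e k) = (\<Sum>k\<in>F. c k *\<^sub>C e k)"
        using insert.hyps by (intro sum.cong) auto
      then show "y \<in> ?L"
        using c insert.hyps by (intro CollectI exI[of _ "c(i := b)"]) auto
    qed
  qed
  moreover have "compact ?R"
    by (intro compact_continuous_image compact_Times insert.IH compact_cball)
      (auto simp: case_prod_unfold intro!: continuous_intros)
  ultimately show ?case by simp
qed auto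

lemma compact_unit_sphere_span:
  assumes "orthonormal_on e F" "finite F"
  shows "compact {f \<in> cspan (e ` F). norm f = 1}"
proof -
  let ?B = "{\<Sum>k\<in>F. c k *\<^sub>C e k | c. \<forall>k\<in>F. cmod (c k) \<le> 1}"
  have "{f \<in> cspan (e ` F). norm f = 1} = ?B \<inter> sphere 0 1"
  proof (intro equalityI subsetI)
    fix f assume f: "f \<in> {f \<in> cspan (e ` F). norm f = 1}"
    have "cmod (cinner f (e k)) \<le> 1" if "k \<in> F" for k
    proof -
      have "norm (e k) = 1"
        using assms(1) that by (intro norm_eq_one) (simp add: orthonormal_on_def)
      then show ?thesis using cauchy_schwarz[of f "e k"] f by simp
    qed
    then show "f \<in> ?B \<inter> sphere 0 1"
      using f onp_span_eq[OF assms, of f] by (auto simp: onp_def intro!: exI[of _ "\<lambda>k. cinner f (e k)"])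
  next
    fix f assume "f \<in> ?B \<inter> sphere 0 1"
    then show "f \<in> {f \<in> cspan (e ` F). norm f = 1}"
      by (auto intro!: L2.span_sum intro: L2.span_scale L2.span_base)
  qed
  moreover have "sphere 0 1 = {f :: L2. norm f = 1}" by (auto simp: sphere_def)
  moreover have "closed {f :: L2. norm f = 1}"
    by (intro closed_Collect_eq continuous_intros)
  ultimately show ?thesis
    using compact_finite_combinations[OF assms(2)] by (simp only: compact_Int_closed)
qed

section \<open>Fourier transforms of compactly supported functions\<close>

definition e2 :: "real \<Rightarrow> complex" where "e2 t = cis (2 * pi * t)"

lemma e2_0 [simp]: "e2 0 = 1"
  by (simp add: e2_def)

lemma e2_add: "e2 (s + t) = e2 s * e2 t"
  by (simp add: e2_def cis_mult ring_distribs)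

lemma e2_minus: "e2 (- t) = cnj (e2 t)"
  by (simp add: e2_def cis_cnj)

lemma cnj_e2: "cnj (e2 t) = e2 (- t)"
  by (simp add: e2_minus)

lemma norm_e2 [simp]: "cmod (e2 t) = 1"
  by (simp add: e2_def)

lemma e2_nonzero [simp]: "e2 t \<noteq> 0"
  using norm_e2[of t] by (metis norm_zero zero_neq_one)

lemma e2_of_int [simp]: "e2 (of_int k) = 1"
  unfolding e2_def by (rule cis_multiple_2pi) simp

lemma e2_add_int: "e2 (t + of_int k) = e2 t"
  by (simp add: e2_add)

lemma e2_cnj_mult: "e2 t * cnj (e2 t) = 1" "cnj (e2 t) * e2 t = 1"
  by (simp_all add: mult_cnj_self)

lemma continuous_on_e2 [continuous_intros]:
  "continuous_on S f \<Longrightarrow> continuous_on S (\<lambda>x. e2 (f x))"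
  unfolding e2_def by (intro continuous_intros)

lemma borel_measurable_e2 [measurable]: "e2 \<in> borel_measurable borel"
  by (intro borel_measurable_continuous_onI continuous_intros)

lemma has_vector_derivative_e2:
  "((\<lambda>x. e2 (c * x)) has_vector_derivative (2 * pi * \<i> * c) * e2 (c * x)) (at x within S)"
  unfolding e2_def cis_conv_exp
  by (rule derivative_eq_intros has_vector_derivative_real_field refl | simp)+

text \<open>For closed \<open>S\<close> this says that \<open>S\<close> contains
  \<open>ess_support f\<close>. The free set allows all the terms of a sum to share one
  interval.\<close>

lift_definition supp_in :: "L2 \<Rightarrow> real set \<Rightarrow> bool" is
  "\<lambda>f S. AE x in lborel. x \<notin> S \<longrightarrow> f x = 0"
proof -
  fix f g :: "real \<Rightarrow> complex" assume "square_integrable f \<and> square_integrable g \<and> (AE x in lborel. f x = g x)"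
  then have ae: "AE x in lborel. f x = g x" by simp
  show "(\<lambda>S. AE x in lborel. x \<notin> S \<longrightarrow> f x = 0) = (\<lambda>S. AE x in lborel. x \<notin> S \<longrightarrow> g x = 0)"
  proof (intro ext iffI)
    fix S
    { assume "AE x in lborel. x \<notin> S \<longrightarrow> f x = 0"
      with ae show "AE x in lborel. x \<notin> S \<longrightarrow> g x = 0" by eventually_elim simp }
    { assume "AE x in lborel. x \<notin> S \<longrightarrow> g x = 0"
      with ae show "AE x in lborel. x \<notin> S \<longrightarrow> f x = 0" by eventually_elim simp }
  qed
qed

lemma supp_in_mono: "supp_in f S \<Longrightarrow> S \<subseteq> T \<Longrightarrow> supp_in f T"
  by transfer (auto elim!: eventually_mono)

lemma supp_in_zero [simp]: "supp_in 0 S"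
  by transfer simp

lemma supp_in_add: "supp_in f S \<Longrightarrow> supp_in g S \<Longrightarrow> supp_in (f + g) S"
  by transfer (auto elim!: eventually_elim2)

lemma supp_in_scale: "supp_in f S \<Longrightarrow> supp_in (c *\<^sub>C f) S"
  by transfer (auto elim!: eventually_mono)

lemma supp_in_diff: "supp_in f S \<Longrightarrow> supp_in g S \<Longrightarrow> supp_in (f - g) S"
  unfolding minus_L2_def uminus_L2_def by (intro supp_in_add supp_in_scale)

lemma supp_in_sum: "(\<And>i. i \<in> F \<Longrightarrow> supp_in (f i) S) \<Longrightarrow> supp_in (\<Sum>i\<in>F. f i) S"
  by (induction F rule: infinite_finite_induct) (auto intro: supp_in_add)

lemma supp_in_span:
  assumes "f \<in> cspan B" "\<And>g. g \<in> B \<Longrightarrow> supp_in g S"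
  shows "supp_in f S"
  using assms(1)
  by (induction rule: L2.span_induct_alt) (auto intro: supp_in_add supp_in_scale assms(2))

lemma AE_lborel_notin_countable: "countable (A :: real set) \<Longrightarrow> AE x in lborel. x \<notin> A"
  using emeasure_lborel_countable[of A] by (intro AE_not_in null_setsI) (auto intro: sets.countable)

text \<open>Supports of neighbouring atoms share endpoints, hence a countable intersection in place
  of an empty one.\<close>

lemma cinner_disjoint:
  assumes "supp_in f S" "supp_in g T" "countable (S \<inter> T)"
  shows "cinner f g = 0"
  using assms
proof transfer
  fix f g S T
  assume f: "square_integrable f \<and> square_integrable f \<and> (AE x in lborel. f x = f x)"
    and g: "square_integrable g \<and> square_integrable g \<and> (AE x in lborel. g x = g x)"
    and ae: "AE x in lborel. x \<notin> S \<longrightarrow> f x = 0" "AE x in lborel. x \<notin> T \<longrightarrow> g x = 0"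
    and "countable (S \<inter> T)"
  have "AE x in lborel. f x * cnj (g x) = 0"
    using ae AE_lborel_notin_countable[OF \<open>countable (S \<inter> T)\<close>] by eventually_elim auto
  then show "(LINT x|lborel. f x * cnj (g x)) = 0"
    using f g by (subst integral_cong_AE[where g = "\<lambda>x. 0"]) (auto dest!: square_integrable_measurable)
qed

text \<open>On a bounded interval \<open>f\<close> is the product of two square integrable
  functions, itself and the indicator of the interval.\<close>

lemma integrable_supp_in:
  assumes "square_integrable f" "AE x in lborel. x \<notin> {- r..r} \<longrightarrow> f x = 0"
  shows "integrable lborel f"
proof -
  have "square_integrable (\<lambda>x. 1 * indicator {-r..r} x)"
    by (rule square_integrable_bounded_interval[where B = 1]) auto
  from integrable_mult_cnj[OF assms(1) this]
  have "integrable lborel (\<lambda>x. f x * cnj (1 * indicator {-r..r} x))" .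
  moreover have "AE x in lborel. f x * cnj (1 * indicator {-r..r} x) = f x"
    using assms(2) by eventually_elim (auto simp: indicator_def)
  ultimately show ?thesis
    using assms(1) by (subst integrable_cong_AE[where g = "\<lambda>x. f x * cnj (1 * indicator {-r..r} x)"])
      (auto dest!: square_integrable_measurable)
qed

text \<open>The integral is 0 by convention where \<open>f\<close> is not integrable, so additivity
  below is stated for bounded supports.\<close>

lift_definition fourier :: "L2 \<Rightarrow> real \<Rightarrow> complex" is
  "\<lambda>f \<omega>. LINT x|lborel. f x * e2 (- (\<omega> * x))"
  by (intro ext integral_cong_AE) (auto dest!: square_integrable_measurable)

lemma fourier_scale: "fourier (c *\<^sub>C f) \<omega> = c * fourier f \<omega>"
  by transfer (simp add: mult.assoc)

lemma integrable_mult_e2: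
  assumes "integrable lborel f"
  shows "integrable lborel (\<lambda>x. f x * e2 (c * x))"
  using assms by (rule Bochner_Integration.integrable_bound)
    (use borel_measurable_integrable[OF assms] in \<open>auto simp: norm_mult\<close>)

lemma fourier_add:
  assumes "supp_in f {- r..r}" "supp_in g {- r..r}"
  shows "fourier (f + g) \<omega> = fourier f \<omega> + fourier g \<omega>"
  using assms
proof transfer
  fix f g :: "real \<Rightarrow> complex" and r \<omega>
  assume a: "square_integrable f \<and> square_integrable f \<and> (AE x in lborel. f x = f x)"
    "square_integrable g \<and> square_integrable g \<and> (AE x in lborel. g x = g x)"
    "AE x in lborel. x \<notin> {- r..r} \<longrightarrow> f x = 0" "AE x in lborel. x \<notin> {- r..r} \<longrightarrow> g x = 0"
  then have "integrable lborel f" "integrable lborel g"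
    using integrable_supp_in[of f r] integrable_supp_in[of g r] by blast+
  from this[THEN integrable_mult_e2, of "- \<omega>"]
  show "(LINT x|lborel. (f x + g x) * e2 (- (\<omega> * x))) =
       (LINT x|lborel. f x * e2 (- (\<omega> * x))) + (LINT x|lborel. g x * e2 (- (\<omega> * x)))"
    by (simp add: ring_distribs)
qed

lemma fourier_zero [simp]: "fourier 0 \<omega> = 0"
  by transfer simp

lemma fourier_sum:
  assumes "\<And>i. i \<in> F \<Longrightarrow> supp_in (f i) {- r..r}"
  shows "fourier (\<Sum>i\<in>F. f i) \<omega> = (\<Sum>i\<in>F. fourier (f i) \<omega>)"
  using assms
proof (induction F rule: infinite_finite_induct)
  case (insert i F)
  then show ?case by (simp add: fourier_add[of _ r] supp_in_sum)
qed auto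

lemma cinner_fourier_atom_aux:
  fixes f :: "real \<Rightarrow> complex" and I :: "real set"
  assumes [measurable]: "f \<in> borel_measurable borel" "I \<in> sets borel"
    and ae: "AE x in lborel. x \<notin> I \<longrightarrow> f x = 0"
  shows "(LINT x|lborel. f x * cnj (complex_of_real (sqrt \<epsilon>) * exp (\<i> * complex_of_real (2 * pi * of_int l * \<epsilon> * x)) * indicator I x))
      = complex_of_real (sqrt \<epsilon>) * (LINT x|lborel. f x * e2 (- (\<epsilon> * of_int l * x)))"
proof -
  have "(LINT x|lborel. f x * cnj (complex_of_real (sqrt \<epsilon>) * exp (\<i> * complex_of_real (2 * pi * of_int l * \<epsilon> * x)) * indicator I x))
      = (LINT x|lborel. sqrt \<epsilon> * (f x * e2 (- (\<epsilon> * of_int l * x))))"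
  proof (rule integral_cong_AE)
    show "AE x in lborel. f x * cnj (complex_of_real (sqrt \<epsilon>) * exp (\<i> * complex_of_real (2 * pi * of_int l * \<epsilon> * x)) * indicator I x)
        = sqrt \<epsilon> * (f x * e2 (- (\<epsilon> * of_int l * x)))"
      using ae
    proof eventually_elim
      case (elim x)
      have "cnj (exp (\<i> * complex_of_real (2 * pi * of_int l * \<epsilon> * x))) = e2 (- (\<epsilon> * of_int l * x))"
        unfolding e2_def cis_conv_exp exp_cnj by (intro arg_cong[where f = exp]) (simp add: algebra_simps)
      then show ?case using elim by (auto simp: indicator_def)
    qed
  qed auto
  then show ?thesis by simp
qed

text \<open>On the window the cut-off of the atom is invisible: up to the factor
  \<open>sqrt \<epsilon>\<close> the samples of \<open>f\<close> are the values of its transform on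
  the lattice of step \<open>\<epsilon>\<close>.\<close>

lemma cinner_fourier_atom:
  assumes "supp_in f {- T1 / (\<epsilon> * (T1 + T2)) .. T2 / (\<epsilon> * (T1 + T2))}"
  shows "cinner f (fourier_atom T1 T2 \<epsilon> l) = sqrt \<epsilon> * fourier f (\<epsilon> * of_int l)"
  using assms
  by transfer (rule cinner_fourier_atom_aux, auto dest!: square_integrable_measurable)

lemma fourier_dyadic:
  "fourier (dyadic_comp j k f) \<omega> = e2 (- (of_int k * \<omega> / 2 powi j)) / complex_of_real (2 powi j) * fourier f (\<omega> / 2 powi j)"
proof transfer
  fix j k :: int and f :: "real \<Rightarrow> complex" and \<omega> :: real
  have p: "(2::real) powi j > 0" by simp
  have "(LINT x|lborel. f x * e2 (- (\<omega> / 2 powi j * x)))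
     = \<bar>2 powi j\<bar> *\<^sub>R (LINT x|lborel. f (- of_int k + 2 powi j * x) * e2 (- (\<omega> / 2 powi j * (- of_int k + 2 powi j * x))))"
    by (rule lborel_integral_real_affine) simp
  also have "(\<lambda>x. f (- of_int k + 2 powi j * x) * e2 (- (\<omega> / 2 powi j * (- of_int k + 2 powi j * x))))
     = (\<lambda>x. e2 (of_int k * \<omega> / 2 powi j) * (f (2 powi j * x - of_int k) * e2 (- (\<omega> * x))))"
  proof
    fix x
    have eq: "- (\<omega> / 2 powi j * (- of_int k + 2 powi j * x)) = of_int k * \<omega> / 2 powi j + - (\<omega> * x)"
      using p by (simp add: field_simps)
    then show "f (- of_int k + 2 powi j * x) * e2 (- (\<omega> / 2 powi j * (- of_int k + 2 powi j * x)))
       = e2 (of_int k * \<omega> / 2 powi j) * (f (2 powi j * x - of_int k) * e2 (- (\<omega> * x)))"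
      unfolding eq e2_add by (simp add: mult_ac)
  qed
  finally have eq: "(LINT x|lborel. f x * e2 (- (\<omega> / 2 powi j * x)))
     = 2 powi j * (e2 (of_int k * \<omega> / 2 powi j) * (LINT x|lborel. f (2 powi j * x - of_int k) * e2 (- (\<omega> * x))))"
    using p by (simp add: scaleR_conv_of_real)
  show "(LINT x|lborel. f (2 powi j * x - of_int k) * e2 (- (\<omega> * x)))
     = e2 (- (of_int k * \<omega> / 2 powi j)) / complex_of_real (2 powi j) * (LINT x|lborel. f x * e2 (- (\<omega> / 2 powi j * x)))"
    unfolding eq using p by (simp add: e2_minus e2_cnj_mult flip: mult.assoc)
qed

text \<open>The exponential is expanded in a power series under the integral; the bounded support
  gives the summable bound \<open>(2 * pi * \<bar>r\<bar> * cmod z) ^ n / fact n\<close> times the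
  integral of \<open>norm (f x)\<close>.\<close>

lemma fourier_entire:
  assumes "supp_in f {- r..r}"
  obtains H where "H holomorphic_on UNIV" "\<And>\<omega>. H (of_real \<omega>) = fourier f \<omega>"
proof -
  have "\<exists>H. H holomorphic_on UNIV \<and> (\<forall>\<omega>. H (of_real \<omega>) = fourier f \<omega>)"
    using assms
  proof transfer
    fix f :: "real \<Rightarrow> complex" and r
    assume f: "square_integrable f \<and> square_integrable f \<and> (AE x in lborel. f x = f x)"
      and ae: "AE x in lborel. x \<notin> {- r..r} \<longrightarrow> f x = 0"
    have int: "integrable lborel f" using integrable_supp_in[of f r] f ae by blast
    note [measurable] = borel_measurable_integrable[OF int, simplified]
    define g :: "nat \<Rightarrow> real \<Rightarrow> complex" where "g n x = (- 2 * pi * \<i> * x) ^ n / fact n * f x" for n x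
    define H where "H z = (LINT x|lborel. f x * exp (- 2 * pi * \<i> * x * z))" for z
    have bd: "AE x in lborel. norm (g n x * z ^ n) \<le> (2 * pi * \<bar>r\<bar> * cmod z) ^ n / fact n * norm (f x)" for n z
      using ae
    proof eventually_elim
      case (elim x)
      show ?case
      proof (cases "f x = 0")
        case False
        then have "\<bar>x\<bar> \<le> \<bar>r\<bar>" using elim by auto
        then have "(2 * pi * \<bar>x\<bar> * cmod z) ^ n \<le> (2 * pi * \<bar>r\<bar> * cmod z) ^ n"
          by (intro power_mono mult_mono) auto
        then have "(2 * pi * \<bar>x\<bar> * cmod z) ^ n / fact n * norm (f x) \<le> (2 * pi * \<bar>r\<bar> * cmod z) ^ n / fact n * norm (f x)"
          by (intro mult_right_mono divide_right_mono) auto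
        then show ?thesis
          by (simp add: g_def norm_mult norm_divide norm_power power_mult_distrib mult_ac)
      qed (simp add: g_def)
    qed
    have ig: "integrable lborel (\<lambda>x. g n x * z ^ n)" for n z
    proof (rule Bochner_Integration.integrable_bound)
      show "integrable lborel (\<lambda>x. (2 * pi * \<bar>r\<bar> * cmod z) ^ n / fact n * norm (f x))"
        using int by auto
      show "(\<lambda>x. g n x * z ^ n) \<in> borel_measurable lborel" unfolding g_def by measurable
      show "AE x in lborel. norm (g n x * z ^ n) \<le> norm ((2 * pi * \<bar>r\<bar> * cmod z) ^ n / fact n * norm (f x))"
        using bd[of n z] by eventually_elim auto
    qed
    have sm: "(\<lambda>n. (LINT x|lborel. g n x * z ^ n)) sums H z" for z
    proof -
      have pt: "(\<lambda>n. g n x * z ^ n) sums (f x * exp (- 2 * pi * \<i> * x * z))" for x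
      proof -
        have "(\<lambda>n. (- 2 * pi * \<i> * x * z) ^ n /\<^sub>R fact n) sums exp (- 2 * pi * \<i> * x * z)"
          by (rule exp_converges)
        from sums_mult[OF this, of "f x"] show ?thesis
          unfolding power_mult_distrib[of _ z] by (simp add: g_def scaleR_conv_of_real field_simps)
      qed
      have ptn: "summable (\<lambda>n. norm (g n x * z ^ n))" for x
      proof -
        have "summable (\<lambda>n. norm (f x) * norm ((- 2 * pi * \<i> * x * z) ^ n /\<^sub>R fact n))"
          by (intro summable_mult summable_norm_exp)
        then show ?thesis
          by (simp add: g_def norm_mult norm_divide norm_power power_mult_distrib field_simps)
      qed
      have "(\<lambda>n. (LINT x|lborel. g n x * z ^ n)) sums (LINT x|lborel. (\<Sum>n. g n x * z ^ n))"
      proof (rule sums_integral[OF ig])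
        show "AE x in lborel. summable (\<lambda>n. norm (g n x * z ^ n))" using ptn by simp
        show "summable (\<lambda>n. LINT x|lborel. norm (g n x * z ^ n))"
        proof (rule summable_comparison_test')
          show "summable (\<lambda>n. (2 * pi * \<bar>r\<bar> * cmod z) ^ n /\<^sub>R fact n * (LINT x|lborel. norm (f x)))"
            by (intro summable_mult2 summable_exp_generic)
          show "norm (LINT x|lborel. norm (g n x * z ^ n)) \<le> (2 * pi * \<bar>r\<bar> * cmod z) ^ n /\<^sub>R fact n * (LINT x|lborel. norm (f x))" for n
          proof -
            have "(LINT x|lborel. norm (g n x * z ^ n)) \<le> (LINT x|lborel. (2 * pi * \<bar>r\<bar> * cmod z) ^ n / fact n * norm (f x))"
              by (intro integral_mono_AE bd integrable_norm ig) (use int in auto)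
            then show ?thesis by (simp add: divide_inverse mult.commute)
          qed
        qed
      qed
      then show ?thesis using pt by (simp add: H_def sums_iff)
    qed
    have hol: "H holomorphic_on ball 0 R" for R
    proof (rule power_series_holomorphic)
      show "(\<lambda>n. (LINT x|lborel. g n x) * (w - 0) ^ n) sums H w" for w
        using sm[of w] by simp
    qed
    have "H holomorphic_on UNIV"
    proof -
      have "H field_differentiable (at z)" for z
        using hol[of "cmod z + 1"] holomorphic_on_imp_differentiable_at[of H "ball 0 (cmod z + 1)" z] by simp
      then show ?thesis by (auto simp: holomorphic_on_def field_differentiable_at_within)
    qed
    moreover have "H (of_real \<omega>) = (LINT x|lborel. f x * e2 (- (\<omega> * x)))" for \<omega>
      unfolding H_def e2_def cis_conv_exp by (simp add: algebra_simps)
    ultimately show "\<exists>H. H holomorphic_on UNIV \<and> (\<forall>\<omega>. H (of_real \<omega>) = (LINT x|lborel. f x * e2 (- (\<omega> * x))))"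
      by blast
  qed
  then show ?thesis using that by blast
qed

lemma continuous_on_fourier:
  assumes "supp_in f {- r..r}"
  shows "continuous_on S (fourier f)"
proof -
  obtain H where H: "H holomorphic_on UNIV" "\<And>\<omega>. H (of_real \<omega>) = fourier f \<omega>"
    using fourier_entire[OF assms] by blast
  have "continuous_on S (\<lambda>\<omega>. H (of_real \<omega>))"
    by (rule continuous_on_compose2[OF holomorphic_on_imp_continuous_on[OF H(1)]]) (auto intro: continuous_intros)
  then show ?thesis by (simp add: H(2))
qed

text \<open>The window has length \<open>1 / \<epsilon>\<close>, a common period of all the
  exponentials.\<close>

lemma fourier_atom_orthonormal:
  assumes "0 < \<epsilon>" "0 < T1 + T2"
  shows "orthonormal_on (fourier_atom T1 T2 \<epsilon>) A"
proof -
  have "cinner (fourier_atom T1 T2 \<epsilon> l) (fourier_atom T1 T2 \<epsilon> k) = (if l = k then 1 else 0)" for l k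
    using assms
  proof transfer
    fix T1 T2 \<epsilon> :: real and l k :: int
    assume pos: "0 < \<epsilon>" "0 < T1 + T2"
    define a b where "a = - T1 / (\<epsilon> * (T1 + T2))" and "b = T2 / (\<epsilon> * (T1 + T2))"
    have ba: "b = a + 1 / \<epsilon>" using pos by (simp add: a_def b_def divide_simps)
    have ab: "a \<le> b" using ba pos by simp
    define n where "n = l - k"
    have eq: "sqrt \<epsilon> * exp (\<i> * complex_of_real (2 * pi * of_int l * \<epsilon> * x)) * indicator {a..b} x
       * cnj (sqrt \<epsilon> * exp (\<i> * complex_of_real (2 * pi * of_int k * \<epsilon> * x)) * indicator {a..b} x)
       = indicator {a..b} x *\<^sub>R (\<epsilon> * e2 ((of_int n * \<epsilon>) * x))" for x
    proof -
      have 1: "exp (\<i> * complex_of_real (2 * pi * of_int l * \<epsilon> * x)) = e2 (of_int l * \<epsilon> * x)" for l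
        unfolding e2_def cis_conv_exp by (simp add: algebra_simps)
      have 2: "e2 (of_int l * \<epsilon> * x) * e2 (- (of_int k * \<epsilon> * x)) = e2 (of_int n * \<epsilon> * x)"
        unfolding e2_add[symmetric] by (simp add: n_def algebra_simps)
      have 3: "complex_of_real (sqrt \<epsilon>) * complex_of_real (sqrt \<epsilon>) = \<epsilon>"
        unfolding of_real_mult[symmetric] using pos by simp
      show ?thesis
      proof (cases "x \<in> {a..b}")
        case True
        then have "sqrt \<epsilon> * e2 (of_int l * \<epsilon> * x) * indicator {a..b} x * cnj (sqrt \<epsilon> * e2 (of_int k * \<epsilon> * x) * indicator {a..b} x)
          = (complex_of_real (sqrt \<epsilon>) * complex_of_real (sqrt \<epsilon>)) * (e2 (of_int l * \<epsilon> * x) * e2 (- (of_int k * \<epsilon> * x)))"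
          by (simp add: cnj_e2 mult_ac del: of_real_mult)
        then show ?thesis unfolding 1 2 3 using True by simp
      qed simp
    qed
    show "(LINT x|lborel. sqrt \<epsilon> * exp (\<i> * complex_of_real (2 * pi * of_int l * \<epsilon> * x)) *
         indicator {- T1 / (\<epsilon> * (T1 + T2))..T2 / (\<epsilon> * (T1 + T2))} x
       * cnj (sqrt \<epsilon> * exp (\<i> * complex_of_real (2 * pi * of_int k * \<epsilon> * x)) *
         indicator {- T1 / (\<epsilon> * (T1 + T2))..T2 / (\<epsilon> * (T1 + T2))} x)) = (if l = k then 1 else 0)"
      unfolding a_def[symmetric] b_def[symmetric] eq
    proof (cases "n = 0")
      case True
      have "(LINT x|lborel. indicator {a..b} x *\<^sub>R complex_of_real \<epsilon>) = (b - a) *\<^sub>R complex_of_real \<epsilon>"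
        using ab by simp
      then have "(LINT x|lborel. indicator {a..b} x *\<^sub>R complex_of_real \<epsilon>) = 1"
        using ab pos by (simp add: ba scaleR_conv_of_real)
      then show "(LINT x|lborel. indicator {a..b} x *\<^sub>R (\<epsilon> * e2 ((of_int n * \<epsilon>) * x))) = (if l = k then 1 else 0)"
        using True by (simp add: n_def)
    next
      case False
      define F where "F x = e2 ((of_int n * \<epsilon>) * x) / (2 * pi * \<i> * of_int n)" for x :: real
      have "has_bochner_integral lborel (\<lambda>x. indicator {a..b} x *\<^sub>R (\<epsilon> * e2 ((of_int n * \<epsilon>) * x))) (F b - F a)"
      proof (rule has_bochner_integral_FTC_Icc[OF ab])
        show "(F has_vector_derivative \<epsilon> * e2 ((of_int n * \<epsilon>) * x)) (at x within {a..b})" for x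
          unfolding F_def
          using has_vector_derivative_divide[OF has_vector_derivative_e2[of "of_int n * \<epsilon>" x "{a..b}"], of "2 * pi * \<i> * of_int n"] False
          by simp
        show "continuous_on {a..b} (\<lambda>x. \<epsilon> * e2 ((of_int n * \<epsilon>) * x))" by (intro continuous_intros)
      qed
      then have "(LINT x|lborel. indicator {a..b} x *\<^sub>R (\<epsilon> * e2 ((of_int n * \<epsilon>) * x))) = F b - F a"
        by (rule has_bochner_integral_integral_eq)
      moreover have "e2 (of_int n * \<epsilon> * b) = e2 (of_int n * \<epsilon> * a)"
      proof -
        have "of_int n * \<epsilon> * b = of_int n * \<epsilon> * a + of_int n" using pos by (simp add: ba algebra_simps)
        then show ?thesis by (simp add: e2_add)
      qed
      ultimately show "(LINT x|lborel. indicator {a..b} x *\<^sub>R (\<epsilon> * e2 ((of_int n * \<epsilon>) * x))) = (if l = k then 1 else 0)"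
        using False by (auto simp: F_def n_def)
    qed
  qed
  then show ?thesis by (simp add: orthonormal_on_def)
qed

lemma supp_in_fourier_atom:
  "supp_in (fourier_atom T1 T2 \<epsilon> l) {- T1 / (\<epsilon> * (T1 + T2)) .. T2 / (\<epsilon> * (T1 + T2))}"
  by transfer (auto simp: indicator_def)

section \<open>Completeness of the trigonometric system\<close>

lemma abs_L2_add:
  "square_integrable f \<Longrightarrow> square_integrable g \<Longrightarrow> abs_L2 f + abs_L2 g = abs_L2 (\<lambda>x. f x + g x)"
  by (rule plus_L2.abs_eq) auto

lemma abs_L2_scale: "square_integrable f \<Longrightarrow> c *\<^sub>C abs_L2 f = abs_L2 (\<lambda>x. c * f x)"
  by (rule cscale.abs_eq) auto

lemma norm_abs_L2: "square_integrable f \<Longrightarrow> norm (abs_L2 f) = sqrt (LINT x|lborel. (cmod (f x))\<^sup>2)"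
  by (rule norm_L2.abs_eq) auto

lemma abs_L2_diff:
  assumes "square_integrable f" "square_integrable g"
  shows "abs_L2 f - abs_L2 g = abs_L2 (\<lambda>x. f x - g x)"
  unfolding minus_L2_def uminus_L2_def abs_L2_scale[OF assms(2)]
    abs_L2_add[OF assms(1) square_integrable_cmult[OF assms(2)]] by simp

lemma square_integrable_diff:
  assumes "square_integrable f" "square_integrable g"
  shows "square_integrable (\<lambda>x. f x - g x)"
  using square_integrable_add[OF assms(1) square_integrable_cmult[OF assms(2), of "-1"]] by simp

lemma tendsto_abs_L2:
  assumes "\<And>n. square_integrable (f n)" "square_integrable g"
    "(\<lambda>n. LINT x|lborel. (cmod (f n x - g x))\<^sup>2) \<longlonglongrightarrow> 0"
  shows "(\<lambda>n. abs_L2 (f n)) \<longlonglongrightarrow> abs_L2 g"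
proof (subst tendsto_dist_iff)
  have "dist (abs_L2 (f n)) (abs_L2 g) = sqrt (LINT x|lborel. (cmod (f n x - g x))\<^sup>2)" for n
    using assms by (simp add: dist_norm abs_L2_diff norm_abs_L2 square_integrable_diff)
  then show "(\<lambda>n. dist (abs_L2 (f n)) (abs_L2 g)) \<longlonglongrightarrow> 0"
    using tendsto_real_sqrt[OF assms(3)] by simp
qed

lemma csubspace_closure:
  assumes "csubspace S"
  shows "csubspace (closure S)"
  unfolding L2.subspace_def
proof (intro conjI ballI allI)
  show "0 \<in> closure S" using assms closure_subset L2.subspace_0 by blast
next
  fix f g assume "f \<in> closure S" "g \<in> closure S"
  then obtain x y where "\<And>n. x n \<in> S" "x \<longlonglongrightarrow> f" "\<And>n. y n \<in> S" "y \<longlonglongrightarrow> g"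
    unfolding closure_sequential by blast
  then have "(\<lambda>n. x n + y n) \<longlonglongrightarrow> f + g" "\<And>n. x n + y n \<in> S"
    using assms by (auto intro: tendsto_intros L2.subspace_add)
  then show "f + g \<in> closure S" unfolding closure_sequential by (intro exI[of _ "\<lambda>n. x n + y n"]) simp
next
  fix c f assume "f \<in> closure S"
  then obtain x where x: "\<And>n. x n \<in> S" "x \<longlonglongrightarrow> f" unfolding closure_sequential by blast
  have "(\<lambda>n. c *\<^sub>C x n) \<longlonglongrightarrow> c *\<^sub>C f"
    by (rule bounded_linear.tendsto[OF bounded_linear_cscale_right x(2)])
  moreover have "\<And>n. c *\<^sub>C x n \<in> S" using assms x by (auto intro: L2.subspace_scale)
  ultimately show "c *\<^sub>C f \<in> closure S" unfolding closure_sequential by (intro exI[of _ "\<lambda>n. c *\<^sub>C x n"]) simp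
qed

text \<open>These are functions rather than elements of \<open>L2\<close>, because density is proved
  through pointwise products and uniform approximation on the circle.\<close>

inductive trig_poly :: "real \<Rightarrow> (real \<Rightarrow> complex) \<Rightarrow> bool" for \<epsilon> where
  base: "trig_poly \<epsilon> (\<lambda>x. c * e2 (of_int l * \<epsilon> * x))"
| add: "trig_poly \<epsilon> f \<Longrightarrow> trig_poly \<epsilon> g \<Longrightarrow> trig_poly \<epsilon> (\<lambda>x. f x + g x)"

lemma trig_poly_const: "trig_poly \<epsilon> (\<lambda>x. c)"
  using trig_poly.base[of \<epsilon> c 0] by simp

lemma trig_poly_mult:
  assumes "trig_poly \<epsilon> f" "trig_poly \<epsilon> g"
  shows "trig_poly \<epsilon> (\<lambda>x. f x * g x)"
  using assms(1)
proof induction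
  case f: (base c l)
  show ?case
    using assms(2)
  proof induction
    case (base d k)
    have "(\<lambda>x. c * e2 (of_int l * \<epsilon> * x) * (d * e2 (of_int k * \<epsilon> * x)))
        = (\<lambda>x. (c * d) * e2 (of_int (l + k) * \<epsilon> * x))"
      by (simp add: fun_eq_iff ring_distribs e2_add)
    then show ?case using trig_poly.base[of \<epsilon> "c * d" "l + k"] by simp
  next
    case (add g h)
    then show ?case using trig_poly.add[OF add.IH] by (simp add: distrib_left)
  qed
next
  case (add f h)
  then show ?case using trig_poly.add[OF add.IH] by (simp add: distrib_right)
qed

text \<open>A real linear form on the plane is a combination of \<open>z\<close> and
  \<open>cnj z\<close>, that is, of the frequencies 1 and -1; sums and products stay
  trigonometric.\<close>

lemma trig_poly_real_polynomial:
  assumes "real_polynomial_function p"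
  shows "trig_poly \<epsilon> (\<lambda>x. complex_of_real (p (e2 (\<epsilon> * x))))"
  using assms
proof induction
  case (linear h)
  then interpret bounded_linear h .
  have h: "h z = Re z * h 1 + Im z * h \<i>" for z
  proof -
    have "h z = h (Re z *\<^sub>R 1 + Im z *\<^sub>R \<i>)"
      by (rule arg_cong[where f = h]) (simp add: complex_eq_iff)
    then show ?thesis by (simp add: add scaleR)
  qed
  define a b where "a = (complex_of_real (h 1) - \<i> * h \<i>) / 2" and "b = (complex_of_real (h 1) + \<i> * h \<i>) / 2"
  have "complex_of_real (h z) = a * z + b * cnj z" for z
  proof -
    have eq: "complex_of_real (Re z * c + Im z * d) = (c - \<i> * d) / 2 * z + (c + \<i> * d) / 2 * cnj z" for c d :: real
      by (simp add: complex_eq_iff add_divide_distrib diff_divide_distrib)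
    show ?thesis unfolding h[of z] a_def b_def by (rule eq)
  qed
  then have "(\<lambda>x. complex_of_real (h (e2 (\<epsilon> * x))))
      = (\<lambda>x. a * e2 (of_int 1 * \<epsilon> * x) + b * e2 (of_int (-1) * \<epsilon> * x))"
    by (simp add: fun_eq_iff e2_minus)
  then show ?case by (simp only: trig_poly.add[OF trig_poly.base trig_poly.base])
next
  case (const c)
  then show ?case by (rule trig_poly_const)
next
  case (add f g)
  then show ?case using trig_poly.add[OF add.IH] by simp
next
  case (mult f g)
  then show ?case using trig_poly_mult[OF mult.IH] by simp
qed

lemma e2_eqD:
  assumes "e2 s = e2 t"
  shows "\<exists>n. s = t + of_int n"
proof -
  have "sin (2 * pi * s) = sin (2 * pi * t) \<and> cos (2 * pi * s) = cos (2 * pi * t)"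
    using assms by (simp add: e2_def complex_eq_iff)
  then obtain n :: int where "2 * pi * s = 2 * pi * t + 2 * pi * of_int n"
    unfolding sin_cos_eq_iff by blast
  then have "2 * pi * s = 2 * pi * (t + of_int n)" by (simp add: algebra_simps)
  then show ?thesis by auto
qed

section \<open>Density of the exponentials: compact sets, Borel sets, arbitrary functions on the
  window\<close>

context
  fixes \<epsilon> T1 T2 :: real and I :: "real set" and C :: "L2 set" and \<alpha> \<beta> :: real
  assumes pos: "0 < \<epsilon>" "0 < T1 + T2"
  defines "\<alpha> \<equiv> - T1 / (\<epsilon> * (T1 + T2))" and "\<beta> \<equiv> T2 / (\<epsilon> * (T1 + T2))"
  defines "I \<equiv> {\<alpha>..\<beta>}"
  defines "C \<equiv> closure (cspan (range (fourier_atom T1 T2 \<epsilon>)))"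
begin

lemma interval_length: "\<beta> = \<alpha> + 1 / \<epsilon>"
  using pos by (simp add: \<alpha>_def \<beta>_def divide_simps)

lemma C_subspace: "csubspace C"
  unfolding C_def by (intro csubspace_closure L2.subspace_span)

lemma trig_poly_in_C:
  assumes "trig_poly \<epsilon> t"
  shows "square_integrable (\<lambda>x. t x * indicator I x) \<and> abs_L2 (\<lambda>x. t x * indicator I x) \<in> C"
  using assms
proof induction
  case (base c l)
  have sq: "square_integrable (\<lambda>x. e2 (of_int l * \<epsilon> * x) * indicator I x)"
    unfolding I_def by (rule square_integrable_bounded_interval[where B = 1]) auto
  have "fourier_atom T1 T2 \<epsilon> l = abs_L2 (\<lambda>x. sqrt \<epsilon> * (e2 (of_int l * \<epsilon> * x) * indicator I x))"
    unfolding fourier_atom.abs_eq I_def \<alpha>_def \<beta>_def e2_def cis_conv_exp by (simp add: algebra_simps)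
  also have "\<dots> = sqrt \<epsilon> *\<^sub>C abs_L2 (\<lambda>x. e2 (of_int l * \<epsilon> * x) * indicator I x)"
    by (rule abs_L2_scale[OF sq, symmetric])
  finally have "(c / sqrt \<epsilon>) *\<^sub>C fourier_atom T1 T2 \<epsilon> l = (c / sqrt \<epsilon> * sqrt \<epsilon>) *\<^sub>C abs_L2 (\<lambda>x. e2 (of_int l * \<epsilon> * x) * indicator I x)"
    by simp
  also have "\<dots> = abs_L2 (\<lambda>x. c * (e2 (of_int l * \<epsilon> * x) * indicator I x))"
    using pos by (simp add: abs_L2_scale[OF sq])
  finally have "(c / sqrt \<epsilon>) *\<^sub>C fourier_atom T1 T2 \<epsilon> l = abs_L2 (\<lambda>x. c * (e2 (of_int l * \<epsilon> * x) * indicator I x))" .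
  moreover have "(c / sqrt \<epsilon>) *\<^sub>C fourier_atom T1 T2 \<epsilon> l \<in> C"
    unfolding C_def by (rule subsetD[OF closure_subset]) (auto intro: L2.span_scale L2.span_base)
  ultimately show ?case using square_integrable_cmult[OF sq, of c] by (simp add: mult.assoc)
next
  case (add f g)
  then have "abs_L2 (\<lambda>x. (f x + g x) * indicator I x) = abs_L2 (\<lambda>x. f x * indicator I x) + abs_L2 (\<lambda>x. g x * indicator I x)"
    by (simp add: abs_L2_add distrib_right)
  moreover have "square_integrable (\<lambda>x. (f x + g x) * indicator I x)"
    using add square_integrable_add[of "\<lambda>x. f x * indicator I x" "\<lambda>x. g x * indicator I x"] by (simp add: distrib_right)
  ultimately show ?case using add C_subspace by (simp add: L2.subspace_add)
qed

lemma closed_C: "closed C"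
  by (simp add: C_def)

lemma square_integrable_indicator:
  assumes "A \<in> sets borel" "A \<subseteq> I"
  shows "square_integrable (indicator A)"
proof -
  have [measurable]: "A \<in> sets borel" by fact
  have "square_integrable (\<lambda>x. indicator A x * indicator I x)"
    unfolding I_def by (rule square_integrable_bounded_interval[where B = 1]) (auto simp: indicator_def)
  moreover have "(\<lambda>x. indicator A x * indicator I x :: complex) = indicator A"
    using assms(2) by (auto simp: indicator_def fun_eq_iff)
  ultimately show ?thesis by simp
qed

lemma integrable_indicator_I: "integrable lborel (indicator I :: real \<Rightarrow> real)"
  unfolding I_def by (rule integrable_real_indicator) (simp_all add: emeasure_lborel_Icc_eq)

text \<open>The map \<open>e2 (\<epsilon> * x)\<close> wraps the window onto the unit circle. The
  continuous functions \<open>F n\<close> decrease to the indicator of the image of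
  \<open>K\<close>, and Stone-Weierstrass replaces them by polynomials with error
  \<open>1 / (n + 1)\<close>.\<close>

lemma compact_indicator_in_C:
  assumes "compact K" "K \<subseteq> I"
  shows "abs_L2 (indicator K) \<in> C"
proof (cases "K = {}")
  case True
  have "abs_L2 (indicator K) = 0" unfolding True zero_L2_def by (intro arg_cong[where f = abs_L2]) (simp add: fun_eq_iff)
  then show ?thesis using C_subspace L2.subspace_0 by simp
next
  case False
  define E where "E = (\<lambda>x. e2 (\<epsilon> * x)) ` K"
  have E: "closed E" "E \<noteq> {}"
    using assms False unfolding E_def by (auto intro!: compact_imp_closed compact_continuous_image continuous_intros)
  define F where "F n z = max 0 (1 - real n * infdist z E)" for n z
  have "\<exists>p. real_polynomial_function p \<and> (\<forall>z\<in>sphere 0 1. \<bar>F n z - p z\<bar> < 1 / (real n + 1))" for n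
  proof -
    have c: "continuous_on (sphere 0 1) (F n)" unfolding F_def by (intro continuous_intros)
    have "0 < 1 / (real n + 1)" by simp
    from Stone_Weierstrass_real_polynomial_function[OF compact_sphere c this] show ?thesis by metis
  qed
  then obtain p where p: "\<And>n. real_polynomial_function (p n)"
      "\<And>n z. z \<in> sphere 0 1 \<Longrightarrow> \<bar>F n z - p n z\<bar> < 1 / (real n + 1)" by metis
  define h where "h n x = complex_of_real (p n (e2 (\<epsilon> * x))) * indicator I x" for n x
  have h: "square_integrable (h n)" "abs_L2 (h n) \<in> C" for n
    using trig_poly_in_C[OF trig_poly_real_polynomial[OF p(1)[of n]]] unfolding h_def by auto
  have Kb: "K \<in> sets borel" using assms(1) by (rule borel_compact)
  have K: "square_integrable (indicator K)" "K \<in> sets borel"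
    using square_integrable_indicator[OF Kb assms(2)] Kb by blast+
  have F01: "0 \<le> F n z" "F n z \<le> 1" for n z using infdist_nonneg[of z E] by (auto simp: F_def)
  have close: "\<bar>F n (e2 t) - p n (e2 t)\<bar> < 1 / (real n + 1)" for n t by (rule p(2)) simp
  have "(\<lambda>n. LINT x|lborel. (cmod (h n x - indicator K x))\<^sup>2) \<longlonglongrightarrow> integral\<^sup>L lborel (\<lambda>x :: real. 0 :: real)"
  proof (rule integral_dominated_convergence[where w = "\<lambda>x. 9 * indicator I x"])
    show "(\<lambda>x. (cmod (h n x - indicator K x))\<^sup>2) \<in> borel_measurable lborel" for n
      using h(1)[of n] K by (auto dest!: square_integrable_measurable)
    show "integrable lborel (\<lambda>x. 9 * indicator I x :: real)" using integrable_indicator_I by simp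
    show "AE x in lborel. norm ((cmod (h n x - indicator K x))\<^sup>2) \<le> 9 * indicator I x" for n
    proof (rule AE_I2)
      fix x
      have "\<bar>p n (e2 (\<epsilon> * x))\<bar> \<le> 2"
      proof -
        have "1 / (real n + 1) \<le> 1" by simp
        then show ?thesis using close[of n "\<epsilon> * x"] F01[of n "e2 (\<epsilon> * x)"] by linarith
      qed
      then have "cmod (h n x - indicator K x) \<le> 3 * indicator I x"
        using assms(2) norm_triangle_ineq4[of "h n x" "indicator K x"]
        by (auto simp: h_def indicator_def split: if_splits)
      then have "(cmod (h n x - indicator K x))\<^sup>2 \<le> (3 * indicator I x)\<^sup>2" by (intro power_mono) auto
      then show "norm ((cmod (h n x - indicator K x))\<^sup>2) \<le> 9 * indicator I x"
        by (auto simp: indicator_def power2_eq_square)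
    qed
    \<comment> \<open>The two endpoints have the same image on the circle. Off them a point of the
      window whose image lies in \<open>E\<close> belongs to \<open>K\<close> itself.\<close>
    have "AE x in lborel. x \<notin> {\<alpha>, \<beta>}" by (rule AE_lborel_notin_countable) auto
    then show "AE x in lborel. (\<lambda>n. (cmod (h n x - indicator K x))\<^sup>2) \<longlonglongrightarrow> 0"
    proof eventually_elim
      case (elim x)
      show ?case
      proof (cases "x \<in> I")
        case True
        have mem: "e2 (\<epsilon> * x) \<in> E \<longleftrightarrow> x \<in> K"
        proof
          assume "e2 (\<epsilon> * x) \<in> E"
          then obtain y where y: "y \<in> K" "e2 (\<epsilon> * x) = e2 (\<epsilon> * y)" by (auto simp: E_def)
          then obtain n where n: "\<epsilon> * x = \<epsilon> * y + of_int n" using e2_eqD by blast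
          have "\<alpha> < x" "x < \<beta>" using elim True by (auto simp: I_def)
          moreover have "\<alpha> \<le> y" "y \<le> \<beta>" using y assms by (auto simp: I_def)
          ultimately have "\<bar>x - y\<bar> < 1 / \<epsilon>" using interval_length by auto
          then have "\<epsilon> * \<bar>x - y\<bar> < 1" using pos by (simp add: field_simps)
          moreover have "\<epsilon> * \<bar>x - y\<bar> = \<bar>\<epsilon> * x - \<epsilon> * y\<bar>"
            using pos by (simp add: right_diff_distrib[symmetric] abs_mult del: right_diff_distrib)
          ultimately have "\<bar>\<epsilon> * x - \<epsilon> * y\<bar> < 1" by simp
          then have "n = 0" using n by simp
          then show "x \<in> K" using n y pos by simp
        qed (auto simp: E_def)
        have FK: "(\<lambda>n. F n (e2 (\<epsilon> * x))) \<longlonglongrightarrow> indicator K x"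
        proof (cases "x \<in> K")
          case True
          then have "F n (e2 (\<epsilon> * x)) = 1" for n using mem by (simp add: F_def)
          then show ?thesis using True by simp
        next
          case False
          then have d: "infdist (e2 (\<epsilon> * x)) E > 0" using mem E infdist_pos_not_in_closed by blast
          obtain N :: nat where N: "1 / infdist (e2 (\<epsilon> * x)) E < real N" using reals_Archimedean2 by blast
          have "F n (e2 (\<epsilon> * x)) = 0" if "n \<ge> N" for n
          proof -
            have "1 / infdist (e2 (\<epsilon> * x)) E < real n" using N that by linarith
            then have "1 < real n * infdist (e2 (\<epsilon> * x)) E" using d by (simp add: field_simps)
            then show ?thesis by (simp add: F_def)
          qed
          then have "\<forall>\<^sub>F n in sequentially. F n (e2 (\<epsilon> * x)) = 0" by (auto simp: eventually_sequentially)
          then show ?thesis using False by (simp add: tendsto_eventually)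
        qed
        have "(\<lambda>n. p n (e2 (\<epsilon> * x)) - F n (e2 (\<epsilon> * x))) \<longlonglongrightarrow> 0"
        proof (rule Lim_null_comparison)
          show "\<forall>\<^sub>F n in sequentially. norm (p n (e2 (\<epsilon> * x)) - F n (e2 (\<epsilon> * x))) \<le> 1 / (real n + 1)"
            using close[of _ "\<epsilon> * x"] by (intro always_eventually allI) (simp add: abs_minus_commute less_imp_le)
          show "(\<lambda>n. 1 / (real n + 1)) \<longlonglongrightarrow> 0" using LIMSEQ_inverse_real_of_nat by (simp add: inverse_eq_divide add.commute)
        qed
        from tendsto_add[OF this FK] have "(\<lambda>n. p n (e2 (\<epsilon> * x))) \<longlonglongrightarrow> indicator K x" by simp
        then have "(\<lambda>n. h n x) \<longlonglongrightarrow> complex_of_real (indicator K x)"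
          using True unfolding h_def by (simp add: tendsto_of_real)
        then have "(\<lambda>n. (cmod (h n x - indicator K x))\<^sup>2) \<longlonglongrightarrow> (cmod (complex_of_real (indicator K x) - indicator K x))\<^sup>2"
          by (intro tendsto_intros)
        moreover have "complex_of_real (indicator K x) - indicator K x = 0" by (simp add: indicator_def)
        ultimately show ?thesis by (simp only: norm_zero power_zero_numeral)
      next
        case False
        then have "x \<notin> K" using assms by blast
        then show ?thesis using False by (simp add: h_def)
      qed
    qed
  qed auto
  then have "(\<lambda>n. abs_L2 (h n)) \<longlonglongrightarrow> abs_L2 (indicator K)"
    by (intro tendsto_abs_L2 h K) simp
  with h(2) show ?thesis by (rule closed_sequentially[OF closed_C])
qed

text \<open>Inner regularity of Lebesgue measure reduces Borel sets to compact ones.\<close>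

lemma indicator_in_C:
  assumes "A \<in> sets borel" "A \<subseteq> I"
  shows "abs_L2 (indicator A) \<in> C"
proof -
  have "\<exists>u\<in>C. dist u (abs_L2 (indicator A)) < e" if "e > 0" for e
  proof -
    have "A \<in> sets lebesgue" using assms(1) by simp
    moreover have "e\<^sup>2 > 0" using that by simp
    ultimately obtain K where K: "closed K" "K \<subseteq> A" "A - K \<in> lmeasurable" "emeasure lebesgue (A - K) < ennreal (e\<^sup>2)"
      by (rule sets_lebesgue_inner_closed)
    have Kb: "K \<in> sets borel" using K by simp
    have "bounded K" using K(2) assms(2) bounded_closed_interval[of \<alpha> \<beta>] unfolding I_def
      by (meson bounded_subset subset_trans)
    then have "compact K" using K by (simp add: compact_eq_bounded_closed)
    then have "abs_L2 (indicator K) \<in> C" using compact_indicator_in_C K assms by blast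
    moreover have "dist (abs_L2 (indicator K)) (abs_L2 (indicator A)) < e"
    proof -
      have si: "square_integrable (indicator K)" "square_integrable (indicator A)"
        using square_integrable_indicator Kb K assms by blast+
      have "(LINT x|lborel. (cmod (indicator K x - indicator A x))\<^sup>2) = (LINT x|lborel. indicator (A - K) x)"
        using K(2) by (intro Bochner_Integration.integral_cong) (auto simp: indicator_def)
      also have "\<dots> = measure lborel (A - K)" using assms Kb by simp
      also have "\<dots> = measure lebesgue (A - K)" using assms Kb by (simp add: measure_completion)
      also have "\<dots> < e\<^sup>2"
      proof -
        have "ennreal (measure lebesgue (A - K)) < ennreal (e\<^sup>2)"
          using K(4) unfolding emeasure_eq_measure2[OF K(3)] .
        then show ?thesis by (subst (asm) ennreal_less_iff) auto
      qed
      finally have "sqrt (LINT x|lborel. (cmod (indicator K x - indicator A x))\<^sup>2) < sqrt (e\<^sup>2)"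
        by (rule real_sqrt_less_mono)
      then show ?thesis using si that by (simp add: dist_norm abs_L2_diff norm_abs_L2 square_integrable_diff)
    qed
    ultimately show ?thesis by blast
  qed
  then have "abs_L2 (indicator A) \<in> closure C" unfolding closure_approachable by simp
  then show ?thesis using closed_C by simp
qed

text \<open>Simple functions dominated by \<open>2 * cmod (g x)\<close> converge pointwise to
  \<open>g\<close>, and each of them is a combination of indicators.\<close>

lemma supported_in_C:
  assumes "supp_in f I"
  shows "f \<in> C"
  using assms
proof (induction f rule: L2.abs_induct)
  case (1 g)
  then have g: "square_integrable g" and ae: "AE x in lborel. x \<notin> I \<longrightarrow> g x = 0"
    by (auto simp: supp_in.abs_eq)
  have gm [measurable]: "g \<in> borel_measurable borel" using g by (auto dest: square_integrable_measurable)
  obtain F where F: "\<And>i. simple_function borel (F i)" "\<And>x. (\<lambda>i. F i x) \<longlonglongrightarrow> g x"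
      "\<And>i x. dist (F i x) 0 \<le> 2 * dist (g x) 0"
    using borel_measurable_implies_sequence_metric[OF gm, of 0] by auto
  have Fm [measurable]: "F i \<in> borel_measurable borel" for i using F(1) by (rule borel_measurable_simple_function)
  define h where "h i x = F i x * indicator I x" for i x
  have hm [measurable]: "h i \<in> borel_measurable borel" for i unfolding h_def I_def by measurable
  have hb: "cmod (h i x) \<le> 2 * cmod (g x)" for i x
    using F(3)[of i x] by (auto simp: h_def indicator_def)
  have g2: "integrable lborel (\<lambda>x. (cmod (g x))\<^sup>2)" using g by (simp add: square_integrable_def)
  have h: "square_integrable (h i)" for i
    unfolding square_integrable_def
  proof
    show "integrable lborel (\<lambda>x. (cmod (h i x))\<^sup>2)"
    proof (rule Bochner_Integration.integrable_bound[OF integrable_mult_right[OF g2, of 4]])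
      show "AE x in lborel. norm ((cmod (h i x))\<^sup>2) \<le> norm (4 * (cmod (g x))\<^sup>2)"
        using power_mono[OF hb norm_ge_zero, of i _ 2] by (simp add: power_mult_distrib)
    qed measurable
  qed simp
  have hC: "abs_L2 (h i) \<in> C" for i
  proof -
    define A where "A y = F i -` {y} \<inter> I" for y
    have A: "A y \<in> sets borel" "A y \<subseteq> I" for y
      using simple_functionD(2)[OF F(1), of i "{y}"] by (auto simp: A_def I_def)
    have fin: "finite (range (F i))" using simple_functionD(1)[OF F(1), of i] by simp
    have eq: "h i x = (\<Sum>y\<in>range (F i). y * indicator (A y) x)" for x
    proof -
      have "(\<Sum>y\<in>range (F i). y * indicator (A y) x) = (\<Sum>y\<in>range (F i). if y = F i x then h i x else 0)"
        by (intro sum.cong) (auto simp: A_def h_def indicator_def)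
      then show ?thesis using fin by simp
    qed
    have "square_integrable (\<lambda>x. \<Sum>y\<in>Y. y * indicator (A y) x) \<and> abs_L2 (\<lambda>x. \<Sum>y\<in>Y. y * indicator (A y) x) \<in> C"
      if "finite Y" for Y
      using that
    proof induction
      case empty
      have "abs_L2 (\<lambda>x. 0) = 0" unfolding zero_L2_def by simp
      then show ?case using C_subspace L2.subspace_0 square_integrable_0 by simp
    next
      case (insert y Y)
      note si = square_integrable_indicator[OF A, of y]
      have "abs_L2 (\<lambda>x. y * indicator (A y) x) = y *\<^sub>C abs_L2 (indicator (A y))"
        using abs_L2_scale[OF si] by simp
      then have 1: "abs_L2 (\<lambda>x. y * indicator (A y) x) \<in> C"
        using indicator_in_C[OF A] C_subspace by (simp add: L2.subspace_scale)
      have 2: "square_integrable (\<lambda>x. y * indicator (A y) x)" by (rule square_integrable_cmult[OF si])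
      have IH: "square_integrable (\<lambda>x. \<Sum>y\<in>Y. y * indicator (A y) x)" "abs_L2 (\<lambda>x. \<Sum>y\<in>Y. y * indicator (A y) x) \<in> C"
        using insert.IH by auto
      have "abs_L2 (\<lambda>x. \<Sum>y\<in>insert y Y. y * indicator (A y) x)
          = abs_L2 (\<lambda>x. y * indicator (A y) x) + abs_L2 (\<lambda>x. \<Sum>y\<in>Y. y * indicator (A y) x)"
        unfolding abs_L2_add[OF 2 IH(1)] sum.insert[OF insert.hyps] ..
      moreover have "square_integrable (\<lambda>x. \<Sum>y\<in>insert y Y. y * indicator (A y) x)"
        using square_integrable_add[OF 2 IH(1)] unfolding sum.insert[OF insert.hyps] .
      ultimately show ?case using L2.subspace_add[OF C_subspace 1 IH(2)] by (simp only:) 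
    qed
    from this[OF fin] show ?thesis unfolding eq[symmetric] by simp
  qed
  have "(\<lambda>n. LINT x|lborel. (cmod (h n x - g x))\<^sup>2) \<longlonglongrightarrow> integral\<^sup>L lborel (\<lambda>x :: real. 0 :: real)"
  proof (rule integral_dominated_convergence[where w = "\<lambda>x. 9 * (cmod (g x))\<^sup>2"])
    show "integrable lborel (\<lambda>x. 9 * (cmod (g x))\<^sup>2)" using g2 by simp
    show "AE x in lborel. norm ((cmod (h n x - g x))\<^sup>2) \<le> 9 * (cmod (g x))\<^sup>2" for n
    proof (rule AE_I2)
      fix x
      have "cmod (h n x - g x) \<le> 3 * cmod (g x)" using hb[of n x] norm_triangle_ineq4[of "h n x" "g x"] by simp
      from power_mono[OF this, of 2] show "norm ((cmod (h n x - g x))\<^sup>2) \<le> 9 * (cmod (g x))\<^sup>2"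
        by (simp add: power_mult_distrib)
    qed
    show "AE x in lborel. (\<lambda>n. (cmod (h n x - g x))\<^sup>2) \<longlonglongrightarrow> 0"
      using ae
    proof eventually_elim
      case (elim x)
      have "(\<lambda>n. h n x) \<longlonglongrightarrow> g x"
        using F(2)[of x] elim by (cases "x \<in> I") (auto simp: h_def)
      then have "(\<lambda>n. (cmod (h n x - g x))\<^sup>2) \<longlonglongrightarrow> (cmod (g x - g x))\<^sup>2" by (intro tendsto_intros)
      then show ?case by simp
    qed
  qed (use gm in measurable)
  then have "(\<lambda>n. abs_L2 (h n)) \<longlonglongrightarrow> abs_L2 g" by (intro tendsto_abs_L2 h g) simp
  with hC show ?case by (rule closed_sequentially[OF closed_C])
qed

end

section \<open>Sample indices and the Parseval identity\<close>

lemma finite_sample_index [simp]: "finite (sample_index M)"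
  by (simp add: sample_index_def)

lemma sample_index_mono: "M \<le> M' \<Longrightarrow> sample_index M \<subseteq> sample_index M'"
  unfolding sample_index_def
  using floor_mono[of "real M / 2" "real M' / 2"] ceiling_mono[of "real M / 2" "real M' / 2"] by auto

lemma sample_index_abs_le: "l \<in> sample_index M \<Longrightarrow> \<bar>real_of_int l\<bar> \<le> real M / 2"
  unfolding sample_index_def by (auto simp: abs_le_iff) linarith+

text \<open>The largest index is \<open>\<lceil>M / 2\<rceil> - 1\<close>, hence the loss of one
  against \<open>M / 2\<close>. Later bounds pay for it with an extra \<open>\<epsilon>\<close> or
  with the margin between two cutoffs.\<close>

lemma sample_indexI: "\<bar>real_of_int l\<bar> \<le> real M / 2 - 1 \<Longrightarrow> l \<in> sample_index M"
  unfolding sample_index_def by (auto simp: abs_le_iff) linarith+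

text \<open>An element of the dense span uses finitely many atoms, which all occur in
  \<open>sample_index M\<close> for large \<open>M\<close>, and projections are best
  approximations.\<close>

lemma parseval_tendsto:
  assumes "0 < \<epsilon>" "0 < T1 + T2" "supp_in f {- T1 / (\<epsilon> * (T1 + T2)) .. T2 / (\<epsilon> * (T1 + T2))}"
  shows "(\<lambda>M. \<Sum>l\<in>sample_index M. (cmod (cinner f (fourier_atom T1 T2 \<epsilon> l)))\<^sup>2) \<longlonglongrightarrow> (norm f)\<^sup>2"
proof -
  let ?s = "fourier_atom T1 T2 \<epsilon>"
  note on = fourier_atom_orthonormal[OF assms(1,2)]
  have "(\<lambda>M. norm (f - onp ?s (sample_index M) f)) \<longlonglongrightarrow> 0"
  proof (rule LIMSEQ_I)
    fix r :: real assume "0 < r"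
    have "f \<in> closure (cspan (range ?s))" by (rule supported_in_C[OF assms])
    then obtain u where u: "u \<in> cspan (range ?s)" "dist u f < r"
      using \<open>0 < r\<close> unfolding closure_approachable by blast
    obtain L where L: "finite L" "u \<in> cspan (?s ` L)"
    proof -
      obtain B c where "finite B" "B \<subseteq> range ?s" "u = (\<Sum>b\<in>B. c b *\<^sub>C b)"
        using u(1) unfolding L2.span_explicit by blast
      then obtain L where "finite L" "B = ?s ` L" by (meson finite_subset_image)
      then show ?thesis using that[of L] \<open>u = _\<close>
        by (auto intro!: L2.span_sum intro: L2.span_scale L2.span_base)
    qed
    obtain M0 :: nat where M0: "\<And>l. l \<in> L \<Longrightarrow> 2 * (\<bar>real_of_int l\<bar> + 1) \<le> real M0"
    proof -
      obtain m :: nat where m: "Max (insert 0 ((\<lambda>l. 2 * (\<bar>real_of_int l\<bar> + 1)) ` L)) \<le> real m"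
        using real_arch_simple by blast
      have "2 * (\<bar>real_of_int l\<bar> + 1) \<le> real m" if "l \<in> L" for l
        by (rule order_trans[OF Max_ge m]) (use that L(1) in auto)
      then show ?thesis using that by blast
    qed
    have "norm (f - onp ?s (sample_index M) f) < r" if "M \<ge> M0" for M
    proof -
      have "L \<subseteq> sample_index M"
      proof
        fix l assume "l \<in> L"
        then show "l \<in> sample_index M" using M0[of l] that by (intro sample_indexI) simp
      qed
      then have "u \<in> cspan (?s ` sample_index M)" using L(2) L2.span_mono[of "?s ` L" "?s ` sample_index M"] by blast
      from onp_best[OF on finite_sample_index this, of f] u(2) show ?thesis
        by (simp add: dist_norm norm_minus_commute)
    qed
    then show "\<exists>no. \<forall>n\<ge>no. norm (norm (f - onp ?s (sample_index n) f) - 0) < r" by auto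
  qed
  then have "(\<lambda>M. (norm f)\<^sup>2 - (norm (f - onp ?s (sample_index M) f))\<^sup>2) \<longlonglongrightarrow> (norm f)\<^sup>2 - 0\<^sup>2"
    by (intro tendsto_intros)
  moreover have "(norm f)\<^sup>2 - (norm (f - onp ?s (sample_index M) f))\<^sup>2
      = (\<Sum>l\<in>sample_index M. (cmod (cinner f (?s l)))\<^sup>2)" for M
    using norm_split_onp[OF on finite_sample_index, of f M] by linarith
  ultimately show ?thesis by (simp only: zero_power2 diff_zero)
qed

section \<open>Wavelet atoms\<close>

lemma wavelet_factor: "complex_of_real (2 powr (of_int j / 2)) * complex_of_real (2 powr (of_int j / 2)) = complex_of_real (2 powi j)"
proof -
  have "2 powr (of_int j / 2) * 2 powr (of_int j / 2) = (2::real) powr (of_int j)"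
    by (simp flip: powr_add)
  also have "\<dots> = 2 powi j" by (simp add: powr_real_of_int')
  finally show ?thesis unfolding of_real_mult[symmetric] by simp
qed

lemma cinner_dyadic:
  "complex_of_real (2 powi j) * cinner (dyadic_comp j k f) (dyadic_comp j k g) = cinner f g"
proof transfer
  fix j k :: int and f g :: "real \<Rightarrow> complex"
  have "(LINT x|lborel. f x * cnj (g x))
     = \<bar>2 powi j\<bar> *\<^sub>R (LINT x|lborel. f (- of_int k + 2 powi j * x) * cnj (g (- of_int k + 2 powi j * x)))"
    by (rule lborel_integral_real_affine) simp
  then show "complex_of_real (2 powi j) * (LINT x|lborel. f (2 powi j * x - of_int k) * cnj (g (2 powi j * x - of_int k)))
     = (LINT x|lborel. f x * cnj (g x))"
    by (simp add: scaleR_conv_of_real)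
qed

lemma cinner_wavelet_atom: "cinner (wavelet_atom f j k) (wavelet_atom g j k) = cinner f g"
proof -
  have "cinner (wavelet_atom f j k) (wavelet_atom g j k)
     = (complex_of_real (2 powr (of_int j / 2)) * complex_of_real (2 powr (of_int j / 2))) * cinner (dyadic_comp j k f) (dyadic_comp j k g)"
    by (simp add: wavelet_atom_def cinner_scale_left cinner_scale_right)
  then show ?thesis unfolding wavelet_factor cinner_dyadic .
qed

lemma dyadic_comp_add: "dyadic_comp j k (f + g) = dyadic_comp j k f + dyadic_comp j k g"
  by transfer (auto intro: square_integrable_add square_integrable_dyadic)

lemma dyadic_comp_scale: "dyadic_comp j k (c *\<^sub>C f) = c *\<^sub>C dyadic_comp j k f"
  by transfer (auto intro: square_integrable_cmult square_integrable_dyadic)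

lemma wavelet_atom_add: "wavelet_atom (f + g) j k = wavelet_atom f j k + wavelet_atom g j k"
  by (simp add: wavelet_atom_def dyadic_comp_add L2.scale_right_distrib)

lemma wavelet_atom_scale: "wavelet_atom (c *\<^sub>C f) j k = c *\<^sub>C wavelet_atom f j k"
  by (simp add: wavelet_atom_def dyadic_comp_scale mult.commute)

lemma wavelet_atom_zero [simp]: "wavelet_atom 0 j k = 0"
  using wavelet_atom_scale[of 0 0 j k] by simp

lemma wavelet_atom_sum: "wavelet_atom (\<Sum>i\<in>F. f i) j k = (\<Sum>i\<in>F. wavelet_atom (f i) j k)"
  by (induction F rule: infinite_finite_induct) (auto simp: wavelet_atom_add)

lemma powi_2_add: "(2::real) powi (i + j) = 2 powi i * 2 powi j"
  by (rule power_int_add) simp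

text \<open>The hypothesis makes the composed shift an integer.\<close>

lemma dyadic_comp_comp:
  assumes "i \<ge> 0 \<or> k = 0"
  shows "dyadic_comp j k (dyadic_comp i l f) = dyadic_comp (i + j) (2 ^ nat i * k + l) f"
  using assms
proof transfer
  fix i k j l :: int and f :: "real \<Rightarrow> complex"
  assume f: "square_integrable f \<and> square_integrable f \<and> (AE x in lborel. f x = f x)" and ik: "i \<ge> 0 \<or> k = 0"
  have eq0: "(2::real) powi i * of_int k = of_int (2 ^ nat i * k)"
    using ik by (cases "k = 0") (simp_all add: power_int_def)
  have eq: "2 powi i * (2 powi j * x - of_int k) - of_int l = 2 powi (i + j) * x - of_int (2 ^ nat i * k + l)" for x :: real
    unfolding of_int_add by (simp only: powi_2_add flip: eq0) (simp add: algebra_simps)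
  show "square_integrable (\<lambda>x. f (2 powi i * (2 powi j * x - of_int k) - of_int l)) \<and>
        square_integrable (\<lambda>x. f (2 powi (i + j) * x - of_int (2 ^ nat i * k + l))) \<and>
        (AE x in lborel. f (2 powi i * (2 powi j * x - of_int k) - of_int l) = f (2 powi (i + j) * x - of_int (2 ^ nat i * k + l)))"
    unfolding eq using f square_integrable_dyadic by blast
qed

lemma wavelet_atom_comp:
  assumes "i \<ge> 0 \<or> k = 0"
  shows "wavelet_atom (wavelet_atom f i l) j k = wavelet_atom f (i + j) (2 ^ nat i * k + l)"
proof -
  have "2 powr (of_int j / 2) * 2 powr (of_int i / 2) = (2::real) powr (of_int (i + j) / 2)"
    by (simp add: add_divide_distrib add.commute flip: powr_add)
  then have "complex_of_real (2 powr (of_int j / 2)) * complex_of_real (2 powr (of_int i / 2)) = complex_of_real (2 powr (of_int (i + j) / 2))"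
    unfolding of_real_mult[symmetric] by (simp only:)
  then show ?thesis
    unfolding wavelet_atom_def dyadic_comp_scale L2.scale_scale dyadic_comp_comp[OF assms] by (simp only:)
qed

lemma dyadic_comp_0_0 [simp]: "dyadic_comp 0 0 f = f"
  by transfer simp

lemma wavelet_atom_0_0 [simp]: "wavelet_atom f 0 0 = f"
  by (simp add: wavelet_atom_def)

lemma wavelet_atom_0: "wavelet_atom f 0 k = dyadic_comp 0 k f"
  by (simp add: wavelet_atom_def)

lemma wavelet_atom_inverse: "wavelet_atom (wavelet_atom f (- j) 0) j 0 = f"
  by (simp add: wavelet_atom_comp)

lemma wavelet_atom_translate: "wavelet_atom (wavelet_atom f 0 k) j 0 = wavelet_atom f j k"
  by (simp add: wavelet_atom_comp)

lemma supp_in_dyadic: "supp_in f S \<Longrightarrow> supp_in (dyadic_comp j k f) {x. 2 powi j * x - of_int k \<in> S}"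
proof transfer
  fix f :: "real \<Rightarrow> complex" and S j k
  assume f: "square_integrable f \<and> square_integrable f \<and> (AE x in lborel. f x = f x)"
    and ae: "AE x in lborel. x \<notin> S \<longrightarrow> f x = 0"
  obtain N where N: "N \<in> null_sets lborel" "\<And>x. x \<notin> N \<Longrightarrow> x \<notin> S \<longrightarrow> f x = 0"
    using AE_E3[OF ae] by auto
  have "AE x in lborel. x \<notin> N" using N(1) by (rule AE_not_in)
  then have "AE x in lborel. - of_int k + 2 powi j * x \<notin> N"
    using N(1) by (intro AE_borel_affine) auto
  then show "AE x in lborel. x \<notin> {x. 2 powi j * x - of_int k \<in> S} \<longrightarrow> f (2 powi j * x - of_int k) = 0"
    by eventually_elim (use N(2) in \<open>simp add: algebra_simps\<close>)
qed

lemma supp_in_wavelet_atom: "supp_in f S \<Longrightarrow> supp_in (wavelet_atom f j k) {x. 2 powi j * x - of_int k \<in> S}"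
  unfolding wavelet_atom_def by (intro supp_in_scale supp_in_dyadic)

lemma fourier_wavelet_atom:
  "fourier (wavelet_atom f j k) \<omega>
     = complex_of_real (2 powr (- of_int j / 2)) * e2 (- (of_int k * \<omega> / 2 powi j)) * fourier f (\<omega> / 2 powi j)"
proof -
  have "2 powr (of_int j / 2) / 2 powi j = (2::real) powr (- of_int j / 2)"
    by (simp add: powr_minus divide_simps) (simp flip: powr_real_of_int' add: powr_add[symmetric])
  then have eq: "complex_of_real (2 powr (- of_int j / 2)) = complex_of_real (2 powr (of_int j / 2)) / complex_of_real (2 powi j)"
    unfolding of_real_divide[symmetric] by (simp only:)
  have "A * (E / B * F) = A / B * E * F" for A B E F :: complex by simp
  then show ?thesis unfolding wavelet_atom_def fourier_scale fourier_dyadic eq by (simp only:)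
qed

text \<open>The complement of the support is a union of possibly uncountably many open sets on which
  \<open>f\<close> vanishes almost everywhere; by Lindelof countably many of them have the same
  union.\<close>

lemma supp_in_ess_support: "supp_in f (ess_support f)"
proof transfer
  fix f :: "real \<Rightarrow> complex"
  define \<F> where "\<F> = {U. open U \<and> (AE x in lborel. x \<in> U \<longrightarrow> f x = 0)}"
  obtain \<G> where G: "\<G> \<subseteq> \<F>" "countable \<G>" "\<Union>\<G> = \<Union>\<F>"
    using Lindelof[of \<F>] by (auto simp: \<F>_def)
  have "AE x in lborel. \<forall>U\<in>\<G>. x \<in> U \<longrightarrow> f x = 0"
    using G(1,2) by (subst AE_ball_countable) (auto simp: \<F>_def)
  then have "AE x in lborel. x \<in> \<Union>\<F> \<longrightarrow> f x = 0"
    unfolding G(3)[symmetric] by eventually_elim auto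
  moreover have "x \<in> \<Union>\<F>" if x: "x \<notin> \<Inter>{C. closed C \<and> (AE x in lborel. x \<notin> C \<longrightarrow> f x = 0)}" for x
  proof -
    obtain C where "closed C" "AE x in lborel. x \<notin> C \<longrightarrow> f x = 0" "x \<notin> C" using x by blast
    then have "- C \<in> \<F>" "x \<in> - C" by (auto simp: \<F>_def)
    then show ?thesis by blast
  qed
  ultimately show "AE x in lborel. x \<notin> \<Inter>{C. closed C \<and> (AE x in lborel. x \<notin> C \<longrightarrow> f x = 0)} \<longrightarrow> f x = 0"
    by (auto elim!: eventually_mono)
qed

lemma ess_support_subset: "supp_in f C \<Longrightarrow> closed C \<Longrightarrow> ess_support f \<subseteq> C"
  by transfer auto

section \<open>Multiresolution analyses with compactly supported generators\<close>

locale wavelets =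
  fixes V :: "int \<Rightarrow> L2 set" and \<phi> \<psi> :: L2 and a :: real
  assumes mra: "multiresolution_analysis V \<phi>" and wavelet: "associated_wavelet V \<psi>"
    and a1: "a \<ge> 1" and supp_eq: "ess_support \<phi> = {0..a}" "ess_support \<psi> = {0..a}"
begin

lemma V_subspace: "csubspace (V j)"
  using mra by (auto simp: multiresolution_analysis_def)

lemma V_mono: "i \<le> j \<Longrightarrow> V i \<subseteq> V j"
proof (induction j rule: int_ge_induct)
  case (step j)
  then show ?case using mra by (auto simp: multiresolution_analysis_def)
qed simp

lemma V_dilate: "f \<in> V i \<longleftrightarrow> wavelet_atom f (int n) 0 \<in> V (i + int n)"
proof (induction n arbitrary: i f)
  case (Suc n)
  have 1: "f \<in> V i \<longleftrightarrow> dyadic_comp 1 0 f \<in> V (i + 1)"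
    using mra by (auto simp: multiresolution_analysis_def)
  have nz: "complex_of_real (2 powr (of_int 1 / 2)) \<noteq> 0" by simp
  have "dyadic_comp 1 0 f \<in> V (i + 1) \<longleftrightarrow> wavelet_atom f 1 0 \<in> V (i + 1)"
  proof
    assume "wavelet_atom f 1 0 \<in> V (i + 1)"
    then have "inverse (complex_of_real (2 powr (of_int 1 / 2))) *\<^sub>C wavelet_atom f 1 0 \<in> V (i + 1)"
      by (rule L2.subspace_scale[OF V_subspace])
    then show "dyadic_comp 1 0 f \<in> V (i + 1)" using nz by (simp add: wavelet_atom_def)
  qed (simp add: wavelet_atom_def L2.subspace_scale[OF V_subspace])
  also have "\<dots> \<longleftrightarrow> wavelet_atom (wavelet_atom f 1 0) (int n) 0 \<in> V (i + 1 + int n)"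
    by (rule Suc.IH)
  finally show ?case using 1 by (simp add: wavelet_atom_comp algebra_simps)
qed simp

lemma V_undilate: "f \<in> V (i + int n) \<longleftrightarrow> wavelet_atom f (- int n) 0 \<in> V i"
  using V_dilate[of "wavelet_atom f (- int n) 0" i n] by (simp add: wavelet_atom_inverse)

lemma V0_basis: "orthonormal_basis (\<lambda>k. wavelet_atom \<phi> 0 k) (V 0)"
  using mra by (simp add: multiresolution_analysis_def wavelet_atom_0)

lemma W0_basis: "orthonormal_basis (\<lambda>k. wavelet_atom \<psi> 0 k) {f \<in> V 1. \<forall>g\<in>V 0. cinner f g = 0}"
  using wavelet by (simp add: associated_wavelet_def wavelet_atom_0)

lemma supp_phi: "supp_in \<phi> {0..a}" and supp_psi: "supp_in \<psi> {0..a}"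
  using supp_in_ess_support[of \<phi>] supp_in_ess_support[of \<psi>] by (simp_all add: supp_eq)

text \<open>Here and in \<open>phi_right\<close> the support of \<open>\<phi>\<close> is bounded
  from below: no smaller interval carries it. This makes the outermost translates in a sum
  detectable from the support of the sum.\<close>

lemma phi_left: "supp_in \<phi> {\<delta>..} \<Longrightarrow> \<delta> \<le> 0"
  using ess_support_subset[of \<phi> "{\<delta>..}"] a1 by (auto simp: supp_eq)

lemma phi_right: "supp_in \<phi> {..\<delta>} \<Longrightarrow> a \<le> \<delta>"
  using ess_support_subset[of \<phi> "{..\<delta>}"] a1 by (auto simp: supp_eq)

lemma orthonormal_basis_memberD: "orthonormal_basis e U \<Longrightarrow> e k \<in> U"
  unfolding orthonormal_basis_def by (metis L2.span_base closure_subset rangeI subsetD)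

lemma phi_in_V: "wavelet_atom \<phi> (int n) k \<in> V (int n)"
  using V_dilate[of "wavelet_atom \<phi> 0 k" 0 n] orthonormal_basis_memberD[OF V0_basis, of k]
  by (simp add: wavelet_atom_translate)

lemma psi_in_V: "wavelet_atom \<psi> (int n) k \<in> V (int n + 1)"
  using V_dilate[of "wavelet_atom \<psi> 0 k" 1 n] orthonormal_basis_memberD[OF W0_basis, of k]
  by (simp add: wavelet_atom_translate add.commute)

lemma psi_perp_V:
  assumes "g \<in> V (int n)"
  shows "cinner g (wavelet_atom \<psi> (int n) k) = 0"
proof -
  have "wavelet_atom g (- int n) 0 \<in> V 0" using V_undilate[of g 0 n] assms by simp
  then have "cinner (wavelet_atom \<psi> 0 k) (wavelet_atom g (- int n) 0) = 0"
    using orthonormal_basis_memberD[OF W0_basis, of k] by blast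
  then have "cinner (wavelet_atom g (- int n) 0) (wavelet_atom \<psi> 0 k) = 0"
    by (subst cinner_commute) simp
  then have "cinner (wavelet_atom (wavelet_atom g (- int n) 0) (int n) 0) (wavelet_atom (wavelet_atom \<psi> 0 k) (int n) 0) = 0"
    unfolding cinner_wavelet_atom .
  then show ?thesis unfolding wavelet_atom_inverse wavelet_atom_translate .
qed

lemma phi_orthonormal: "cinner (wavelet_atom \<phi> j k) (wavelet_atom \<phi> j l) = (if k = l then 1 else 0)"
proof -
  have "cinner (wavelet_atom (wavelet_atom \<phi> 0 k) j 0) (wavelet_atom (wavelet_atom \<phi> 0 l) j 0) = (if k = l then 1 else 0)"
    unfolding cinner_wavelet_atom using V0_basis by (simp add: orthonormal_basis_def)
  then show ?thesis unfolding wavelet_atom_translate .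
qed

lemma psi_orthonormal: "cinner (wavelet_atom \<psi> j k) (wavelet_atom \<psi> j l) = (if k = l then 1 else 0)"
proof -
  have "cinner (wavelet_atom (wavelet_atom \<psi> 0 k) j 0) (wavelet_atom (wavelet_atom \<psi> 0 l) j 0) = (if k = l then 1 else 0)"
    unfolding cinner_wavelet_atom using W0_basis by (simp add: orthonormal_basis_def)
  then show ?thesis unfolding wavelet_atom_translate .
qed

lemma norm_phi: "norm \<phi> = 1"
  using phi_orthonormal[of 0 0 0] by (intro norm_eq_one) simp

text \<open>One index type for both families, so that the whole system can be treated as a single
  orthonormal family.\<close>

fun atom :: "int + nat \<times> int \<Rightarrow> L2" where
  "atom (Inl k) = wavelet_atom \<phi> 0 k"
| "atom (Inr (j, k)) = wavelet_atom \<psi> (int j) k"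

lemma atom_orthonormal: "orthonormal_on atom A"
proof -
  have phipsi: "cinner (wavelet_atom \<phi> 0 k) (wavelet_atom \<psi> (int j) l) = 0" for k j l
    using psi_perp_V[of "wavelet_atom \<phi> 0 k" j l] phi_in_V[of 0 k] V_mono[of 0 "int j"] by auto
  have lt: "cinner (wavelet_atom \<psi> (int i) k) (wavelet_atom \<psi> (int j) l) = 0" if "i < j" for i j k l
    using psi_perp_V[of "wavelet_atom \<psi> (int i) k" j l] psi_in_V[of i k] V_mono[of "int i + 1" "int j"] that by auto
  have psipsi: "cinner (wavelet_atom \<psi> (int i) k) (wavelet_atom \<psi> (int j) l) = (if (i, k) = (j, l) then 1 else 0)" for i j k l
  proof (cases i j rule: linorder_cases)
    case equal
    then show ?thesis by (simp add: psi_orthonormal)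
  next
    case less
    then show ?thesis by (simp add: lt)
  next
    case greater
    then show ?thesis using lt[of j i l k] by (subst cinner_commute) simp
  qed
  have psiphi: "cinner (wavelet_atom \<psi> (int j) l) (wavelet_atom \<phi> 0 k) = 0" for k j l
    by (subst cinner_commute) (simp add: phipsi)
  have "cinner (atom i) (atom j) = (if i = j then 1 else 0)" for i j
    by (cases i rule: atom.cases; cases j rule: atom.cases)
      (simp_all add: phi_orthonormal phipsi psiphi psipsi)
  then show ?thesis by (simp add: orthonormal_on_def)
qed

lemma supp_in_atom_interval:
  assumes "supp_in \<eta> {0..a}"
  shows "supp_in (wavelet_atom \<eta> j k) {of_int k / 2 powi j..(of_int k + a) / 2 powi j}"
proof (rule supp_in_mono[OF supp_in_wavelet_atom[OF assms, of j k]])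
  have "(2::real) powi j > 0" by simp
  then show "{x. 2 powi j * x - of_int k \<in> {0..a}} \<subseteq> {of_int k / 2 powi j..(of_int k + a) / 2 powi j}"
    by (auto simp: field_simps)
qed

lemma cinner_atom_disjoint:
  assumes "supp_in \<eta> {0..a}" "supp_in f {\<alpha>..\<beta>}"
    and "(of_int k + a) / 2 powi j \<le> \<alpha> \<or> \<beta> \<le> of_int k / 2 powi j"
  shows "cinner f (wavelet_atom \<eta> j k) = 0"
proof (rule cinner_disjoint[OF assms(2) supp_in_atom_interval[OF assms(1)]])
  have "{\<alpha>..\<beta>} \<inter> {of_int k / 2 powi j..(of_int k + a) / 2 powi j} \<subseteq> {\<alpha>, \<beta>}"
    using assms(3) by auto
  then show "countable ({\<alpha>..\<beta>} \<inter> {of_int k / 2 powi j..(of_int k + a) / 2 powi j})"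
    by (rule countable_subset) auto
qed

text \<open>Bounded support leaves finitely many nonzero coefficients at each scale, so that all
  expansions below are finite sums.\<close>

definition bounded_supp :: "L2 \<Rightarrow> bool" where "bounded_supp f \<longleftrightarrow> (\<exists>r. supp_in f {- r..r})"

lemma bounded_suppI: "supp_in f {\<alpha>..\<beta>} \<Longrightarrow> bounded_supp f"
  unfolding bounded_supp_def
  by (rule exI[of _ "max \<bar>\<alpha>\<bar> \<bar>\<beta>\<bar>"], erule supp_in_mono) auto

lemma bounded_supp_atom: "bounded_supp (wavelet_atom \<phi> j k)" "bounded_supp (wavelet_atom \<psi> j k)"
  using supp_in_atom_interval[OF supp_phi] supp_in_atom_interval[OF supp_psi] bounded_suppI by blast+

lemma bounded_supp_add: "bounded_supp f \<Longrightarrow> bounded_supp g \<Longrightarrow> bounded_supp (f + g)"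
proof -
  assume "bounded_supp f" "bounded_supp g"
  then obtain r s where "supp_in f {-r..r}" "supp_in g {-s..s}" by (auto simp: bounded_supp_def)
  then have "supp_in f {- max r s..max r s}" "supp_in g {- max r s..max r s}"
    by (auto elim!: supp_in_mono)
  then show ?thesis unfolding bounded_supp_def by (auto intro: supp_in_add)
qed

lemma bounded_supp_scale: "bounded_supp f \<Longrightarrow> bounded_supp (c *\<^sub>C f)"
  unfolding bounded_supp_def by (auto intro: supp_in_scale)

lemma bounded_supp_diff: "bounded_supp f \<Longrightarrow> bounded_supp g \<Longrightarrow> bounded_supp (f - g)"
  unfolding minus_L2_def uminus_L2_def by (intro bounded_supp_add bounded_supp_scale)

lemma bounded_supp_zero: "bounded_supp 0"
  by (simp add: bounded_supp_def)

lemma bounded_supp_sum: "(\<And>i. i \<in> F \<Longrightarrow> bounded_supp (f i)) \<Longrightarrow> bounded_supp (\<Sum>i\<in>F. f i)"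
  by (induction F rule: infinite_finite_induct) (auto intro: bounded_supp_add bounded_supp_zero)

lemma bounded_supp_onp: "(\<And>i. i \<in> F \<Longrightarrow> bounded_supp (e i)) \<Longrightarrow> bounded_supp (onp e F f)"
  unfolding onp_def by (intro bounded_supp_sum bounded_supp_scale)

lemma bounded_supp_dilate: "bounded_supp f \<Longrightarrow> bounded_supp (wavelet_atom f j 0)"
proof -
  assume "bounded_supp f"
  then obtain r where r: "supp_in f {-r..r}" by (auto simp: bounded_supp_def)
  have "(2::real) powi j > 0" by simp
  then have "{x. 2 powi j * x - of_int 0 \<in> {-r..r}} \<subseteq> {- (r / 2 powi j)..r / 2 powi j}"
    by (auto simp: field_simps)
  from supp_in_mono[OF supp_in_wavelet_atom[OF r, of j 0] this] show ?thesis by (auto simp: bounded_supp_def)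
qed

lemma finitely_many_overlaps:
  assumes "supp_in \<eta> {0..a}" "bounded_supp f"
  shows "\<exists>F. finite F \<and> (\<forall>k. k \<notin> F \<longrightarrow> cinner f (wavelet_atom \<eta> j k) = 0)"
proof -
  obtain r where r: "supp_in f {-r..r}" using assms by (auto simp: bounded_supp_def)
  define m where "m = \<lceil>2 powi j * \<bar>r\<bar> + a\<rceil>"
  have p: "(2::real) powi j > 0" by simp
  have "cinner f (wavelet_atom \<eta> j k) = 0" if "k \<notin> {- m..m}" for k
  proof (rule cinner_atom_disjoint[OF assms(1) r])
    have m: "2 powi j * \<bar>r\<bar> + a \<le> of_int m" unfolding m_def by linarith
    have rr: "2 powi j * r \<le> 2 powi j * \<bar>r\<bar>" using p by (intro mult_left_mono) auto
    consider "of_int k < - real_of_int m" | "real_of_int m < of_int k"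
    proof -
      have "k < - m \<or> m < k" using \<open>k \<notin> {- m..m}\<close> by auto
      then have "real_of_int k < of_int (- m) \<or> real_of_int m < of_int k" by (simp only: of_int_less_iff)
      then show ?thesis using that by (elim disjE) simp_all
    qed
    then show "(of_int k + a) / 2 powi j \<le> - r \<or> r \<le> of_int k / 2 powi j"
    proof cases
      case 1
      then have "of_int k + a \<le> - (2 powi j * r)" using m rr by linarith
      then show ?thesis using p by (simp add: field_simps)
    next
      case 2
      then have "2 powi j * r \<le> of_int k" using m rr a1 by linarith
      then show ?thesis using p by (simp add: field_simps)
    qed
  qed
  then show ?thesis by (intro exI[of _ "{-m..m}"]) auto
qed

text \<open>After rescaling to level 0, the part of \<open>f\<close> orthogonal to
  \<open>V 0\<close> lies in the wavelet space and has no wavelet coefficients, so it is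
  zero.\<close>

lemma descend:
  assumes "f \<in> V (int n + 1)" "bounded_supp f" "\<And>k. cinner f (wavelet_atom \<psi> (int n) k) = 0"
  shows "f \<in> V (int n)"
proof -
  define u where "u = wavelet_atom f (- int n) 0"
  have u: "u \<in> V 1" "bounded_supp u"
    using V_undilate[of f 1 n] assms(1) bounded_supp_dilate[OF assms(2)] by (auto simp: u_def add.commute)
  have fu: "f = wavelet_atom u (int n) 0" by (simp add: u_def wavelet_atom_inverse)
  have upsi: "cinner u (wavelet_atom \<psi> 0 k) = 0" for k
    using assms(3)[of k] cinner_wavelet_atom[of u "int n" 0 "wavelet_atom \<psi> 0 k"]
    by (simp add: fu wavelet_atom_translate)
  let ?e = "\<lambda>k. wavelet_atom \<phi> 0 k"
  obtain F where F: "finite F" "\<And>k. k \<notin> F \<Longrightarrow> cinner u (?e k) = 0"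
    using finitely_many_overlaps[OF supp_phi u(2), of 0] by blast
  define p where "p = onp ?e F u"
  have on: "orthonormal_on ?e A" for A by (simp add: orthonormal_on_def phi_orthonormal)
  have p0: "p \<in> V 0"
    unfolding p_def onp_def
    by (intro L2.subspace_sum L2.subspace_scale V_subspace) (use phi_in_V[of 0] in simp)
  have perp: "cinner (u - p) (?e k) = 0" for k
  proof (cases "k \<in> F")
    case True
    then show ?thesis unfolding p_def using cinner_onp_residual[OF on F(1)] by (simp add: L2.span_base)
  next
    case False
    then have "cinner p (?e k) = 0"
      unfolding p_def onp_def cinner_sum_left cinner_scale_left
      by (intro sum.neutral) (auto simp: phi_orthonormal)
    then show ?thesis using F(2)[OF False] by (simp add: cinner_diff_left)
  qed
  have "cinner (u - p) g = 0" if "g \<in> V 0" for g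
  proof (rule cinner_closure_zero)
    show "g \<in> closure (cspan (range ?e))" using that V0_basis by (simp add: orthonormal_basis_def)
    show "cinner (u - p) v = 0" if "v \<in> cspan (range ?e)" for v
      by (rule cinner_span_zero[OF _ that]) (auto simp: perp)
  qed
  moreover have "u - p \<in> V 1"
    using u(1) p0 V_mono[of 0 1] by (auto intro: L2.subspace_diff[OF V_subspace])
  moreover have "cinner (u - p) (wavelet_atom \<psi> 0 k) = 0" for k
    using upsi psi_perp_V[of p 0 k] p0 by (simp add: cinner_diff_left)
  ultimately have "u - p = onp (\<lambda>k. wavelet_atom \<psi> 0 k) {} (u - p)"
    by (intro orthonormal_basis_expand[OF W0_basis]) auto
  then have "u = p" by (simp add: onp_def)
  then show ?thesis using p0 V_dilate[of u 0 n] by (simp add: fu)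
qed

text \<open>Chosen so that an atom of level \<open>i\<close> lies in \<open>V (int i)\<close>: a
  wavelet of scale \<open>j\<close> belongs to the space one step finer.\<close>

fun level :: "int + nat \<times> int \<Rightarrow> nat" where
  "level (Inl k) = 0"
| "level (Inr (j, k)) = Suc j"

lemma perp_atoms_zero:
  assumes "f \<in> V (int n)" "bounded_supp f" "\<And>i. level i \<le> n \<Longrightarrow> cinner f (atom i) = 0"
  shows "f = 0"
  using assms
proof (induction n)
  case 0
  have "cinner f (wavelet_atom \<phi> 0 k) = 0" for k using 0(3)[of "Inl k"] by simp
  then have "f = onp (\<lambda>k. wavelet_atom \<phi> 0 k) {} f"
    using 0(1) by (intro orthonormal_basis_expand[OF V0_basis]) auto
  then show ?case by (simp add: onp_def)
next
  case (Suc n)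
  have "f \<in> V (int n)"
    using Suc.prems(1,2) Suc.prems(3)[of "Inr (n, _)"] by (intro descend) (auto simp: add.commute)
  then show ?case using Suc.prems by (intro Suc.IH) auto
qed

lemma atom_in_V: "level i \<le> n \<Longrightarrow> atom i \<in> V (int n)"
proof (cases i rule: level.cases)
  case (1 k)
  then show ?thesis using phi_in_V[of 0 k] V_mono[of 0 "int n"] by auto
next
  case (2 j k)
  assume "level i \<le> n"
  then have "int j + 1 \<le> int n" using 2 by simp
  then show ?thesis using 2 psi_in_V[of j k] V_mono[of "int j + 1" "int n"] by auto
qed

lemma bounded_supp_atom': "bounded_supp (atom i)"
  by (cases i rule: atom.cases) (auto simp: bounded_supp_atom)

text \<open>What remains after projecting is orthogonal to all atoms up to level \<open>n\<close>,
  and \<open>perp_atoms_zero\<close> pushes it down one level at a time until it is zero.\<close>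

lemma atom_expand:
  assumes "f \<in> V (int n)" "bounded_supp f" "finite F" "\<And>i. i \<in> F \<Longrightarrow> level i \<le> n"
    and "\<And>i. i \<notin> F \<Longrightarrow> level i \<le> n \<Longrightarrow> cinner f (atom i) = 0"
  shows "f \<in> cspan (atom ` F)"
proof -
  have "f - onp atom F f = 0"
  proof (rule perp_atoms_zero)
    show "f - onp atom F f \<in> V (int n)"
      using assms(1,4) unfolding onp_def
      by (intro L2.subspace_diff L2.subspace_sum L2.subspace_scale V_subspace atom_in_V)
    show "bounded_supp (f - onp atom F f)"
      by (intro bounded_supp_diff assms(2) bounded_supp_onp bounded_supp_atom')
    show "cinner (f - onp atom F f) (atom i) = 0" if "level i \<le> n" for i
    proof (cases "i \<in> F")
      case True
      then show ?thesis using cinner_onp_residual[OF atom_orthonormal assms(3)] by (simp add: L2.span_base)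
    next
      case False
      then have "cinner (onp atom F f) (atom i) = 0"
        unfolding onp_def cinner_sum_left cinner_scale_left
        using atom_orthonormal[of UNIV] by (intro sum.neutral) (auto simp: orthonormal_on_def)
      then show ?thesis using assms(5)[OF False that] by (simp add: cinner_diff_left)
    qed
  qed
  then show ?thesis using onp_in_span[of atom F f] by simp
qed

end

section \<open>Prefixes of the enumeration as index sets\<close>

lemma take_upto:
  assumes "int m \<le> j - i + 1"
  shows "take m [i..j] = [i..i + int m - 1]"
  using assms by (intro nth_equalityI) (auto simp: nth_upto)

context wavelets
begin

definition idx :: "nat \<Rightarrow> (int + nat \<times> int) set" where
  "idx n = Inl ` {- \<lceil>a\<rceil> + 1..\<lceil>a\<rceil> - 1} \<union> Inr ` (SIGMA j:{..<n}. {- \<lceil>a\<rceil> + 1..2 ^ j * \<lceil>a\<rceil> - 1})"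

text \<open>Every long enough prefix of the enumeration stops inside some scale \<open>n\<close>
  after \<open>m\<close> of its wavelets (\<open>dimn_partition\<close>), so the spaces
  \<open>recon_space w N\<close> are handled through the pair \<open>n\<close>,
  \<open>m\<close>.\<close>

definition idx_partial :: "nat \<Rightarrow> nat \<Rightarrow> (int + nat \<times> int) set" where
  "idx_partial n m = idx n \<union> (\<lambda>k. Inr (n, k)) ` {- \<lceil>a\<rceil> + 1..<- \<lceil>a\<rceil> + 1 + int m}"

definition dimn :: "nat \<Rightarrow> nat" where "dimn n = length (wavelet_list \<phi> \<psi> a n)"

lemma finite_idx [simp]: "finite (idx n)" "finite (idx_partial n m)"
  by (auto simp: idx_def idx_partial_def)

lemma ceiling_a: "1 \<le> \<lceil>a\<rceil>" "a \<le> of_int \<lceil>a\<rceil>" "of_int \<lceil>a\<rceil> < a + 1"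
  using a1 by linarith+

lemma wavelet_list_Suc:
  "wavelet_list \<phi> \<psi> a (Suc n) = wavelet_list \<phi> \<psi> a n @ map (wavelet_atom \<psi> (int n)) [- \<lceil>a\<rceil> + 1..2 ^ n * \<lceil>a\<rceil> - 1]"
  by (simp add: wavelet_list_def)

lemma dimn_Suc: "int (dimn (Suc n)) = int (dimn n) + 2 ^ n * \<lceil>a\<rceil> + \<lceil>a\<rceil> - 1"
proof -
  have "0 \<le> 2 ^ n * \<lceil>a\<rceil>" using ceiling_a by simp
  then have "0 \<le> 2 ^ n * \<lceil>a\<rceil> + \<lceil>a\<rceil> - 1" using ceiling_a by linarith
  then show ?thesis unfolding dimn_def wavelet_list_Suc by (simp add: algebra_simps)
qed

lemma dimn_eq: "int (dimn n) = \<lceil>a\<rceil> * 2 ^ n + (int n + 1) * (\<lceil>a\<rceil> - 1)"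
proof (induction n)
  case 0
  show ?case using ceiling_a by (simp add: dimn_def wavelet_list_def)
next
  case (Suc n)
  then show ?case unfolding dimn_Suc by (simp add: algebra_simps)
qed

lemma dimn_ge: "real_of_int \<lceil>a\<rceil> * 2 ^ n \<le> real (dimn n)"
proof -
  have "0 \<le> (int n + 1) * (\<lceil>a\<rceil> - 1)" using ceiling_a by (intro mult_nonneg_nonneg) auto
  then have "\<lceil>a\<rceil> * 2 ^ n \<le> int (dimn n)" unfolding dimn_eq by linarith
  then have "real_of_int (\<lceil>a\<rceil> * 2 ^ n) \<le> real_of_int (int (dimn n))" by (simp only: of_int_le_iff)
  then show ?thesis by simp
qed

lemma set_wavelet_list_idx: "set (wavelet_list \<phi> \<psi> a n) = atom ` idx n"
  unfolding wavelet_list_def idx_def by (auto simp: image_Un image_image) force+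

lemma wavelet_seq_image:
  assumes "N \<le> dimn n"
  shows "wavelet_seq \<phi> \<psi> a ` {1..N} = set (take N (wavelet_list \<phi> \<psi> a n))"
proof -
  let ?xs = "wavelet_list \<phi> \<psi> a n"
  have eq: "wavelet_seq \<phi> \<psi> a i = ?xs ! (i - 1)" if i: "1 \<le> i" "i \<le> N" for i
  proof -
    obtain zs where zs: "wavelet_list \<phi> \<psi> a (max n i) = ?xs @ zs"
      using wavelet_list_append[of n "max n i" \<phi> \<psi> a] by auto
    have "wavelet_seq \<phi> \<psi> a i = wavelet_list \<phi> \<psi> a (max n i) ! (i - 1)"
      by (rule wavelet_seq_eq[OF a1 i(1)]) simp
    also have "\<dots> = ?xs ! (i - 1)"
    proof -
      have "i - 1 < length ?xs" using i assms by (simp add: dimn_def)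
      then show ?thesis unfolding zs by (simp add: nth_append)
    qed
    finally show ?thesis .
  qed
  have "wavelet_seq \<phi> \<psi> a ` {1..N} = (\<lambda>i. ?xs ! (i - 1)) ` {1..N}"
    using eq by (intro image_cong) auto
  also have "\<dots> = (\<lambda>i. ?xs ! i) ` {0..<N}"
    by (subst image_image[of "\<lambda>i. ?xs ! (i - 1)" Suc "{0..<N}", simplified, symmetric])
      (simp add: image_Suc_atLeastLessThan atLeastLessThanSuc_atLeastAtMost)
  also have "\<dots> = set (take N ?xs)"
    using assms by (subst nth_image) (simp_all add: dimn_def)
  finally show ?thesis .
qed

abbreviation "w \<equiv> wavelet_seq \<phi> \<psi> a"

lemma recon_space_partial:
  assumes "int m \<le> 2 ^ n * \<lceil>a\<rceil> + \<lceil>a\<rceil> - 1"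
  shows "recon_space w (dimn n + m) = cspan (atom ` idx_partial n m)"
proof -
  have "dimn n + m \<le> dimn (Suc n)" using dimn_Suc[of n] assms by linarith
  from wavelet_seq_image[OF this]
  have "w ` {1..dimn n + m} = set (take (dimn n + m) (wavelet_list \<phi> \<psi> a (Suc n)))" .
  also have "\<dots> = set (wavelet_list \<phi> \<psi> a n) \<union> wavelet_atom \<psi> (int n) ` set (take m [- \<lceil>a\<rceil> + 1..2 ^ n * \<lceil>a\<rceil> - 1])"
    unfolding wavelet_list_Suc by (simp add: dimn_def take_map)
  also have "take m [- \<lceil>a\<rceil> + 1..2 ^ n * \<lceil>a\<rceil> - 1] = [- \<lceil>a\<rceil> + 1..- \<lceil>a\<rceil> + 1 + int m - 1]"
    using assms by (intro take_upto) simp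
  also have "set (wavelet_list \<phi> \<psi> a n) \<union> wavelet_atom \<psi> (int n) ` set [- \<lceil>a\<rceil> + 1..- \<lceil>a\<rceil> + 1 + int m - 1]
      = atom ` idx_partial n m"
  proof -
    have "{- \<lceil>a\<rceil> + 1..- \<lceil>a\<rceil> + 1 + int m - 1} = {- \<lceil>a\<rceil> + 1..<- \<lceil>a\<rceil> + 1 + int m}" by auto
    then show ?thesis unfolding idx_partial_def image_Un set_wavelet_list_idx set_upto image_image atom.simps by (simp only:)
  qed
  finally show ?thesis by (simp add: recon_space_def)
qed

lemma idx_partial_0: "idx_partial n 0 = idx n"
  by (simp add: idx_partial_def)

lemma dimn_partition:
  assumes "dimn 0 < N"
  obtains n m where "N = dimn n + m" "1 \<le> m" "int m \<le> 2 ^ n * \<lceil>a\<rceil> + \<lceil>a\<rceil> - 1"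
proof -
  have ex: "\<exists>k. N \<le> dimn k"
    using length_wavelet_list[OF a1, of N \<phi> \<psi>] by (auto simp: dimn_def)
  define k where "k = (LEAST k. N \<le> dimn k)"
  have k: "N \<le> dimn k" unfolding k_def using ex by (rule LeastI_ex)
  then have "k \<noteq> 0" using assms by (intro notI) simp
  then obtain n where n: "k = Suc n" by (cases k) auto
  have "dimn n < N" using not_less_Least[of n "\<lambda>k. N \<le> dimn k"] unfolding k_def[symmetric] n by simp
  then show ?thesis using k dimn_Suc[of n] unfolding n by (intro that[of n "N - dimn n"]) auto
qed

lemma recon_in_V:
  assumes "f \<in> cspan (atom ` idx_partial n m)"
  shows "f \<in> V (int (Suc n))"
proof -
  have "atom i \<in> V (int (Suc n))" if "i \<in> idx_partial n m" for i
    using that by (intro atom_in_V) (auto simp: idx_partial_def idx_def)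
  then have "atom ` idx_partial n m \<subseteq> V (int (Suc n))" by blast
  then show ?thesis using assms L2.span_minimal[OF _ V_subspace] by blast
qed

lemma idx_in_V:
  assumes "f \<in> cspan (atom ` idx n)"
  shows "f \<in> V (int n)"
proof -
  have "atom i \<in> V (int n)" if "i \<in> idx n" for i
    using that by (intro atom_in_V) (auto simp: idx_def)
  then have "atom ` idx n \<subseteq> V (int n)" by blast
  then show ?thesis using assms L2.span_minimal[OF _ V_subspace] by blast
qed

text \<open>Level 0 is the worst case at both ends. The window has length
  \<open>3 * \<lceil>a\<rceil> - 2\<close>, the number that decides later whether a sampling period
  leaves room for a cutoff.\<close>

lemma recon_supp:
  assumes "f \<in> cspan (atom ` idx_partial n m)" "int m \<le> 2 ^ n * \<lceil>a\<rceil> + \<lceil>a\<rceil> - 1"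
  shows "supp_in f {- (of_int \<lceil>a\<rceil> - 1)..2 * of_int \<lceil>a\<rceil> - 1}"
proof (rule supp_in_span[OF assms(1)])
  have psi: "supp_in (wavelet_atom \<psi> (int j) k) {- (of_int \<lceil>a\<rceil> - 1)..2 * of_int \<lceil>a\<rceil> - 1}"
    if "- \<lceil>a\<rceil> + 1 \<le> k" "k \<le> 2 ^ j * \<lceil>a\<rceil> - 1" for j k
  proof (rule supp_in_mono[OF supp_in_atom_interval[OF supp_psi]])
    have p: "(1::real) \<le> 2 ^ j" by simp
    have k1: "- of_int \<lceil>a\<rceil> + 1 \<le> real_of_int k" using that(1) by linarith
    have k2: "real_of_int k \<le> 2 ^ j * of_int \<lceil>a\<rceil> - 1"
      using that(2) by (simp flip: of_int_le_iff[where 'a = real])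
    have "2 ^ j * (- (of_int \<lceil>a\<rceil> - 1)) \<le> - (real_of_int \<lceil>a\<rceil> - 1)"
      using mult_right_mono[OF p, of "real_of_int \<lceil>a\<rceil> - 1"] ceiling_a by (simp add: algebra_simps)
    then have 1: "- (of_int \<lceil>a\<rceil> - 1) \<le> of_int k / (2::real) ^ j" using k1 p by (simp add: field_simps)
    have "1 * (real_of_int \<lceil>a\<rceil> - 1) \<le> 2 ^ j * (real_of_int \<lceil>a\<rceil> - 1)"
      using ceiling_a(1) by (intro mult_right_mono[OF p]) simp
    moreover have "a - 1 \<le> 1 * (real_of_int \<lceil>a\<rceil> - 1)" using ceiling_a(2) by simp
    ultimately have "a - 1 \<le> 2 ^ j * (real_of_int \<lceil>a\<rceil> - 1)" by (rule order_trans[rotated])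
    then have "of_int k + a \<le> 2 ^ j * (2 * of_int \<lceil>a\<rceil> - 1)" using k2 by (simp add: algebra_simps)
    then have 2: "(of_int k + a) / 2 ^ j \<le> 2 * of_int \<lceil>a\<rceil> - 1" by (simp add: field_simps)
    show "{of_int k / 2 powi int j..(of_int k + a) / 2 powi int j} \<subseteq> {- (of_int \<lceil>a\<rceil> - 1)..2 * real_of_int \<lceil>a\<rceil> - 1}"
      using 1 2 by auto
  qed
  have phi: "supp_in (wavelet_atom \<phi> 0 k) {- (of_int \<lceil>a\<rceil> - 1)..2 * of_int \<lceil>a\<rceil> - 1}"
    if "- \<lceil>a\<rceil> + 1 \<le> k" "k \<le> \<lceil>a\<rceil> - 1" for k
  proof (rule supp_in_mono[OF supp_in_atom_interval[OF supp_phi]])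
    have k1: "- of_int \<lceil>a\<rceil> + 1 \<le> real_of_int k" "real_of_int k \<le> of_int \<lceil>a\<rceil> - 1" using that by linarith+
    then show "{of_int k / 2 powi 0..(of_int k + a) / 2 powi 0} \<subseteq> {- (of_int \<lceil>a\<rceil> - 1)..2 * real_of_int \<lceil>a\<rceil> - 1}"
      using add_mono[OF k1(2) ceiling_a(2)] by auto
  qed
  have "- \<lceil>a\<rceil> + int m \<le> 2 ^ n * \<lceil>a\<rceil> - 1" using assms(2) by simp
  then show "supp_in g {- (of_int \<lceil>a\<rceil> - 1)..2 * of_int \<lceil>a\<rceil> - 1}" if "g \<in> atom ` idx_partial n m" for g
    using that by (auto simp: idx_partial_def idx_def intro!: phi[simplified] psi[simplified])
qed

text \<open>The leftmost translate with a nonzero coefficient is the only one that reaches the left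
  end of its own support, so it cannot be cancelled there; the same holds on the right.\<close>

lemma phi_sum_support:
  assumes "finite F" "f = (\<Sum>k\<in>F. c k *\<^sub>C wavelet_atom \<phi> 0 k)" "supp_in f {\<alpha>..\<beta>}" "k \<in> F" "c k \<noteq> 0"
  shows "\<alpha> \<le> of_int k" "of_int k + a \<le> \<beta>"
proof -
  define G where "G = {k \<in> F. c k \<noteq> 0}"
  have G: "finite G" "k \<in> G" using assms by (auto simp: G_def)
  have fG: "f = (\<Sum>k\<in>G. c k *\<^sub>C wavelet_atom \<phi> 0 k)"
    unfolding assms(2) using assms(1) by (intro sum.mono_neutral_right) (auto simp: G_def)
  have solve: "supp_in \<phi> {x. x + of_int l \<in> S}"
    if l: "l \<in> G" and f: "supp_in f S" and o: "\<And>j. j \<in> G - {l} \<Longrightarrow> supp_in (wavelet_atom \<phi> 0 j) S" for l S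
  proof -
    have "f = c l *\<^sub>C wavelet_atom \<phi> 0 l + (\<Sum>j\<in>G - {l}. c j *\<^sub>C wavelet_atom \<phi> 0 j)"
      unfolding fG by (rule sum.remove[OF G(1) l])
    then have "c l *\<^sub>C wavelet_atom \<phi> 0 l = f - (\<Sum>j\<in>G - {l}. c j *\<^sub>C wavelet_atom \<phi> 0 j)" by simp
    then have "supp_in (c l *\<^sub>C wavelet_atom \<phi> 0 l) S"
      using f o by (auto intro!: supp_in_diff supp_in_sum supp_in_scale)
    then have "supp_in (inverse (c l) *\<^sub>C (c l *\<^sub>C wavelet_atom \<phi> 0 l)) S" by (rule supp_in_scale)
    then have "supp_in (wavelet_atom \<phi> 0 l) S" using l by (simp add: G_def)
    from supp_in_wavelet_atom[OF this, of 0 "- l"] show ?thesis by (simp add: wavelet_atom_comp)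
  qed
  have at: "supp_in (wavelet_atom \<phi> 0 j) {of_int j..of_int j + a}" for j
    using supp_in_atom_interval[OF supp_phi, of 0 j] by simp
  show "\<alpha> \<le> of_int k"
  proof -
    define l where "l = Min G"
    have l: "l \<in> G" using G unfolding l_def by (intro Min_in) auto
    \<comment> \<open>The other translates start at \<open>l + 1\<close> or later and the sum
      vanishes left of \<open>\<alpha>\<close>, so the translate by \<open>l\<close> lives right of
      the minimum. As it starts exactly at \<open>l\<close>, the minimum is at most \<open>l\<close>
      and must be \<open>\<alpha>\<close>.\<close>
    have "supp_in \<phi> {x. x + of_int l \<in> {min \<alpha> (of_int l + 1)..}}"
    proof (rule solve[OF l])
      show "supp_in f {min \<alpha> (of_int l + 1)..}" by (rule supp_in_mono[OF assms(3)]) auto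
      show "supp_in (wavelet_atom \<phi> 0 j) {min \<alpha> (of_int l + 1)..}" if "j \<in> G - {l}" for j
      proof (rule supp_in_mono[OF at])
        have "l \<le> j" using that G(1) by (simp add: l_def)
        then have "l + 1 \<le> j" using that by simp
        then have "real_of_int l + 1 \<le> of_int j" by linarith
        then show "{of_int j..of_int j + a} \<subseteq> {min \<alpha> (real_of_int l + 1)..}" by auto
      qed
    qed
    then have "supp_in \<phi> {min \<alpha> (of_int l + 1) - of_int l..}"
      by (rule supp_in_mono) auto
    from phi_left[OF this] have "\<alpha> \<le> of_int l" by auto
    moreover have "l \<le> k" using G by (simp add: l_def)
    ultimately show ?thesis by linarith
  qed
  show "of_int k + a \<le> \<beta>"
  proof -
    define l where "l = Max G"
    have l: "l \<in> G" using G unfolding l_def by (intro Max_in) auto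
    have "supp_in \<phi> {x. x + of_int l \<in> {..max \<beta> (of_int l - 1 + a)}}"
    proof (rule solve[OF l])
      show "supp_in f {..max \<beta> (of_int l - 1 + a)}" by (rule supp_in_mono[OF assms(3)]) auto
      show "supp_in (wavelet_atom \<phi> 0 j) {..max \<beta> (of_int l - 1 + a)}" if "j \<in> G - {l}" for j
      proof (rule supp_in_mono[OF at])
        have "j \<le> l" using that G(1) by (simp add: l_def)
        then have "j + 1 \<le> l" using that by simp
        then have "real_of_int j + 1 \<le> of_int l" by linarith
        then show "{of_int j..of_int j + a} \<subseteq> {..max \<beta> (real_of_int l - 1 + a)}" by auto
      qed
    qed
    then have "supp_in \<phi> {..max \<beta> (of_int l - 1 + a) - of_int l}"
      by (rule supp_in_mono) auto
    from phi_right[OF this] have "of_int l + a \<le> \<beta>" by auto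
    moreover have "k \<le> l" using G by (simp add: l_def)
    ultimately show ?thesis by linarith
  qed
qed

definition phi_range :: "nat \<Rightarrow> real \<Rightarrow> real \<Rightarrow> int set" where
  "phi_range n \<alpha> \<beta> = {k. \<alpha> * 2 ^ n \<le> of_int k \<and> of_int k + a \<le> \<beta> * 2 ^ n}"

lemma phi_range_subset: "phi_range n \<alpha> \<beta> \<subseteq> {\<lceil>\<alpha> * 2 ^ n\<rceil>..\<lfloor>\<beta> * 2 ^ n\<rfloor>}"
  using a1 by (auto simp: phi_range_def ceiling_le_iff le_floor_iff)

lemma finite_phi_range [simp]: "finite (phi_range n \<alpha> \<beta>)"
  using finite_subset[OF phi_range_subset] by simp

text \<open>Bounded support first gives some finite expansion; \<open>phi_sum_support\<close> then
  confines it to translates whose support lies inside the given interval, so there are no boundary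
  terms.\<close>

lemma phi_expand:
  assumes "f \<in> V (int n)" "supp_in f {\<alpha>..\<beta>}"
  shows "f = onp (wavelet_atom \<phi> (int n)) (phi_range n \<alpha> \<beta>) f"
proof -
  let ?e = "wavelet_atom \<phi> 0"
  define u where "u = wavelet_atom f (- int n) 0"
  have fu: "f = wavelet_atom u (int n) 0" by (simp add: u_def wavelet_atom_inverse)
  have u0: "u \<in> V 0" using V_undilate[of f 0 n] assms(1) by (simp add: u_def)
  have pw: "(2::real) powi (- int n) = 1 / 2 ^ n" by (simp add: power_int_minus divide_inverse)
  have us: "supp_in u {\<alpha> * 2 ^ n..\<beta> * 2 ^ n}"
    unfolding u_def
    by (rule supp_in_mono[OF supp_in_wavelet_atom[OF assms(2)]]) (auto simp: pw field_simps)
  have coeff: "cinner u (?e k) = cinner f (wavelet_atom \<phi> (int n) k)" for k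
    using cinner_wavelet_atom[of u "int n" 0 "?e k"] by (simp add: fu wavelet_atom_translate)
  obtain F where F: "finite F" "\<And>k. k \<notin> F \<Longrightarrow> cinner u (?e k) = 0"
    using finitely_many_overlaps[OF supp_phi bounded_suppI[OF us], of 0] by blast
  have "u = onp ?e F u" by (rule orthonormal_basis_expand[OF V0_basis u0 F])
  then have eq: "u = (\<Sum>k\<in>F. cinner u (?e k) *\<^sub>C ?e k)" by (simp add: onp_def)
  have "k \<in> phi_range n \<alpha> \<beta>" if "cinner u (?e k) \<noteq> 0" for k
    using phi_sum_support[OF F(1) eq us, of k] F(2)[of k] that by (auto simp: phi_range_def)
  then have "u = onp ?e (phi_range n \<alpha> \<beta>) u"
    by (intro orthonormal_basis_expand[OF V0_basis u0]) auto
  then have "wavelet_atom u (int n) 0 = wavelet_atom (onp ?e (phi_range n \<alpha> \<beta>) u) (int n) 0" by (rule arg_cong)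
  then show ?thesis
    unfolding onp_def wavelet_atom_sum wavelet_atom_scale wavelet_atom_translate coeff fu[symmetric] .
qed

text \<open>The atoms up to level \<open>Suc n\<close> that are missing from the space meet the
  support of this translate in endpoints at most. The third bound keeps the translate left of the
  first missing wavelet of scale \<open>n\<close>, whose index is
  \<open>m - \<lceil>a\<rceil> + 1\<close>. So the scale \<open>Suc n\<close> is present near the
  origin soon after the wavelets of scale \<open>n\<close> have begun.\<close>

lemma phi_in_recon:
  assumes "0 \<le> k" "of_int k + a \<le> 2 ^ Suc n * of_int \<lceil>a\<rceil>" "of_int k + a \<le> 2 * (of_int (int m - \<lceil>a\<rceil> + 1))"
    and m: "int m \<le> 2 ^ n * \<lceil>a\<rceil> + \<lceil>a\<rceil> - 1"
  shows "wavelet_atom \<phi> (int (Suc n)) k \<in> recon_space w (dimn n + m)"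
  unfolding recon_space_partial[OF m]
proof (rule atom_expand)
  show "wavelet_atom \<phi> (int (Suc n)) k \<in> V (int (Suc n))" by (rule phi_in_V)
  show "bounded_supp (wavelet_atom \<phi> (int (Suc n)) k)" by (rule bounded_supp_atom)
  show "finite (idx_partial n m)" by simp
  show "level i \<le> Suc n" if "i \<in> idx_partial n m" for i
    using that by (auto simp: idx_partial_def idx_def)
  fix i assume i: "i \<notin> idx_partial n m" "level i \<le> Suc n"
  have supp: "supp_in (wavelet_atom \<phi> (int (Suc n)) k) {of_int k / 2 ^ Suc n..(of_int k + a) / 2 ^ Suc n}"
    using supp_in_atom_interval[OF supp_phi, of "int (Suc n)" k] by (simp only: power_int_of_nat)
  have k0: "0 \<le> real_of_int k / 2 ^ Suc n" using assms(1) by simp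
  have k1: "(of_int k + a) / 2 ^ Suc n \<le> of_int \<lceil>a\<rceil>" using assms(2) by (simp add: field_simps)
  have low: "(of_int l + a) / 2 ^ j \<le> of_int k / 2 ^ Suc n" if "l \<le> - \<lceil>a\<rceil>" for l j
  proof -
    have "of_int l + a \<le> 0" using that ceiling_a(2) by linarith
    then have "(of_int l + a) / 2 ^ j \<le> 0" by (simp add: divide_nonpos_pos)
    then show ?thesis using k0 by linarith
  qed
  have high: "(of_int k + a) / 2 ^ Suc n \<le> of_int l / 2 ^ j" if "2 ^ j * \<lceil>a\<rceil> \<le> l" for l j
  proof -
    have "real_of_int (2 ^ j * \<lceil>a\<rceil>) \<le> of_int l" using that by (simp only: of_int_le_iff)
    then have "of_int \<lceil>a\<rceil> \<le> of_int l / (2::real) ^ j" by (simp add: field_simps)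
    then show ?thesis using k1 by linarith
  qed
  show "cinner (wavelet_atom \<phi> (int (Suc n)) k) (atom i) = 0"
  proof (cases i rule: atom.cases)
    case (1 l)
    then have "l \<le> - \<lceil>a\<rceil> \<or> 2 ^ 0 * \<lceil>a\<rceil> \<le> l" using i by (auto simp: idx_partial_def idx_def)
    then show ?thesis using low[of l 0] high[of 0 l] unfolding 1 atom.simps
      by (intro cinner_atom_disjoint[OF supp_phi supp]) auto
  next
    case (2 j l)
    have "l \<le> - \<lceil>a\<rceil> \<or> (of_int k + a) / 2 ^ Suc n \<le> of_int l / 2 ^ j"
    proof (cases "j < n")
      case True
      then have "l \<le> - \<lceil>a\<rceil> \<or> 2 ^ j * \<lceil>a\<rceil> \<le> l" using i 2 by (auto simp: idx_partial_def idx_def)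
      then show ?thesis using high by blast
    next
      case False
      then have jn: "j = n" using i 2 by simp
      then have "l \<le> - \<lceil>a\<rceil> \<or> int m - \<lceil>a\<rceil> + 1 \<le> l" using i 2 by (auto simp: idx_partial_def)
      moreover have "(of_int k + a) / 2 ^ Suc n \<le> of_int l / 2 ^ j" if "int m - \<lceil>a\<rceil> + 1 \<le> l"
      proof -
        have "real_of_int (int m - \<lceil>a\<rceil> + 1) \<le> of_int l" using that by (simp only: of_int_le_iff)
        then have "2 * real_of_int (int m - \<lceil>a\<rceil> + 1) \<le> 2 * of_int l" by (rule mult_left_mono) simp
        with assms(3) have "of_int k + a \<le> 2 * of_int l" by (rule order_trans)
        then have "(of_int k + a) / 2 / 2 ^ n \<le> of_int l / 2 ^ n" by (intro divide_right_mono) auto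
        then show ?thesis unfolding jn by simp
      qed
      ultimately show ?thesis by blast
    qed
    then show ?thesis using low[of l j] unfolding 2 atom.simps
      by (intro cinner_atom_disjoint[OF supp_psi supp]) auto
  qed
qed

text \<open>The refinement equation. Its coefficients depend neither on scale nor on position, which
  later turns an exponential sum for the coefficients of \<open>\<phi>\<close> into one for those of
  \<open>\<psi>\<close>.\<close>

lemma psi_refine:
  obtains g where "\<And>n k. wavelet_atom \<psi> (int n) k = (\<Sum>i\<in>phi_range 1 0 a. g i *\<^sub>C wavelet_atom \<phi> (int (Suc n)) (2 * k + i))"
proof -
  have "\<psi> \<in> V (int 1)" using psi_in_V[of 0 0] by simp
  from phi_expand[OF this supp_psi]
  have eq: "\<psi> = (\<Sum>i\<in>phi_range 1 0 a. cinner \<psi> (wavelet_atom \<phi> 1 i) *\<^sub>C wavelet_atom \<phi> 1 i)" by (simp add: onp_def)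
  have "wavelet_atom \<psi> (int n) k = (\<Sum>i\<in>phi_range 1 0 a. cinner \<psi> (wavelet_atom \<phi> 1 i) *\<^sub>C wavelet_atom \<phi> (int (Suc n)) (2 * k + i))" for n k
    by (subst eq) (simp add: wavelet_atom_sum wavelet_atom_scale wavelet_atom_comp add.commute)
  then show ?thesis by (rule that)
qed

lemma recon_drop_level:
  assumes "f \<in> cspan (atom ` idx_partial n m)" "\<And>k. cinner f (wavelet_atom \<psi> (int n) k) = 0"
  shows "f \<in> cspan (atom ` idx n)"
proof -
  have "f = onp atom (idx_partial n m) f"
    using onp_span_eq[OF atom_orthonormal _ assms(1)] by simp
  also have "\<dots> = onp atom (idx n) f"
    unfolding onp_def by (rule sum.mono_neutral_right) (auto simp: idx_partial_def assms(2))
  finally show ?thesis using onp_in_span[of atom "idx n" f] by simp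
qed

text \<open>The translates share one transform up to phases, so the sum factors into a trigonometric
  polynomial, the symbol, and the transform of \<open>\<phi>\<close>. Every energy below is computed
  from this factorisation.\<close>

lemma fourier_phi_sum:
  assumes "finite F"
  shows "fourier (\<Sum>k\<in>F. c k *\<^sub>C wavelet_atom \<phi> (int n) k) \<omega>
     = complex_of_real (2 powr (- real n / 2)) * (\<Sum>k\<in>F. c k * e2 (- (of_int k * (\<omega> / 2 ^ n)))) * fourier \<phi> (\<omega> / 2 ^ n)"
proof -
  have "\<exists>r. \<forall>k\<in>F. supp_in (wavelet_atom \<phi> (int n) k) {- r..r}"
    using assms
  proof induction
    case (insert k F)
    then obtain r s where r: "\<forall>k\<in>F. supp_in (wavelet_atom \<phi> (int n) k) {- r..r}"
      and s: "supp_in (wavelet_atom \<phi> (int n) k) {- s..s}"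
      using bounded_supp_atom(1)[of "int n" k] by (auto simp: bounded_supp_def)
    have "{- r..r} \<subseteq> {- max r s..max r s}" "{- s..s} \<subseteq> {- max r s..max r s}" by auto
    then have "\<forall>l\<in>insert k F. supp_in (wavelet_atom \<phi> (int n) l) {- max r s..max r s}"
      using r s supp_in_mono by blast
    then show ?case by blast
  qed simp
  then obtain r where "\<And>k. k \<in> F \<Longrightarrow> supp_in (wavelet_atom \<phi> (int n) k) {- r..r}" by blast
  then have "fourier (\<Sum>k\<in>F. c k *\<^sub>C wavelet_atom \<phi> (int n) k) \<omega> = (\<Sum>k\<in>F. fourier (c k *\<^sub>C wavelet_atom \<phi> (int n) k) \<omega>)"
    by (intro fourier_sum[of _ _ r] supp_in_scale)
  also have "\<dots> = (\<Sum>k\<in>F. complex_of_real (2 powr (- real n / 2)) * (c k * e2 (- (of_int k * (\<omega> / 2 ^ n)))) * fourier \<phi> (\<omega> / 2 ^ n))"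
    unfolding fourier_scale fourier_wavelet_atom by (intro sum.cong) (auto simp: mult_ac)
  finally show ?thesis by (simp only: sum_distrib_left sum_distrib_right)
qed

end

section \<open>Exponential sums\<close>

lemma norm_e2_minus_1: "cmod (e2 x - 1) = 2 * \<bar>sin (pi * x)\<bar>"
proof -
  have "(cmod (e2 x - 1))\<^sup>2 = (cos (2 * (pi * x)) - 1)\<^sup>2 + (sin (2 * (pi * x)))\<^sup>2"
    by (simp add: cmod_power2 e2_def mult.assoc)
  also have "\<dots> = (2 * \<bar>sin (pi * x)\<bar>)\<^sup>2"
  proof -
    define s c where "s = sin (pi * x)" and "c = cos (pi * x)"
    have "(1 - 2 * s\<^sup>2 - 1)\<^sup>2 + (2 * s * c)\<^sup>2 = 4 * s\<^sup>2 * (s\<^sup>2 + c\<^sup>2)"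
      by (simp add: power2_eq_square algebra_simps)
    also have "s\<^sup>2 + c\<^sup>2 = 1" unfolding s_def c_def by (rule sin_cos_squared_add)
    finally show ?thesis unfolding cos_double_sin sin_double s_def c_def by (simp add: power_mult_distrib)
  qed
  finally show ?thesis by (rule power2_eq_imp_eq) auto
qed

lemma sin_ge_half: "x / 2 \<le> sin x" if "0 \<le> x" "x \<le> 1" for x :: real
proof -
  have "sin 0 - 0 / 2 \<le> sin x - x / 2"
  proof (rule DERIV_nonneg_imp_nondecreasing[OF that(1)])
    fix t :: real assume t: "0 \<le> t" "t \<le> x"
    have "cos (pi / 3) \<le> cos t" using t that pi_gt3 by (intro cos_monotone_0_pi_le) auto
    then show "\<exists>y. ((\<lambda>x. sin x - x / 2) has_real_derivative y) (at t) \<and> 0 \<le> y"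
      by (intro exI[of _ "cos t - 1 / 2"]) (auto intro!: derivative_eq_intros simp: cos_60)
  qed
  then show ?thesis by simp
qed

lemma e2_power: "e2 x ^ n = e2 (of_nat n * x)" for x :: real
  by (induction n) (simp_all add: e2_add ring_distribs mult.commute)

lemma sum_e2_bound: "cmod (\<Sum>i<n. e2 (of_nat i * x)) * cmod (e2 x - 1) = cmod (e2 (of_nat n * x) - 1)" for x :: real
proof -
  have "(\<Sum>i<n. e2 (of_nat i * x)) * (e2 x - 1) = e2 (of_nat n * x) - 1"
    using power_diff_1_eq[of "e2 x" n] by (simp add: e2_power mult.commute)
  then show ?thesis by (metis norm_mult)
qed

lemma sum_roots_of_unity:
  assumes "L > 0"
  shows "(\<Sum>r<L. e2 (of_int j * (of_nat r / of_nat L))) = (if int L dvd j then of_nat L else 0)"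
proof -
  define x where "x = of_int j / real L"
  have eq: "(\<Sum>r<L. e2 (of_int j * (of_nat r / of_nat L))) = (\<Sum>r<L. e2 (of_nat r * x))"
    by (simp add: x_def mult.commute)
  show ?thesis
  proof (cases "int L dvd j")
    case True
    then obtain q where "j = int L * q" by blast
    then have x: "x = of_int q" using assms by (simp add: x_def)
    have "e2 (of_nat r * x) = 1" for r
    proof -
      have "of_nat r * x = of_int (int r * q)" by (simp add: x)
      then show ?thesis by (simp only: e2_of_int)
    qed
    then show ?thesis using True unfolding eq by simp
  next
    case False
    have "e2 x \<noteq> 1"
    proof
      assume "e2 x = 1"
      then obtain q where "x = of_int q" using e2_eqD[of x 0] by auto
      then have "real_of_int j = real_of_int (int L * q)" using assms by (simp add: x_def field_simps)
      then show False using False by (simp only: of_int_eq_iff) simp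
    qed
    moreover have "e2 (of_nat L * x) = 1" using assms by (simp add: x_def)
    ultimately have "cmod (\<Sum>r<L. e2 (of_nat r * x)) = 0" using sum_e2_bound[of x L] by simp
    then show ?thesis using False unfolding eq by simp
  qed
qed

definition trig_sum :: "int set \<Rightarrow> (int \<Rightarrow> complex) \<Rightarrow> real \<Rightarrow> complex" where
  "trig_sum F c x = (\<Sum>k\<in>F. c k * e2 (- (of_int k * x)))"

lemma trig_sum_periodic: "trig_sum F c (x + of_int k) = trig_sum F c x"
proof -
  have "e2 (- (of_int j * (x + of_int k))) = e2 (- (of_int j * x))" for j
  proof -
    have "- (of_int j * (x + of_int k)) = - (of_int j * x) + of_int (- j * k)" by (simp add: algebra_simps)
    then show ?thesis by (simp only: e2_add_int)
  qed
  then show ?thesis by (simp add: trig_sum_def)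
qed

text \<open>Inversion of the discrete Fourier transform: \<open>F\<close> meets each residue class
  modulo \<open>L\<close> at most once.\<close>

lemma trig_sum_inverse:
  assumes "L > 0" "F \<subseteq> {k0..<k0 + int L}" "k \<in> {k0..<k0 + int L}"
  shows "(\<Sum>r<L. trig_sum F c (of_nat r / of_nat L) * e2 (of_int k * (of_nat r / of_nat L))) = of_nat L * (if k \<in> F then c k else 0)"
proof -
  have fin: "finite F" using assms(2) by (rule finite_subset) simp
  have "(\<Sum>r<L. trig_sum F c (of_nat r / of_nat L) * e2 (of_int k * (of_nat r / of_nat L)))
      = (\<Sum>j\<in>F. c j * (\<Sum>r<L. e2 (of_int (k - j) * (of_nat r / of_nat L))))"
  proof -
    have "e2 (- (of_int j * x)) * e2 (of_int k * x) = e2 (of_int (k - j) * x)" for j x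
      unfolding e2_add[symmetric] by (simp add: algebra_simps)
    then show ?thesis
      unfolding trig_sum_def sum_distrib_right sum_distrib_left mult.assoc by (subst sum.swap) (simp only:)
  qed
  also have "\<dots> = (\<Sum>j\<in>F. if j = k then of_nat L * c k else 0)"
  proof (rule sum.cong)
    fix j assume j: "j \<in> F"
    have "int L dvd k - j \<longleftrightarrow> j = k"
    proof
      assume d: "int L dvd k - j"
      have "j \<in> {k0..<k0 + int L}" using j assms(2) by blast
      then have "\<bar>k - j\<bar> < int L" using assms(3) by auto
      then show "j = k" using d zdvd_imp_le[of "int L" "\<bar>k - j\<bar>"] by (cases "k = j") auto
    qed simp
    then show "c j * (\<Sum>r<L. e2 (of_int (k - j) * (of_nat r / of_nat L))) = (if j = k then of_nat L * c k else 0)"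
      unfolding sum_roots_of_unity[OF assms(1)] by (simp add: mult.commute)
  qed simp
  also have "\<dots> = of_nat L * (if k \<in> F then c k else 0)" using fin by simp
  finally show ?thesis .
qed

lemma trig_sum_parseval:
  assumes "L > 0" "F \<subseteq> {k0..<k0 + int L}"
  shows "(\<Sum>r<L. (cmod (trig_sum F c (of_nat r / of_nat L)))\<^sup>2) = real L * (\<Sum>k\<in>F. (cmod (c k))\<^sup>2)"
proof -
  let ?t = "\<lambda>r. trig_sum F c (of_nat r / of_nat L)"
  have "complex_of_real (\<Sum>r<L. (cmod (?t r))\<^sup>2) = (\<Sum>r<L. ?t r * cnj (?t r))"
    by (simp add: mult_cnj_self)
  also have "\<dots> = (\<Sum>r<L. \<Sum>k\<in>F. cnj (c k) * (?t r * e2 (of_int k * (of_nat r / of_nat L))))"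
    by (subst (2) trig_sum_def) (simp add: sum_distrib_left cnj_e2 mult_ac)
  also have "\<dots> = (\<Sum>k\<in>F. cnj (c k) * (\<Sum>r<L. ?t r * e2 (of_int k * (of_nat r / of_nat L))))"
    by (subst sum.swap) (simp add: sum_distrib_left)
  also have "\<dots> = (\<Sum>k\<in>F. of_nat L * (c k * cnj (c k)))"
  proof (rule sum.cong)
    fix k assume k: "k \<in> F"
    then have "k \<in> {k0..<k0 + int L}" using assms(2) by blast
    from trig_sum_inverse[OF assms this, of c] k
    show "cnj (c k) * (\<Sum>r<L. ?t r * e2 (of_int k * (of_nat r / of_nat L))) = of_nat L * (c k * cnj (c k))" by simp
  qed simp
  also have "\<dots> = complex_of_real (real L * (\<Sum>k\<in>F. (cmod (c k))\<^sup>2))"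
    by (simp add: mult_cnj_self sum_distrib_left)
  finally show ?thesis by (simp only: of_real_eq_iff)
qed

text \<open>An exponential sum with \<open>q\<close> frequencies satisfies a linear recurrence of order \<open>q\<close>.\<close>

lemma exponential_sum_zero:
  assumes "finite Z" "\<And>k. i \<le> k \<Longrightarrow> k < i + int (card Z) \<Longrightarrow> (\<Sum>x\<in>Z. b x * e2 (of_int k * t x)) = 0"
  shows "(\<Sum>x\<in>Z. b x * e2 (of_int k * t x)) = 0"
  using assms
proof (induction Z arbitrary: b k)
  case (insert y Z)
  define u where "u k = (\<Sum>x\<in>insert y Z. b x * e2 (of_int k * t x))" for k
  \<comment> \<open>This combination removes the frequency of \<open>y\<close>, so the induction
    hypothesis applies to it. What is left is a geometric sequence that vanishes at
    \<open>i\<close>.\<close>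
  have step: "u (k + 1) - e2 (t y) * u k = (\<Sum>x\<in>Z. (b x * (e2 (t x) - e2 (t y))) * e2 (of_int k * t x))" for k
  proof -
    have e: "e2 (of_int (k + 1) * t x) = e2 (t x) * e2 (of_int k * t x)" for x
      unfolding e2_add[symmetric] by (simp add: algebra_simps)
    have "u (k + 1) - e2 (t y) * u k = (\<Sum>x\<in>insert y Z. (b x * (e2 (t x) - e2 (t y))) * e2 (of_int k * t x))"
      unfolding u_def e sum_distrib_left sum_subtractf[symmetric] by (intro sum.cong) (auto simp: algebra_simps)
    then show ?thesis using insert.hyps by simp
  qed
  have u0: "u k = 0" if "i \<le> k" "k < i + int (card Z) + 1" for k
    using insert.prems[of k] that insert.hyps by (simp add: u_def)
  have "(\<Sum>x\<in>Z. (b x * (e2 (t x) - e2 (t y))) * e2 (of_int k * t x)) = 0" for k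
    by (rule insert.IH) (simp add: u0 flip: step)
  then have rec: "u (k + 1) = e2 (t y) * u k" for k using step[of k] by simp
  have "u i = 0" by (rule u0) auto
  have up: "u (i + int n) = 0" for n
  proof (induction n)
    case (Suc n)
    then show ?case using rec[of "i + int n"] by (simp add: algebra_simps)
  qed (simp add: \<open>u i = 0\<close>)
  have down: "u (i - int n) = 0" for n
  proof (induction n)
    case (Suc n)
    then show ?case using rec[of "i - int (Suc n)"] by (simp add: algebra_simps)
  qed (simp add: \<open>u i = 0\<close>)
  have "u k = 0"
  proof (cases "i \<le> k")
    case True
    then show ?thesis using up[of "nat (k - i)"] by simp
  next
    case False
    then show ?thesis using down[of "nat (i - k)"] by simp
  qed
  then show ?case by (simp add: u_def)
qed simp

section \<open>Concentration of the Fejer kernel\<close>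

definition dirichlet :: "nat \<Rightarrow> real \<Rightarrow> complex" where
  "dirichlet n x = (\<Sum>j<n. e2 (of_nat j * x))"

text \<open>The mean square of the Dirichlet kernel over a period is \<open>n\<close>. Points of
  step \<open>h\<close> in a window shorter than 1 are among \<open>P\<close> consecutive ones,
  about a full period: the diagonal terms give \<open>n * P\<close>, the others are nearly complete
  geometric sums. The smallness of \<open>h\<close> keeps all rounding below 1.\<close>

lemma fejer_window:
  assumes n: "1 \<le> n" and h: "0 < h" "h * (4 * (real n + 2 * real n ^ 2)) \<le> 1"
    and I: "finite I" "\<And>l l'. l \<in> I \<Longrightarrow> l' \<in> I \<Longrightarrow> h * (of_int l - of_int l') < 1"
  shows "(\<Sum>l\<in>I. h * (cmod (dirichlet n (h * of_int l - \<xi>)))\<^sup>2) \<le> real n + 1"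
proof (cases "I = {}")
  case False
  define P where "P = nat \<lceil>1 / h\<rceil>"
  define l0 where "l0 = Min I"
  have P: "1 / h \<le> real P" "real P < 1 / h + 1" 
  proof -
    have "0 < \<lceil>1 / h\<rceil>" using h(1) by simp
    then have "real P = of_int \<lceil>1 / h\<rceil>" by (simp add: P_def)
    then show "1 / h \<le> real P" "real P < 1 / h + 1" by linarith+
  qed
  have Ph: "1 \<le> real P * h" "real P * h \<le> 1 + h" using P h(1) by (simp_all add: field_simps)
  have sub: "I \<subseteq> (\<lambda>i. l0 + int i) ` {..<P}"
  proof
    fix l assume l: "l \<in> I"
    have "l0 \<in> I" "l0 \<le> l" using I(1) False l by (auto simp: l0_def)
    then have "of_int l - of_int l0 < 1 / h" using I(2)[OF l, of l0] h(1) by (simp add: field_simps)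
    then have "l - l0 < int P" using P by linarith
    then show "l \<in> (\<lambda>i. l0 + int i) ` {..<P}"
      using \<open>l0 \<le> l\<close> by (intro image_eqI[of _ _ "nat (l - l0)"]) auto
  qed
  define x where "x i = h * of_int (l0 + int i) - \<xi>" for i
  have expand: "complex_of_real ((cmod (dirichlet n y))\<^sup>2) = (\<Sum>j<n. \<Sum>k<n. e2 ((of_nat j - of_nat k) * y))" for y
  proof -
    have "e2 (of_nat j * y) * cnj (e2 (of_nat k * y)) = e2 ((of_nat j - of_nat k) * y)" for j k
      unfolding cnj_e2 e2_add[symmetric] by (simp add: algebra_simps)
    then show ?thesis unfolding complex_norm_square dirichlet_def by (simp add: sum_product)
  qed
  define T where "T j k = (\<Sum>i<P. e2 ((of_nat j - of_nat k) * x i))" for j k :: nat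
  have Tdiag: "cmod (T j j) \<le> real P" for j by (simp add: T_def)
  \<comment> \<open>As \<open>P * h\<close> exceeds 1 by at most \<open>h\<close>, the numerator of
    the geometric sum is at most \<open>2 * pi * \<bar>d\<bar> * h\<close>, and the denominator is
    at least half of that.\<close>
  have Toff: "cmod (T j k) \<le> 2" if "j < n" "k < n" "j \<noteq> k" for j k
  proof -
    define d where "d = real j - real k"
    have d: "1 \<le> \<bar>d\<bar>" "\<bar>d\<bar> \<le> real n" using that by (auto simp: d_def)
    have "h * (4 * real n) \<le> h * (4 * (real n + 2 * real n ^ 2))" using h(1) by (intro mult_left_mono) auto
    then have nh: "4 * (real n * h) \<le> 1" using h(2) by (simp add: mult_ac)
    have dh: "\<bar>d\<bar> * h \<le> 1 / 4" 
    proof -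
      have "\<bar>d\<bar> * h \<le> real n * h" using d(2) h(1) by (intro mult_right_mono) auto
      then show ?thesis using nh by linarith
    qed
    have fac: "e2 ((of_nat j - of_nat k) * x i) = e2 (d * (h * of_int l0 - \<xi>)) * e2 (of_nat i * (d * h))" for i
      unfolding e2_add[symmetric] d_def x_def by (simp add: algebra_simps)
    have T: "cmod (T j k) = cmod (\<Sum>i<P. e2 (of_nat i * (d * h)))"
      unfolding T_def fac sum_distrib_left[symmetric] by (simp add: norm_mult)
    have num: "cmod (e2 (of_nat P * (d * h)) - 1) \<le> 2 * pi * (\<bar>d\<bar> * h)"
    proof -
      have "of_nat P * (d * h) = d * (real P * h - 1) + of_int (int j - int k)" by (simp add: d_def algebra_simps)
      then have "e2 (of_nat P * (d * h)) = e2 (d * (real P * h - 1))" by (simp only: e2_add_int)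
      then have "cmod (e2 (of_nat P * (d * h)) - 1) = 2 * \<bar>sin (pi * (d * (real P * h - 1)))\<bar>" by (simp add: norm_e2_minus_1)
      also have "\<dots> \<le> 2 * \<bar>pi * (d * (real P * h - 1))\<bar>" by (intro mult_left_mono abs_sin_x_le_abs_x) auto
      also have "\<dots> = 2 * pi * (\<bar>d\<bar> * (real P * h - 1))" using Ph by (simp add: abs_mult)
      also have "\<dots> \<le> 2 * pi * (\<bar>d\<bar> * h)" using Ph by (intro mult_left_mono) auto
      finally show ?thesis .
    qed
    have den: "pi * (\<bar>d\<bar> * h) \<le> cmod (e2 (d * h) - 1)"
    proof -
      have "pi * (\<bar>d\<bar> * h) \<le> 4 * (1 / 4)" using dh pi_less_4 h(1) by (intro mult_mono) auto
      then have "pi * (\<bar>d\<bar> * h) / 2 \<le> sin (pi * (\<bar>d\<bar> * h))" using h(1) by (intro sin_ge_half) auto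
      moreover have "\<bar>sin (pi * (d * h))\<bar> = \<bar>sin (pi * (\<bar>d\<bar> * h))\<bar>" by (cases "d \<ge> 0") auto
      ultimately show ?thesis unfolding norm_e2_minus_1 by linarith
    qed
    have pos: "0 < pi * (\<bar>d\<bar> * h)" using d h by (intro mult_pos_pos) auto
    have "cmod (T j k) * (pi * (\<bar>d\<bar> * h)) \<le> cmod (T j k) * cmod (e2 (d * h) - 1)"
      using den by (intro mult_left_mono) auto
    also have "\<dots> \<le> 2 * (pi * (\<bar>d\<bar> * h))" unfolding T sum_e2_bound using num by simp
    finally show ?thesis using pos by (simp only: mult_le_cancel_right)
  qed
  have "(\<Sum>l\<in>I. (cmod (dirichlet n (h * of_int l - \<xi>)))\<^sup>2) \<le> (\<Sum>l\<in>(\<lambda>i. l0 + int i) ` {..<P}. (cmod (dirichlet n (h * of_int l - \<xi>)))\<^sup>2)"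
    using sub by (intro sum_mono2) auto
  also have "\<dots> = (\<Sum>i<P. (cmod (dirichlet n (x i)))\<^sup>2)"
    by (subst sum.reindex) (auto simp: inj_on_def x_def)
  also have "\<dots> \<le> (\<Sum>j<n. \<Sum>k<n. cmod (T j k))"
  proof -
    have "complex_of_real (\<Sum>i<P. (cmod (dirichlet n (x i)))\<^sup>2) = (\<Sum>i<P. \<Sum>j<n. \<Sum>k<n. e2 ((of_nat j - of_nat k) * x i))"
      unfolding of_real_sum expand ..
    also have "\<dots> = (\<Sum>j<n. \<Sum>i<P. \<Sum>k<n. e2 ((of_nat j - of_nat k) * x i))" by (rule sum.swap)
    also have "\<dots> = (\<Sum>j<n. \<Sum>k<n. T j k)" unfolding T_def by (intro sum.cong refl sum.swap)
    finally have "cmod (complex_of_real (\<Sum>i<P. (cmod (dirichlet n (x i)))\<^sup>2)) = cmod (\<Sum>j<n. \<Sum>k<n. T j k)" by simp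
    also have "\<dots> \<le> (\<Sum>j<n. \<Sum>k<n. cmod (T j k))" by (intro sum_norm_le norm_sum)
    finally show ?thesis unfolding norm_of_real by linarith
  qed
  also have "\<dots> \<le> (\<Sum>j<n. \<Sum>k<n. (if k = j then real P else 0) + 2)"
  proof (intro sum_mono)
    fix j k assume "j \<in> {..<n}" "k \<in> {..<n}"
    then show "cmod (T j k) \<le> (if k = j then real P else 0) + 2"
      using Toff[of j k] Tdiag[of j] by (cases "k = j") auto
  qed
  also have "\<dots> = real n * real P + 2 * real n ^ 2"
    by (simp add: sum.distrib power2_eq_square algebra_simps)
  finally have main: "(\<Sum>l\<in>I. (cmod (dirichlet n (h * of_int l - \<xi>)))\<^sup>2) \<le> real n * real P + 2 * real n ^ 2" .
  have "(\<Sum>l\<in>I. h * (cmod (dirichlet n (h * of_int l - \<xi>)))\<^sup>2) \<le> h * (real n * real P + 2 * real n ^ 2)"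
    unfolding sum_distrib_left[symmetric] using main h(1) by (intro mult_left_mono) auto
  also have "\<dots> = real n * (real P * h) + h * (2 * real n ^ 2)" by (simp add: algebra_simps)
  also have "\<dots> \<le> real n * (1 + h) + h * (2 * real n ^ 2)" using Ph by (intro add_right_mono mult_left_mono) auto
  also have "\<dots> = real n + h * (real n + 2 * real n ^ 2)" by (simp add: algebra_simps)
  also have "\<dots> \<le> real n + 1"
  proof -
    have "0 \<le> h * (real n + 2 * real n ^ 2)" using h(1) by simp
    then show ?thesis using h(2) by (simp add: algebra_simps)
  qed
  finally show ?thesis .
qed simp

text \<open>The geometric sum is at most \<open>2 / cmod (e2 x - 1)\<close> for every
  \<open>n\<close>, and away from the integers this denominator has a positive minimum.\<close>

lemma dirichlet_bound:
  assumes "0 < \<delta>" "\<delta> < 1 / 2"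
  obtains B where "\<And>n x. (\<And>k :: int. \<delta> \<le> \<bar>x - of_int k\<bar>) \<Longrightarrow> (cmod (dirichlet n x))\<^sup>2 \<le> B" "B \<ge> 0"
proof -
  have "\<exists>y\<in>{\<delta>..1 - \<delta>}. \<forall>z\<in>{\<delta>..1 - \<delta>}. cmod (e2 y - 1) \<le> cmod (e2 z - 1)"
    using assms by (intro continuous_attains_inf continuous_intros) auto
  then obtain y where y: "y \<in> {\<delta>..1 - \<delta>}" "\<And>z. z \<in> {\<delta>..1 - \<delta>} \<Longrightarrow> cmod (e2 y - 1) \<le> cmod (e2 z - 1)" by blast
  have pos: "cmod (e2 y - 1) > 0"
  proof (rule ccontr)
    assume "\<not> ?thesis"
    then have "e2 y = e2 0" by simp
    then obtain n where "y = of_int n" using e2_eqD[of y 0] by auto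
    then have "0 < real_of_int n" "real_of_int n < 1" using y(1) assms by auto
    then show False by simp
  qed
  have "(cmod (dirichlet n x))\<^sup>2 \<le> (2 / cmod (e2 y - 1))\<^sup>2" if x: "\<And>k :: int. \<delta> \<le> \<bar>x - of_int k\<bar>" for n x
  proof -
    define z where "z = x - of_int \<lfloor>x\<rfloor>"
    have "z \<in> {\<delta>..1 - \<delta>}"
      using x[of "\<lfloor>x\<rfloor>"] x[of "\<lfloor>x\<rfloor> + 1"] unfolding z_def by simp
    then have "cmod (e2 y - 1) \<le> cmod (e2 z - 1)" by (rule y(2))
    also have "e2 z = e2 x" using e2_add_int[of z "\<lfloor>x\<rfloor>"] by (simp add: z_def)
    finally have le: "cmod (e2 y - 1) \<le> cmod (e2 x - 1)" .
    have "cmod (dirichlet n x) * cmod (e2 y - 1) \<le> cmod (dirichlet n x) * cmod (e2 x - 1)"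
      using le by (intro mult_left_mono) auto
    also have "\<dots> = cmod (e2 (of_nat n * x) - 1)" unfolding dirichlet_def by (rule sum_e2_bound)
    also have "\<dots> \<le> 2" using norm_triangle_ineq4[of "e2 (of_nat n * x)" 1] by simp
    finally have "cmod (dirichlet n x) \<le> 2 / cmod (e2 y - 1)" using pos by (simp add: field_simps)
    then show ?thesis by (rule power_mono) simp
  qed
  with that[of "(2 / cmod (e2 y - 1))\<^sup>2"] show ?thesis using zero_le_power2 by blast
qed

definition near :: "real \<Rightarrow> real \<Rightarrow> int set" where "near K \<xi> = {k. \<bar>\<xi> + of_int k\<bar> \<le> K}"

lemma near_subset: "near K \<xi> \<subseteq> {\<lceil>- K - \<xi>\<rceil>..\<lfloor>K - \<xi>\<rfloor>}"
  by (auto simp: near_def ceiling_le_iff le_floor_iff abs_le_iff)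

lemma finite_near [simp]: "finite (near K \<xi>)"
  using finite_subset[OF near_subset] by simp

text \<open>For large \<open>n\<close> the squared kernel divided by \<open>n\<close> acts like unit
  masses at the translates of \<open>\<xi>\<close>. Dividing the hypothesis by \<open>n\<close>
  therefore leaves the values of \<open>W\<close> at the translates in
  \<open>[-K, K]\<close>.\<close>

lemma fejer_concentration:
  fixes W :: "real \<Rightarrow> real"
  assumes cont: "continuous_on UNIV W" and nonneg: "\<And>x. 0 \<le> W x" and K: "0 \<le> K"
    and hyp: "\<And>n \<eta>. 1 \<le> n \<Longrightarrow> 0 < \<eta> \<Longrightarrow> \<exists>h I. 0 < h \<and> h < \<eta> \<and> finite I \<and> (\<forall>l\<in>I. \<bar>h * of_int l\<bar> \<le> K) \<and>
        c * real n \<le> (\<Sum>l\<in>I. h * (cmod (dirichlet n (h * of_int l - \<xi>)))\<^sup>2 * W (h * of_int l))"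
  shows "c \<le> (\<Sum>k\<in>near K \<xi>. W (\<xi> + of_int k))"
proof (rule field_le_epsilon)
  fix e :: real assume e: "0 < e"
  let ?P = "near K \<xi>"
  define \<tau> where "\<tau> = e / (real (card ?P) + 1)"
  have \<tau>: "0 < \<tau>" "real (card ?P) * \<tau> \<le> e" using e by (auto simp: \<tau>_def field_simps)
  have "\<forall>\<^sub>F d in at_right 0. \<forall>k\<in>?P. \<forall>x. \<bar>x - (\<xi> + of_int k)\<bar> \<le> d \<longrightarrow> W x \<le> W (\<xi> + of_int k) + \<tau>"
  proof (rule eventually_ball_finite[OF finite_near], rule ballI)
    fix k
    have "isCont W (\<xi> + of_int k)" using cont by (simp add: continuous_on_eq_continuous_at)
    then obtain s where s: "s > 0" "\<And>x. \<bar>x - (\<xi> + of_int k)\<bar> < s \<Longrightarrow> \<bar>W x - W (\<xi> + of_int k)\<bar> < \<tau>"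
      using \<tau>(1) unfolding continuous_at_real_range real_norm_def by blast
    have "\<forall>\<^sub>F d in at_right 0. d < s" using s(1) by (auto simp: eventually_at_right_field)
    then show "\<forall>\<^sub>F d in at_right 0. \<forall>x. \<bar>x - (\<xi> + of_int k)\<bar> \<le> d \<longrightarrow> W x \<le> W (\<xi> + of_int k) + \<tau>"
      by eventually_elim (use s(2) in \<open>smt (verit)\<close>)
  qed
  \<comment> \<open>Translates outside \<open>[-K, K]\<close> are kept at a distance of more than
    \<open>\<delta>\<close> from the interval, so no sampling point is close to them.\<close>
  moreover have "\<forall>\<^sub>F d in at_right 0. \<forall>k\<in>near (K + 1) \<xi> - ?P. K + d < \<bar>\<xi> + of_int k\<bar>"
  proof (rule eventually_ball_finite, simp, rule ballI)
    fix k assume "k \<in> near (K + 1) \<xi> - ?P"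
    then have "0 < \<bar>\<xi> + of_int k\<bar> - K" by (simp add: near_def)
    then have "\<forall>\<^sub>F d in at_right 0. d < \<bar>\<xi> + of_int k\<bar> - K"
      unfolding eventually_at_right_field by (intro exI[of _ "\<bar>\<xi> + of_int k\<bar> - K"]) auto
    then show "\<forall>\<^sub>F d in at_right 0. K + d < \<bar>\<xi> + of_int k\<bar>" by eventually_elim simp
  qed
  moreover have "\<forall>\<^sub>F d in at_right 0. 0 < d \<and> d < (1 / 2 :: real)"
    by (auto simp: eventually_at_right_field intro!: exI[of _ "1 / 2 :: real"])
  ultimately have "\<forall>\<^sub>F d in at_right 0. (\<forall>k\<in>?P. \<forall>x. \<bar>x - (\<xi> + of_int k)\<bar> \<le> d \<longrightarrow> W x \<le> W (\<xi> + of_int k) + \<tau>)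
      \<and> (\<forall>k\<in>near (K + 1) \<xi> - ?P. K + d < \<bar>\<xi> + of_int k\<bar>) \<and> 0 < d \<and> d < (1 / 2 :: real)"
    by eventually_elim blast
  then obtain \<delta> where \<delta>: "\<And>k x. k \<in> ?P \<Longrightarrow> \<bar>x - (\<xi> + of_int k)\<bar> \<le> \<delta> \<Longrightarrow> W x \<le> W (\<xi> + of_int k) + \<tau>"
      "\<And>k. k \<in> near (K + 1) \<xi> - ?P \<Longrightarrow> K + \<delta> < \<bar>\<xi> + of_int k\<bar>" "0 < \<delta>" "\<delta> < 1 / 2"
    using eventually_happens'[OF trivial_limit_at_right_real] by blast
  obtain B where B: "\<And>n x. (\<And>k :: int. \<delta> \<le> \<bar>x - of_int k\<bar>) \<Longrightarrow> (cmod (dirichlet n x))\<^sup>2 \<le> B" "B \<ge> 0"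
    using dirichlet_bound[OF \<delta>(3,4)] by blast
  have "\<exists>x\<in>{-K..K}. \<forall>y\<in>{-K..K}. W y \<le> W x"
    using K cont by (intro continuous_attains_sup) (auto intro: continuous_on_subset)
  then obtain z where z: "\<forall>y\<in>{-K..K}. W y \<le> W z" by blast
  define Bm where "Bm = W z"
  have Bm: "W y \<le> Bm" if "\<bar>y\<bar> \<le> K" for y using z that by (auto simp: Bm_def abs_le_iff)
  have Bm0: "0 \<le> Bm" using nonneg by (simp add: Bm_def)
  \<comment> \<open>\<open>A\<close> collects the peaks, \<open>R\<close> everything away from the
    translates. As \<open>R\<close> does not depend on \<open>n\<close>, it disappears when
    \<open>n\<close> grows.\<close>
  define A where "A = (\<Sum>k\<in>?P. W (\<xi> + of_int k) + \<tau>)"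
  define R where "R = B * Bm * (2 * K + 1)"
  have main: "c * real n \<le> A * (real n + 1) + R" if n: "1 \<le> n" for n
  proof -
    have "0 < real n + 2 * real n ^ 2" using n by (intro add_pos_nonneg) auto
    then have hpos: "0 < min 1 (1 / (4 * (real n + 2 * real n ^ 2)))" by simp
    obtain h I where h: "0 < h" "h < min 1 (1 / (4 * (real n + 2 * real n ^ 2)))" and I: "finite I" "\<And>l. l \<in> I \<Longrightarrow> \<bar>h * of_int l\<bar> \<le> K"
      and le: "c * real n \<le> (\<Sum>l\<in>I. h * (cmod (dirichlet n (h * of_int l - \<xi>)))\<^sup>2 * W (h * of_int l))"
      using hyp[OF n hpos] by blast
    have h1: "h * (4 * (real n + 2 * real n ^ 2)) \<le> 1" "h < 1"
      using h \<open>0 < real n + 2 * real n ^ 2\<close> by (auto simp: field_simps)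
    define f where "f l = h * (cmod (dirichlet n (h * of_int l - \<xi>)))\<^sup>2" for l :: int
    have f0: "0 \<le> f l" for l using h by (simp add: f_def)
    define Ik where "Ik k = {l \<in> I. \<bar>h * of_int l - (\<xi> + of_int k)\<bar> \<le> \<delta>}" for k
    \<comment> \<open>Either the point is close to a translate within reach, and continuity replaces
      \<open>W\<close> by its value there, or the kernel is bounded by \<open>B\<close>.\<close>
    have pt: "f l * W (h * of_int l) \<le> (\<Sum>k\<in>?P. if l \<in> Ik k then f l * (W (\<xi> + of_int k) + \<tau>) else 0) + h * (B * Bm)" if l: "l \<in> I" for l
    proof (cases "\<exists>k\<in>?P. l \<in> Ik k")
      case True
      then obtain k where k: "k \<in> ?P" "l \<in> Ik k" by blast
      have "f l * W (h * of_int l) \<le> f l * (W (\<xi> + of_int k) + \<tau>)"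
        using k f0 by (intro mult_left_mono \<delta>(1)) (auto simp: Ik_def)
      also have "\<dots> = (if l \<in> Ik k then f l * (W (\<xi> + of_int k) + \<tau>) else 0)" using k by simp
      also have "\<dots> \<le> (\<Sum>k\<in>?P. if l \<in> Ik k then f l * (W (\<xi> + of_int k) + \<tau>) else 0)"
        using k f0 nonneg \<tau>(1) by (intro member_le_sum) (auto intro!: mult_nonneg_nonneg add_nonneg_nonneg)
      also have "\<dots> \<le> \<dots> + h * (B * Bm)" using h(1) B(2) Bm0 by simp
      finally show ?thesis .
    next
      case False
      have far: "\<delta> \<le> \<bar>(h * of_int l - \<xi>) - of_int k\<bar>" for k :: int
      proof (rule ccontr)
        assume "\<not> ?thesis"
        then have close: "\<bar>h * of_int l - (\<xi> + of_int k)\<bar> \<le> \<delta>" by (simp add: algebra_simps)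
        then have "\<bar>\<xi> + of_int k\<bar> \<le> K + \<delta>" using I(2)[OF l] by linarith
        then have "k \<in> ?P" using \<delta>(2)[of k] \<delta>(4) by (force simp: near_def)
        then show False using False close l by (auto simp: Ik_def)
      qed
      have "f l * W (h * of_int l) \<le> (h * B) * Bm"
        unfolding f_def using h(1) B(2) Bm Bm0 I(2)[OF l] nonneg far
        by (intro mult_mono mult_left_mono B(1)) auto
      moreover have "0 \<le> (\<Sum>k\<in>?P. if l \<in> Ik k then f l * (W (\<xi> + of_int k) + \<tau>) else 0)"
        using f0 nonneg \<tau>(1) by (intro sum_nonneg) (auto intro!: mult_nonneg_nonneg add_nonneg_nonneg)
      ultimately show ?thesis by (simp add: mult.assoc)
    qed
    have card: "h * real (card I) \<le> 2 * K + 1"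
    proof -
      have "I \<subseteq> {- \<lfloor>K / h\<rfloor>..\<lfloor>K / h\<rfloor>}"
      proof
        fix l assume "l \<in> I"
        then have "\<bar>of_int l\<bar> \<le> K / h" using I(2)[of l] h(1) by (simp add: abs_mult field_simps)
        then have "of_int l \<le> K / h" "of_int (- l) \<le> K / h" by (auto simp: abs_le_iff)
        then have "l \<le> \<lfloor>K / h\<rfloor>" "- l \<le> \<lfloor>K / h\<rfloor>" by (simp_all only: le_floor_iff)
        then show "l \<in> {- \<lfloor>K / h\<rfloor>..\<lfloor>K / h\<rfloor>}" by auto
      qed
      from card_mono[OF _ this] have "card I \<le> nat (2 * \<lfloor>K / h\<rfloor> + 1)" by simp
      then have "int (card I) \<le> 2 * \<lfloor>K / h\<rfloor> + 1" using K h(1) by (simp add: nat_le_eq_zle le_nat_iff)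
      then have "real (card I) \<le> 2 * (K / h) + 1" by linarith
      then have "h * real (card I) \<le> 2 * K + h" using h(1) by (simp add: field_simps)
      then show ?thesis using h1 by simp
    qed
    have window: "(\<Sum>l\<in>I. if l \<in> Ik k then f l * (W (\<xi> + of_int k) + \<tau>) else 0) \<le> (W (\<xi> + of_int k) + \<tau>) * (real n + 1)" for k
    proof -
      have "(\<Sum>l\<in>I. if l \<in> Ik k then f l * (W (\<xi> + of_int k) + \<tau>) else 0) = (\<Sum>l\<in>Ik k. f l * (W (\<xi> + of_int k) + \<tau>))"
        using I(1) by (intro sum.mono_neutral_cong_right) (auto simp: Ik_def)
      also have "\<dots> = (W (\<xi> + of_int k) + \<tau>) * (\<Sum>l\<in>Ik k. f l)" by (subst mult.commute) (simp only: sum_distrib_right)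
      also have "\<dots> \<le> (W (\<xi> + of_int k) + \<tau>) * (real n + 1)"
      proof (rule mult_left_mono)
        show "(\<Sum>l\<in>Ik k. f l) \<le> real n + 1"
          unfolding f_def
        proof (rule fejer_window[OF n h(1) h1(1)])
          show "finite (Ik k)" using I(1) by (simp add: Ik_def)
          fix l l' assume "l \<in> Ik k" "l' \<in> Ik k"
          then have "\<bar>h * of_int l - (\<xi> + of_int k)\<bar> \<le> \<delta>" "\<bar>h * of_int l' - (\<xi> + of_int k)\<bar> \<le> \<delta>" by (auto simp: Ik_def)
          then have "h * of_int l - h * of_int l' < 1" using \<delta>(4) by linarith
          then show "h * (of_int l - of_int l') < 1" by (simp add: algebra_simps)
        qed
        show "0 \<le> W (\<xi> + of_int k) + \<tau>" using nonneg[of "\<xi> + of_int k"] \<tau>(1) by linarith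
      qed
      finally show ?thesis .
    qed
    have "c * real n \<le> (\<Sum>l\<in>I. f l * W (h * of_int l))" using le by (simp add: f_def)
    also have "\<dots> \<le> (\<Sum>l\<in>I. (\<Sum>k\<in>?P. if l \<in> Ik k then f l * (W (\<xi> + of_int k) + \<tau>) else 0) + h * (B * Bm))"
      using pt by (intro sum_mono) auto
    also have "\<dots> = (\<Sum>k\<in>?P. \<Sum>l\<in>I. if l \<in> Ik k then f l * (W (\<xi> + of_int k) + \<tau>) else 0) + (h * real (card I)) * (B * Bm)"
      unfolding sum.distrib by (subst sum.swap) (simp add: mult_ac)
    also have "\<dots> \<le> (\<Sum>k\<in>?P. (W (\<xi> + of_int k) + \<tau>) * (real n + 1)) + (2 * K + 1) * (B * Bm)"
      using window card B(2) Bm0 by (intro add_mono sum_mono mult_right_mono) auto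
    also have "\<dots> = A * (real n + 1) + R" unfolding A_def R_def sum_distrib_right by (simp only: mult_ac)
    finally show ?thesis .
  qed
  have "c \<le> A"
  proof (rule ccontr)
    assume "\<not> c \<le> A"
    then have "0 < c - A" by simp
    then obtain n :: nat where n: "A + R < real n * (c - A)" using ex_less_of_nat_mult by blast
    have "c * real (Suc n) \<le> A * (real (Suc n) + 1) + R" by (rule main) simp
    then have "real n * (c - A) + (c - A) \<le> A + R" by (simp add: algebra_simps)
    then show False using n \<open>0 < c - A\<close> by linarith
  qed
  also have "A = (\<Sum>k\<in>?P. W (\<xi> + of_int k)) + real (card ?P) * \<tau>" by (simp add: A_def sum.distrib)
  finally show "c \<le> (\<Sum>k\<in>?P. W (\<xi> + of_int k)) + e" using \<tau>(2) by linarith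
qed

section \<open>Lower bounds for the periodised scaling function\<close>

text \<open>Near each real point an entire function that is not identically zero is bounded below by
  a power of the distance. Compactness of \<open>[0, 1]\<close> leaves finitely many centres, which
  form \<open>Z\<close>, and a largest exponent; this is why \<open>d \<le> 1\<close> is
  assumed.\<close>

lemma entire_lower_bound:
  assumes hol: "H holomorphic_on UNIV" and nz: "H z0 \<noteq> 0"
  obtains Z :: "real set" and p C where "finite Z" "0 < C"
    "\<And>x d. 0 \<le> x \<Longrightarrow> x \<le> 1 \<Longrightarrow> 0 < d \<Longrightarrow> d \<le> 1 \<Longrightarrow> (\<And>z. z \<in> Z \<Longrightarrow> d \<le> \<bar>x - z\<bar>) \<Longrightarrow> C * d ^ p \<le> cmod (H (of_real x))"
proof -
  have local: "\<exists>e C p. 0 < e \<and> 0 < C \<and> (\<forall>x. \<bar>x - y\<bar> < e \<longrightarrow> C * \<bar>x - y\<bar> ^ p \<le> cmod (H (of_real x)))" for y :: real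
  proof -
    obtain g r p where r: "0 < r" "continuous_on (ball (of_real y) r) g"
        "\<And>z. z \<in> ball (of_real y) r \<Longrightarrow> H z = (z - of_real y) ^ p * g z" "g (of_real y) \<noteq> 0"
    proof (cases "H (of_real y) = 0")
      case True
      have "\<not> H constant_on UNIV" using True nz unfolding constant_on_def by (metis UNIV_I)
      then show ?thesis
        by (rule holomorphic_factor_zero_nonconstant[OF hol open_UNIV connected_UNIV UNIV_I True])
          (rule that, assumption, erule holomorphic_on_imp_continuous_on, assumption, simp)
    next
      case False
      have "continuous_on (ball (of_real y) 1) H"
        using holomorphic_on_imp_continuous_on[OF hol] by (rule continuous_on_subset) simp
      then show ?thesis using that[of 1 H 0] False by simp
    qed
    have "isCont g (of_real y)" using r(1,2) by (simp add: continuous_on_eq_continuous_at)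
    then have "((\<lambda>z. cmod (g z)) \<longlongrightarrow> cmod (g (of_real y))) (at (of_real y))"
      by (intro tendsto_norm) (simp add: isCont_def)
    moreover have "cmod (g (of_real y)) / 2 < cmod (g (of_real y))" using r(4) by simp
    ultimately have "\<forall>\<^sub>F z in at (of_real y). cmod (g (of_real y)) / 2 < cmod (g z)" by (rule order_tendstoD)
    then obtain d where d: "d > 0" "\<And>z. z \<noteq> of_real y \<Longrightarrow> dist z (of_real y) < d \<Longrightarrow> cmod (g (of_real y)) / 2 < cmod (g z)"
      unfolding eventually_at by auto
    have "cmod (g (of_real y)) / 2 * \<bar>x - y\<bar> ^ p \<le> cmod (H (of_real x))" if x: "\<bar>x - y\<bar> < min d r" for x
    proof -
      have dx: "dist (of_real x) (of_real y :: complex) = \<bar>x - y\<bar>" by (simp add: dist_norm flip: of_real_diff)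
      have "cmod (g (of_real y)) / 2 \<le> cmod (g (of_real x))"
        using d(2)[of "of_real x"] x by (cases "x = y") (auto simp: dist_real_def)
      then have "cmod (g (of_real y)) / 2 * \<bar>x - y\<bar> ^ p \<le> cmod (g (of_real x)) * \<bar>x - y\<bar> ^ p"
        by (intro mult_right_mono) auto
      also have "\<dots> = cmod (H (of_real x))"
      proof -
        have "of_real x \<in> ball (of_real y :: complex) r" using x dx by (simp add: dist_commute)
        from r(3)[OF this] show ?thesis by (simp add: norm_mult norm_power mult.commute flip: of_real_diff)
      qed
      finally show ?thesis .
    qed
    then show ?thesis using d r by (intro exI[of _ "min d r"] exI[of _ "cmod (g (of_real y)) / 2"] exI[of _ p]) auto
  qed
  then obtain e C p where loc: "\<And>y. 0 < e y" "\<And>y. 0 < C y"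
      "\<And>x y :: real. \<bar>x - y\<bar> < e y \<Longrightarrow> C y * \<bar>x - y\<bar> ^ p y \<le> cmod (H (of_real x))" by metis
  have cover: "{0..1} \<subseteq> (\<Union>y\<in>{0..1::real}. ball y (e y))" using loc(1) by force
  obtain Z where Z: "Z \<subseteq> {0..1}" "finite Z" "{0..1} \<subseteq> (\<Union>y\<in>Z. ball y (e y))"
    by (rule compactE_image[OF compact_Icc open_ball cover])
  define C' where "C' = Min (insert 1 (C ` Z))"
  define p' where "p' = Max (insert 0 (p ` Z))"
  have C'pos: "0 < C'" unfolding C'_def using Z(2) loc(2) by (subst Min_gr_iff) auto
  show ?thesis
  proof (rule that[OF Z(2) C'pos])
    fix x d :: real assume x: "0 \<le> x" "x \<le> 1" and d: "0 < d" "d \<le> 1" "\<And>z. z \<in> Z \<Longrightarrow> d \<le> \<bar>x - z\<bar>"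
    obtain y where y: "y \<in> Z" "\<bar>x - y\<bar> < e y" using x Z(3) by (force simp: dist_real_def)
    have le: "C' \<le> C y" "p y \<le> p'" unfolding C'_def p'_def using y Z(2) by auto
    have "C' * d ^ p' \<le> C y * d ^ p y"
      using le d C'pos by (intro mult_mono power_decreasing) auto
    also have "\<dots> \<le> C y * \<bar>x - y\<bar> ^ p y"
      using d(1) d(3)[OF y(1)] loc(2)[of y] by (intro mult_left_mono power_mono) auto
    also have "\<dots> \<le> cmod (H (of_real x))" by (rule loc(3)[OF y(2)])
    finally show "C' * d ^ p' \<le> cmod (H (of_real x))" .
  qed
qed

context wavelets
begin

definition Phi :: "real \<Rightarrow> real \<Rightarrow> real" where
  "Phi K \<xi> = (\<Sum>k\<in>near K \<xi>. (cmod (fourier \<phi> (\<xi> + of_int k)))\<^sup>2)"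

lemma phi_bounded: "supp_in \<phi> {- a..a}"
  by (rule supp_in_mono[OF supp_phi]) (use a1 in auto)

lemma Phi_mono: "K \<le> K' \<Longrightarrow> Phi K \<xi> \<le> Phi K' \<xi>"
  unfolding Phi_def by (intro sum_mono2 finite_near) (auto simp: near_def)

text \<open>The integers lie in the lattice of step \<open>1 / \<lceil>a\<rceil>\<close>, one period
  of which is \<open>[0, \<lceil>a\<rceil>]\<close> and carries \<open>\<phi>\<close>. The bound is
  independent of \<open>N\<close>, so finitely many shifts cannot contribute a fixed positive amount
  at every integer.\<close>

lemma fourier_phi_bessel:
  fixes k :: int
  shows "(\<Sum>n<N. (cmod (fourier \<phi> (real n + of_int k)))\<^sup>2) \<le> of_int \<lceil>a\<rceil>"
proof -
  define B where "B = real_of_int \<lceil>a\<rceil>"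
  have B: "B > 0" "a \<le> B" using ceiling_a unfolding B_def by linarith+
  let ?s = "fourier_atom 0 1 (1 / B)"
  have on: "orthonormal_on ?s A" for A using B by (intro fourier_atom_orthonormal) auto
  have "supp_in \<phi> {- 0 / (1 / B * (0 + 1))..1 / (1 / B * (0 + 1))}"
    by (rule supp_in_mono[OF supp_phi]) (use B in auto)
  note coeff = cinner_fourier_atom[OF this]
  define l where "l n = \<lceil>a\<rceil> * (int n + k)" for n
  have fl: "(cmod (cinner \<phi> (?s (l n))))\<^sup>2 = (cmod (fourier \<phi> (real n + of_int k)))\<^sup>2 / B" for n
  proof -
    have "1 / B * of_int (l n) = real n + of_int k" using ceiling_a(1) by (simp add: l_def B_def del: one_le_ceiling)
    then show ?thesis unfolding coeff using B(1) by (simp add: norm_mult power_mult_distrib)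
  qed
  have "\<lceil>a\<rceil> \<noteq> 0" using ceiling_a(1) by linarith
  then have inj: "inj_on l {..<N}" by (auto simp: inj_on_def l_def)
  have "(\<Sum>n<N. (cmod (fourier \<phi> (real n + of_int k)))\<^sup>2 / B) = (\<Sum>j\<in>l ` {..<N}. (cmod (cinner \<phi> (?s j)))\<^sup>2)"
    by (simp add: sum.reindex[OF inj] fl)
  also have "\<dots> \<le> (norm \<phi>)\<^sup>2" by (rule bessel[OF on]) simp
  finally show ?thesis using B(1) by (simp add: norm_phi field_simps B_def flip: sum_divide_distrib)
qed

text \<open>\<open>Phi K\<close> itself is not analytic, since the set of shifts in
  \<open>near K \<xi>\<close> jumps. For a fixed finite set \<open>S\<close> of shifts the sum is
  the restriction of an entire function, and for \<open>\<xi>\<close> in \<open>[0, 1]\<close> only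
  finitely many sets occur.\<close>

lemma Phi_lower:
  assumes c: "0 < c" "\<And>\<xi>. c \<le> Phi K \<xi>"
  obtains Z :: "real set" and p C where "finite Z" "0 < C"
    "\<And>x d. 0 \<le> x \<Longrightarrow> x \<le> 1 \<Longrightarrow> 0 < d \<Longrightarrow> d \<le> 1 \<Longrightarrow> (\<And>z. z \<in> Z \<Longrightarrow> d \<le> \<bar>x - z\<bar>) \<Longrightarrow> c + C * d ^ p \<le> Phi K x"
proof -
  obtain H where H: "H holomorphic_on UNIV" "\<And>\<omega>. H (of_real \<omega>) = fourier \<phi> \<omega>"
    using fourier_entire[OF phi_bounded] by blast
  \<comment> \<open>The squared modulus on the real line continues analytically as
    \<open>H z * cnj (H (cnj z))\<close>.\<close>
  define G where "G S z = (\<Sum>k\<in>S. H (z + of_int k) * cnj (H (cnj (z + of_int k)))) - complex_of_real c" for S z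
  have hol: "G S holomorphic_on UNIV" for S
  proof -
    have hc: "(cnj \<circ> H \<circ> cnj) holomorphic_on UNIV"
      using H(1) by (intro holomorphic_on_compose_cnj_cnj) (auto elim: holomorphic_on_subset)
    have t: "(\<lambda>z. z + of_int k) holomorphic_on UNIV" for k
      by (intro holomorphic_intros)
    have "((cnj \<circ> H \<circ> cnj) \<circ> (\<lambda>z. z + of_int k)) holomorphic_on UNIV" for k
      by (rule holomorphic_on_compose[OF t holomorphic_on_subset[OF hc subset_UNIV]])
    then have conj: "(\<lambda>z. cnj (H (cnj (z + of_int k)))) holomorphic_on UNIV" for k
      by (simp only: comp_def)
    have "(H \<circ> (\<lambda>z. z + of_int k)) holomorphic_on UNIV" for k
      by (rule holomorphic_on_compose[OF t holomorphic_on_subset[OF H(1) subset_UNIV]])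
    then have "(\<lambda>z. H (z + of_int k)) holomorphic_on UNIV" for k
      by (simp only: comp_def)
    then show ?thesis unfolding G_def by (intro holomorphic_intros conj)
  qed
  have real: "G S (of_real x) = complex_of_real ((\<Sum>k\<in>S. (cmod (fourier \<phi> (x + of_int k)))\<^sup>2) - c)" for S x
  proof -
    have "H (of_real x + of_int k) * cnj (H (cnj (of_real x + of_int k))) = complex_of_real ((cmod (fourier \<phi> (x + of_int k)))\<^sup>2)" for k
      using H(2)[of "x + of_int k"] by (simp add: mult_cnj_self)
    then show ?thesis by (simp add: G_def)
  qed
  \<comment> \<open>If the sum over \<open>S\<close> were \<open>c\<close> at every natural number,
    adding up \<open>N\<close> of them would give \<open>N * c\<close>, against the bound of
    \<open>fourier_phi_bessel\<close>.\<close>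
  have nz: "\<exists>z. G S z \<noteq> 0" if S: "finite S" for S
  proof (rule ccontr)
    assume "\<not> ?thesis"
    then have "complex_of_real ((\<Sum>k\<in>S. (cmod (fourier \<phi> (real n + of_int k)))\<^sup>2) - c) = 0" for n
      using real[of S "real n"] by metis
    then have eq: "(\<Sum>k\<in>S. (cmod (fourier \<phi> (real n + of_int k)))\<^sup>2) = c" for n
      by (simp only: of_real_eq_0_iff) simp
    have "real N * c \<le> real (card S) * of_int \<lceil>a\<rceil>" for N
    proof -
      have "real N * c = (\<Sum>n<N. \<Sum>k\<in>S. (cmod (fourier \<phi> (real n + of_int k)))\<^sup>2)" by (simp add: eq)
      also have "\<dots> = (\<Sum>k\<in>S. \<Sum>n<N. (cmod (fourier \<phi> (real n + of_int k)))\<^sup>2)" by (rule sum.swap)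
      also have "\<dots> \<le> (\<Sum>k\<in>S. of_int \<lceil>a\<rceil>)" by (intro sum_mono fourier_phi_bessel)
      finally show ?thesis by simp
    qed
    moreover obtain N :: nat where "real (card S) * of_int \<lceil>a\<rceil> < real N * c"
      using ex_less_of_nat_mult[OF c(1)] by blast
    ultimately show False by (meson not_less)
  qed
  define Q where "Q S Z p C \<longleftrightarrow> finite Z \<and> 0 < C \<and> (\<forall>x d. 0 \<le> x \<longrightarrow> x \<le> 1 \<longrightarrow> 0 < d \<longrightarrow> d \<le> 1 \<longrightarrow>
      (\<forall>z\<in>Z. d \<le> \<bar>x - z\<bar>) \<longrightarrow> C * d ^ p \<le> cmod (G S (of_real x)))" for S and Z :: "real set" and p C
  have "\<exists>Z p C. Q S Z p C" if S: "finite S" for S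
  proof -
    obtain z0 where z0: "G S z0 \<noteq> 0" using nz[OF S] by blast
    show ?thesis
    proof (rule entire_lower_bound[OF hol z0])
      fix Z p C
      assume "finite Z" "0 < C" and "\<And>x d. 0 \<le> x \<Longrightarrow> x \<le> 1 \<Longrightarrow> 0 < d \<Longrightarrow> d \<le> 1 \<Longrightarrow> (\<And>z. z \<in> Z \<Longrightarrow> d \<le> \<bar>x - z\<bar>) \<Longrightarrow> C * d ^ p \<le> cmod (G S (of_real x))"
      then have "Q S Z p C" unfolding Q_def by simp
      then show ?thesis by blast
    qed
  qed
  then have "\<forall>S. \<exists>Z p C. finite S \<longrightarrow> Q S Z p C" by blast
  then obtain Zf pf Cf where Q: "\<And>S. finite S \<Longrightarrow> Q S (Zf S) (pf S) (Cf S)" by metis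
  have f: "finite (Zf S)" "0 < Cf S" if "finite S" for S using Q[OF that] by (auto simp: Q_def)
  \<comment> \<open>For \<open>x\<close> in \<open>[0, 1]\<close> every shift that brings
    \<open>x\<close> into \<open>[-K, K]\<close> lies between \<open>- m\<close> and
    \<open>m\<close>.\<close>
  define m where "m = \<lceil>\<bar>K\<bar>\<rceil> + 1"
  define \<S> where "\<S> = Pow {- m..m}"
  have fS: "finite \<S>" "\<And>S. S \<in> \<S> \<Longrightarrow> finite S" by (auto simp: \<S>_def intro: finite_subset)
  have near: "near K x \<in> \<S>" if "0 \<le> x" "x \<le> 1" for x
  proof -
    have "- m \<le> k \<and> k \<le> m" if "\<bar>x + of_int k\<bar> \<le> K" for k
      using that \<open>0 \<le> x\<close> \<open>x \<le> 1\<close> unfolding m_def by linarith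
    then show ?thesis by (auto simp: \<S>_def near_def)
  qed
  define Z where "Z = (\<Union>S\<in>\<S>. Zf S)"
  define C where "C = Min (insert 1 (Cf ` \<S>))"
  define p where "p = Max (insert 0 (pf ` \<S>))"
  have Z: "finite Z" using fS f by (auto simp: Z_def)
  have C: "0 < C" unfolding C_def using fS f by (subst Min_gr_iff) auto
  show ?thesis
  proof (rule that[OF Z C])
    fix x d :: real assume x: "0 \<le> x" "x \<le> 1" and d: "0 < d" "d \<le> 1" "\<And>z. z \<in> Z \<Longrightarrow> d \<le> \<bar>x - z\<bar>"
    define S where "S = near K x"
    have S: "S \<in> \<S>" using near[OF x] by (simp add: S_def)
    have le: "C \<le> Cf S" "pf S \<le> p" unfolding C_def p_def using S fS by auto
    have "C * d ^ p \<le> Cf S * d ^ pf S"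
      using le d C by (intro mult_mono power_decreasing) auto
    also have "\<dots> \<le> cmod (G S (of_real x))"
      using Q[OF fS(2)[OF S]] x d S unfolding Q_def Z_def by blast
    also have "\<dots> = \<bar>Phi K x - c\<bar>" unfolding real by (simp only: Phi_def S_def norm_of_real)
    also have "\<dots> = Phi K x - c" using c(2)[of x] by simp
    finally show "c + C * d ^ p \<le> Phi K x" by simp
  qed
qed

text \<open>With \<open>l = r + k * L\<close> the symbol depends on \<open>r\<close> alone, and the
  sum over \<open>k\<close> is the truncated periodisation.\<close>

lemma periodise:
  assumes "L > 0"
  shows "(\<Sum>r<L. (cmod (trig_sum F c (of_nat r / of_nat L)))\<^sup>2 * Phi K (of_nat r / of_nat L))
    = (\<Sum>l\<in>{l. \<bar>real_of_int l / real L\<bar> \<le> K}. (cmod (trig_sum F c (of_int l / of_nat L)))\<^sup>2 * (cmod (fourier \<phi> (of_int l / of_nat L)))\<^sup>2)"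
proof -
  define g where "g l = (cmod (trig_sum F c (of_int l / of_nat L)))\<^sup>2 * (cmod (fourier \<phi> (of_int l / of_nat L)))\<^sup>2" for l :: int
  have shift: "real_of_int (int r + k * int L) / real L = of_nat r / of_nat L + of_int k" for r k
    using assms by (simp add: field_simps)
  have "(\<Sum>r<L. (cmod (trig_sum F c (of_nat r / of_nat L)))\<^sup>2 * Phi K (of_nat r / of_nat L))
      = (\<Sum>r<L. \<Sum>k\<in>near K (of_nat r / of_nat L). g (int r + k * int L))"
    unfolding Phi_def g_def shift trig_sum_periodic sum_distrib_left ..
  also have "\<dots> = (\<Sum>(r, k)\<in>(SIGMA r:{..<L}. near K (of_nat r / of_nat L)). g (int r + k * int L))"
    by (rule sum.Sigma) auto
  also have "\<dots> = (\<Sum>l\<in>{l. \<bar>real_of_int l / real L\<bar> \<le> K}. g l)"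
  proof (rule sum.reindex_bij_witness[where i = "\<lambda>l. (nat (l mod int L), l div int L)" and j = "\<lambda>(r, k). int r + k * int L"])
    fix l assume l: "l \<in> {l. \<bar>real_of_int l / real L\<bar> \<le> K}"
    have e: "int (nat (l mod int L)) + l div int L * int L = l" using assms by simp
    then show "(case (nat (l mod int L), l div int L) of (r, k) \<Rightarrow> int r + k * int L) = l" by simp
    have eq: "of_nat (nat (l mod int L)) / of_nat L + of_int (l div int L) = real_of_int l / real L"
      using shift[of "nat (l mod int L)" "l div int L"] unfolding e by (rule sym)
    have "nat (l mod int L) < L" using assms by (simp add: nat_less_iff)
    then show "(nat (l mod int L), l div int L) \<in> (SIGMA r:{..<L}. near K (of_nat r / of_nat L))"
      using l unfolding near_def mem_Sigma_iff mem_Collect_eq eq by simp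
  next
    fix q assume "q \<in> (SIGMA r:{..<L}. near K (of_nat r / of_nat L))"
    then obtain r k where q: "q = (r, k)" "r < L" "k \<in> near K (of_nat r / of_nat L)" by auto
    show "(nat ((case q of (r, k) \<Rightarrow> int r + k * int L) mod int L), (case q of (r, k) \<Rightarrow> int r + k * int L) div int L) = q"
      using q by simp
    show "(case q of (r, k) \<Rightarrow> int r + k * int L) \<in> {l. \<bar>real_of_int l / real L\<bar> \<le> K}"
      using q shift[of r k] by (simp add: near_def)
    show "g (case q of (r, k) \<Rightarrow> int r + k * int L) = (case q of (r, k) \<Rightarrow> g (int r + k * int L))" using q by simp
  qed
  finally show ?thesis by (simp add: g_def)
qed

end

section \<open>Samples, energy and the lower bound for \<open>Phi\<close>\<close>

locale generalized_sampling = wavelets +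
  fixes T1 T2 \<epsilon> :: real
  assumes T1: "T1 \<ge> of_int \<lceil>a\<rceil> - 1" and T2: "T2 \<ge> 2 * of_int \<lceil>a\<rceil> - 1"
    and eps: "0 < \<epsilon>" "\<epsilon> \<le> 1 / (T1 + T2)"
begin

abbreviation "s \<equiv> fourier_atom T1 T2 \<epsilon>"

lemma T_pos: "0 \<le> T1" "1 \<le> T2" "0 < T1 + T2"
  using T1 T2 ceiling_a(1) by linarith+

lemma s_orthonormal: "orthonormal_on s A"
  using fourier_atom_orthonormal[OF eps(1) T_pos(3)] .

lemma s_window: "supp_in f {- (of_int \<lceil>a\<rceil> - 1)..2 * of_int \<lceil>a\<rceil> - 1} \<Longrightarrow> supp_in f {- T1 / (\<epsilon> * (T1 + T2))..T2 / (\<epsilon> * (T1 + T2))}"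
proof (erule supp_in_mono)
  define q where "q = \<epsilon> * (T1 + T2)"
  have q: "0 < q" "q \<le> 1"
    using eps(2) mult_pos_pos[OF eps(1) T_pos(3)] by (simp_all add: q_def pos_le_divide_eq[OF T_pos(3)])
  have "T1 * q \<le> T1 * 1" "T2 * q \<le> T2 * 1"
    using mult_left_mono[OF q(2), of T1] mult_left_mono[OF q(2), of T2] T_pos by simp_all
  then have "T1 \<le> T1 / q" "T2 \<le> T2 / q" unfolding pos_le_divide_eq[OF q(1)] by simp_all
  then show "{- (real_of_int \<lceil>a\<rceil> - 1)..2 * real_of_int \<lceil>a\<rceil> - 1} \<subseteq> {- T1 / (\<epsilon> * (T1 + T2))..T2 / (\<epsilon> * (T1 + T2))}"
    unfolding q_def using T1 T2 by auto
qed

text \<open>By orthonormality of the atoms this is the squared norm of the projection onto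
  \<open>sampling_space s M\<close>, hence the square of what \<open>subspace_cos\<close>
  minimises.\<close>

definition energy :: "nat \<Rightarrow> L2 \<Rightarrow> real" where
  "energy M f = (\<Sum>l\<in>sample_index M. (cmod (cinner f (s l)))\<^sup>2)"

lemma sample_norm_energy: "sample_norm s M f = sqrt (energy M f)"
  by (simp add: sample_norm_def energy_def L2_set_def)

lemma energy_nonneg: "0 \<le> energy M f"
  by (simp add: energy_def sum_nonneg)

lemma energy_mono: "M \<le> M' \<Longrightarrow> energy M f \<le> energy M' f"
  unfolding energy_def by (intro sum_mono2 sample_index_mono) auto

lemma coeff_formula:
  assumes "finite F" "f = (\<Sum>k\<in>F. c k *\<^sub>C wavelet_atom \<phi> (int n) k)"
    and "supp_in f {- (of_int \<lceil>a\<rceil> - 1)..2 * of_int \<lceil>a\<rceil> - 1}"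
  shows "(cmod (cinner f (s l)))\<^sup>2 = \<epsilon> / 2 ^ n * (cmod (trig_sum F c (\<epsilon> / 2 ^ n * of_int l)))\<^sup>2 * (cmod (fourier \<phi> (\<epsilon> / 2 ^ n * of_int l)))\<^sup>2"
proof -
  have "(2 powr (- real n / 2))\<^sup>2 = (2::real) powr (- real n / 2 + - real n / 2)"
    unfolding power2_eq_square by (rule powr_add[symmetric])
  also have "- real n / 2 + - real n / 2 = - real n" by simp
  also have "(2::real) powr (- real n) = 1 / 2 ^ n" by (simp add: powr_minus_divide powr_realpow)
  finally have "(2 powr (- real n / 2))\<^sup>2 = 1 / (2::real) ^ n" .
  moreover have "cinner f (s l) = sqrt \<epsilon> * (complex_of_real (2 powr (- real n / 2)) * trig_sum F c (\<epsilon> / 2 ^ n * of_int l) * fourier \<phi> (\<epsilon> / 2 ^ n * of_int l))"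
    unfolding cinner_fourier_atom[OF s_window[OF assms(3)]]
    unfolding assms(2) fourier_phi_sum[OF assms(1)] trig_sum_def by simp
  ultimately show ?thesis using eps by (simp add: norm_mult power_mult_distrib)
qed

text \<open>The test function has the coefficients \<open>e2 (k * \<xi>)\<close> on \<open>n\<close>
  translates of scale \<open>Suc S\<close>, so the modulus of its symbol is that of a Dirichlet
  kernel centred at \<open>\<xi>\<close>. With \<open>n\<close> fixed and \<open>S\<close> large,
  \<open>N\<close> is about \<open>\<lceil>a\<rceil> * 2 ^ S\<close>, and the sampled frequencies
  divided by \<open>2 ^ Suc S\<close> stay below \<open>K\<close>.\<close>

lemma Phi_ge_of_stability:
  assumes stable: "\<And>N M f. N0 \<le> N \<Longrightarrow> \<eta> * real N \<le> real M \<Longrightarrow> f \<in> recon_space w N \<Longrightarrow> c * (norm f)\<^sup>2 \<le> energy M f"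
    and eta: "0 \<le> \<eta>" and K: "\<epsilon> * \<eta> * of_int \<lceil>a\<rceil> / 4 < K"
  shows "c \<le> Phi K \<xi>"
  unfolding Phi_def
proof (rule fejer_concentration[of "\<lambda>x. (cmod (fourier \<phi> x))\<^sup>2"])
  show "continuous_on UNIV (\<lambda>x. (cmod (fourier \<phi> x))\<^sup>2)"
    by (intro continuous_intros continuous_on_fourier[OF phi_bounded])
  have "0 \<le> \<epsilon> * \<eta> * of_int \<lceil>a\<rceil> / 4" using eps eta ceiling_a(1) by simp
  then show "0 \<le> K" using K by linarith
  fix n :: nat and d :: real assume n: "1 \<le> n" and d: "0 < d"
  \<comment> \<open>This lets \<open>n\<close> translates fit left of the first missing wavelet:
    \<open>k + a \<le> m \<le> 2 * (m - \<lceil>a\<rceil> + 1)\<close>. For the limit it matters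
    that \<open>m\<close> does not grow with \<open>S\<close>.\<close>
  define m where "m = nat (2 * \<lceil>a\<rceil>) + n"
  have im: "int m = 2 * \<lceil>a\<rceil> + int n" using ceiling_a(1) by (simp add: m_def)
  define A where "A = real_of_int \<lceil>a\<rceil>"
  have "(\<lambda>S. \<epsilon> * (\<eta> * (A * 2 ^ S + (real S + 1) * (A - 1) + real m) + 1) / (4 * 2 ^ S)) \<longlonglongrightarrow> \<epsilon> * \<eta> * A / 4"
    by real_asymp
  from order_tendstoD(2)[OF this, of K] K
  have e1: "\<forall>\<^sub>F S in sequentially. \<epsilon> * (\<eta> * (A * 2 ^ S + (real S + 1) * (A - 1) + real m) + 1) / (4 * 2 ^ S) < K"
    by (simp add: A_def)
  have "(\<lambda>S. \<epsilon> / 2 ^ Suc S) \<longlonglongrightarrow> 0" by real_asymp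
  from order_tendstoD(2)[OF this d]
  have e2: "\<forall>\<^sub>F S in sequentially. \<epsilon> / 2 ^ Suc S < d" .
  have e3: "\<forall>\<^sub>F S in sequentially. real m + real N0 \<le> 2 ^ S" by real_asymp
  from eventually_conj[OF e1 eventually_conj[OF e2 e3]]
  obtain S where S: "\<epsilon> * (\<eta> * (A * 2 ^ S + (real S + 1) * (A - 1) + real m) + 1) / (4 * 2 ^ S) < K"
      "\<epsilon> / 2 ^ Suc S < d" "real m + real N0 \<le> 2 ^ S"
    using eventually_happens'[OF sequentially_bot] by blast
  define h where "h = \<epsilon> / 2 ^ Suc S"
  have h: "0 < h" "h < d" using S eps by (simp_all add: h_def)
  have mS: "int m \<le> 2 ^ S"
  proof -
    have "real m \<le> 2 ^ S" using S(3) by linarith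
    then show ?thesis by simp
  qed
  have aS: "2 ^ S \<le> 2 ^ S * \<lceil>a\<rceil>" using ceiling_a(1) by simp
  have m: "int m \<le> 2 ^ S * \<lceil>a\<rceil> + \<lceil>a\<rceil> - 1" using mS aS ceiling_a(1) by linarith
  define N where "N = dimn S + m"
  define M where "M = nat \<lceil>\<eta> * real N\<rceil>"
  have dS: "real (dimn S) = A * 2 ^ S + (real S + 1) * (A - 1)"
    using arg_cong[OF dimn_eq[of S], of real_of_int] by (simp add: A_def)
  have M: "\<eta> * real N \<le> real M" "real M \<le> \<eta> * real N + 1"
  proof -
    have "0 \<le> \<eta> * real N" using eta by simp
    then show "\<eta> * real N \<le> real M" "real M \<le> \<eta> * real N + 1" unfolding M_def by linarith+
  qed
  have "1 * 2 ^ S \<le> A * 2 ^ S" using ceiling_a(1) by (intro mult_right_mono) (auto simp: A_def)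
  also have "\<dots> \<le> real (dimn S)" unfolding A_def by (rule dimn_ge)
  finally have "2 ^ S \<le> real (dimn S)" by (simp only: mult_1)
  then have "real N0 \<le> real (dimn S)" using S(3) by linarith
  then have N: "N0 \<le> N" by (simp add: N_def)
  define F where "F = {0..<int n}"
  define b where "b k = e2 (of_int k * \<xi>)" for k :: int
  define f where "f = (\<Sum>k\<in>F. b k *\<^sub>C wavelet_atom \<phi> (int (Suc S)) k)"
  have mem: "wavelet_atom \<phi> (int (Suc S)) k \<in> recon_space w N" if k: "k \<in> F" for k
    unfolding N_def
  proof (rule phi_in_recon[OF _ _ _ m])
    show "0 \<le> k" using k by (simp add: F_def)
    have kn: "real_of_int k \<le> real n" using k by (simp add: F_def)
    have ka: "of_int k + a \<le> real m" using kn ceiling_a im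
      by (simp add: m_def) linarith
    have "real m \<le> 2 ^ Suc S * of_int \<lceil>a\<rceil>"
    proof -
      have "(0::int) \<le> 2 ^ S" by simp
      then have "int m \<le> 2 * (2 ^ S * \<lceil>a\<rceil>)" using mS aS by linarith
      then have "int m \<le> 2 ^ Suc S * \<lceil>a\<rceil>" by (simp only: power_Suc mult.assoc)
      then have "real_of_int (int m) \<le> real_of_int (2 ^ Suc S * \<lceil>a\<rceil>)" by (simp only: of_int_le_iff)
      then show ?thesis by simp
    qed
    then show "of_int k + a \<le> 2 ^ Suc S * of_int \<lceil>a\<rceil>" using ka by linarith
    have "int m \<le> 2 * (int m - \<lceil>a\<rceil> + 1)" unfolding im by simp
    then have "real_of_int (int m) \<le> real_of_int (2 * (int m - \<lceil>a\<rceil> + 1))" by (simp only: of_int_le_iff)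
    then show "of_int k + a \<le> 2 * of_int (int m - \<lceil>a\<rceil> + 1)" using ka by simp
  qed
  have fN: "f \<in> recon_space w N"
    unfolding f_def using mem by (auto simp: recon_space_def intro!: L2.span_sum L2.span_scale)
  have fin: "finite F" by (simp add: F_def)
  have "(norm f)\<^sup>2 = (\<Sum>k\<in>F. (cmod (b k))\<^sup>2)"
    unfolding f_def by (rule norm_orthonormal_sum[OF _ fin]) (simp add: orthonormal_on_def phi_orthonormal)
  then have nf: "(norm f)\<^sup>2 = real n" by (simp add: b_def F_def)
  have supp: "supp_in f {- (of_int \<lceil>a\<rceil> - 1)..2 * of_int \<lceil>a\<rceil> - 1}"
    using fN unfolding N_def recon_space_partial[OF m] by (rule recon_supp[OF _ m])
  have dir: "cmod (trig_sum F b x) = cmod (dirichlet n (x - \<xi>))" for x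
  proof -
    have "trig_sum F b x = (\<Sum>k\<in>int ` {..<n}. e2 (of_int k * \<xi>) * e2 (- (of_int k * x)))"
      unfolding trig_sum_def b_def F_def by (simp add: image_int_atLeastLessThan lessThan_atLeast0)
    also have "\<dots> = (\<Sum>j<n. e2 (real j * \<xi>) * e2 (- (real j * x)))" by (simp add: sum.reindex)
    also have "\<dots> = (\<Sum>j<n. cnj (e2 (real j * (x - \<xi>))))"
      unfolding cnj_e2 e2_add[symmetric] by (intro sum.cong refl arg_cong[where f = e2]) (simp add: algebra_simps)
    finally have "trig_sum F b x = cnj (dirichlet n (x - \<xi>))" by (simp add: dirichlet_def)
    then show ?thesis by simp
  qed
  have "c * real n \<le> energy M f" using stable[OF N M(1) fN] by (simp add: nf)
  also have "\<dots> = (\<Sum>l\<in>sample_index M. h * (cmod (dirichlet n (h * of_int l - \<xi>)))\<^sup>2 * (cmod (fourier \<phi> (h * of_int l)))\<^sup>2)"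
    unfolding energy_def coeff_formula[OF fin f_def supp] dir h_def ..
  finally have le: "c * real n \<le> (\<Sum>l\<in>sample_index M. h * (cmod (dirichlet n (h * of_int l - \<xi>)))\<^sup>2 * (cmod (fourier \<phi> (h * of_int l)))\<^sup>2)" .
  have "\<bar>h * of_int l\<bar> \<le> K" if "l \<in> sample_index M" for l
  proof -
    have "\<bar>h * of_int l\<bar> = h * \<bar>of_int l\<bar>" using h by (simp add: abs_mult)
    also have "\<dots> \<le> h * (real M / 2)" using h sample_index_abs_le[OF that] by (intro mult_left_mono) auto
    also have "\<dots> \<le> h * ((\<eta> * real N + 1) / 2)" using h M by (intro mult_left_mono) auto
    also have "\<dots> = \<epsilon> * (\<eta> * (A * 2 ^ S + (real S + 1) * (A - 1) + real m) + 1) / (4 * 2 ^ S)"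
      by (simp add: h_def N_def dS)
    finally show ?thesis using S(1) by linarith
  qed
  then show "\<exists>h I. 0 < h \<and> h < d \<and> finite I \<and> (\<forall>l\<in>I. \<bar>h * of_int l\<bar> \<le> K) \<and>
      c * real n \<le> (\<Sum>l\<in>I. h * (cmod (dirichlet n (h * of_int l - \<xi>)))\<^sup>2 * (cmod (fourier \<phi> (h * of_int l)))\<^sup>2)"
    using h le by (intro exI[of _ h] exI[of _ "sample_index M"]) auto
qed auto

end

section \<open>Smooth cutoff functions\<close>

lemma integral_e2_bound:
  assumes "\<alpha> \<le> \<beta>" "t \<noteq> 0"
  shows "cmod (LINT x|lborel. indicator {\<alpha>..\<beta>} x *\<^sub>R e2 (t * x)) \<le> 1 / \<bar>t\<bar>"
proof -
  define F where "F x = e2 (t * x) / (2 * pi * \<i> * t)" for x :: real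
  have "has_bochner_integral lborel (\<lambda>x. indicator {\<alpha>..\<beta>} x *\<^sub>R e2 (t * x)) (F \<beta> - F \<alpha>)"
  proof (rule has_bochner_integral_FTC_Icc[OF assms(1)])
    show "(F has_vector_derivative e2 (t * x)) (at x within {\<alpha>..\<beta>})" for x
      unfolding F_def
      using has_vector_derivative_divide[OF has_vector_derivative_e2[of t x "{\<alpha>..\<beta>}"], of "2 * pi * \<i> * t"] assms(2)
      by simp
    show "continuous_on {\<alpha>..\<beta>} (\<lambda>x. e2 (t * x))" by (intro continuous_intros)
  qed
  then have "(LINT x|lborel. indicator {\<alpha>..\<beta>} x *\<^sub>R e2 (t * x)) = F \<beta> - F \<alpha>"
    by (rule has_bochner_integral_integral_eq)
  also have "cmod \<dots> \<le> cmod (F \<beta>) + cmod (F \<alpha>)" by (rule norm_triangle_ineq4)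
  also have "\<dots> = 1 / (pi * \<bar>t\<bar>)" by (simp add: F_def norm_mult norm_divide)
  also have "\<dots> \<le> 1 / (1 * \<bar>t\<bar>)" using assms(2) pi_gt3 by (intro divide_left_mono mult_right_mono) auto
  finally show ?thesis by simp
qed

text \<open>Each averaging over a short interval multiplies the transform by one more factor of
  order \<open>1 / \<bar>t\<bar>\<close>. Decay of a prescribed polynomial order thus takes finitely
  many averagings of an indicator.\<close>

lemma smooth_cutoff:
  assumes "\<alpha> \<le> \<beta>" "0 < g"
  shows "\<exists>v :: real \<Rightarrow> real. \<exists>C. v \<in> borel_measurable borel \<and> (\<forall>x. 0 \<le> v x \<and> v x \<le> 1) \<and>
    (\<forall>x. x \<in> {\<alpha>..\<beta>} \<longrightarrow> v x = 1) \<and> (\<forall>x. x \<notin> {\<alpha> - g..\<beta> + g} \<longrightarrow> v x = 0) \<and> 0 < C \<and>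
    (\<forall>t. t \<noteq> 0 \<longrightarrow> cmod (LINT x|lborel. complex_of_real (v x) * e2 (t * x)) \<le> C / \<bar>t\<bar> ^ Suc n)"
  using assms
proof (induction n arbitrary: \<alpha> \<beta> g)
  case 0
  have eq: "complex_of_real (indicator {\<alpha>..\<beta>} x) * e2 (t * x) = indicator {\<alpha>..\<beta>} x *\<^sub>R e2 (t * x)" for t x
    by (simp add: scaleR_conv_of_real)
  show ?case
  proof (rule exI[of _ "indicator {\<alpha>..\<beta>}"], rule exI[of _ 1], intro conjI allI impI)
    show "(indicator {\<alpha>..\<beta>} :: real \<Rightarrow> real) \<in> borel_measurable borel" by simp
    show "0 \<le> (indicator {\<alpha>..\<beta>} x :: real)" "(indicator {\<alpha>..\<beta>} x :: real) \<le> 1" for x by simp_all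
    show "(indicator {\<alpha>..\<beta>} x :: real) = 1" if "x \<in> {\<alpha>..\<beta>}" for x using that by simp
    show "(indicator {\<alpha>..\<beta>} x :: real) = 0" if "x \<notin> {\<alpha> - g..\<beta> + g}" for x
      using that 0(2) by (auto simp: indicator_def)
    show "(0::real) < 1" by simp
    show "cmod (LINT x|lborel. complex_of_real (indicator {\<alpha>..\<beta>} x) * e2 (t * x)) \<le> 1 / \<bar>t\<bar> ^ Suc 0" if "t \<noteq> 0" for t
      unfolding eq using integral_e2_bound[OF 0(1) that] by simp
  qed
next
  case (Suc n)
  \<comment> \<open>One third of the margin widens the plateau, one third is the margin of
    \<open>v\<close>, and one third is lost to the averaging.\<close>
  define \<eta> where "\<eta> = g / 3"
  have \<eta>: "0 < \<eta>" "g = 3 * \<eta>" using Suc.prems by (simp_all add: \<eta>_def)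
  obtain v :: "real \<Rightarrow> real" and C where vm [measurable]: "v \<in> borel_measurable borel" and v: "\<And>x. 0 \<le> v x \<and> v x \<le> 1"
      "\<And>x. x \<in> {\<alpha> - \<eta>..\<beta> + \<eta>} \<Longrightarrow> v x = 1" "\<And>x. x \<notin> {\<alpha> - 2 * \<eta>..\<beta> + 2 * \<eta>} \<Longrightarrow> v x = 0"
    and C: "0 < C" "\<And>t. t \<noteq> 0 \<Longrightarrow> cmod (LINT x|lborel. complex_of_real (v x) * e2 (t * x)) \<le> C / \<bar>t\<bar> ^ Suc n"
  proof -
    have "\<alpha> - \<eta> \<le> \<beta> + \<eta>" using Suc.prems(1) \<eta>(1) by simp
    from Suc.IH[OF this \<eta>(1)] obtain v :: "real \<Rightarrow> real" and C where
      "v \<in> borel_measurable borel" "\<forall>x. 0 \<le> v x \<and> v x \<le> 1" "\<forall>x. x \<in> {\<alpha> - \<eta>..\<beta> + \<eta>} \<longrightarrow> v x = 1"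
      "\<forall>x. x \<notin> {\<alpha> - \<eta> - \<eta>..\<beta> + \<eta> + \<eta>} \<longrightarrow> v x = 0" "0 < C"
      "\<forall>t. t \<noteq> 0 \<longrightarrow> cmod (LINT x|lborel. complex_of_real (v x) * e2 (t * x)) \<le> C / \<bar>t\<bar> ^ Suc n" by blast
    then show ?thesis by (intro that[of v C]) auto
  qed
  define u where "u x = (LINT y|lborel. indicator {-\<eta>..\<eta>} y * v (x + y)) / (2 * \<eta>)" for x
  have inn: "integrable lborel (\<lambda>y. indicator {-\<eta>..\<eta>} y * v (x + y))" for x
  proof (rule Bochner_Integration.integrable_bound)
    show "integrable lborel (indicator {-\<eta>..\<eta>} :: real \<Rightarrow> real)"
      by (rule integrable_real_indicator) (simp_all add: emeasure_lborel_Icc_eq)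
    show "AE y in lborel. norm (indicator {-\<eta>..\<eta>} y * v (x + y)) \<le> norm (indicator {-\<eta>..\<eta>} y :: real)"
      using v(1) by (intro AE_I2) (auto simp: indicator_def)
  qed measurable
  have len: "(LINT y|lborel. indicator {-\<eta>..\<eta>} y) = 2 * \<eta>" using \<eta> by simp
  have um [measurable]: "u \<in> borel_measurable borel"
    unfolding u_def by measurable
  have u01: "0 \<le> u x \<and> u x \<le> 1" for x
  proof -
    have "(LINT y|lborel. indicator {-\<eta>..\<eta>} y * v (x + y)) \<le> (LINT y|lborel. indicator {-\<eta>..\<eta>} y)"
      using v(1) by (intro integral_mono inn integrable_real_indicator) (auto simp: emeasure_lborel_Icc_eq indicator_def)
    moreover have "0 \<le> (LINT y|lborel. indicator {-\<eta>..\<eta>} y * v (x + y))"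
      using v(1) by (intro Bochner_Integration.integral_nonneg) (auto simp: indicator_def)
    ultimately show ?thesis using \<eta>(1) unfolding len u_def by (simp add: field_simps)
  qed
  have u1: "u x = 1" if "x \<in> {\<alpha>..\<beta>}" for x
  proof -
    have "(LINT y|lborel. indicator {-\<eta>..\<eta>} y * v (x + y)) = (LINT y|lborel. indicator {-\<eta>..\<eta>} y)"
      using that by (intro Bochner_Integration.integral_cong) (auto simp: indicator_def intro!: v(2))
    then show ?thesis using \<eta>(1) unfolding u_def len by simp
  qed
  have u0: "u x = 0" if "x \<notin> {\<alpha> - g..\<beta> + g}" for x
  proof -
    have "(LINT y|lborel. indicator {-\<eta>..\<eta>} y * v (x + y)) = (LINT y|(lborel :: real measure). 0)"
      using that \<eta> by (intro Bochner_Integration.integral_cong) (auto simp: indicator_def intro!: v(3))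
    then show ?thesis by (simp add: u_def)
  qed
  have ft: "cmod (LINT x|lborel. complex_of_real (u x) * e2 (t * x)) \<le> (C / (2 * \<eta>)) / \<bar>t\<bar> ^ Suc (Suc n)" if t: "t \<noteq> 0" for t
  proof -
    define k where "k x y = indicator {-\<eta>..\<eta>} y *\<^sub>R (v (x + y) * e2 (t * x))" for x y
    have ik: "integrable (lborel \<Otimes>\<^sub>M lborel) (case_prod k)"
    proof (rule Bochner_Integration.integrable_bound)
      have fin: "emeasure (lborel \<Otimes>\<^sub>M lborel) ({\<alpha> - g..\<beta> + g} \<times> {-\<eta>..\<eta>}) < \<infinity>"
        by (subst lborel.emeasure_pair_measure_Times) (auto simp: emeasure_lborel_Icc_eq ennreal_mult_less_top)
      show "integrable (lborel \<Otimes>\<^sub>M lborel) (indicator ({\<alpha> - g..\<beta> + g} \<times> {-\<eta>..\<eta>}) :: real \<times> real \<Rightarrow> real)"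
        using fin by (intro integrable_real_indicator) auto
      show "case_prod k \<in> borel_measurable (lborel \<Otimes>\<^sub>M lborel)" unfolding k_def by measurable
      have "cmod (k x y) \<le> indicator ({\<alpha> - g..\<beta> + g} \<times> {-\<eta>..\<eta>}) (x, y)" for x y
      proof (cases "y \<in> {-\<eta>..\<eta>} \<and> x \<notin> {\<alpha> - g..\<beta> + g}")
        case True
        then have "v (x + y) = 0" using \<eta> by (intro v(3)) auto
        then show ?thesis by (simp add: k_def)
      next
        case False
        then show ?thesis using v(1)[of "x + y"] by (auto simp: k_def norm_mult indicator_def)
      qed
      then show "AE p in lborel \<Otimes>\<^sub>M lborel. norm (case_prod k p) \<le> norm (indicator ({\<alpha> - g..\<beta> + g} \<times> {-\<eta>..\<eta>}) p :: real)"
        by (intro AE_I2) (auto simp: split_beta)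
    qed
    have inner1: "(LINT y|lborel. k x y) = (2 * \<eta>) * (u x * e2 (t * x))" for x
    proof -
      have "(LINT y|lborel. k x y) = (LINT y|lborel. complex_of_real (indicator {-\<eta>..\<eta>} y * v (x + y)) * e2 (t * x))"
        by (simp add: k_def scaleR_conv_of_real mult.assoc)
      also have "\<dots> = complex_of_real (LINT y|lborel. indicator {-\<eta>..\<eta>} y * v (x + y)) * e2 (t * x)"
        by (subst integral_mult_left_zero) (simp only: integral_complex_of_real)
      also have "(LINT y|lborel. indicator {-\<eta>..\<eta>} y * v (x + y)) = 2 * \<eta> * u x" using \<eta>(1) by (simp add: u_def)
      finally show ?thesis by simp
    qed
    have inner2: "(LINT x|lborel. k x y) = indicator {-\<eta>..\<eta>} y *\<^sub>R e2 ((- t) * y) * (LINT x|lborel. complex_of_real (v x) * e2 (t * x))" for y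
    proof -
      have "(LINT x|lborel. complex_of_real (v x) * e2 (t * x)) = \<bar>1\<bar> *\<^sub>R (LINT x|lborel. v (y + 1 * x) * e2 (t * (y + 1 * x)))"
        by (rule lborel_integral_real_affine) simp
      also have "\<dots> = (LINT x|lborel. e2 (t * y) * (v (x + y) * e2 (t * x)))"
        by (simp add: distrib_left e2_add mult_ac add.commute)
      finally have "(LINT x|lborel. complex_of_real (v x) * e2 (t * x)) = e2 (t * y) * (LINT x|lborel. v (x + y) * e2 (t * x))" by simp
      moreover have "e2 ((- t) * y) * e2 (t * y) = 1" unfolding e2_add[symmetric] by simp
      ultimately have "e2 ((- t) * y) * (LINT x|lborel. complex_of_real (v x) * e2 (t * x)) = (LINT x|lborel. v (x + y) * e2 (t * x))"
        by (simp only: mult.assoc[symmetric] mult_1_left)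
      then show ?thesis by (simp add: k_def)
    qed
    have "(2 * \<eta>) * (LINT x|lborel. u x * e2 (t * x)) = (LINT x|lborel. LINT y|lborel. k x y)"
      by (simp add: inner1)
    also have "\<dots> = (LINT y|lborel. LINT x|lborel. k x y)"
      by (rule lborel_pair.Fubini_integral[OF ik, symmetric])
    also have "\<dots> = (LINT y|lborel. indicator {-\<eta>..\<eta>} y *\<^sub>R e2 ((- t) * y)) * (LINT x|lborel. complex_of_real (v x) * e2 (t * x))"
      unfolding inner2 by (rule integral_mult_left_zero)
    finally have "cmod ((2 * \<eta>) * (LINT x|lborel. u x * e2 (t * x)))
        = cmod (LINT y|lborel. indicator {-\<eta>..\<eta>} y *\<^sub>R e2 ((- t) * y)) * cmod (LINT x|lborel. complex_of_real (v x) * e2 (t * x))"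
      by (simp only: norm_mult)
    also have "\<dots> \<le> (1 / \<bar>- t\<bar>) * (C / \<bar>t\<bar> ^ Suc n)"
      using t \<eta>(1) by (intro mult_mono integral_e2_bound C(2)) auto
    finally have "(2 * \<eta>) * cmod (LINT x|lborel. complex_of_real (u x) * e2 (t * x)) \<le> C / \<bar>t\<bar> ^ Suc (Suc n)"
      using \<eta>(1) by (simp add: norm_mult)
    then have "(2 * \<eta>) * cmod (LINT x|lborel. complex_of_real (u x) * e2 (t * x)) / (2 * \<eta>) \<le> C / \<bar>t\<bar> ^ Suc (Suc n) / (2 * \<eta>)"
      using \<eta>(1) by (intro divide_right_mono) auto
    moreover have "C / \<bar>t\<bar> ^ Suc (Suc n) / (2 * \<eta>) = C / (2 * \<eta>) / \<bar>t\<bar> ^ Suc (Suc n)"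
      by (simp only: divide_divide_eq_left mult.commute)
    ultimately show ?thesis using \<eta>(1) by (simp add: mult_ac)
  qed
  show ?case
    using um u01 u1 u0 ft C(1) \<eta>(1) by (intro exI[of _ u] exI[of _ "C / (2 * \<eta>)"]) auto
qed

lemma sum_inverse_squares_bound: "(\<Sum>l=1..n. 1 / (real l)\<^sup>2) \<le> 2"
proof (cases n)
  case (Suc m)
  \<comment> \<open>The subtracted term makes the induction telescope.\<close>
  have "(\<Sum>l=1..Suc m. 1 / (real l)\<^sup>2) \<le> 2 - 1 / real (Suc m)"
  proof (induction m)
    case (Suc m)
    have "1 / (x + 1)\<^sup>2 \<le> 1 / x - 1 / (x + 1)" if "0 < x" for x :: real
    proof -
      have "1 / x - 1 / (x + 1) = 1 / (x * (x + 1))" using that by (simp add: field_simps)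
      also have "\<dots> \<ge> 1 / ((x + 1) * (x + 1))" using that by (intro divide_left_mono mult_right_mono) auto
      finally show ?thesis by (simp add: power2_eq_square)
    qed
    from this[of "real (Suc m)"] have "1 / (real (Suc (Suc m)))\<^sup>2 \<le> 1 / real (Suc m) - 1 / real (Suc (Suc m))"
      by (simp add: add.commute)
    then show ?case using Suc by simp
  qed simp
  moreover have "0 \<le> 1 / real (Suc m)" by simp
  ultimately show ?thesis unfolding Suc by linarith
qed simp

section \<open>Exponentials cut off by a window function\<close>

lemma cinner_abs_L2: "square_integrable f \<Longrightarrow> square_integrable g \<Longrightarrow> cinner (abs_L2 f) (abs_L2 g) = (LINT x|lborel. f x * cnj (g x))"
  by (rule cinner.abs_eq) auto

lemma fourier_abs_L2: "square_integrable f \<Longrightarrow> fourier (abs_L2 f) \<omega> = (LINT x|lborel. f x * e2 (- (\<omega> * x)))"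
proof -
  assume "square_integrable f"
  then have "fourier (abs_L2 f) = (\<lambda>\<omega>. LINT x|lborel. f x * e2 (- (\<omega> * x)))" by (intro fourier.abs_eq) auto
  then show ?thesis by simp
qed

lemma supp_in_abs_L2: "square_integrable f \<Longrightarrow> supp_in (abs_L2 f) S \<longleftrightarrow> (AE x in lborel. x \<notin> S \<longrightarrow> f x = 0)"
  using supp_in.abs_eq[of f] by auto

text \<open>The inner product of \<open>f\<close> with this vector is the transform of the product
  \<open>v f\<close> at \<open>\<omega>\<close>, and so that of \<open>f\<close> itself if
  \<open>v\<close> is 1 on its support.\<close>

definition windowed_exp :: "(real \<Rightarrow> real) \<Rightarrow> real \<Rightarrow> L2" where
  "windowed_exp v \<omega> = abs_L2 (\<lambda>x. complex_of_real (v x) * e2 (\<omega> * x))"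

context
  fixes v :: "real \<Rightarrow> real" and \<alpha> \<beta> :: real
  assumes vm [measurable]: "v \<in> borel_measurable borel" and v01: "\<And>x. 0 \<le> v x \<and> v x \<le> 1"
    and v0': "\<forall>x. x \<notin> {\<alpha>..\<beta>} \<longrightarrow> v x = 0"
begin


lemma square_integrable_windowed: "square_integrable (\<lambda>x. complex_of_real (v x) * e2 (\<omega> * x))"
proof -
  have "square_integrable (\<lambda>x. complex_of_real (v x) * e2 (\<omega> * x) * indicator {\<alpha>..\<beta>} x)"
    using v01 by (intro square_integrable_bounded_interval[where B = 1]) (auto simp: norm_mult)
  moreover have "complex_of_real (v x) * e2 (\<omega> * x) * indicator {\<alpha>..\<beta>} x = complex_of_real (v x) * e2 (\<omega> * x)" for x
    using v0'[rule_format, of x] by (auto simp: indicator_def)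
  ultimately show ?thesis by simp
qed

lemma supp_in_windowed: "supp_in (windowed_exp v \<omega>) {\<alpha>..\<beta>}"
  unfolding windowed_exp_def supp_in_abs_L2[OF square_integrable_windowed] using v0' by simp

lemma fourier_windowed: "fourier (windowed_exp v \<omega>) \<xi> = (LINT x|lborel. complex_of_real (v x) * e2 ((\<omega> - \<xi>) * x))"
  unfolding windowed_exp_def fourier_abs_L2[OF square_integrable_windowed]
proof (rule Bochner_Integration.integral_cong[OF refl])
  fix x
  have "(\<omega> - \<xi>) * x = \<omega> * x + - (\<xi> * x)" by (simp add: algebra_simps)
  then have "e2 ((\<omega> - \<xi>) * x) = e2 (\<omega> * x) * e2 (- (\<xi> * x))" by (simp only: e2_add)
  then show "complex_of_real (v x) * e2 (\<omega> * x) * e2 (- (\<xi> * x)) = complex_of_real (v x) * e2 ((\<omega> - \<xi>) * x)" by simp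
qed

lemma cinner_windowed_eq_fourier:
  assumes "supp_in f S" "\<And>x. x \<in> S \<Longrightarrow> v x = 1"
  shows "cinner f (windowed_exp v \<omega>) = fourier f \<omega>"
  using assms(1)
proof (induction f rule: L2.abs_induct)
  case (1 g)
  then have g: "square_integrable g" by simp
  have ae: "AE x in lborel. x \<notin> S \<longrightarrow> g x = 0" using 1 supp_in_abs_L2[OF g] by simp
  have [measurable]: "g \<in> borel_measurable borel" using g by (auto dest: square_integrable_measurable)
  show ?case
    unfolding windowed_exp_def cinner_abs_L2[OF g square_integrable_windowed] fourier_abs_L2[OF g]
  proof (rule integral_cong_AE)
    show "AE x in lborel. g x * cnj (complex_of_real (v x) * e2 (\<omega> * x)) = g x * e2 (- (\<omega> * x))"
      using ae by eventually_elim (use assms(2) in \<open>auto simp: cnj_e2\<close>)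
  qed auto
qed

text \<open>The witness is the product of \<open>v\<close> and \<open>p\<close>: cutting off shrinks
  the norm and localises the support.\<close>

lemma windowed_multiplication:
  obtains y where "norm y \<le> norm p" "supp_in y {\<alpha>..\<beta>}" "\<And>\<omega>. cinner p (windowed_exp v \<omega>) = fourier y \<omega>"
proof -
  have "\<exists>y. norm y \<le> norm p \<and> supp_in y {\<alpha>..\<beta>} \<and> (\<forall>\<omega>. cinner p (windowed_exp v \<omega>) = fourier y \<omega>)"
  proof (induction p rule: L2.abs_induct)
    case (1 g)
    then have g: "square_integrable g" by simp
    have gm [measurable]: "g \<in> borel_measurable borel" using g by (auto dest: square_integrable_measurable)
    have g2: "integrable lborel (\<lambda>x. (cmod (g x))\<^sup>2)" using g by (simp add: square_integrable_def)
    have le: "(cmod (v x * g x))\<^sup>2 \<le> (cmod (g x))\<^sup>2" for x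
      using v01[of x] by (intro power_mono) (auto simp: norm_mult mult_left_le_one_le)
    have vi: "integrable lborel (\<lambda>x. (cmod (complex_of_real (v x) * g x))\<^sup>2)"
      using le by (intro Bochner_Integration.integrable_bound[OF g2]) auto
    have vg: "square_integrable (\<lambda>x. complex_of_real (v x) * g x)"
      using vi by (simp add: square_integrable_def)
    have "(LINT x|lborel. (cmod (complex_of_real (v x) * g x))\<^sup>2) \<le> (LINT x|lborel. (cmod (g x))\<^sup>2)"
      using le by (intro integral_mono vi g2)
    then have "norm (abs_L2 (\<lambda>x. complex_of_real (v x) * g x)) \<le> norm (abs_L2 g)"
      unfolding norm_abs_L2[OF g] norm_abs_L2[OF vg] by (rule real_sqrt_le_mono)
    moreover have "supp_in (abs_L2 (\<lambda>x. complex_of_real (v x) * g x)) {\<alpha>..\<beta>}"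
      unfolding supp_in_abs_L2[OF vg] using v0' by simp
    moreover have "cinner (abs_L2 g) (windowed_exp v \<omega>) = fourier (abs_L2 (\<lambda>x. complex_of_real (v x) * g x)) \<omega>" for \<omega>
      unfolding windowed_exp_def cinner_abs_L2[OF g square_integrable_windowed] fourier_abs_L2[OF vg]
      by (intro Bochner_Integration.integral_cong) (simp_all add: cnj_e2 mult_ac)
    ultimately show ?case by blast
  qed
  then show ?thesis using that by blast
qed

end

text \<open>All but two of the powers are estimated by \<open>R\<close>; the remaining inverse
  squares sum to at most 2 on either side of 0.\<close>

lemma sum_abs_ge_inverse_power_bound:
  fixes I :: "int set"
  assumes "finite I" "0 < R" "\<And>l. l \<in> I \<Longrightarrow> R \<le> \<bar>real_of_int l\<bar>"
  shows "(\<Sum>l\<in>I. 1 / \<bar>real_of_int l\<bar> ^ (2 * n + 2)) \<le> 4 / R ^ (2 * n)"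
proof -
  obtain m where m: "\<And>l. l \<in> I \<Longrightarrow> \<bar>l\<bar> \<le> int m"
  proof -
    have "finite ((\<lambda>l. nat \<bar>l\<bar>) ` I)" using assms(1) by simp
    then obtain m where "\<forall>x\<in>(\<lambda>l. nat \<bar>l\<bar>) ` I. x \<le> m" using finite_nat_set_iff_bounded_le by blast
    then show ?thesis using that[of m] by force
  qed
  have pt: "1 / \<bar>real_of_int l\<bar> ^ (2 * n + 2) \<le> 1 / R ^ (2 * n) * (1 / (real_of_int l)\<^sup>2)" if "l \<in> I" for l
  proof -
    have l: "R \<le> \<bar>real_of_int l\<bar>" by (rule assms(3)[OF that])
    then have "l \<noteq> 0" using assms(2) by auto
    have "1 / \<bar>real_of_int l\<bar> ^ (2 * n) \<le> 1 / R ^ (2 * n)"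
      using l assms(2) by (intro divide_left_mono power_mono mult_pos_pos zero_less_power) auto
    then have "1 / \<bar>real_of_int l\<bar> ^ (2 * n) * (1 / (real_of_int l)\<^sup>2) \<le> 1 / R ^ (2 * n) * (1 / (real_of_int l)\<^sup>2)"
      by (rule mult_right_mono) simp
    moreover have eq: "\<bar>real_of_int l\<bar> ^ (2 * n + 2) = \<bar>real_of_int l\<bar> ^ (2 * n) * (real_of_int l)\<^sup>2"
      by (simp only: power_add power2_abs)
    ultimately show ?thesis unfolding eq by simp
  qed
  have first: "(\<Sum>l\<in>I. 1 / \<bar>real_of_int l\<bar> ^ (2 * n + 2)) \<le> 1 / R ^ (2 * n) * (\<Sum>l\<in>I. 1 / (real_of_int l)\<^sup>2)"
    unfolding sum_distrib_left using pt by (rule sum_mono)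
  have "(\<Sum>l\<in>I. 1 / (real_of_int l)\<^sup>2) \<le> (\<Sum>l\<in>(\<lambda>n. int n) ` {1..m} \<union> (\<lambda>n. - int n) ` {1..m}. 1 / (real_of_int l)\<^sup>2)"
  proof (rule sum_mono2)
    show "I \<subseteq> (\<lambda>n. int n) ` {1..m} \<union> (\<lambda>n. - int n) ` {1..m}"
    proof
      fix l assume l: "l \<in> I"
      then have "l \<noteq> 0" using assms(2) assms(3)[OF l] by auto
      show "l \<in> (\<lambda>n. int n) ` {1..m} \<union> (\<lambda>n. - int n) ` {1..m}"
      proof (cases "l > 0")
        case True
        then have "l = int (nat l)" "nat l \<in> {1..m}" using m[OF l] by auto
        then show ?thesis by blast
      next
        case False
        then have "l = - int (nat (- l))" "nat (- l) \<in> {1..m}" using m[OF l] \<open>l \<noteq> 0\<close> by auto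
        then show ?thesis by blast
      qed
    qed
  qed auto
  also have "\<dots> \<le> (\<Sum>l\<in>(\<lambda>n. int n) ` {1..m}. 1 / (real_of_int l)\<^sup>2) + (\<Sum>l\<in>(\<lambda>n. - int n) ` {1..m}. 1 / (real_of_int l)\<^sup>2)"
    by (subst sum.union_disjoint) auto
  also have "\<dots> = (\<Sum>l=1..m. 1 / (real l)\<^sup>2) + (\<Sum>l=1..m. 1 / (real l)\<^sup>2)"
    by (subst (1 2) sum.reindex) (auto simp: inj_on_def)
  also have "\<dots> \<le> 4" using sum_inverse_squares_bound[of m] by simp
  finally have "1 / R ^ (2 * n) * (\<Sum>l\<in>I. 1 / (real_of_int l)\<^sup>2) \<le> 1 / R ^ (2 * n) * 4"
    using assms(2) by (intro mult_left_mono) auto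
  then show ?thesis using first by (simp only: times_divide_eq_left mult_1)
qed

text \<open>Passing from the lattice \<open>\<epsilon>\<close> to the lattice \<open>1 / B\<close>: since \<open>f = v f\<close> for a smooth cutoff \<open>v\<close> that
  vanishes outside one period, \<open>v\<close> times the projection of \<open>f\<close> onto the low frequencies of the first lattice
  loses only a rapidly decaying part of the low frequencies on the second one.\<close>

lemma change_of_lattice:
  assumes eps: "0 < \<epsilon>" and ab: "\<alpha> \<le> \<beta>" "\<epsilon> * (\<beta> - \<alpha>) < 1" and K: "0 \<le> K0" "K0 < K1"
  obtains D B0 where "0 \<le> D"
    "\<And>J M f B. B0 \<le> real B \<Longrightarrow> (\<And>l. l \<notin> sample_index M \<Longrightarrow> K1 * 2 ^ J \<le> \<epsilon> * \<bar>real_of_int l\<bar>) \<Longrightarrow> supp_in f {\<alpha>..\<beta>} \<Longrightarrow> norm f = 1 \<Longrightarrow>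
       sqrt (\<Sum>l\<in>{l::int. \<bar>of_int l / real B\<bar> \<le> K0 * 2 ^ J}. (cmod (fourier f (of_int l / real B)))\<^sup>2 / real B)
       \<le> sqrt (\<Sum>l\<in>sample_index M. \<epsilon> * (cmod (fourier f (\<epsilon> * of_int l)))\<^sup>2) + D / 2 ^ (n * J)"
proof -
  \<comment> \<open>The choice makes \<open>[\<alpha> - g, \<beta> + g]\<close> exactly one period
    of the exponentials on the lattice \<open>\<epsilon>\<close>.\<close>
  define g where "g = (1 / \<epsilon> - (\<beta> - \<alpha>)) / 2"
  have g: "0 < g" "1 / \<epsilon> = \<beta> - \<alpha> + 2 * g" using ab(2) eps by (simp_all add: g_def field_simps)
  \<comment> \<open>One order of decay more than claimed, because the number of lattice points to be
    summed grows like \<open>2 ^ J\<close>.\<close>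
  define q where "q = n + 1"
  from smooth_cutoff[OF ab(1) g(1), of q]
  obtain v :: "real \<Rightarrow> real" and C where vm: "v \<in> borel_measurable borel" and v01': "\<forall>x. 0 \<le> v x \<and> v x \<le> 1"
      and v1': "\<forall>x. x \<in> {\<alpha>..\<beta>} \<longrightarrow> v x = 1" and v0': "\<forall>x. x \<notin> {\<alpha> - g..\<beta> + g} \<longrightarrow> v x = 0" and C0: "0 < C"
      and C': "\<forall>t. t \<noteq> 0 \<longrightarrow> cmod (LINT x|lborel. complex_of_real (v x) * e2 (t * x)) \<le> C / \<bar>t\<bar> ^ Suc q" by blast
  note v01 = v01'[rule_format] and v1 = v1'[rule_format] and v0 = v0'[rule_format] and C = C0 C'[rule_format]
  define s where "s = fourier_atom (g - \<alpha>) (\<beta> + g) \<epsilon>"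
  have per: "\<epsilon> * (g - \<alpha> + (\<beta> + g)) = 1" using g(2) eps by (simp add: field_simps)
  have "0 < \<epsilon> * (g - \<alpha> + (\<beta> + g))" using per by simp
  then have Tp: "0 < g - \<alpha> + (\<beta> + g)" using eps by (simp add: zero_less_mult_iff)
  have win: "{- (g - \<alpha>) / (\<epsilon> * (g - \<alpha> + (\<beta> + g)))..(\<beta> + g) / (\<epsilon> * (g - \<alpha> + (\<beta> + g)))} = {\<alpha> - g..\<beta> + g}"
    unfolding per by simp
  note on = fourier_atom_orthonormal[OF eps Tp, folded s_def]
  have coeff: "cinner f (s l) = sqrt \<epsilon> * fourier f (\<epsilon> * of_int l)" if "supp_in f {\<alpha> - g..\<beta> + g}" for f l
    unfolding s_def by (rule cinner_fourier_atom) (unfold win, rule that)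
  note par = parseval_tendsto[OF eps Tp, unfolded win, folded s_def]
  \<comment> \<open>A frequency up to \<open>K0 * 2 ^ J\<close> and a sampling point beyond
    \<open>K1 * 2 ^ J\<close> are at least \<open>\<kappa>\<close> times the modulus of the latter
    apart.\<close>
  define \<kappa> where "\<kappa> = 1 - K0 / K1"
  have \<kappa>: "0 < \<kappa>" using K by (simp add: \<kappa>_def)
  define D0 where "D0 = 4 * \<epsilon> * C\<^sup>2 / ((\<kappa> * \<epsilon>) ^ (2 * q + 2) * (K1 / \<epsilon>) ^ (2 * q))"
  have D0: "0 \<le> D0" using eps K \<kappa> C(1) unfolding D0_def by (intro divide_nonneg_nonneg mult_nonneg_nonneg zero_le_power) auto
  \<comment> \<open>Large enough for \<open>[\<alpha> - g, \<beta> + g]\<close> to fit into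
    \<open>[- B / 2, B / 2]\<close>, one period for the lattice \<open>1 / B\<close>.\<close>
  define B0 where "B0 = 2 * (\<bar>\<alpha>\<bar> + \<bar>\<beta>\<bar> + g) + 1"
  define D where "D = sqrt (D0 * (2 * K0 + 1))"
  have "0 \<le> D" using D0 K by (simp add: D_def)
  moreover have "sqrt (\<Sum>l\<in>{l::int. \<bar>of_int l / real B\<bar> \<le> K0 * 2 ^ J}. (cmod (fourier f (of_int l / real B)))\<^sup>2 / real B)
       \<le> sqrt (\<Sum>l\<in>sample_index M. \<epsilon> * (cmod (fourier f (\<epsilon> * of_int l)))\<^sup>2) + D / 2 ^ (n * J)"
    if B: "B0 \<le> real B" and far: "\<And>l. l \<notin> sample_index M \<Longrightarrow> K1 * 2 ^ J \<le> \<epsilon> * \<bar>real_of_int l\<bar>"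
      and f: "supp_in f {\<alpha>..\<beta>}" "norm f = 1" for J M f B
  proof -
    let ?u = "windowed_exp v"
    have Bp: "0 < real B" "1 \<le> real B" using B g(1) by (auto simp: B0_def)
    define \<Lambda> where "\<Lambda> = {l::int. \<bar>of_int l / real B\<bar> \<le> K0 * 2 ^ J}"
    have \<Lambda>sub: "\<Lambda> \<subseteq> {- \<lfloor>K0 * 2 ^ J * real B\<rfloor>..\<lfloor>K0 * 2 ^ J * real B\<rfloor>}"
    proof
      fix l assume "l \<in> \<Lambda>"
      then have "\<bar>real_of_int l\<bar> \<le> K0 * 2 ^ J * real B" using Bp by (simp add: \<Lambda>_def field_simps)
      then have "of_int l \<le> K0 * 2 ^ J * real B" "of_int (- l) \<le> K0 * 2 ^ J * real B" by (auto simp: abs_le_iff)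
      then have "l \<le> \<lfloor>K0 * 2 ^ J * real B\<rfloor>" "- l \<le> \<lfloor>K0 * 2 ^ J * real B\<rfloor>" by (simp_all only: le_floor_iff)
      then show "l \<in> {- \<lfloor>K0 * 2 ^ J * real B\<rfloor>..\<lfloor>K0 * 2 ^ J * real B\<rfloor>}" by auto
    qed
    then have fin: "finite \<Lambda>" by (rule finite_subset) simp
    have card: "real (card \<Lambda>) / real B \<le> (2 * K0 + 1) * 2 ^ J"
    proof -
      have nn: "0 \<le> K0 * 2 ^ J * real B" using K by simp
      have "card \<Lambda> \<le> nat (2 * \<lfloor>K0 * 2 ^ J * real B\<rfloor> + 1)" using card_mono[OF _ \<Lambda>sub] by simp
      then have "int (card \<Lambda>) \<le> 2 * \<lfloor>K0 * 2 ^ J * real B\<rfloor> + 1" using nn by (simp add: le_nat_iff)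
      then have "real (card \<Lambda>) \<le> 2 * (K0 * 2 ^ J * real B) + 1" by linarith
      also have "\<dots> \<le> 2 * (K0 * 2 ^ J * real B) + 1 * (2 ^ J * real B)"
        using Bp mult_mono[of 1 "2 ^ J" 1 "real B"] by simp
      also have "\<dots> = (2 * K0 + 1) * 2 ^ J * real B" by (simp add: algebra_simps)
      finally show ?thesis using Bp by (simp add: pos_divide_le_eq)
    qed
    have fs: "supp_in f {\<alpha> - g..\<beta> + g}" by (rule supp_in_mono[OF f(1)]) (use g in auto)
    \<comment> \<open>\<open>p\<close> is what the samples see of \<open>f\<close>. In general it
      fills the whole period; multiplied by \<open>v\<close> it becomes \<open>y\<close>, to which
      Bessel's inequality on the lattice \<open>1 / B\<close> applies.\<close>
    define p where "p = onp s (sample_index M) f"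
    have np: "(norm p)\<^sup>2 = (\<Sum>l\<in>sample_index M. \<epsilon> * (cmod (fourier f (\<epsilon> * of_int l)))\<^sup>2)"
      unfolding p_def norm_onp[OF on finite_sample_index] coeff[OF fs]
      using eps by (simp add: norm_mult power_mult_distrib)
    obtain y where y: "norm y \<le> norm p" "supp_in y {\<alpha> - g..\<beta> + g}" "\<And>\<omega>. cinner p (?u \<omega>) = fourier y \<omega>"
      using windowed_multiplication[OF vm v01 v0'] by blast
    let ?s' = "fourier_atom (real B / 2) (real B / 2) (1 / real B)"
    have bessel_y: "(\<Sum>l\<in>\<Lambda>. (cmod (fourier y (of_int l / real B)))\<^sup>2 / real B) \<le> (norm p)\<^sup>2"
    proof -
      have sB: "supp_in y {- (real B / 2) / (1 / real B * (real B / 2 + real B / 2))..(real B / 2) / (1 / real B * (real B / 2 + real B / 2))}"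
        by (rule supp_in_mono[OF y(2)]) (use B Bp g in \<open>auto simp: B0_def\<close>)
      have on': "orthonormal_on ?s' A" for A using Bp by (intro fourier_atom_orthonormal) auto
      have "(\<Sum>l\<in>\<Lambda>. (cmod (fourier y (of_int l / real B)))\<^sup>2 / real B) = (\<Sum>l\<in>\<Lambda>. (cmod (cinner y (?s' l)))\<^sup>2)"
        unfolding cinner_fourier_atom[OF sB] using Bp by (simp add: norm_mult power_mult_distrib)
      also have "\<dots> \<le> (norm y)\<^sup>2" by (rule bessel[OF on' fin])
      also have "\<dots> \<le> (norm p)\<^sup>2" using y(1) by (intro power_mono) auto
      finally show ?thesis .
    qed
    \<comment> \<open>\<open>f - p\<close> is orthogonal to the sampled exponentials, so only the
      components of the windowed exponential outside \<open>sample_index M\<close> count, and these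
      decay by the choice of \<open>v\<close>.\<close>
    have rest: "(cmod (cinner (f - p) (?u \<omega>)))\<^sup>2 \<le> D0 / 2 ^ (2 * q * J)" if \<omega>: "\<bar>\<omega>\<bar> \<le> K0 * 2 ^ J" for \<omega>
    proof -
      let ?r = "?u \<omega> - onp s (sample_index M) (?u \<omega>)"
      have us: "supp_in (?u \<omega>) {\<alpha> - g..\<beta> + g}" by (rule supp_in_windowed[OF vm v01 v0'])
      have uc: "(cmod (cinner (?u \<omega>) (s l)))\<^sup>2 \<le> \<epsilon> * C\<^sup>2 / (\<kappa> * \<epsilon>) ^ (2 * q + 2) * (1 / \<bar>real_of_int l\<bar> ^ (2 * q + 2))"
        if l: "l \<notin> sample_index M" for l
      proof -
        have fl: "K1 * 2 ^ J \<le> \<epsilon> * \<bar>real_of_int l\<bar>" by (rule far[OF l])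
        have "K0 * 2 ^ J = K0 / K1 * (K1 * 2 ^ J)" using K by simp
        also have "\<dots> \<le> K0 / K1 * (\<epsilon> * \<bar>real_of_int l\<bar>)" using fl K by (intro mult_left_mono) auto
        finally have "\<bar>\<omega>\<bar> \<le> K0 / K1 * (\<epsilon> * \<bar>real_of_int l\<bar>)" using \<omega> by linarith
        moreover have "\<bar>\<epsilon> * of_int l\<bar> = \<epsilon> * \<bar>real_of_int l\<bar>" using eps by (simp add: abs_mult)
        ultimately have t: "\<kappa> * \<epsilon> * \<bar>real_of_int l\<bar> \<le> \<bar>\<omega> - \<epsilon> * of_int l\<bar>"
          unfolding \<kappa>_def by (simp add: algebra_simps)
        have "0 < K1 * 2 ^ J" using K by simp
        then have "0 < \<epsilon> * \<bar>real_of_int l\<bar>" using fl by linarith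
        then have lp: "0 < \<kappa> * \<epsilon> * \<bar>real_of_int l\<bar>" using \<kappa> by (simp add: mult.assoc)
        have "cmod (fourier (?u \<omega>) (\<epsilon> * of_int l)) \<le> C / \<bar>\<omega> - \<epsilon> * of_int l\<bar> ^ Suc q"
          unfolding fourier_windowed[OF vm v01 v0'] using t lp by (intro C(2)) auto
        also have "\<dots> \<le> C / (\<kappa> * \<epsilon> * \<bar>real_of_int l\<bar>) ^ Suc q"
          using C(1) t lp by (intro divide_left_mono power_mono mult_pos_pos[OF zero_less_power zero_less_power]) linarith+
        finally have "(cmod (fourier (?u \<omega>) (\<epsilon> * of_int l)))\<^sup>2 \<le> (C / (\<kappa> * \<epsilon> * \<bar>real_of_int l\<bar>) ^ Suc q)\<^sup>2"
          by (rule power_mono) simp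
        also have "\<dots> = C\<^sup>2 / ((\<kappa> * \<epsilon>) ^ (2 * q + 2) * \<bar>real_of_int l\<bar> ^ (2 * q + 2))"
        proof -
          have "Suc q * 2 = 2 * q + 2" by simp
          then show ?thesis by (simp only: power_divide power_mult[symmetric] power_mult_distrib)
        qed
        finally have "\<epsilon> * (cmod (fourier (?u \<omega>) (\<epsilon> * of_int l)))\<^sup>2 \<le> \<epsilon> * (C\<^sup>2 / ((\<kappa> * \<epsilon>) ^ (2 * q + 2) * \<bar>real_of_int l\<bar> ^ (2 * q + 2)))"
          using eps by (intro mult_left_mono) auto
        moreover have "(cmod (cinner (?u \<omega>) (s l)))\<^sup>2 = \<epsilon> * (cmod (fourier (?u \<omega>) (\<epsilon> * of_int l)))\<^sup>2"
          unfolding coeff[OF us] using eps by (simp add: norm_mult power_mult_distrib)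
        ultimately show ?thesis using eps by (simp add: mult_ac)
      qed
      have tail: "(\<Sum>l\<in>sample_index M'. (cmod (cinner (?u \<omega>) (s l)))\<^sup>2) \<le> (\<Sum>l\<in>sample_index M. (cmod (cinner (?u \<omega>) (s l)))\<^sup>2) + D0 / 2 ^ (2 * q * J)" for M'
      proof -
        have "(\<Sum>l\<in>sample_index M'. (cmod (cinner (?u \<omega>) (s l)))\<^sup>2)
            \<le> (\<Sum>l\<in>sample_index M \<union> (sample_index M' - sample_index M). (cmod (cinner (?u \<omega>) (s l)))\<^sup>2)"
          by (rule sum_mono2) auto
        also have "\<dots> = (\<Sum>l\<in>sample_index M. (cmod (cinner (?u \<omega>) (s l)))\<^sup>2) + (\<Sum>l\<in>sample_index M' - sample_index M. (cmod (cinner (?u \<omega>) (s l)))\<^sup>2)"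
          by (rule sum.union_disjoint) auto
        also have "(\<Sum>l\<in>sample_index M' - sample_index M. (cmod (cinner (?u \<omega>) (s l)))\<^sup>2)
            \<le> (\<Sum>l\<in>sample_index M' - sample_index M. \<epsilon> * C\<^sup>2 / (\<kappa> * \<epsilon>) ^ (2 * q + 2) * (1 / \<bar>real_of_int l\<bar> ^ (2 * q + 2)))"
          using uc by (intro sum_mono) auto
        also have "\<dots> \<le> \<epsilon> * C\<^sup>2 / (\<kappa> * \<epsilon>) ^ (2 * q + 2) * (4 / (K1 * 2 ^ J / \<epsilon>) ^ (2 * q))"
          unfolding sum_distrib_left[symmetric]
        proof (rule mult_left_mono)
          show "(\<Sum>l\<in>sample_index M' - sample_index M. 1 / \<bar>real_of_int l\<bar> ^ (2 * q + 2)) \<le> 4 / (K1 * 2 ^ J / \<epsilon>) ^ (2 * q)"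
            using far eps K by (intro sum_abs_ge_inverse_power_bound) (auto simp: field_simps)
          show "0 \<le> \<epsilon> * C\<^sup>2 / (\<kappa> * \<epsilon>) ^ (2 * q + 2)" using eps \<kappa> by simp
        qed
        also have "\<dots> = D0 / 2 ^ (2 * q * J)"
        proof -
          have e1: "(K1 * 2 ^ J / \<epsilon>) ^ (2 * q) = (K1 / \<epsilon>) ^ (2 * q) * 2 ^ (2 * q * J)"
          proof -
            have "K1 * 2 ^ J / \<epsilon> = K1 / \<epsilon> * 2 ^ J" by simp
            then have "(K1 * 2 ^ J / \<epsilon>) ^ (2 * q) = (K1 / \<epsilon>) ^ (2 * q) * (2 ^ J) ^ (2 * q)" by (simp only: power_mult_distrib)
            moreover have "((2::real) ^ J) ^ (2 * q) = 2 ^ (2 * q * J)" by (simp only: power_mult[symmetric] mult.commute)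
            ultimately show ?thesis by simp
          qed
          show ?thesis unfolding D0_def e1 by (simp add: mult_ac)
        qed
        finally show ?thesis by simp
      qed
      have "(norm (?u \<omega>))\<^sup>2 \<le> (\<Sum>l\<in>sample_index M. (cmod (cinner (?u \<omega>) (s l)))\<^sup>2) + D0 / 2 ^ (2 * q * J)"
        using tail by (intro LIMSEQ_le_const2[OF par[OF us]]) blast
      then have r2: "(norm ?r)\<^sup>2 \<le> D0 / 2 ^ (2 * q * J)"
        using norm_split_onp[OF on finite_sample_index, of "?u \<omega>" M] by linarith
      have perp: "cinner (f - p) (onp s (sample_index M) (?u \<omega>)) = 0"
        unfolding p_def by (rule cinner_onp_residual[OF on finite_sample_index onp_in_span])
      have "cinner (f - p) (?u \<omega>) = cinner (f - p) ?r" using perp by (simp add: cinner_diff_right)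
      then have "cmod (cinner (f - p) (?u \<omega>)) \<le> norm (f - p) * norm ?r" by (simp only: cauchy_schwarz)
      also have "\<dots> \<le> 1 * norm ?r"
      proof (rule mult_right_mono)
        have "(norm (f - p))\<^sup>2 \<le> (norm f)\<^sup>2"
          using norm_split_onp[OF on finite_sample_index, of f M] unfolding p_def by (simp add: sum_nonneg)
        then show "norm (f - p) \<le> 1" using f(2) by (simp add: power2_le_imp_le abs_square_le_1)
      qed simp
      finally have "(cmod (cinner (f - p) (?u \<omega>)))\<^sup>2 \<le> (1 * norm ?r)\<^sup>2" by (rule power_mono) simp
      then show ?thesis unfolding mult_1 by (rule order_trans[OF _ r2])
    qed
    have split: "fourier f \<omega> = fourier y \<omega> + cinner (f - p) (?u \<omega>)" for \<omega>
    proof -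
      have "cinner f (?u \<omega>) = fourier f \<omega>" by (rule cinner_windowed_eq_fourier[OF vm v01 v0' f(1)]) (rule v1)
      then show ?thesis using y(3)[of \<omega>] by (simp add: cinner_diff_left)
    qed
    define F where "F l = cmod (fourier y (of_int l / real B)) / sqrt (real B)" for l :: int
    define G where "G l = cmod (cinner (f - p) (?u (of_int l / real B))) / sqrt (real B)" for l :: int
    have FG: "cmod (fourier f (of_int l / real B)) / sqrt (real B) \<le> F l + G l" for l
      unfolding F_def G_def split[of "of_int l / real B"] add_divide_distrib[symmetric]
      by (intro divide_right_mono norm_triangle_ineq) simp
    have "sqrt (\<Sum>l\<in>\<Lambda>. (cmod (fourier f (of_int l / real B)))\<^sup>2 / real B) = L2_set (\<lambda>l. cmod (fourier f (of_int l / real B)) / sqrt (real B)) \<Lambda>"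
      by (simp add: L2_set_def power_divide)
    also have "\<dots> \<le> L2_set (\<lambda>l. F l + G l) \<Lambda>" using FG by (intro L2_set_mono) auto
    also have "\<dots> \<le> L2_set F \<Lambda> + L2_set G \<Lambda>" by (rule L2_set_triangle_ineq)
    also have "L2_set F \<Lambda> \<le> norm p"
      unfolding L2_set_def F_def using bessel_y by (intro real_le_lsqrt) (auto simp: power_divide)
    also have "norm p = sqrt (\<Sum>l\<in>sample_index M. \<epsilon> * (cmod (fourier f (\<epsilon> * of_int l)))\<^sup>2)"
      unfolding np[symmetric] by simp
    also have "L2_set G \<Lambda> \<le> D / 2 ^ (n * J)"
    proof -
      have "(\<Sum>l\<in>\<Lambda>. (G l)\<^sup>2) \<le> (\<Sum>l\<in>\<Lambda>. D0 / 2 ^ (2 * q * J) / real B)"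
      proof (rule sum_mono)
        fix l assume "l \<in> \<Lambda>"
        then show "(G l)\<^sup>2 \<le> D0 / 2 ^ (2 * q * J) / real B"
          using divide_right_mono[OF rest[of "of_int l / real B"], of "real B"] Bp
          unfolding G_def power_divide by (simp add: \<Lambda>_def)
      qed
      also have "\<dots> = D0 / 2 ^ (2 * q * J) * (real (card \<Lambda>) / real B)" by simp
      also have "\<dots> \<le> D0 / 2 ^ (2 * q * J) * ((2 * K0 + 1) * 2 ^ J)" using card D0 by (intro mult_left_mono) auto
      also have "\<dots> = D\<^sup>2 * (2 ^ J / 2 ^ (2 * q * J))" using D0 K by (simp add: D_def)
      also have "\<dots> \<le> D\<^sup>2 * (1 / 2 ^ (2 * n * J))"
      proof (rule mult_left_mono)
        have "2 * q * J = (2 * n * J + J) + J" by (simp add: q_def algebra_simps)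
        then have "(2::real) ^ (2 * q * J) = 2 ^ (2 * n * J) * 2 ^ J * 2 ^ J" by (simp only: power_add)
        then have "(2::real) ^ J / 2 ^ (2 * q * J) = 1 / (2 ^ (2 * n * J) * 2 ^ J)" by simp
        also have "\<dots> \<le> 1 / (2 ^ (2 * n * J) * 1)" by (intro divide_left_mono mult_left_mono) auto
        finally show "(2::real) ^ J / 2 ^ (2 * q * J) \<le> 1 / 2 ^ (2 * n * J)" by simp
      qed simp
      also have "\<dots> = (D / 2 ^ (n * J))\<^sup>2"
      proof -
        have "((2::real) ^ (n * J))\<^sup>2 = 2 ^ (2 * n * J)" by (simp only: power_mult[symmetric] mult_ac)
        then show ?thesis by (simp add: power_divide)
      qed
      finally show ?thesis unfolding L2_set_def using \<open>0 \<le> D\<close> by (intro real_le_lsqrt) auto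
    qed
    finally show ?thesis unfolding \<Lambda>_def by simp
  qed
  ultimately show ?thesis by (rule that)
qed

section \<open>Strict stability\<close>

lemma norm_trig_sum_le:
  assumes "finite F"
  shows "(cmod (trig_sum F c x))\<^sup>2 \<le> real (card F) * (\<Sum>k\<in>F. (cmod (c k))\<^sup>2)"
proof -
  have "cmod (trig_sum F c x) \<le> (\<Sum>k\<in>F. cmod (c k))"
    unfolding trig_sum_def by (rule sum_norm_le) (simp add: norm_mult)
  then have "(cmod (trig_sum F c x))\<^sup>2 \<le> (\<Sum>k\<in>F. 1 * cmod (c k))\<^sup>2" by (intro power_mono) auto
  also have "\<dots> \<le> (\<Sum>k\<in>F. 1\<^sup>2) * (\<Sum>k\<in>F. (cmod (c k))\<^sup>2)" by (rule Cauchy_Schwarz_ineq_sum)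
  finally show ?thesis by simp
qed

text \<open>A lattice point closer to \<open>z\<close> than one step comes from rounding
  \<open>z * L\<close> up or down.\<close>

lemma card_near_lattice_le:
  fixes Z :: "real set"
  assumes "finite Z" "0 < L"
  shows "card {r. r < L \<and> (\<exists>z\<in>Z. \<bar>real r / real L - z\<bar> < 1 / real L)} \<le> 2 * card Z"
proof -
  define N where "N z = {nat \<lfloor>z * real L\<rfloor>, nat \<lceil>z * real L\<rceil>}" for z :: real
  have "{r. r < L \<and> (\<exists>z\<in>Z. \<bar>real r / real L - z\<bar> < 1 / real L)} \<subseteq> (\<Union>z\<in>Z. N z)"
  proof
    fix r assume "r \<in> {r. r < L \<and> (\<exists>z\<in>Z. \<bar>real r / real L - z\<bar> < 1 / real L)}"
    then obtain z where z: "z \<in> Z" "\<bar>real r / real L - z\<bar> < 1 / real L" by blast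
    have "real L * \<bar>real r / real L - z\<bar> < real L * (1 / real L)" using z(2) assms(2) by (intro mult_strict_left_mono) auto
    moreover have "real L * \<bar>real r / real L - z\<bar> = \<bar>real r - z * real L\<bar>"
    proof -
      have "real L * (real r / real L - z) = real r - z * real L" using assms(2) by (simp add: field_simps)
      moreover have "real L * \<bar>real r / real L - z\<bar> = \<bar>real L * (real r / real L - z)\<bar>" by (simp add: abs_mult)
      ultimately show ?thesis by simp
    qed
    ultimately have *: "\<bar>real r - z * real L\<bar> < 1" using assms(2) by simp
    have "int r = \<lfloor>z * real L\<rfloor> \<or> int r = \<lceil>z * real L\<rceil>" using * by linarith
    then have "r \<in> N z" unfolding N_def by (metis insertCI nat_int)
    then show "r \<in> (\<Union>z\<in>Z. N z)" using z(1) by blast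
  qed
  then have "card {r. r < L \<and> (\<exists>z\<in>Z. \<bar>real r / real L - z\<bar> < 1 / real L)} \<le> card (\<Union>z\<in>Z. N z)"
    using assms(1) by (intro card_mono) (auto simp: N_def)
  also have "\<dots> \<le> (\<Sum>z\<in>Z. card (N z))" by (rule card_UN_le[OF assms(1)])
  also have "\<dots> \<le> (\<Sum>z\<in>Z. 2)" unfolding N_def by (intro sum_mono) (simp add: card_insert_if)
  finally show ?thesis by simp
qed

section \<open>Symbols, lattice energies and the case with room for a cutoff\<close>

context generalized_sampling
begin

text \<open>With \<open>hi\<close> the ends of the window at scale \<open>J\<close>. Their distance
  is \<open>(3 * \<lceil>a\<rceil> - 2) * 2 ^ J\<close>, and that many equally spaced values
  determine a symbol (\<open>symbol_parseval\<close>).\<close>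

definition lo :: "nat \<Rightarrow> int" where "lo J = - (\<lceil>a\<rceil> - 1) * 2 ^ J"
definition hi :: "nat \<Rightarrow> int" where "hi J = (2 * \<lceil>a\<rceil> - 1) * 2 ^ J"

abbreviation "\<alpha> \<equiv> - (real_of_int \<lceil>a\<rceil> - 1)"
abbreviation "\<beta> \<equiv> 2 * real_of_int \<lceil>a\<rceil> - 1"

definition coef :: "nat \<Rightarrow> L2 \<Rightarrow> int \<Rightarrow> complex" where "coef J f k = cinner f (wavelet_atom \<phi> (int J) k)"

lemma phi_range_window: "phi_range J \<alpha> \<beta> \<subseteq> {lo J..hi J - 1}"
proof
  fix k assume "k \<in> phi_range J \<alpha> \<beta>"
  then have "\<alpha> * 2 ^ J \<le> of_int k" "of_int k + a \<le> \<beta> * 2 ^ J" by (auto simp: phi_range_def)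
  then have "real_of_int (lo J) \<le> of_int k" "real_of_int (k + 1) \<le> of_int (hi J)" using a1 by (simp_all add: lo_def hi_def)
  then have "lo J \<le> k" "k + 1 \<le> hi J" by (simp_all only: of_int_le_iff)
  then show "k \<in> {lo J..hi J - 1}" by simp
qed

lemma hi_lo: "hi J = lo J + (3 * \<lceil>a\<rceil> - 2) * 2 ^ J"
  by (simp add: lo_def hi_def algebra_simps)

lemma f_expand:
  assumes "f \<in> V (int J)" "supp_in f {\<alpha>..\<beta>}"
  shows "f = (\<Sum>k\<in>phi_range J \<alpha> \<beta>. coef J f k *\<^sub>C wavelet_atom \<phi> (int J) k)"
  using phi_expand[OF assms] by (simp only: onp_def coef_def)

lemma norm_coef:
  assumes "f \<in> V (int J)" "supp_in f {\<alpha>..\<beta>}"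
  shows "(norm f)\<^sup>2 = (\<Sum>k\<in>phi_range J \<alpha> \<beta>. (cmod (coef J f k))\<^sup>2)"
proof -
  have on: "orthonormal_on (wavelet_atom \<phi> (int J)) A" for A by (simp add: orthonormal_on_def phi_orthonormal)
  have "(norm f)\<^sup>2 = (norm (\<Sum>k\<in>phi_range J \<alpha> \<beta>. coef J f k *\<^sub>C wavelet_atom \<phi> (int J) k))\<^sup>2"
    using f_expand[OF assms] by simp
  also have "\<dots> = (\<Sum>k\<in>phi_range J \<alpha> \<beta>. (cmod (coef J f k))\<^sup>2)"
    by (rule norm_orthonormal_sum[OF on]) simp
  finally show ?thesis .
qed

definition symbol :: "nat \<Rightarrow> L2 \<Rightarrow> real \<Rightarrow> complex" where "symbol J f = trig_sum (phi_range J \<alpha> \<beta>) (coef J f)"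

lemma fourier_symbol:
  assumes "f \<in> V (int J)" "supp_in f {\<alpha>..\<beta>}"
  shows "(cmod (fourier f \<omega>))\<^sup>2 = (cmod (symbol J f (\<omega> / 2 ^ J)))\<^sup>2 * (cmod (fourier \<phi> (\<omega> / 2 ^ J)))\<^sup>2 / 2 ^ J"
proof -
  have "(2 powr (- real J / 2))\<^sup>2 = (2::real) powr (- real J / 2 + - real J / 2)"
    unfolding power2_eq_square by (rule powr_add[symmetric])
  also have "- real J / 2 + - real J / 2 = - real J" by simp
  also have "(2::real) powr (- real J) = 1 / 2 ^ J" by (simp add: powr_minus_divide powr_realpow)
  finally have p: "(2 powr (- real J / 2))\<^sup>2 = 1 / (2::real) ^ J" .
  have "fourier f \<omega> = fourier (\<Sum>k\<in>phi_range J \<alpha> \<beta>. coef J f k *\<^sub>C wavelet_atom \<phi> (int J) k) \<omega>"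
    using f_expand[OF assms] by simp
  also have "\<dots> = complex_of_real (2 powr (- real J / 2)) * symbol J f (\<omega> / 2 ^ J) * fourier \<phi> (\<omega> / 2 ^ J)"
    unfolding symbol_def trig_sum_def by (rule fourier_phi_sum) simp
  finally show ?thesis using p by (simp add: norm_mult power_mult_distrib)
qed

lemma energy_fourier:
  assumes "supp_in f {\<alpha>..\<beta>}"
  shows "energy M f = (\<Sum>l\<in>sample_index M. \<epsilon> * (cmod (fourier f (\<epsilon> * of_int l)))\<^sup>2)"
  unfolding energy_def cinner_fourier_atom[OF s_window[OF assms]] using eps by (simp add: norm_mult power_mult_distrib)

text \<open>On the lattice \<open>1 / B\<close> the energy becomes an average of \<open>Phi\<close>
  weighted by the squared symbol; here the lower bounds for \<open>Phi\<close> enter.\<close>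

lemma lattice_energy:
  assumes f: "f \<in> V (int J)" "supp_in f {\<alpha>..\<beta>}" and B: "0 < B"
  shows "(\<Sum>l\<in>{l::int. \<bar>of_int l / real B\<bar> \<le> K * 2 ^ J}. (cmod (fourier f (of_int l / real B)))\<^sup>2 / real B)
    = (\<Sum>r<B * 2 ^ J. (cmod (symbol J f (real r / real (B * 2 ^ J))))\<^sup>2 * Phi K (real r / real (B * 2 ^ J))) / real (B * 2 ^ J)"
proof -
  define L where "L = B * 2 ^ J"
  have L: "0 < L" "real L = real B * 2 ^ J" using B by (auto simp: L_def)
  have index_eq: "{l::int. \<bar>of_int l / real B\<bar> \<le> K * 2 ^ J} = {l. \<bar>real_of_int l / real L\<bar> \<le> K}"
    using B unfolding L(2) by (auto simp: field_simps)
  have summand: "(cmod (fourier f (of_int l / real B)))\<^sup>2 / real B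
      = (cmod (symbol J f (of_int l / real L)))\<^sup>2 * (cmod (fourier \<phi> (of_int l / real L)))\<^sup>2 / real L" for l :: int
    unfolding fourier_symbol[OF f] L(2) by (simp add: mult_ac)
  show ?thesis
    unfolding index_eq summand sum_divide_distrib[symmetric] L_def[symmetric]
    using periodise[OF L(1), of "phi_range J \<alpha> \<beta>" "coef J f" K] unfolding symbol_def by simp
qed

lemma symbol_parseval:
  assumes f: "f \<in> V (int J)" "supp_in f {\<alpha>..\<beta>}" and B: "3 * \<lceil>a\<rceil> - 2 \<le> int B"
  shows "(\<Sum>r<B * 2 ^ J. (cmod (symbol J f (real r / real (B * 2 ^ J))))\<^sup>2) = real (B * 2 ^ J) * (norm f)\<^sup>2"
proof -
  have "0 < B" using B ceiling_a(1) by linarith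
  then have B0: "0 < B * 2 ^ J" by simp
  have "(3 * \<lceil>a\<rceil> - 2) * 2 ^ J \<le> int B * 2 ^ J" using B by (intro mult_right_mono) auto
  then have "hi J \<le> lo J + int (B * 2 ^ J)" unfolding hi_lo by simp
  then have "phi_range J \<alpha> \<beta> \<subseteq> {lo J..<lo J + int (B * 2 ^ J)}" using phi_range_window[of J] by auto
  from trig_sum_parseval[OF B0 this] show ?thesis unfolding symbol_def norm_coef[OF f] .
qed

text \<open>Near the exceptional points nothing is gained, so \<open>B\<close> is taken so large
  that the few lattice points there carry at most half of the squared symbol. Elsewhere the gain is
  of order \<open>1 / 2 ^ (p * J)\<close>, while the change of lattice loses only
  \<open>1 / 2 ^ (Suc p * J)\<close> up to a constant.\<close>

lemma strict_of_gap:
  assumes gap: "\<epsilon> * (3 * of_int \<lceil>a\<rceil> - 2) < 1" and c: "0 < c" "\<And>\<xi>. c \<le> Phi K0 \<xi>" and K: "0 \<le> K0" "K0 < K2"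
  shows "\<exists>J0. \<forall>J\<ge>J0. \<forall>M f. K2 * 2 ^ J \<le> \<epsilon> * real M / 2 \<longrightarrow> f \<in> V (int J) \<longrightarrow> supp_in f {\<alpha>..\<beta>} \<longrightarrow> norm f = 1 \<longrightarrow> c < energy M f"
proof -
  obtain Z :: "real set" and p C where Z: "finite Z" "0 < C"
    "\<And>x d. 0 \<le> x \<Longrightarrow> x \<le> 1 \<Longrightarrow> 0 < d \<Longrightarrow> d \<le> 1 \<Longrightarrow> (\<And>z. z \<in> Z \<Longrightarrow> d \<le> \<bar>x - z\<bar>) \<Longrightarrow> c + C * d ^ p \<le> Phi K0 x"
    by (rule Phi_lower[OF c]) blast
  \<comment> \<open>Two margins: \<open>K0 < K1\<close> for the change of lattice,
    \<open>K1 < K2\<close> for the rounding of the last sample index.\<close>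
  define K1 where "K1 = (K0 + K2) / 2"
  have K1: "K0 < K1" "K1 < K2" using K by (simp_all add: K1_def)
  have "(1::real) \<le> of_int \<lceil>a\<rceil>" using ceiling_a(1) by (simp only: of_int_1_le_iff)
  then have ab: "\<alpha> \<le> \<beta>" by linarith
  have ab': "\<epsilon> * (\<beta> - \<alpha>) < 1" using gap by (simp add: algebra_simps)
  obtain D B0 where D: "0 \<le> D" and change: "\<And>J M f B. B0 \<le> real B \<Longrightarrow> (\<And>l. l \<notin> sample_index M \<Longrightarrow> K1 * 2 ^ J \<le> \<epsilon> * \<bar>real_of_int l\<bar>) \<Longrightarrow> supp_in f {\<alpha>..\<beta>} \<Longrightarrow> norm f = 1 \<Longrightarrow>
       sqrt (\<Sum>l\<in>{l::int. \<bar>of_int l / real B\<bar> \<le> K0 * 2 ^ J}. (cmod (fourier f (of_int l / real B)))\<^sup>2 / real B)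
       \<le> sqrt (\<Sum>l\<in>sample_index M. \<epsilon> * (cmod (fourier f (\<epsilon> * of_int l)))\<^sup>2) + D / 2 ^ (Suc p * J)"
    by (rule change_of_lattice[OF eps(1) ab ab' K(1) K1(1)]) blast
  define A where "A = nat (3 * \<lceil>a\<rceil> - 1)"
  have A: "int A = 3 * \<lceil>a\<rceil> - 1" using ceiling_a(1) by (simp add: A_def)
  \<comment> \<open>Each point carries at most \<open>A * 2 ^ J\<close> of the total
    \<open>B * 2 ^ J\<close>, and at most \<open>2 * card Z\<close> points are bad.\<close>
  obtain B where B: "B0 \<le> real B" "4 * card Z * A \<le> B" "A \<le> B"
  proof -
    obtain b :: nat where "B0 \<le> real b" using real_arch_simple by blast
    then show ?thesis by (intro that[of "max b (max (4 * card Z * A) A)"]) auto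
  qed
  have Bp: "0 < B" using B(3) A ceiling_a(1) by linarith
  define Q where "Q = 2 * sqrt c * D + D\<^sup>2"
  \<comment> \<open>\<open>J1\<close> pays for the rounding of the sample range. \<open>J2\<close>
    makes the gain exceed the loss, which after squaring is at most
    \<open>Q / 2 ^ (Suc p * J)\<close>.\<close>
  obtain J1 :: nat where J1: "\<epsilon> / (K2 - K1) < 2 ^ J1" using real_arch_pow[of 2 "\<epsilon> / (K2 - K1)"] by auto
  obtain J2 :: nat where J2: "2 * Q * real B ^ p / C < 2 ^ J2" using real_arch_pow[of 2 "2 * Q * real B ^ p / C"] by auto
  show ?thesis
  proof (intro exI allI impI)
    fix J M f
    assume J: "max J1 J2 \<le> J" and M: "K2 * 2 ^ J \<le> \<epsilon> * real M / 2" and f: "f \<in> V (int J)" "supp_in f {\<alpha>..\<beta>}" and nf: "norm f = 1"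
    define L where "L = B * 2 ^ J"
    have L: "0 < L" "real L = real B * 2 ^ J" using Bp by (auto simp: L_def)
    have pw: "(2::real) ^ J1 \<le> 2 ^ J" "(2::real) ^ J2 \<le> 2 ^ J" using J by (intro power_increasing; simp)+
    have far: "K1 * 2 ^ J \<le> \<epsilon> * \<bar>real_of_int l\<bar>" if "l \<notin> sample_index M" for l
    proof -
      have "real M / 2 - 1 < \<bar>real_of_int l\<bar>" using that sample_indexI[of l M] by force
      then have "\<epsilon> * (real M / 2 - 1) \<le> \<epsilon> * \<bar>real_of_int l\<bar>" using eps by (intro mult_left_mono) auto
      then have "\<epsilon> * real M / 2 - \<epsilon> \<le> \<epsilon> * \<bar>real_of_int l\<bar>" by (simp add: algebra_simps)
      moreover have "\<epsilon> \<le> (K2 - K1) * 2 ^ J"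
      proof -
        have "\<epsilon> / (K2 - K1) \<le> 2 ^ J" using J1 pw by linarith
        then show ?thesis using K1 by (simp add: pos_divide_le_eq mult.commute)
      qed
      then have "\<epsilon> \<le> K2 * 2 ^ J - K1 * 2 ^ J" by (simp add: left_diff_distrib)
      ultimately show ?thesis using M by linarith
    qed
    define d where "d = 1 / real L"
    have d: "0 < d" "d \<le> 1" using L(1) by (simp_all add: d_def)
    define t where "t r = (cmod (symbol J f (real r / real L)))\<^sup>2" for r
    have tsum: "(\<Sum>r<L. t r) = real L"
      using symbol_parseval[OF f, of B] A B(3) nf unfolding t_def L_def by simp
    \<comment> \<open>Outside this set every lattice point keeps the distance
      \<open>d = 1 / L\<close> from \<open>Z\<close>, as \<open>Phi_lower\<close> requires.\<close>
    define bad where "bad = {r. r < L \<and> (\<exists>z\<in>Z. \<bar>real r / real L - z\<bar> < 1 / real L)}"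
    have bad: "card bad \<le> 2 * card Z" "bad \<subseteq> {..<L}" "finite bad"
      using card_near_lattice_le[OF Z(1) L(1)] by (auto simp: bad_def)
    have cF: "card (phi_range J \<alpha> \<beta>) \<le> A * 2 ^ J"
    proof -
      have "card (phi_range J \<alpha> \<beta>) \<le> card {lo J..hi J - 1}" by (rule card_mono[OF _ phi_range_window]) simp
      also have "\<dots> = nat ((3 * \<lceil>a\<rceil> - 2) * 2 ^ J)" by (simp add: hi_lo)
      also have "\<dots> \<le> nat (int A * 2 ^ J)" unfolding A by (intro nat_mono mult_right_mono) auto
      finally show ?thesis by (simp add: nat_mult_distrib nat_power_eq)
    qed
    have tle: "t r \<le> real (A * 2 ^ J)" for r
    proof -
      have "t r \<le> real (card (phi_range J \<alpha> \<beta>)) * (\<Sum>k\<in>phi_range J \<alpha> \<beta>. (cmod (coef J f k))\<^sup>2)"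
        unfolding t_def symbol_def by (rule norm_trig_sum_le) simp
      then have "t r \<le> real (card (phi_range J \<alpha> \<beta>))" unfolding norm_coef[OF f, symmetric] nf by simp
      also have "\<dots> \<le> real (A * 2 ^ J)" using cF by (simp only: of_nat_le_iff)
      finally show ?thesis .
    qed
    have badsum: "(\<Sum>r\<in>bad. t r) \<le> real L / 2"
    proof -
      have "(\<Sum>r\<in>bad. t r) \<le> real (card bad) * real (A * 2 ^ J)" using sum_bounded_above[of bad t, OF tle] by simp
      also have "\<dots> = real (card bad * (A * 2 ^ J))" by simp
      also have "\<dots> \<le> real (2 * card Z * (A * 2 ^ J))" using bad(1) by (intro of_nat_mono mult_right_mono) auto
      also have "\<dots> = real (4 * card Z * A) * 2 ^ J / 2" by simp
      also have "\<dots> \<le> real B * 2 ^ J / 2" using B(2) by (intro divide_right_mono mult_right_mono of_nat_mono) auto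
      finally show ?thesis by (simp add: L(2))
    qed
    have low: "c * t r + C * d ^ p * (if r \<in> bad then 0 else t r) \<le> t r * Phi K0 (real r / real L)" if r: "r < L" for r
    proof (cases "r \<in> bad")
      case True
      have "0 \<le> t r" by (simp add: t_def)
      with True show ?thesis using mult_right_mono[OF c(2)[of "real r / real L"], of "t r"] by (simp add: mult.commute)
    next
      case False
      have "c + C * d ^ p \<le> Phi K0 (real r / real L)"
      proof (rule Z(3)[OF _ _ d])
        show "0 \<le> real r / real L" "real r / real L \<le> 1" using r by simp_all
        show "d \<le> \<bar>real r / real L - z\<bar>" if "z \<in> Z" for z using False r that by (force simp: bad_def d_def)
      qed
      then have "t r * (c + C * d ^ p) \<le> t r * Phi K0 (real r / real L)" by (intro mult_left_mono) (simp_all add: t_def)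
      then show ?thesis using False by (simp add: algebra_simps)
    qed
    have "c * real L + C * d ^ p * (real L / 2) \<le> c * (\<Sum>r<L. t r) + C * d ^ p * (\<Sum>r<L. if r \<in> bad then 0 else t r)"
    proof -
      have "(\<Sum>r<L. t r) = (\<Sum>r<L. (if r \<in> bad then t r else 0) + (if r \<in> bad then 0 else t r))"
        by (intro sum.cong) auto
      also have "\<dots> = (\<Sum>r<L. if r \<in> bad then t r else 0) + (\<Sum>r<L. if r \<in> bad then 0 else t r)" by (rule sum.distrib)
      also have "(\<Sum>r<L. if r \<in> bad then t r else 0) = (\<Sum>r\<in>bad. t r)"
        using bad by (intro sum.mono_neutral_cong_right) auto
      finally have "real L / 2 \<le> (\<Sum>r<L. if r \<in> bad then 0 else t r)" using tsum badsum by linarith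
      then show ?thesis unfolding tsum using Z(2) d by (intro add_left_mono mult_left_mono) auto
    qed
    also have "\<dots> = (\<Sum>r<L. c * t r + C * d ^ p * (if r \<in> bad then 0 else t r))"
      by (simp only: sum.distrib sum_distrib_left)
    also have "\<dots> \<le> (\<Sum>r<L. t r * Phi K0 (real r / real L))" using low by (intro sum_mono) simp
    finally have "(c * real L + C * d ^ p * (real L / 2)) / real L \<le> (\<Sum>r<L. t r * Phi K0 (real r / real L)) / real L"
      by (intro divide_right_mono) auto
    then have "c + C * d ^ p / 2 \<le> (\<Sum>r<L. t r * Phi K0 (real r / real L)) / real L"
      using L(1) by (simp add: add_divide_distrib)
    also have "\<dots> = (\<Sum>l\<in>{l::int. \<bar>of_int l / real B\<bar> \<le> K0 * 2 ^ J}. (cmod (fourier f (of_int l / real B)))\<^sup>2 / real B)"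
      using lattice_energy[OF f Bp, of K0] unfolding t_def L_def[symmetric] by simp
    finally have "sqrt (c + C * d ^ p / 2) \<le> sqrt (energy M f) + D / 2 ^ (Suc p * J)"
      using change[OF B(1) far f(2) nf] unfolding energy_fourier[OF f(2)] by (meson order_trans real_sqrt_le_mono)
    show "c < energy M f"
    proof (rule ccontr)
      assume "\<not> ?thesis"
      then have "sqrt (energy M f) \<le> sqrt c" by simp
      define \<tau> where "\<tau> = D / 2 ^ (Suc p * J)"
      have tau: "0 \<le> \<tau>" using D by (simp add: \<tau>_def)
      have "sqrt (c + C * d ^ p / 2) \<le> sqrt c + \<tau>"
        using \<open>sqrt (c + C * d ^ p / 2) \<le> sqrt (energy M f) + D / 2 ^ (Suc p * J)\<close> \<open>sqrt (energy M f) \<le> sqrt c\<close>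
        unfolding \<tau>_def by linarith
      moreover have "0 \<le> C * d ^ p / 2" using Z(2) d by simp
      ultimately have "(sqrt (c + C * d ^ p / 2))\<^sup>2 \<le> (sqrt c + \<tau>)\<^sup>2" using c(1) by (intro power_mono) auto
      then have "c + C * d ^ p / 2 \<le> c + 2 * sqrt c * \<tau> + \<tau>\<^sup>2"
        using c(1) \<open>0 \<le> C * d ^ p / 2\<close> by (simp add: power2_sum)
      then have 1: "C * d ^ p / 2 \<le> 2 * sqrt c * \<tau> + \<tau>\<^sup>2" by simp
      have "\<tau>\<^sup>2 \<le> D\<^sup>2 / 2 ^ (Suc p * J)"
      proof -
        have "(2::real) ^ (Suc p * J) * 1 \<le> 2 ^ (Suc p * J) * 2 ^ (Suc p * J)" by (intro mult_left_mono) auto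
        then have "(2::real) ^ (Suc p * J) \<le> (2 ^ (Suc p * J))\<^sup>2" by (simp only: power2_eq_square mult_1_right)
        then show ?thesis unfolding \<tau>_def power_divide by (intro divide_left_mono) auto
      qed
      then have "C * d ^ p / 2 \<le> 2 * sqrt c * (D / 2 ^ (Suc p * J)) + D\<^sup>2 / 2 ^ (Suc p * J)"
        using 1 unfolding \<tau>_def by linarith
      also have "\<dots> = Q / 2 ^ (Suc p * J)" by (simp add: Q_def add_divide_distrib)
      also have "(2::real) ^ (Suc p * J) = 2 ^ J * (2 ^ J) ^ p" by (simp add: power_add power_mult power_commutes flip: power_mult)
      finally have 2: "C * d ^ p / 2 \<le> Q / (2 ^ J * (2 ^ J) ^ p)" .
      have "d ^ p = 1 / (real B ^ p * (2 ^ J) ^ p)" unfolding d_def L(2) by (simp add: power_divide power_mult_distrib)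
      then have "C / (2 * (real B ^ p * (2 ^ J) ^ p)) \<le> Q / (2 ^ J * (2 ^ J) ^ p)" using 2 by (simp add: mult_ac)
      then have "C / (2 * (real B ^ p * (2 ^ J) ^ p)) * (2 * real B ^ p * (2 ^ J) ^ p * 2 ^ J) \<le> Q / (2 ^ J * (2 ^ J) ^ p) * (2 * real B ^ p * (2 ^ J) ^ p * 2 ^ J)"
        by (rule mult_right_mono) simp
      then have "C * 2 ^ J \<le> 2 * Q * real B ^ p" using Bp by simp
      moreover have "2 * Q * real B ^ p / C < 2 ^ J" using J2 pw by linarith
      then have "2 * Q * real B ^ p < C * 2 ^ J" using Z(2) by (simp add: pos_divide_less_eq mult.commute)
      ultimately show False by simp
    qed
  qed
qed

end

section \<open>The critical case, in which the window fills a whole sampling period\<close>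

context wavelets
begin

lemma Phi_eq_finite:
  assumes "0 < c" "\<And>\<xi>. c \<le> Phi K \<xi>"
  obtains Z where "finite Z" "\<And>x. 0 \<le> x \<Longrightarrow> x \<le> 1 \<Longrightarrow> Phi K x \<le> c \<Longrightarrow> x \<in> Z"
proof (rule Phi_lower[OF assms])
  fix Z :: "real set" and C p
  assume Z: "finite Z" "0 < C" and low: "\<And>x d. 0 \<le> x \<Longrightarrow> x \<le> 1 \<Longrightarrow> 0 < d \<Longrightarrow> d \<le> 1 \<Longrightarrow> (\<And>z. z \<in> Z \<Longrightarrow> d \<le> \<bar>x - z\<bar>) \<Longrightarrow> c + C * d ^ p \<le> Phi K x"
  have "x \<in> Z" if x: "0 \<le> x" "x \<le> 1" "Phi K x \<le> c" for x
  proof (rule ccontr)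
    assume "x \<notin> Z"
    define d where "d = Min (insert 1 ((\<lambda>z. \<bar>x - z\<bar>) ` Z))"
    have d: "0 < d" unfolding d_def using Z(1) \<open>x \<notin> Z\<close> by (subst Min_gr_iff) auto
    have "d \<le> 1" "\<And>z. z \<in> Z \<Longrightarrow> d \<le> \<bar>x - z\<bar>" unfolding d_def using Z(1) by auto
    then have "c + C * d ^ p \<le> Phi K x" using low[OF x(1,2) d] by blast
    moreover have "0 < C * d ^ p" using Z(2) d by simp
    ultimately show False using x(3) by linarith
  qed
  then show thesis using that Z(1) by blast
qed

lemma atom_perp:
  assumes "f \<in> cspan (atom ` F)" "i \<notin> F"
  shows "cinner f (atom i) = 0"
proof -
  have "cinner (atom i) u = 0" if "u \<in> atom ` F" for u
    using that assms(2) atom_orthonormal[of UNIV] by (auto simp: orthonormal_on_def simp del: atom.simps)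
  then have "cinner (atom i) f = 0" using assms(1) by (rule cinner_span_zero)
  then show ?thesis by (subst cinner_commute) simp
qed

lemma idx_Suc: "idx_partial n (nat (2 ^ n * \<lceil>a\<rceil> + \<lceil>a\<rceil> - 1)) = idx (Suc n)"
proof -
  have "0 \<le> 2 ^ n * \<lceil>a\<rceil>" using ceiling_a(1) by simp
  then have "0 \<le> 2 ^ n * \<lceil>a\<rceil> + \<lceil>a\<rceil> - 1" using ceiling_a(1) by linarith
  then have "int (nat (2 ^ n * \<lceil>a\<rceil> + \<lceil>a\<rceil> - 1)) = 2 ^ n * \<lceil>a\<rceil> + \<lceil>a\<rceil> - 1" by (rule int_nat_eq[THEN trans, OF if_P])
  then have "{- \<lceil>a\<rceil> + 1..<- \<lceil>a\<rceil> + 1 + int (nat (2 ^ n * \<lceil>a\<rceil> + \<lceil>a\<rceil> - 1))} = {- \<lceil>a\<rceil> + 1..2 ^ n * \<lceil>a\<rceil> - 1}" by auto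
  then show ?thesis unfolding idx_partial_def idx_def by (auto simp: less_Suc_eq)
qed

lemma idx_partial_subset: "int m \<le> 2 ^ n * \<lceil>a\<rceil> + \<lceil>a\<rceil> - 1 \<Longrightarrow> idx_partial n m \<subseteq> idx (Suc n)"
  unfolding idx_partial_def idx_def by auto

lemma idx_supp:
  assumes "f \<in> cspan (atom ` idx n)"
  shows "supp_in f {- (of_int \<lceil>a\<rceil> - 1)..2 * of_int \<lceil>a\<rceil> - 1}"
proof (rule recon_supp)
  show "f \<in> cspan (atom ` idx_partial n 0)" using assms by (simp add: idx_partial_0)
  have "0 \<le> 2 ^ n * \<lceil>a\<rceil>" using ceiling_a(1) by simp
  then show "int 0 \<le> 2 ^ n * \<lceil>a\<rceil> + \<lceil>a\<rceil> - 1" using ceiling_a(1) by linarith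
qed

end

context generalized_sampling
begin

lemma exact_support:
  assumes lat: "\<epsilon> * (3 * of_int \<lceil>a\<rceil> - 2) = 1" and c: "\<And>\<xi>. c \<le> Phi K \<xi>"
    and M: "K * 2 ^ J + \<epsilon> \<le> \<epsilon> * real M / 2"
    and f: "f \<in> V (int J)" "supp_in f {\<alpha>..\<beta>}" "norm f = 1" and low: "energy M f \<le> c"
    and B: "int B = 3 * \<lceil>a\<rceil> - 2" and r: "r < B * 2 ^ J" "symbol J f (real r / real (B * 2 ^ J)) \<noteq> 0"
  shows "Phi K (real r / real (B * 2 ^ J)) \<le> c"
proof -
  define L where "L = B * 2 ^ J"
  have Bp: "0 < B" using B ceiling_a(1) by linarith
  have L: "0 < L" using Bp by (simp add: L_def)
  have rB: "real B = 3 * of_int \<lceil>a\<rceil> - 2" using arg_cong[OF B, of real_of_int] by simp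
  have eB: "\<epsilon> = 1 / real B" using lat Bp unfolding rB[symmetric] by (simp add: field_simps)
  have lB: "of_int l / real B = \<epsilon> * of_int l" "x / real B = \<epsilon> * x" for l :: int and x :: real
    by (subst eB, simp)+
  define t where "t r = (cmod (symbol J f (real r / real L)))\<^sup>2" for r
  have tsum: "(\<Sum>r<L. t r) = real L"
    using symbol_parseval[OF f(1,2), of B] B f(3) unfolding t_def L_def by simp
  have "(\<Sum>r<L. t r * Phi K (real r / real L)) / real L
      = (\<Sum>l\<in>{l::int. \<bar>of_int l / real B\<bar> \<le> K * 2 ^ J}. (cmod (fourier f (of_int l / real B)))\<^sup>2 / real B)"
    using lattice_energy[OF f(1,2) Bp, of K] unfolding t_def L_def[symmetric] by simp
  also have "\<dots> \<le> (\<Sum>l\<in>sample_index M. (cmod (fourier f (of_int l / real B)))\<^sup>2 / real B)"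
  proof (rule sum_mono2)
    show "{l::int. \<bar>of_int l / real B\<bar> \<le> K * 2 ^ J} \<subseteq> sample_index M"
    proof
      fix l :: int assume "l \<in> {l. \<bar>of_int l / real B\<bar> \<le> K * 2 ^ J}"
      then have "\<bar>real_of_int l\<bar> / real B \<le> K * 2 ^ J" by simp
      then have "\<bar>real_of_int l\<bar> / real B + \<epsilon> \<le> \<epsilon> * real M / 2" using M by linarith
      then have "\<bar>real_of_int l\<bar> / real B + 1 / real B \<le> real M / 2 / real B" by (subst (asm) (1 2) eB) simp
      then have "(\<bar>real_of_int l\<bar> + 1) / real B \<le> real M / 2 / real B" by (simp only: add_divide_distrib)
      then have "\<bar>real_of_int l\<bar> + 1 \<le> real M / 2" using Bp by (subst (asm) divide_le_cancel) auto
      then show "l \<in> sample_index M" by (intro sample_indexI) linarith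
    qed
  qed auto
  also have "\<dots> = energy M f" unfolding energy_fourier[OF f(2)] by (intro sum.cong refl) (simp add: eB[symmetric] lB)
  also have "\<dots> \<le> c" by (rule low)
  finally have "(\<Sum>r<L. t r * Phi K (real r / real L)) \<le> c * real L" using L by (simp add: pos_divide_le_eq)
  also have "\<dots> = (\<Sum>r<L. t r * c)" unfolding tsum[symmetric] by (simp add: sum_distrib_left mult.commute)
  finally have "(\<Sum>r<L. t r * (Phi K (real r / real L) - c)) \<le> 0"
    by (simp add: right_diff_distrib sum_subtractf)
  moreover have nn: "0 \<le> t r * (Phi K (real r / real L) - c)" for r
    using c[of "real r / real L"] by (simp add: t_def)
  moreover have "0 \<le> (\<Sum>r<L. t r * (Phi K (real r / real L) - c))" by (intro sum_nonneg nn)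
  ultimately have "(\<Sum>r<L. t r * (Phi K (real r / real L) - c)) = 0" by linarith
  then have "t r * (Phi K (real r / real L) - c) = 0"
    using sum_nonneg_eq_0_iff[of "{..<L}" "\<lambda>r. t r * (Phi K (real r / real L) - c)"] nn r(1) by (auto simp: L_def)
  moreover have "t r \<noteq> 0" using r(2) by (simp add: t_def L_def)
  ultimately show ?thesis by (simp add: L_def)
qed

text \<open>If the symbol lives on few lattice points, the wavelet coefficients of the finest level form an
  exponential sum, and a long enough run of zeros makes all of them vanish.\<close>

lemma drop_level_of_zero_run:
  assumes f: "f \<in> cspan (atom ` idx_partial n m)" and m: "int m \<le> 2 ^ n * \<lceil>a\<rceil> + \<lceil>a\<rceil> - 1"
    and B: "int B = 3 * \<lceil>a\<rceil> - 2" and Z: "finite Z"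
    and sup: "\<And>r. r < B * 2 ^ Suc n \<Longrightarrow> symbol (Suc n) f (real r / real (B * 2 ^ Suc n)) \<noteq> 0 \<Longrightarrow> real r / real (B * 2 ^ Suc n) \<in> Z"
    and run: "lo n \<le> i" "2 * (i + int (card Z) - 1) + \<lceil>a\<rceil> < hi (Suc n)"
      "\<And>k. i \<le> k \<Longrightarrow> k < i + int (card Z) \<Longrightarrow> cinner f (wavelet_atom \<psi> (int n) k) = 0"
  shows "f \<in> cspan (atom ` idx n)"
proof (rule recon_drop_level[OF f])
  define L where "L = B * 2 ^ Suc n"
  have Bp: "0 < B" using B ceiling_a(1) by linarith
  have L: "0 < L" using Bp by (simp add: L_def)
  have fV: "f \<in> V (int (Suc n))" by (rule recon_in_V[OF f])
  have fs: "supp_in f {\<alpha>..\<beta>}" by (rule recon_supp[OF f m])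
  have lo2: "lo (Suc n) = 2 * lo n" by (simp add: lo_def)
  have "hi (Suc n) = lo (Suc n) + int L" unfolding hi_lo L_def using B by simp
  note hiL = this
  let ?F = "phi_range (Suc n) \<alpha> \<beta>"
  have sub: "?F \<subseteq> {lo (Suc n)..<lo (Suc n) + int L}" using phi_range_window[of "Suc n"] hiL by auto
  have coef0: "coef (Suc n) f k = (if k \<in> ?F then coef (Suc n) f k else 0)" for k
  proof (cases "k \<in> ?F")
    case False
    have "coef (Suc n) f k = cinner (\<Sum>j\<in>?F. coef (Suc n) f j *\<^sub>C wavelet_atom \<phi> (int (Suc n)) j) (wavelet_atom \<phi> (int (Suc n)) k)"
      using f_expand[OF fV fs] by (simp only: coef_def)
    also have "\<dots> = 0"
      unfolding cinner_sum_left cinner_scale_left phi_orthonormal using False by (intro sum.neutral) auto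
    finally show ?thesis using False by simp
  qed simp
  define R where "R = {r. r < L \<and> symbol (Suc n) f (real r / real L) \<noteq> 0}"
  \<comment> \<open>Collecting by position lets the sum run over the same set \<open>Z\<close> at
    every level; positions off the lattice receive the empty sum.\<close>
  define b where "b x = (\<Sum>r\<in>{r \<in> R. real r / real L = x}. symbol (Suc n) f (real r / real L)) / real L" for x
  have RZ: "(\<lambda>r. real r / real L) ` R \<subseteq> Z" using sup by (auto simp: R_def L_def)
  have coef: "coef (Suc n) f k = (\<Sum>x\<in>Z. b x * e2 (of_int k * x))" if k: "k \<in> {lo (Suc n)..<lo (Suc n) + int L}" for k
  proof -
    have "of_nat L * coef (Suc n) f k = (\<Sum>r<L. symbol (Suc n) f (real r / real L) * e2 (of_int k * (real r / real L)))"
      unfolding symbol_def trig_sum_inverse[OF L sub k] using coef0[of k] by simp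
    also have "\<dots> = (\<Sum>r\<in>R. symbol (Suc n) f (real r / real L) * e2 (of_int k * (real r / real L)))"
      by (intro sum.mono_neutral_right) (auto simp: R_def)
    also have "\<dots> = (\<Sum>x\<in>Z. \<Sum>r\<in>{r \<in> R. real r / real L = x}. symbol (Suc n) f (real r / real L) * e2 (of_int k * (real r / real L)))"
      by (rule sum.group[symmetric]) (use Z RZ in \<open>auto simp: R_def\<close>)
    also have "\<dots> = (\<Sum>x\<in>Z. of_nat L * (b x * e2 (of_int k * x)))"
      using L by (intro sum.cong refl) (simp add: b_def sum_distrib_right)
    finally have "of_nat L * coef (Suc n) f k = of_nat L * (\<Sum>x\<in>Z. b x * e2 (of_int k * x))" by (simp only: sum_distrib_left)
    then show ?thesis using L by simp
  qed
  obtain g where g: "\<And>n k. wavelet_atom \<psi> (int n) k = (\<Sum>i\<in>phi_range 1 0 a. g i *\<^sub>C wavelet_atom \<phi> (int (Suc n)) (2 * k + i))"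
    by (rule psi_refine) blast
  \<comment> \<open>By the refinement equation the wavelet at \<open>k\<close> sees the translates
    \<open>2 * k + i\<close>. This doubles the frequencies and otherwise changes only the
    coefficients.\<close>
  define b' where "b' x = b x * (\<Sum>i\<in>phi_range 1 0 a. cnj (g i) * e2 (of_int i * x))" for x
  have psi: "cinner f (wavelet_atom \<psi> (int n) k) = (\<Sum>x\<in>Z. b' x * e2 (of_int k * (2 * x)))"
    if k: "lo n \<le> k" "2 * k + \<lceil>a\<rceil> < hi (Suc n)" for k
  proof -
    have range: "2 * k + i \<in> {lo (Suc n)..<lo (Suc n) + int L}" if "i \<in> phi_range 1 0 a" for i
    proof -
      have "0 \<le> real_of_int i" "real_of_int i \<le> a" using that by (auto simp: phi_range_def)
      then have "0 \<le> i" "i \<le> \<lceil>a\<rceil>" by linarith+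
      then show ?thesis using k lo2 hiL by auto
    qed
    have "cinner f (wavelet_atom \<psi> (int n) k) = (\<Sum>i\<in>phi_range 1 0 a. cnj (g i) * coef (Suc n) f (2 * k + i))"
      unfolding g[of n k] cinner_sum_right cinner_scale_right coef_def ..
    also have "\<dots> = (\<Sum>i\<in>phi_range 1 0 a. cnj (g i) * (\<Sum>x\<in>Z. b x * e2 (of_int (2 * k + i) * x)))"
      using range by (intro sum.cong refl) (simp only: coef)
    also have "\<dots> = (\<Sum>x\<in>Z. \<Sum>i\<in>phi_range 1 0 a. cnj (g i) * (b x * e2 (of_int (2 * k + i) * x)))"
      unfolding sum_distrib_left by (rule sum.swap)
    also have "\<dots> = (\<Sum>x\<in>Z. b' x * e2 (of_int k * (2 * x)))"
    proof (rule sum.cong[OF refl])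
      fix x
      have e: "e2 (of_int (2 * k + i) * x) = e2 (of_int i * x) * e2 (of_int k * (2 * x))" for i
        unfolding e2_add[symmetric] by (simp add: algebra_simps)
      show "(\<Sum>i\<in>phi_range 1 0 a. cnj (g i) * (b x * e2 (of_int (2 * k + i) * x))) = b' x * e2 (of_int k * (2 * x))"
        unfolding e b'_def sum_distrib_left sum_distrib_right by (simp add: mult_ac)
    qed
    finally show ?thesis .
  qed
  have all: "(\<Sum>x\<in>Z. b' x * e2 (of_int k * (2 * x))) = 0" for k
  proof (rule exponential_sum_zero[OF Z, of i])
    fix k assume k: "i \<le> k" "k < i + int (card Z)"
    then show "(\<Sum>x\<in>Z. b' x * e2 (of_int k * (2 * x))) = 0"
      using run(3)[OF k] psi[of k] run(1,2) by simp
  qed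
  have out: "cinner f (wavelet_atom \<psi> (int n) k) = 0" if "k < - \<lceil>a\<rceil> + 1 \<or> 2 ^ n * \<lceil>a\<rceil> \<le> k" for k
  proof -
    have "Inr (n, k) \<notin> idx_partial n m" using that m by (auto simp: idx_partial_def idx_def)
    from atom_perp[OF f this] show ?thesis by simp
  qed
  show "cinner f (wavelet_atom \<psi> (int n) k) = 0" for k
  proof -
    \<comment> \<open>The fact \<open>psi\<close> covers the indices whose translates
      \<open>2 * k + i\<close> lie in the window. The remaining ones are outside the index range of
      scale \<open>n\<close>, where the coefficients vanish anyway.\<close>
    consider "k < lo n" | "hi (Suc n) \<le> 2 * k + \<lceil>a\<rceil>" | "lo n \<le> k" "2 * k + \<lceil>a\<rceil> < hi (Suc n)" by linarith
    then show ?thesis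
    proof cases
      case 1
      have le: "(\<lceil>a\<rceil> - 1) * 1 \<le> (\<lceil>a\<rceil> - 1) * 2 ^ n" using ceiling_a(1) by (intro mult_left_mono) auto
      note 1
      also have "lo n = - ((\<lceil>a\<rceil> - 1) * 2 ^ n)" by (simp add: lo_def algebra_simps)
      also have "\<dots> \<le> - ((\<lceil>a\<rceil> - 1) * 1)" using le by (simp only: neg_le_iff_le)
      finally have "k < - \<lceil>a\<rceil> + 1" by simp
      then show ?thesis by (simp add: out)
    next
      case 2
      have "(\<lceil>a\<rceil> - 1) * 1 \<le> (\<lceil>a\<rceil> - 1) * 2 ^ Suc n" using ceiling_a(1) by (intro mult_left_mono one_le_power) auto
      moreover have "hi (Suc n) = \<lceil>a\<rceil> * 2 ^ Suc n + (\<lceil>a\<rceil> - 1) * 2 ^ Suc n" by (simp add: hi_def algebra_simps)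
      moreover have "A * p - 1 \<le> 2 * k" if "(A - 1) * 1 \<le> (A - 1) * p" "h = A * p + (A - 1) * p" "h \<le> 2 * k + A" for A p h
        using that by (simp add: algebra_simps)
      ultimately have "\<lceil>a\<rceil> * 2 ^ Suc n - 1 \<le> 2 * k" using 2 by blast
      moreover have "\<lceil>a\<rceil> * 2 ^ Suc n = 2 * (2 ^ n * \<lceil>a\<rceil>)" by simp
      ultimately have "2 ^ n * \<lceil>a\<rceil> \<le> k" by linarith
      then show ?thesis by (simp add: out)
    next
      case 3
      then show ?thesis using psi[OF 3] all by simp
    qed
  qed
qed

text \<open>On a fixed finite-dimensional space the projections converge uniformly on the unit
  sphere: the error is at most the sum of the errors of finitely many atoms.\<close>

lemma energy_eventually_gt:
  assumes "c < 1"
  shows "\<exists>M0. \<forall>M\<ge>M0. \<forall>f\<in>cspan (atom ` idx R). norm f = 1 \<longrightarrow> c < energy M f"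
proof -
  let ?r = "\<lambda>M i. norm (atom i - onp s (sample_index M) (atom i))"
  have "(\<lambda>M. ?r M i) \<longlonglongrightarrow> 0" if i: "i \<in> idx R" for i
  proof -
    have "supp_in (atom i) {\<alpha>..\<beta>}" using i by (intro idx_supp) (auto intro: L2.span_base)
    from parseval_tendsto[OF eps(1) T_pos(3) s_window[OF this]]
    have "(\<lambda>M. (norm (atom i))\<^sup>2 - (\<Sum>l\<in>sample_index M. (cmod (cinner (atom i) (s l)))\<^sup>2)) \<longlonglongrightarrow> (norm (atom i))\<^sup>2 - (norm (atom i))\<^sup>2"
      by (intro tendsto_intros)
    moreover have "(norm (atom i))\<^sup>2 - (\<Sum>l\<in>sample_index M. (cmod (cinner (atom i) (s l)))\<^sup>2) = (?r M i)\<^sup>2" for M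
      using norm_split_onp[OF s_orthonormal finite_sample_index, of "atom i" M] by linarith
    ultimately have "(\<lambda>M. sqrt ((?r M i)\<^sup>2)) \<longlonglongrightarrow> sqrt 0" by (intro tendsto_real_sqrt) simp
    then show ?thesis by simp
  qed
  then have "(\<lambda>M. \<Sum>i\<in>idx R. ?r M i) \<longlonglongrightarrow> (\<Sum>i\<in>idx R. 0)" by (intro tendsto_sum)
  then have "(\<lambda>M. (\<Sum>i\<in>idx R. ?r M i)\<^sup>2) \<longlonglongrightarrow> (\<Sum>i\<in>idx R. 0)\<^sup>2" by (intro tendsto_power)
  then have "(\<lambda>M. (\<Sum>i\<in>idx R. ?r M i)\<^sup>2) \<longlonglongrightarrow> 0" by simp
  then have "\<forall>\<^sub>F M in sequentially. (\<Sum>i\<in>idx R. ?r M i)\<^sup>2 < 1 - c"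
    by (rule order_tendstoD(2)) (use assms in simp)
  then obtain M0 where M0: "\<And>M. M \<ge> M0 \<Longrightarrow> (\<Sum>i\<in>idx R. ?r M i)\<^sup>2 < 1 - c"
    unfolding eventually_sequentially by blast
  have "c < energy M f" if M: "M \<ge> M0" and f: "f \<in> cspan (atom ` idx R)" "norm f = 1" for M f
  proof -
    have "f = onp atom (idx R) f" using onp_span_eq[OF atom_orthonormal _ f(1)] by simp
    then have fe: "f = (\<Sum>i\<in>idx R. cinner f (atom i) *\<^sub>C atom i)" by (simp add: onp_def)
    define u where "u = (\<Sum>i\<in>idx R. cinner f (atom i) *\<^sub>C onp s (sample_index M) (atom i))"
    have "u \<in> cspan (s ` sample_index M)"
      unfolding u_def by (intro L2.span_sum L2.span_scale onp_in_span)
    from onp_best[OF s_orthonormal finite_sample_index this, of f]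
    have "norm (f - onp s (sample_index M) f) \<le> norm (f - u)" .
    also have "f - u = (\<Sum>i\<in>idx R. cinner f (atom i) *\<^sub>C (atom i - onp s (sample_index M) (atom i)))"
      by (subst fe) (simp add: u_def sum_subtractf L2.scale_right_diff_distrib)
    also have "norm \<dots> \<le> (\<Sum>i\<in>idx R. ?r M i)"
    proof (rule sum_norm_le)
      fix i
      have na: "norm (atom i) = 1" using atom_orthonormal[of UNIV] by (intro norm_eq_one) (simp add: orthonormal_on_def del: atom.simps)
      have "cmod (cinner f (atom i)) \<le> 1" using cauchy_schwarz[of f "atom i"] f(2) na by simp
      then show "norm (cinner f (atom i) *\<^sub>C (atom i - onp s (sample_index M) (atom i))) \<le> ?r M i"
        unfolding norm_cscale by (intro mult_left_le_one_le) auto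
    qed
    finally have "(norm (f - onp s (sample_index M) f))\<^sup>2 \<le> (\<Sum>i\<in>idx R. ?r M i)\<^sup>2" by (intro power_mono) auto
    then have "(norm (f - onp s (sample_index M) f))\<^sup>2 < 1 - c" using M0[OF M] by linarith
    then show ?thesis
      using norm_split_onp[OF s_orthonormal finite_sample_index, of f M] f(2) unfolding energy_def by simp
  qed
  then show ?thesis by blast
qed

text \<open>The run of zeros lies left of the listed wavelets, at the positions from
  \<open>lo n\<close> to \<open>- \<lceil>a\<rceil>\<close>. There are
  \<open>(\<lceil>a\<rceil> - 1) * (2 ^ n - 1)\<close> of them, at least \<open>card Z\<close> for
  large \<open>n\<close> since \<open>\<lceil>a\<rceil> \<ge> 2\<close>. As \<open>Z\<close> is the
  same at every level, the descent can be repeated down to the fixed level \<open>R\<close>.\<close>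

lemma strict_of_lattice:
  assumes a2: "2 \<le> \<lceil>a\<rceil>" and lat: "\<epsilon> * (3 * of_int \<lceil>a\<rceil> - 2) = 1" and c: "0 < c" "c < 1" "\<And>\<xi>. c \<le> Phi K0 \<xi>" and K: "0 \<le> K0" "K0 < K2"
  shows "\<exists>n0. \<forall>n\<ge>n0. \<forall>M f. K2 * 2 ^ Suc n \<le> \<epsilon> * real M / 2 \<longrightarrow> f \<in> cspan (atom ` idx (Suc n)) \<longrightarrow> norm f = 1 \<longrightarrow> c < energy M f"
proof -
  obtain Z where Z: "finite Z" "\<And>x. 0 \<le> x \<Longrightarrow> x \<le> 1 \<Longrightarrow> Phi K0 x \<le> c \<Longrightarrow> x \<in> Z"
    using Phi_eq_finite[OF c(1,3)] by blast
  define B where "B = nat (3 * \<lceil>a\<rceil> - 2)"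
  have "0 \<le> 3 * \<lceil>a\<rceil> - 2" using a2 by linarith
  then have B: "int B = 3 * \<lceil>a\<rceil> - 2" unfolding B_def by (rule int_nat_eq[THEN trans, OF if_P])
  \<comment> \<open>\<open>R1\<close> makes the run long enough, and \<open>R2\<close> lets the gap
    between \<open>K0\<close> and \<open>K2\<close> cover the rounding of the sample range.\<close>
  obtain R1 :: nat where R1: "real (card Z) + 1 < 2 ^ R1" using real_arch_pow[of 2 "real (card Z) + 1"] by auto
  obtain R2 :: nat where R2: "\<epsilon> / (K2 - K0) < 2 ^ R2" using real_arch_pow[of 2 "\<epsilon> / (K2 - K0)"] by auto
  define R where "R = max R1 R2"
  have pw: "(2::real) ^ R1 \<le> 2 ^ n" "(2::real) ^ R2 \<le> 2 ^ n" if "R \<le> n" for n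
    using that by (intro power_increasing; simp add: R_def)+
  obtain M0 where M0: "\<And>M f. M0 \<le> M \<Longrightarrow> f \<in> cspan (atom ` idx R) \<Longrightarrow> norm f = 1 \<Longrightarrow> c < energy M f"
    using energy_eventually_gt[OF c(2), of R] by blast
  have one_step: "f \<in> cspan (atom ` idx n)"
    if n: "R \<le> n" and M: "K2 * 2 ^ Suc n \<le> \<epsilon> * real M / 2" and f: "f \<in> cspan (atom ` idx (Suc n))" "norm f = 1" and low: "energy M f \<le> c" for n M f
  proof -
    have "\<epsilon> / (K2 - K0) \<le> 2 ^ n" using R2 pw[OF n] by linarith
    then have "\<epsilon> \<le> 2 ^ n * (K2 - K0)" using K by (simp add: pos_divide_le_eq)
    also have "\<dots> \<le> 2 ^ Suc n * (K2 - K0)" using K by (intro mult_right_mono) auto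
    finally have M': "K0 * 2 ^ Suc n + \<epsilon> \<le> \<epsilon> * real M / 2" using M by (simp add: algebra_simps)
    have fV: "f \<in> V (int (Suc n))" by (rule idx_in_V[OF f(1)])
    have fs: "supp_in f {\<alpha>..\<beta>}" by (rule idx_supp[OF f(1)])
    have sup: "real r / real (B * 2 ^ Suc n) \<in> Z"
      if r: "r < B * 2 ^ Suc n" "symbol (Suc n) f (real r / real (B * 2 ^ Suc n)) \<noteq> 0" for r
    proof (rule Z(2))
      have "real r \<le> real (B * 2 ^ Suc n)" using r(1) by (simp only: of_nat_le_iff)
      then show "real r / real (B * 2 ^ Suc n) \<le> 1" by (simp only: divide_le_eq_1) auto
      show "Phi K0 (real r / real (B * 2 ^ Suc n)) \<le> c"
        by (rule exact_support[OF lat c(3) M' fV fs f(2) low B r])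
    qed simp
    define m where "m = nat (2 ^ n * \<lceil>a\<rceil> + \<lceil>a\<rceil> - 1)"
    have "0 \<le> 2 ^ n * \<lceil>a\<rceil>" using a2 by simp
    then have "0 \<le> 2 ^ n * \<lceil>a\<rceil> + \<lceil>a\<rceil> - 1" using a2 by linarith
    then have m: "int m \<le> 2 ^ n * \<lceil>a\<rceil> + \<lceil>a\<rceil> - 1" unfolding m_def by (subst int_nat_eq) (simp only: if_True)
    have fm: "f \<in> cspan (atom ` idx_partial n m)" using f(1) unfolding m_def idx_Suc .
    have q: "int (card Z) + 1 \<le> 2 ^ n"
    proof -
      have "real (card Z + 1) \<le> 2 ^ n" using R1 pw(1)[OF n] by (simp only: of_nat_add of_nat_1)
      then have "card Z + 1 \<le> 2 ^ n" by (simp only: of_nat_le_numeral_power_cancel_iff)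
      then have "int (card Z + 1) \<le> int (2 ^ n)" by (simp only: of_nat_le_iff)
      then show ?thesis by simp
    qed
    have "(\<lceil>a\<rceil> - 1) * (int (card Z) + 1) \<le> (\<lceil>a\<rceil> - 1) * 2 ^ n" using q a2 by (intro mult_left_mono) auto
    moreover have "1 * int (card Z) \<le> (\<lceil>a\<rceil> - 1) * int (card Z)" using a2 by (intro mult_right_mono) auto
    ultimately have end_run: "lo n + int (card Z) \<le> - \<lceil>a\<rceil> + 1" by (simp add: lo_def algebra_simps)
    show ?thesis
    proof (rule drop_level_of_zero_run[OF fm m B Z(1) sup, of "lo n"])
      have "0 \<le> hi (Suc n)" using a2 by (simp add: hi_def)
      moreover have "2 * (l + q - 1) + A < h" if "0 \<le> h" "l + q \<le> - A + 1" "2 \<le> A" for l q h A :: int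
        using that by presburger
      ultimately show "2 * (lo n + int (card Z) - 1) + \<lceil>a\<rceil> < hi (Suc n)" using end_run a2 by blast
      show "cinner f (wavelet_atom \<psi> (int n) k) = 0" if "lo n \<le> k" "k < lo n + int (card Z)" for k
      proof -
        have "Inr (n, k) \<notin> idx (Suc n)" using that end_run by (auto simp: idx_def)
        from atom_perp[OF f(1) this] show ?thesis by simp
      qed
    qed simp_all
  qed
  have desc: "f \<in> cspan (atom ` idx R)"
    if "R \<le> n" "K2 * 2 ^ n \<le> \<epsilon> * real M / 2" "f \<in> cspan (atom ` idx n)" "norm f = 1" "energy M f \<le> c" for n M f
    using that
  proof (induction n rule: dec_induct)
    case (step n)
    have "K2 * 2 ^ n \<le> K2 * 2 ^ Suc n" using K by (intro mult_left_mono) auto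
    then have "K2 * 2 ^ n \<le> \<epsilon> * real M / 2" using step.prems(1) by linarith
    moreover have "f \<in> cspan (atom ` idx n)" by (rule one_step[OF step.hyps(1) step.prems])
    ultimately show ?case using step.IH step.prems by blast
  qed
  \<comment> \<open>\<open>R3\<close> makes \<open>M\<close> so large that unit vectors in the fixed
    space of level \<open>R\<close> have energy above \<open>c\<close>, which contradicts the
    descent.\<close>
  obtain R3 :: nat where R3: "\<epsilon> * real M0 / (2 * K2) < 2 ^ R3" using real_arch_pow[of 2 "\<epsilon> * real M0 / (2 * K2)"] by auto
  show ?thesis
  proof (intro exI allI impI)
    fix n M f
    assume n: "max R R3 \<le> n" and M: "K2 * 2 ^ Suc n \<le> \<epsilon> * real M / 2" and f: "f \<in> cspan (atom ` idx (Suc n))" "norm f = 1"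
    show "c < energy M f"
    proof (rule ccontr)
      assume "\<not> ?thesis"
      then have low: "energy M f \<le> c" by simp
      have "f \<in> cspan (atom ` idx R)" by (rule desc[OF _ M f low]) (use n in simp)
      moreover have "M0 \<le> M"
      proof -
        have "(2::real) ^ R3 \<le> 2 ^ Suc n" using n by (intro power_increasing) auto
        then have "\<epsilon> * real M0 / (2 * K2) \<le> 2 ^ Suc n" using R3 by linarith
        then have "\<epsilon> * real M0 \<le> 2 * (K2 * 2 ^ Suc n)" using K by (simp add: pos_divide_le_eq mult_ac)
        then have "\<epsilon> * real M0 \<le> \<epsilon> * real M" using M by linarith
        then show ?thesis using eps by simp
      qed
      ultimately show False using M0[of M f] f(2) low by simp
    qed
  qed
qed

end

section \<open>The Haar wavelet\<close>

text \<open>\<open>fourier_atom 0 1 1 0\<close> is the indicator of \<open>[0, 1]\<close>, the Haar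
  scaling function.\<close>

lemma fourier_unit_interval:
  assumes "\<omega> \<noteq> 0"
  shows "cmod (fourier (fourier_atom 0 1 1 0) \<omega>) = \<bar>sin (pi * \<omega>)\<bar> / (pi * \<bar>\<omega>\<bar>)"
  using assms
proof transfer
  fix \<omega> :: real assume w: "\<omega> \<noteq> 0"
  define F where "F x = e2 (- \<omega> * x) / (2 * pi * \<i> * (- \<omega>))" for x :: real
  have "has_bochner_integral lborel (\<lambda>x. indicator {0..1} x *\<^sub>R e2 (- \<omega> * x)) (F 1 - F 0)"
  proof (rule has_bochner_integral_FTC_Icc)
    show "(F has_vector_derivative e2 (- \<omega> * x)) (at x within {0..1})" for x
      unfolding F_def
      using has_vector_derivative_divide[OF has_vector_derivative_e2[of "- \<omega>" x "{0..1}"], of "2 * pi * \<i> * (- \<omega>)"] w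
      by simp
    show "continuous_on {0..1} (\<lambda>x. e2 (- \<omega> * x))" by (intro continuous_intros)
  qed simp
  then have "(LINT x|lborel. indicator {0..1} x *\<^sub>R e2 (- \<omega> * x)) = F 1 - F 0"
    by (rule has_bochner_integral_integral_eq)
  also have "F 1 - F 0 = (e2 (- \<omega>) - 1) / (2 * pi * \<i> * (- \<omega>))" by (simp add: F_def diff_divide_distrib)
  also have "cmod \<dots> = \<bar>sin (pi * \<omega>)\<bar> / (pi * \<bar>\<omega>\<bar>)"
    unfolding norm_divide norm_e2_minus_1 by (simp add: norm_mult)
  finally show "cmod (LINT x|lborel. complex_of_real (sqrt 1) * exp (\<i> * complex_of_real (2 * pi * of_int 0 * 1 * x)) *
      indicator {- 0 / (1 * (0 + 1))..1 / (1 * (0 + 1))} x * e2 (- (\<omega> * x))) = \<bar>sin (pi * \<omega>)\<bar> / (pi * \<bar>\<omega>\<bar>)"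
    by (simp add: scaleR_conv_of_real of_real_indicator)
qed

text \<open>The squared modulus of the Fourier transform of the indicator of
  \<open>[0, 1]\<close>.\<close>

definition sinc2 :: "real \<Rightarrow> real" where "sinc2 x = (if x = 0 then 1 else (sin (pi * x) / (pi * x))\<^sup>2)"

lemma sinc2_nonneg [simp]: "0 \<le> sinc2 x"
  by (simp add: sinc2_def)

lemma sinc2_abs [simp]: "sinc2 \<bar>x\<bar> = sinc2 x"
  by (cases "0 \<le> x") (simp_all add: sinc2_def)

lemma sinc2_eq_0D: "sinc2 x = 0 \<Longrightarrow> x \<in> \<int>"
  using sin_zero_iff_int2[of "pi * x"] by (auto simp: sinc2_def split: if_splits)

text \<open>The mean slope of the sine over \<open>[0, x]\<close> exceeds the one over
  \<open>[x, y]\<close>, as the cosine decreases.\<close>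

lemma sin_over_id_less:
  assumes "0 < x" "x < y" "y \<le> pi"
  shows "sin y * x < sin x * y"
proof -
  obtain s where s: "0 < s" "s < x" "sin x - sin 0 = (x - 0) * cos s"
    using MVT2[OF assms(1), of sin cos] by (auto intro: DERIV_sin)
  obtain t where t: "x < t" "t < y" "sin y - sin x = (y - x) * cos t"
    using MVT2[OF assms(2), of sin cos] by (auto intro: DERIV_sin)
  have "cos t < cos s" using s t assms by (intro cos_monotone_0_pi) auto
  then have "x * (y - x) * cos t < x * (y - x) * cos s" using assms by (intro mult_strict_left_mono) auto
  moreover have e: "sin y = sin x + (y - x) * cos t" "sin x = x * cos s" using s(3) t(3) by auto
  moreover have "sin y * x = sin x * x + x * (y - x) * cos t" unfolding e(1) by (simp add: algebra_simps)
  moreover have "sin x * y = sin x * x + x * (y - x) * cos s" unfolding e(2) by (simp add: algebra_simps)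
  ultimately show ?thesis by linarith
qed

lemma sinc2_less:
  assumes "0 < x" "x < y" "y \<le> 1"
  shows "sinc2 y < sinc2 x"
proof -
  have "sin (pi * y) * (pi * x) < sin (pi * x) * (pi * y)" using assms by (intro sin_over_id_less) auto
  then have "sin (pi * y) / (pi * y) < sin (pi * x) / (pi * x)" using assms by (simp add: field_simps)
  moreover have "0 \<le> sin (pi * y) / (pi * y)" using assms by (intro divide_nonneg_pos sin_ge_zero) auto
  ultimately have "(sin (pi * y) / (pi * y))\<^sup>2 < (sin (pi * x) / (pi * x))\<^sup>2" by (intro power_strict_mono) auto
  then show ?thesis using assms by (simp add: sinc2_def)
qed

text \<open>By the double angle formula everything reduces to
  \<open>v\<^sup>2 \<le> S\<^sup>2 * ((1 - v)\<^sup>2 + v\<^sup>2)\<close>. This follows from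
  \<open>2 * v\<^sup>2 \<le> S\<^sup>2\<close>, as \<open>sin x / x\<close> decreases up to
  \<open>pi / 4\<close>, and from \<open>1 / 2 \<le> (1 - v)\<^sup>2 + v\<^sup>2\<close>.\<close>

lemma sinc2_halfway:
  assumes "0 < v" "v \<le> 1 / 2"
  shows "sinc2 ((1 - v) / 2) \<le> sinc2 v + sinc2 (1 - v)"
proof -
  define S C where "S = sin (pi * v / 2)" and "C = cos (pi * v / 2)"
  have S: "2 * v\<^sup>2 \<le> S\<^sup>2"
  proof -
    have "sin (pi / 4) * (pi * v / 2) \<le> S * (pi / 4)"
    proof (cases "v = 1 / 2")
      case False
      then show ?thesis unfolding S_def using assms by (intro less_imp_le sin_over_id_less) auto
    next
      case True
      show ?thesis unfolding S_def True by simp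
    qed
    then have "sqrt 2 * v \<le> S" by (simp add: sin_45 field_simps)
    then have "(sqrt 2 * v)\<^sup>2 \<le> S\<^sup>2" using assms by (intro power_mono) auto
    then show ?thesis by (simp add: power_mult_distrib)
  qed
  have C: "sin (pi * (1 - v) / 2) = C"
    unfolding C_def by (subst cos_sin_eq) (simp add: diff_divide_distrib right_diff_distrib)
  have d: "sin (pi * v) = 2 * S * C" using sin_double[of "pi * v / 2"] by (simp add: S_def C_def)
  have d': "sin (pi * (1 - v)) = 2 * S * C" unfolding d[symmetric] by (simp add: right_diff_distrib)
  have v1: "0 < 1 - v" using assms by simp
  have "1 \<le> 2 * ((1 - v)\<^sup>2 + v\<^sup>2)"
    using zero_le_power2[of "1 - 2 * v"] by (simp add: power2_eq_square algebra_simps)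
  then have "v\<^sup>2 * 1 \<le> v\<^sup>2 * (2 * ((1 - v)\<^sup>2 + v\<^sup>2))" by (intro mult_left_mono) auto
  also have "\<dots> = (2 * v\<^sup>2) * ((1 - v)\<^sup>2 + v\<^sup>2)" by simp
  also have "\<dots> \<le> S\<^sup>2 * ((1 - v)\<^sup>2 + v\<^sup>2)" using S by (intro mult_right_mono) auto
  finally have key: "v\<^sup>2 \<le> S\<^sup>2 * ((1 - v)\<^sup>2 + v\<^sup>2)" by simp
  have "1 / (1 - v)\<^sup>2 = v\<^sup>2 / (v\<^sup>2 * (1 - v)\<^sup>2)" using assms by simp
  also have "\<dots> \<le> (S\<^sup>2 * ((1 - v)\<^sup>2 + v\<^sup>2)) / (v\<^sup>2 * (1 - v)\<^sup>2)" using key by (intro divide_right_mono) auto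
  also have "\<dots> = S\<^sup>2 / v\<^sup>2 + S\<^sup>2 / (1 - v)\<^sup>2" using assms v1 by (simp add: field_simps)
  finally have "4 * C\<^sup>2 / pi\<^sup>2 * (1 / (1 - v)\<^sup>2) \<le> 4 * C\<^sup>2 / pi\<^sup>2 * (S\<^sup>2 / v\<^sup>2 + S\<^sup>2 / (1 - v)\<^sup>2)"
    by (intro mult_left_mono) auto
  moreover have sc: "sinc2 x = (sin (pi * x))\<^sup>2 / pi\<^sup>2 * (1 / x\<^sup>2)" if "x \<noteq> 0" for x
    using that by (simp add: sinc2_def power_divide power_mult_distrib)
  moreover have "sinc2 ((1 - v) / 2) = 4 * C\<^sup>2 / pi\<^sup>2 * (1 / (1 - v)\<^sup>2)"
    using C v1 by (simp add: sinc2_def power_divide power_mult_distrib)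
  moreover have "sinc2 v + sinc2 (1 - v) = 4 * C\<^sup>2 / pi\<^sup>2 * (S\<^sup>2 / v\<^sup>2 + S\<^sup>2 / (1 - v)\<^sup>2)"
    using sc[of v] sc[of "1 - v"] assms unfolding d d' by (simp add: power_mult_distrib distrib_left mult_ac)
  ultimately show ?thesis by simp
qed

text \<open>Since the sums \<open>P K0\<close> and \<open>P (2 * K1)\<close> agree at \<open>\<xi>\<close>, no translate of \<open>\<xi>\<close> has modulus in
  \<open>(K0, 2 * K1]\<close>. This pins down \<open>K0\<close> so well that some point \<open>y\<close> has the single translate \<open>y\<close> of
  modulus at most \<open>K0\<close>, and there the sum is too small.\<close>

lemma haar_contradiction:
  fixes P :: "real \<Rightarrow> real \<Rightarrow> real"
  assumes P: "\<And>K x. P K x = (\<Sum>k\<in>near K x. sinc2 (x + of_int k))"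
    and c: "0 < c" "c < 1" "\<And>x. c \<le> P K0 x" and K: "K0 < K1" and \<xi>: "P (2 * K1) \<xi> \<le> c"
  shows False
proof -
  have ne: "\<exists>k. \<bar>x + of_int k\<bar> \<le> K0" for x
  proof (rule ccontr)
    assume "\<not> ?thesis"
    then have "near K0 x = {}" by (auto simp: near_def)
    then show False using c(1) c(3)[of x] P[of K0 x] by simp
  qed
  \<comment> \<open>No translate of \<open>1 / 2\<close> has modulus below
    \<open>1 / 2\<close>.\<close>
  obtain k0 where k0: "\<bar>1 / 2 + real_of_int k0\<bar> \<le> K0" using ne by blast
  have "1 / 2 \<le> \<bar>1 / 2 + real_of_int k0\<bar>" by (cases "0 \<le> k0") linarith+
  then have K0: "1 / 2 \<le> K0" using k0 by linarith
  have lower: "sinc2 (\<xi> + of_int i) + (if i = j then 0 else sinc2 (\<xi> + of_int j)) \<le> P K \<xi>" if "i \<in> near K \<xi>" "j \<in> near K \<xi>" for i j K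
  proof -
    have "(\<Sum>k\<in>{i, j}. sinc2 (\<xi> + of_int k)) \<le> P K \<xi>"
      unfolding P using that by (intro sum_mono2) auto
    then show ?thesis by auto
  qed
  have nint: "\<xi> \<notin> \<int>"
  proof
    assume "\<xi> \<in> \<int>"
    then obtain z where z: "\<xi> = of_int z" by (auto elim: Ints_cases)
    have "- z \<in> near (2 * K1) \<xi>" using K K0 by (simp add: near_def z)
    from lower[OF this this] show False using \<xi> c(2) by (simp add: z sinc2_def)
  qed
  \<comment> \<open>A translate there would raise the sum above the one for \<open>K0\<close> unless
    it contributed 0, but \<open>sinc2\<close> has only integer zeros and \<open>\<xi>\<close> is
    not an integer.\<close>
  have annulus: "\<not> (K0 < \<bar>\<xi> + of_int k\<bar> \<and> \<bar>\<xi> + of_int k\<bar> \<le> 2 * K1)" for k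
  proof
    assume k: "K0 < \<bar>\<xi> + of_int k\<bar> \<and> \<bar>\<xi> + of_int k\<bar> \<le> 2 * K1"
    have "sum (\<lambda>k. sinc2 (\<xi> + of_int k)) (insert k (near K0 \<xi>)) \<le> P (2 * K1) \<xi>"
      unfolding P by (intro sum_mono2 finite_near) (use K K0 k in \<open>auto simp: near_def\<close>)
    moreover have "k \<notin> near K0 \<xi>" using k by (auto simp: near_def)
    ultimately have "sinc2 (\<xi> + of_int k) + P K0 \<xi> \<le> c" using \<xi> by (simp add: P)
    then have "sinc2 (\<xi> + of_int k) = 0" using c(3)[of \<xi>] sinc2_nonneg[of "\<xi> + of_int k"] by linarith
    then have "\<xi> + of_int k \<in> \<int>" by (rule sinc2_eq_0D)
    then have "\<xi> + of_int k - of_int k \<in> \<int>" by (intro Ints_diff Ints_of_int)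
    then show False using nint by simp
  qed
  define r where "r = frac \<xi>"
  have r: "0 < r" "r < 1" using nint by (simp_all add: r_def frac_lt_1)
  have rk: "\<xi> + of_int (k - \<lfloor>\<xi>\<rfloor>) = r + of_int k" for k by (simp add: r_def frac_def)
  have ann: "\<not> (K0 < \<bar>r + of_int k\<bar> \<and> \<bar>r + of_int k\<bar> \<le> 2 * K1)" for k using annulus[of "k - \<lfloor>\<xi>\<rfloor>"] unfolding rk .
  \<comment> \<open>Some translate of \<open>\<xi>\<close> lies in \<open>(K0, K0 + 1]\<close>,
    which for \<open>K0 \<ge> 1\<close> is part of the forbidden annulus.\<close>
  have K01: "K0 < 1"
  proof (rule ccontr)
    assume "\<not> K0 < 1"
    moreover have "K0 < r + of_int (\<lfloor>K0 - r\<rfloor> + 1)" "r + of_int (\<lfloor>K0 - r\<rfloor> + 1) \<le> K0 + 1" by (simp; linarith)+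
    ultimately show False using ann[of "\<lfloor>K0 - r\<rfloor> + 1"] K by linarith
  qed
  \<comment> \<open>\<open>v\<close> is the distance of \<open>\<xi>\<close> from the integers; the
    moduli of its translates include \<open>v\<close>, \<open>1 - v\<close> and
    \<open>1 + v\<close>.\<close>
  define v where "v = min r (1 - r)"
  have v: "0 < v" "v \<le> 1 / 2" using r by (auto simp: v_def min_def)
  have "1 - v = r \<or> 1 - v = 1 - r" "1 + v = 1 + r \<or> 1 + v = 2 - r" by (auto simp: v_def)
  then have av: "\<not> (K0 < 1 - v \<and> 1 - v \<le> 2 * K1)" "\<not> (K0 < 1 + v \<and> 1 + v \<le> 2 * K1)"
    using ann[of 0] ann[of "-1"] ann[of 1] ann[of "-2"] r by auto
  \<comment> \<open>\<open>1 - v\<close> is below \<open>2 * K1\<close>, so avoiding the annulus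
    puts it at most at \<open>K0\<close>; \<open>1 + v\<close> is above \<open>K0\<close>, so it
    exceeds \<open>2 * K1\<close>.\<close>
  have v1: "1 - v \<le> K0" "2 * K0 < 1 + v" using av v K K0 K01 by linarith+
  have "sinc2 v + sinc2 (1 - v) = sinc2 r + sinc2 (r - 1)"
    using sinc2_abs[of "1 - r"] sinc2_abs[of "r - 1"] by (auto simp: v_def min_def abs_minus_commute)
  also have "\<dots> \<le> P (2 * K1) \<xi>"
    using lower[of "0 - \<lfloor>\<xi>\<rfloor>" "2 * K1" "- 1 - \<lfloor>\<xi>\<rfloor>"] K K0 r unfolding near_def mem_Collect_eq rk by simp
  finally have vc: "sinc2 v + sinc2 (1 - v) \<le> c" using \<xi> by linarith
  \<comment> \<open>Below \<open>1 - K0\<close> the translate \<open>y - 1\<close> is out of reach;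
    above \<open>(1 - v) / 2\<close> the value of \<open>sinc2\<close> is too small.\<close>
  obtain y where y: "(1 - v) / 2 < y" "y < 1 - K0"
  proof (rule exE[OF dense])
    show "(1 - v) / 2 < 1 - K0" using v1(2) by (simp add: field_simps)
  qed blast
  have "0 < (1 - v) / 2" using v by simp
  then have y0: "0 < y" using y(1) by (rule less_trans)
  have "near K0 y = {0}"
  proof (intro equalityI subsetI)
    fix k assume "k \<in> near K0 y"
    then have "\<bar>y + of_int k\<bar> \<le> K0" by (simp add: near_def)
    then have "real_of_int k < 1" "- 1 < real_of_int k" using y(2) y0 K01 unfolding abs_le_iff by linarith+
    then show "k \<in> {0}" by simp
  next
    fix k :: int assume "k \<in> {0}"
    then show "k \<in> near K0 y" using y(2) y0 K0 by (simp add: near_def)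
  qed
  then have "P K0 y = sinc2 y" by (simp add: P)
  then have "c \<le> sinc2 y" using c(3)[of y] by simp
  also have "\<dots> < sinc2 ((1 - v) / 2)" using y v K0 by (intro sinc2_less) auto
  also have "\<dots> \<le> sinc2 v + sinc2 (1 - v)" by (rule sinc2_halfway[OF v])
  finally show False using vc by simp
qed


section \<open>Identification of the scaling function supported on \<open>[0, 1]\<close>\<close>

context wavelets
begin

context
  assumes haar: "a = 1"
begin

text \<open>The indicator of \<open>[0, 1]\<close> is approximated from some
  \<open>V (int J)\<close>. Its projection involves only the \<open>2 ^ J\<close> translates inside
  \<open>[0, 1]\<close>, each with squared coefficient
  \<open>(cmod (fourier \<phi> 0))\<^sup>2 / 2 ^ J\<close>. They add up to
  \<open>(cmod (fourier \<phi> 0))\<^sup>2\<close>, which must be close to 1.\<close>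

lemma haar_density: "1 \<le> (cmod (fourier \<phi> 0))\<^sup>2"
proof (rule field_le_epsilon)
  fix d :: real assume d: "0 < d"
  let ?u = "fourier_atom 0 1 1 0"
  have u: "supp_in ?u {0..1}" using supp_in_fourier_atom[of 0 1 1 0] by simp
  have nu: "norm ?u = 1" using fourier_atom_orthonormal[of 1 0 1 UNIV] by (intro norm_eq_one) (simp add: orthonormal_on_def)
  have "?u \<in> closure (\<Union>j. V j)" using mra by (simp add: multiresolution_analysis_def)
  then obtain j v where "v \<in> V j" "dist v ?u < sqrt d" using d unfolding closure_approachable by (metis UN_E real_sqrt_gt_zero)
  moreover define J where "J = nat j"
  moreover have "V j \<subseteq> V (int J)" unfolding J_def by (rule V_mono) simp
  ultimately have v: "v \<in> V (int J)" "norm (v - ?u) < sqrt d" by (auto simp: dist_norm)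
  define F :: "int set" where "F = {0..<2 ^ J}"
  let ?e = "wavelet_atom \<phi> (int J)"
  have on: "orthonormal_on ?e A" for A by (simp add: orthonormal_on_def phi_orthonormal)
  have fin: "finite F" by (simp add: F_def)
  define \<rho> where "\<rho> = ?u - onp ?e F ?u"
  have perp: "cinner \<rho> (?e k) = 0" for k
  proof (cases "k \<in> F")
    case True
    then show ?thesis unfolding \<rho>_def by (intro cinner_onp_residual[OF on fin] L2.span_base) auto
  next
    case False
    have p: "(0::real) < 2 ^ J" by simp
    have "real_of_int k + 1 \<le> 0 \<or> (2::real) ^ J \<le> of_int k"
    proof (cases "k < 0")
      case True
      then have "k + 1 \<le> 0" by simp
      then have "real_of_int (k + 1) \<le> 0" by (simp only: of_int_le_0_iff)
      then show ?thesis by simp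
    next
      case nn: False
      then have "2 ^ J \<le> k" using False by (simp add: F_def)
      then have "real_of_int (2 ^ J) \<le> of_int k" by (simp only: of_int_le_iff)
      then show ?thesis by simp
    qed
    then have "cinner ?u (?e k) = 0"
      by (intro cinner_atom_disjoint[OF supp_phi u]) (use p haar in \<open>auto simp: field_simps\<close>)
    moreover have "cinner (onp ?e F ?u) (?e k) = 0"
      unfolding onp_def cinner_sum_left cinner_scale_left phi_orthonormal using False by (intro sum.neutral) auto
    ultimately show ?thesis by (simp add: \<rho>_def cinner_diff_left)
  qed
  have perpV: "cinner \<rho> g = 0" if g: "g \<in> V (int J)" for g
  proof -
    define h where "h = wavelet_atom g (- int J) 0"
    have "h \<in> V 0" using V_undilate[of g 0 J] g by (simp add: h_def)
    then have h: "h \<in> closure (cspan (range (\<lambda>k. wavelet_atom \<phi> 0 k)))" using V0_basis by (simp add: orthonormal_basis_def)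
    have dil: "cinner (wavelet_atom \<rho> (- int J) 0) f = cinner \<rho> (wavelet_atom f (int J) 0)" for f
      using cinner_wavelet_atom[of "wavelet_atom \<rho> (- int J) 0" "int J" 0 f] by (simp add: wavelet_atom_inverse)
    have "cinner (wavelet_atom \<rho> (- int J) 0) h = 0"
    proof (rule cinner_closure_zero[OF _ h])
      show "cinner (wavelet_atom \<rho> (- int J) 0) f = 0" if "f \<in> cspan (range (\<lambda>k. wavelet_atom \<phi> 0 k))" for f
        by (rule cinner_span_zero[OF _ that]) (auto simp: dil wavelet_atom_translate perp)
    qed
    then show ?thesis unfolding dil by (simp add: h_def wavelet_atom_inverse)
  qed
  have "onp ?e F ?u - v \<in> V (int J)"
    using v(1) phi_in_V unfolding onp_def
    by (intro L2.subspace_diff L2.subspace_sum L2.subspace_scale V_subspace) auto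
  then have "cinner \<rho> (onp ?e F ?u - v) = 0" by (rule perpV)
  from norm_add_orthogonal[OF this] have "(norm \<rho>)\<^sup>2 \<le> (norm (?u - v))\<^sup>2" by (simp add: \<rho>_def)
  also have "\<dots> \<le> (sqrt d)\<^sup>2" using v(2) by (intro power_mono) (auto simp: norm_minus_commute)
  finally have small: "(norm \<rho>)\<^sup>2 \<le> d" using d by simp
  have coeff: "(cmod (cinner ?u (?e k)))\<^sup>2 = (cmod (fourier \<phi> 0))\<^sup>2 / 2 ^ J" if k: "k \<in> F" for k
  proof -
    have "supp_in (?e k) {of_int k / 2 powi int J..(of_int k + a) / 2 powi int J}"
      by (rule supp_in_atom_interval[OF supp_phi])
    moreover have "{of_int k / 2 powi int J..(of_int k + a) / 2 powi int J} \<subseteq> {0..1}"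
    proof -
      have "0 \<le> k" "k + 1 \<le> 2 ^ J" using k by (auto simp: F_def)
      then have "0 \<le> real_of_int k" "real_of_int (k + 1) \<le> real_of_int (2 ^ J)" by (simp_all only: of_int_le_iff of_int_0_le_iff)
      then show ?thesis using haar by (auto simp: field_simps)
    qed
    ultimately have "supp_in (?e k) {0..1}" by (rule supp_in_mono)
    then have "cinner (?e k) ?u = fourier (?e k) 0" using cinner_fourier_atom[of "?e k" 0 1 1 0] by simp
    also have "\<dots> = complex_of_real (2 powr (- real J / 2)) * fourier \<phi> 0" by (simp add: fourier_wavelet_atom)
    finally have "cmod (cinner ?u (?e k)) = 2 powr (- real J / 2) * cmod (fourier \<phi> 0)"
      using cinner_commute[of ?u "?e k"] by (simp add: norm_mult)
    moreover have "(2 powr (- real J / 2))\<^sup>2 = 1 / (2::real) ^ J"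
    proof -
      have "(2 powr (- real J / 2))\<^sup>2 = (2::real) powr (- real J / 2 + - real J / 2)" unfolding power2_eq_square powr_add ..
      then show ?thesis by (simp add: powr_minus powr_realpow divide_simps)
    qed
    ultimately show ?thesis by (simp add: power_mult_distrib)
  qed
  have "1 = (\<Sum>k\<in>F. (cmod (cinner ?u (?e k)))\<^sup>2) + (norm \<rho>)\<^sup>2"
    using norm_split_onp[OF on fin, of ?u] nu by (simp add: \<rho>_def)
  also have "(\<Sum>k\<in>F. (cmod (cinner ?u (?e k)))\<^sup>2) = (cmod (fourier \<phi> 0))\<^sup>2" by (simp add: coeff) (simp add: F_def)
  finally show "1 \<le> (cmod (fourier \<phi> 0))\<^sup>2 + d" using small by linarith
qed

text \<open>By \<open>haar_density\<close> the projection of the indicator of \<open>[0, 1]\<close>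
  onto \<open>\<phi>\<close> loses no norm, so the two differ by a unimodular factor.\<close>

lemma haar_fourier: "(cmod (fourier \<phi> \<omega>))\<^sup>2 = sinc2 \<omega>"
proof -
  let ?u = "fourier_atom 0 1 1 0"
  have phi: "supp_in \<phi> {0..1}" using supp_phi haar by simp
  have nu: "norm ?u = 1" using fourier_atom_orthonormal[of 1 0 1 UNIV] by (intro norm_eq_one) (simp add: orthonormal_on_def)
  have on: "orthonormal_on (\<lambda>k. wavelet_atom \<phi> 0 k) {0}" using phi_orthonormal[of 0 0 0] by (simp add: orthonormal_on_def)
  define l where "l = cinner ?u \<phi>"
  have "cinner \<phi> ?u = fourier \<phi> 0" using cinner_fourier_atom[of \<phi> 0 1 1 0] phi by simp
  then have l: "cmod l = cmod (fourier \<phi> 0)" using cinner_commute[of ?u \<phi>] by (simp add: l_def)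
  have "1 = (cmod l)\<^sup>2 + (norm (?u - l *\<^sub>C \<phi>))\<^sup>2"
    using norm_split_onp[OF on, of ?u] nu by (simp add: onp_def l_def)
  then have l1: "(cmod l)\<^sup>2 = 1" and "(norm (?u - l *\<^sub>C \<phi>))\<^sup>2 = 0"
    using haar_density zero_le_power2[of "norm (?u - l *\<^sub>C \<phi>)"] unfolding l by linarith+
  then have ul: "?u = l *\<^sub>C \<phi>" by simp
  show ?thesis
  proof (cases "\<omega> = 0")
    case True
    then show ?thesis using l1 unfolding l by (simp add: sinc2_def)
  next
    case False
    have "(cmod (fourier ?u \<omega>))\<^sup>2 = (cmod (fourier \<phi> \<omega>))\<^sup>2"
      unfolding ul fourier_scale norm_mult power_mult_distrib l1 by simp
    then show ?thesis using fourier_unit_interval[OF False] False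
      by (simp add: sinc2_def power_divide power_mult_distrib)
  qed
qed

end

end

context generalized_sampling
begin

text \<open>The aim is to reach the cutoff \<open>2 * K1\<close>, for which \<open>Phi\<close>
  exceeds \<open>c\<close> everywhere. If at least \<open>card Z\<close> wavelets of scale
  \<open>n\<close> are missing, they form a run of zeros at the right end, and \<open>f\<close>
  drops one level, where the samples reach twice as far relative to the scale. Otherwise
  \<open>N\<close> is nearly \<open>2 ^ Suc n\<close> and the samples reach far enough without
  dropping.\<close>

lemma strict_of_haar:
  assumes one: "\<lceil>a\<rceil> = 1" and lat: "\<epsilon> * (3 * of_int \<lceil>a\<rceil> - 2) = 1"
    and c: "0 < c" "c < 1" "\<And>\<xi>. c \<le> Phi K0 \<xi>" and K: "0 \<le> K0" "K0 < K2"
  shows "\<exists>n0. \<forall>n\<ge>n0. \<forall>m M f. int m \<le> 2 ^ n * \<lceil>a\<rceil> + \<lceil>a\<rceil> - 1 \<longrightarrow> 2 * K2 * (2 ^ n + real m) \<le> \<epsilon> * real M / 2 \<longrightarrow>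
    f \<in> cspan (atom ` idx_partial n m) \<longrightarrow> norm f = 1 \<longrightarrow> c < energy M f"
proof -
  obtain Z where Z: "finite Z" "\<And>x. 0 \<le> x \<Longrightarrow> x \<le> 1 \<Longrightarrow> Phi K0 x \<le> c \<Longrightarrow> x \<in> Z"
    using Phi_eq_finite[OF c(1,3)] by blast
  have haar: "a = 1" using one a1 ceiling_a(2) by simp
  define K1 where "K1 = (K0 + K2) / 2"
  have K1: "K0 < K1" "K0 \<le> 2 * K1" using K by (auto simp: K1_def)
  have not_le: "\<not> Phi (2 * K1) \<xi> \<le> c" for \<xi>
  proof
    assume \<xi>: "Phi (2 * K1) \<xi> \<le> c"
    show False by (rule haar_contradiction[of Phi c K0 K1 \<xi>]) (use c K1 \<xi> in \<open>auto simp: Phi_def haar_fourier[OF haar]\<close>)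
  qed
  have c2: "c \<le> Phi (2 * K1) \<xi>" for \<xi> using c(3)[of \<xi>] Phi_mono[OF K1(2), of \<xi>] by linarith
  have B: "int 1 = 3 * \<lceil>a\<rceil> - 2" using one by simp
  \<comment> \<open>With energy at most \<open>c\<close> the symbol would vanish at every lattice
    point, because no point satisfies \<open>Phi (2 * K1) \<xi> \<le> c\<close>.\<close>
  have gt: "c < energy M f" if M: "2 * K1 * 2 ^ J + \<epsilon> \<le> \<epsilon> * real M / 2" and f: "f \<in> V (int J)" "supp_in f {\<alpha>..\<beta>}" "norm f = 1" for J M f
  proof (rule ccontr)
    assume "\<not> ?thesis"
    then have low: "energy M f \<le> c" by simp
    have "symbol J f (real r / real (1 * 2 ^ J)) = 0" if "r < 1 * 2 ^ J" for r
      using exact_support[OF lat c2 M f low B that] not_le by blast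
    then have "(\<Sum>r<1 * 2 ^ J. (cmod (symbol J f (real r / real (1 * 2 ^ J))))\<^sup>2) = 0" by (intro sum.neutral) auto
    moreover have "(\<Sum>r<1 * 2 ^ J. (cmod (symbol J f (real r / real (1 * 2 ^ J))))\<^sup>2) = real (1 * 2 ^ J) * (norm f)\<^sup>2"
      by (rule symbol_parseval[OF f(1,2)]) (use B in simp)
    ultimately show False using f(3) by simp
  qed
  \<comment> \<open>From here on the margin between \<open>K0\<close> and \<open>K2\<close> pays for
    up to \<open>card Z\<close> missing wavelets and for the rounding of the sample range.\<close>
  obtain n0 :: nat where n0: "(2 * K2 * card Z + \<epsilon>) / (K2 - K0) < 2 ^ n0"
    using real_arch_pow[of 2 "(2 * K2 * card Z + \<epsilon>) / (K2 - K0)"] by auto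
  show ?thesis
  proof (intro exI allI impI)
    fix n m M f
    assume n: "n0 \<le> n" and m: "int m \<le> 2 ^ n * \<lceil>a\<rceil> + \<lceil>a\<rceil> - 1" and M: "2 * K2 * (2 ^ n + real m) \<le> \<epsilon> * real M / 2"
      and f: "f \<in> cspan (atom ` idx_partial n m)" "norm f = 1"
    have "(2::real) ^ n0 \<le> 2 ^ n" using n by (intro power_increasing) auto
    then have "(2 * K2 * card Z + \<epsilon>) / (K2 - K0) \<le> 2 ^ n" using n0 by linarith
    then have big: "2 * K2 * card Z + \<epsilon> \<le> 2 ^ n * (K2 - K0)" using K by (simp add: pos_divide_le_eq)
    have M': "2 * (K2 * 2 ^ n) + 2 * (K2 * real m) \<le> \<epsilon> * real M / 2" using M by (simp add: algebra_simps)
    have big': "2 * (K2 * card Z) + \<epsilon> \<le> K2 * 2 ^ n - K0 * 2 ^ n" using big by (simp add: algebra_simps)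
    have K1p: "2 * K1 * 2 ^ n = K0 * 2 ^ n + K2 * 2 ^ n" by (simp add: K1_def algebra_simps)
    have K2q: "0 \<le> K2 * card Z" "0 \<le> K2 * real m" using K by auto
    have fs: "supp_in f {\<alpha>..\<beta>}" by (rule recon_supp[OF f(1) m])
    have fV: "f \<in> V (int (Suc n))" by (rule recon_in_V[OF f(1)])
    show "c < energy M f"
    proof (cases "m + card Z \<le> 2 ^ n")
      case True
      show ?thesis
      proof (rule ccontr)
        assume "\<not> ?thesis"
        then have low: "energy M f \<le> c" by simp
        have "K0 * 2 ^ n \<le> K2 * 2 ^ n" using K by (intro mult_right_mono) auto
        moreover have "K0 * 2 ^ Suc n = 2 * (K0 * 2 ^ n)" by simp
        ultimately have M0: "K0 * 2 ^ Suc n + \<epsilon> \<le> \<epsilon> * real M / 2" using K2q M' big' by linarith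
        have sup: "real r / real (1 * 2 ^ Suc n) \<in> Z"
          if r: "r < 1 * 2 ^ Suc n" "symbol (Suc n) f (real r / real (1 * 2 ^ Suc n)) \<noteq> 0" for r
        proof (rule Z(2))
          have "real r \<le> real (1 * 2 ^ Suc n)" using r(1) by (simp only: of_nat_le_iff)
          then show "real r / real (1 * 2 ^ Suc n) \<le> 1" by (simp only: divide_le_eq_1) auto
          show "Phi K0 (real r / real (1 * 2 ^ Suc n)) \<le> c"
            by (rule exact_support[OF lat c(3) M0 fV fs f(2) low B r])
        qed simp
        have "f \<in> cspan (atom ` idx n)"
        proof (rule drop_level_of_zero_run[OF f(1) m B Z(1) sup, of "int m"])
          show "lo n \<le> int m" by (simp add: lo_def one)
          have "int (m + card Z) \<le> int (2 ^ n)" using True by (simp only: of_nat_le_iff)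
          then show "2 * (int m + int (card Z) - 1) + \<lceil>a\<rceil> < hi (Suc n)" by (simp add: hi_def one)
          show "cinner f (wavelet_atom \<psi> (int n) k) = 0" if "int m \<le> k" "k < int m + int (card Z)" for k
          proof -
            have "Inr (n, k) \<notin> idx_partial n m" using that by (auto simp: idx_partial_def idx_def one)
            from atom_perp[OF f(1) this] show ?thesis by simp
          qed
        qed
        then have fn: "f \<in> V (int n)" by (rule idx_in_V)
        have "2 * K1 * 2 ^ n + \<epsilon> \<le> \<epsilon> * real M / 2" using M' big' K2q K1p by linarith
        from gt[OF this fn fs f(2)] show False using low by simp
      qed
    next
      case False
      then have "2 ^ n \<le> m + card Z" by simp
      then have "real (2 ^ n) \<le> real (m + card Z)" by (simp only: of_nat_le_iff)
      then have "2 * K2 * 2 ^ n \<le> 2 * K2 * (real m + card Z)" using K by (intro mult_left_mono) auto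
      then have "2 * (K2 * 2 ^ n) \<le> 2 * (K2 * real m) + 2 * (K2 * card Z)" by (simp add: algebra_simps)
      moreover have "2 * K1 * 2 ^ Suc n = 2 * (2 * K1 * 2 ^ n)" by simp
      ultimately have "2 * K1 * 2 ^ Suc n + \<epsilon> \<le> \<epsilon> * real M / 2" using M' big' K1p K2q eps(1) by linarith
      then show ?thesis by (rule gt[OF _ fV fs f(2)])
    qed
  qed
qed

end

section \<open>Perfect methods and the stable sampling rate\<close>

lemma sample_norm_scale: "sample_norm s M (c *\<^sub>C f) = cmod c * sample_norm s M f"
  by (simp add: sample_norm_def cinner_scale_left norm_mult L2_set_right_distrib)

text \<open>Perturbing 0 by small multiples of \<open>f\<close> shows the difference quotient
  \<open>norm f / sample_norm s M f\<close> at every size \<open>t\<close>, since the method fixes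
  the whole space. If all samples of \<open>f\<close> vanish, \<open>f\<close> and 0 have the same
  reconstruction, so \<open>f = 0\<close>.\<close>

lemma perfect_method_stable:
  assumes rm: "reconstruction_method w s \<Theta> G" and pf: "perfect w G" and N: "1 \<le> N"
    and cn: "condition_number s (\<Theta> N) (G N) \<le> ereal \<theta>" and f: "f \<in> recon_space w N"
  shows "norm f \<le> \<theta> * sample_norm s (\<Theta> N) f"
proof -
  define M where "M = \<Theta> N"
  have fixed: "G N g = g" if "g \<in> recon_space w N" for g using pf N that by (simp add: perfect_def)
  have scale: "c *\<^sub>C f \<in> recon_space w N" for c using f unfolding recon_space_def by (rule L2.span_scale)
  have zero: "0 \<in> recon_space w N" unfolding recon_space_def by (rule L2.span_zero)
  show ?thesis
  proof (cases "sample_norm s M f = 0")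
    case True
    then have "\<forall>l\<in>sample_index M. cinner f (s l) = cinner 0 (s l)"
      using cinner_scale_left[of 0 0] by (simp add: sample_norm_def L2_set_eq_0_iff finite_sample_index)
    then have "G N f = G N 0" using rm N unfolding reconstruction_method_def M_def by blast
    then show ?thesis using fixed[OF f] fixed[OF zero] True by (simp add: M_def)
  next
    case False
    then have sn: "0 < sample_norm s M f" by (simp add: sample_norm_def less_le L2_set_nonneg)
    define h where "h t = (SUP g \<in> {g. 0 < sample_norm s M g \<and> sample_norm s M g \<le> t}.
      ereal (norm (G N (0 + g) - G N 0) / sample_norm s M g))" for t :: real
    have mono: "h t \<le> h u" if "t \<le> u" for t u unfolding h_def using that by (intro SUP_subset_mono) auto
    have low: "ereal (norm f / sample_norm s M f) \<le> h t" if t: "0 < t" for t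
    proof -
      define g where "g = complex_of_real (t / sample_norm s M f) *\<^sub>C f"
      have g: "sample_norm s M g = t" using t sn by (simp add: g_def sample_norm_scale norm_divide)
      have "norm (G N (0 + g) - G N 0) = t / sample_norm s M f * norm f"
        using fixed[OF zero] fixed[OF scale] t sn by (simp add: g_def norm_cscale norm_divide)
      then have "ereal (norm f / sample_norm s M f) = ereal (norm (G N (0 + g) - G N 0) / sample_norm s M g)"
        using t by (simp add: g)
      also have "\<dots> \<le> h t" unfolding h_def using t g by (intro SUP_upper) simp
      finally show ?thesis .
    qed
    \<comment> \<open>\<open>Lim\<close> is a definite description, so convergence has to be proved:
      \<open>h\<close> is monotone in \<open>t\<close> and tends to its infimum at 0.\<close>
    define L where "L = (INF t\<in>{0<..}. h t)"
    have "(h \<longlongrightarrow> L) (at_right 0)"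
    proof (rule order_tendstoI)
      fix b assume "b < L"
      then have "b < h t" if "0 < t" for t using that unfolding L_def by (intro less_INF_D[of _ h "{0<..}"]) auto
      then show "\<forall>\<^sub>F t in at_right 0. b < h t" unfolding eventually_at_right_field by (intro exI[of _ 1]) auto
    next
      fix b assume "L < b"
      then obtain u where "0 < u" "h u < b" unfolding L_def INF_less_iff by auto
      then show "\<forall>\<^sub>F t in at_right 0. h t < b"
        unfolding eventually_at_right_field using mono by (intro exI[of _ u]) (auto intro: le_less_trans less_imp_le)
    qed
    then have "Lim (at_right 0) h = L" by (intro tendsto_Lim) simp
    moreover have "ereal (norm f / sample_norm s M f) \<le> L" unfolding L_def using low by (intro INF_greatest) simp
    moreover have "Lim (at_right 0) h \<le> condition_number s M (G N)"
      unfolding condition_number_def h_def by (rule SUP_upper) simp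
    ultimately have "ereal (norm f / sample_norm s M f) \<le> ereal \<theta>" using cn unfolding M_def by (metis order_trans)
    then show ?thesis using sn by (simp add: M_def pos_divide_le_eq)
  qed
qed

context generalized_sampling
begin

lemma strict_eventually:
  assumes c: "0 < c" "c < 1" and \<eta>: "0 \<le> \<eta>" "\<eta> < \<eta>'"
    and stable: "\<And>N M f. N0 \<le> N \<Longrightarrow> \<eta> * real N \<le> real M \<Longrightarrow> f \<in> recon_space w N \<Longrightarrow> c * (norm f)\<^sup>2 \<le> energy M f"
  shows "\<exists>N1. \<forall>N\<ge>N1. dimn 0 < N \<and> (\<forall>M f. \<eta>' * real N \<le> real M \<longrightarrow> f \<in> recon_space w N \<longrightarrow> norm f = 1 \<longrightarrow> c < energy M f)"
proof -
  define A where "A = real_of_int \<lceil>a\<rceil>"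
  have A: "1 \<le> A" using ceiling_a(1) unfolding A_def by (metis of_int_1 of_int_le_iff)
  define p q where "p = \<epsilon> * \<eta> * A" and "q = \<epsilon> * \<eta>' * A"
  have pq: "p < q" "0 \<le> p" using eps(1) \<eta> A by (auto simp: p_def q_def)
  \<comment> \<open>\<open>K2\<close> is the reach of the samples for the slope
    \<open>\<eta>'\<close> at the start of a level. \<open>K0\<close> lies halfway between it and
    \<open>p / 4\<close>, above which \<open>Phi_ge_of_stability\<close> applies.\<close>
  define K2 K0 where "K2 = q / 4" and "K0 = (p + q) / 8"
  have K: "0 \<le> K0" "K0 < K2" "\<epsilon> * \<eta> * of_int \<lceil>a\<rceil> / 4 < K0"
    unfolding A_def[symmetric] p_def[symmetric] using pq by (auto simp: K2_def K0_def)
  have Phi: "c \<le> Phi K0 \<xi>" for \<xi> by (rule Phi_ge_of_stability[OF stable \<eta>(1) K(3)])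
  have "\<exists>n0. \<forall>n\<ge>n0. \<forall>m M f. int m \<le> 2 ^ n * \<lceil>a\<rceil> + \<lceil>a\<rceil> - 1 \<longrightarrow> K2 * 2 ^ Suc n \<le> \<epsilon> * real M / 2 \<longrightarrow>
      (\<lceil>a\<rceil> = 1 \<longrightarrow> 2 * K2 * (2 ^ n + real m) \<le> \<epsilon> * real M / 2) \<longrightarrow>
      f \<in> cspan (atom ` idx_partial n m) \<longrightarrow> norm f = 1 \<longrightarrow> c < energy M f"
  proof (cases "\<epsilon> * (3 * of_int \<lceil>a\<rceil> - 2) < 1")
    case True
    obtain J0 where J0: "\<And>J M f. J0 \<le> J \<Longrightarrow> K2 * 2 ^ J \<le> \<epsilon> * real M / 2 \<Longrightarrow> f \<in> V (int J) \<Longrightarrow> supp_in f {\<alpha>..\<beta>} \<Longrightarrow> norm f = 1 \<Longrightarrow> c < energy M f"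
      using strict_of_gap[OF True c(1) Phi K(1,2)] by blast
    show ?thesis
    proof (intro exI allI impI)
      fix n m M f assume "J0 \<le> n" and m: "int m \<le> 2 ^ n * \<lceil>a\<rceil> + \<lceil>a\<rceil> - 1" and "K2 * 2 ^ Suc n \<le> \<epsilon> * real M / 2"
        and f: "f \<in> cspan (atom ` idx_partial n m)" "norm f = 1"
      then show "c < energy M f" by (intro J0[OF _ _ recon_in_V[OF f(1)] recon_supp[OF f(1) m]]) auto
    qed
  next
    case False
    \<comment> \<open>\<open>T1 + T2\<close> is at least the length of the window, so the bound on
      \<open>\<epsilon>\<close> leaves only equality here.\<close>
    have "\<epsilon> * (3 * of_int \<lceil>a\<rceil> - 2) \<le> \<epsilon> * (T1 + T2)" using T1 T2 eps(1) by (intro mult_left_mono) auto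
    also have "\<dots> \<le> 1" using eps T_pos by (simp add: pos_le_divide_eq)
    finally have lat: "\<epsilon> * (3 * of_int \<lceil>a\<rceil> - 2) = 1" using False by simp
    show ?thesis
    proof (cases "2 \<le> \<lceil>a\<rceil>")
      case True
      obtain n0 where n0: "\<And>n M f. n0 \<le> n \<Longrightarrow> K2 * 2 ^ Suc n \<le> \<epsilon> * real M / 2 \<Longrightarrow> f \<in> cspan (atom ` idx (Suc n)) \<Longrightarrow> norm f = 1 \<Longrightarrow> c < energy M f"
        using strict_of_lattice[OF True lat c Phi K(1,2)] by blast
      show ?thesis
      proof (intro exI allI impI)
        fix n m M f assume "n0 \<le> n" "int m \<le> 2 ^ n * \<lceil>a\<rceil> + \<lceil>a\<rceil> - 1" "K2 * 2 ^ Suc n \<le> \<epsilon> * real M / 2"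
          "f \<in> cspan (atom ` idx_partial n m)" "norm f = 1"
        moreover from this have "f \<in> cspan (atom ` idx (Suc n))"
          using L2.span_mono[OF image_mono[OF idx_partial_subset]] by blast
        ultimately show "c < energy M f" by (intro n0)
      qed
    next
      case False
      then have one: "\<lceil>a\<rceil> = 1" using ceiling_a(1) by linarith
      from strict_of_haar[OF this lat c Phi K(1,2)] one show ?thesis by blast
    qed
  qed
  then obtain n0 where n0: "\<And>n m M f. n0 \<le> n \<Longrightarrow> int m \<le> 2 ^ n * \<lceil>a\<rceil> + \<lceil>a\<rceil> - 1 \<Longrightarrow> K2 * 2 ^ Suc n \<le> \<epsilon> * real M / 2 \<Longrightarrow>
      (\<lceil>a\<rceil> = 1 \<Longrightarrow> 2 * K2 * (2 ^ n + real m) \<le> \<epsilon> * real M / 2) \<Longrightarrow>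
      f \<in> cspan (atom ` idx_partial n m) \<Longrightarrow> norm f = 1 \<Longrightarrow> c < energy M f" by blast
  have "dimn n \<le> dimn (Suc n)" for n
  proof -
    have "0 \<le> 2 ^ n * \<lceil>a\<rceil>" using ceiling_a(1) by simp
    then show ?thesis using dimn_Suc[of n] ceiling_a(1) by linarith
  qed
  then have dimn_mono: "dimn i \<le> dimn j" if "i \<le> j" for i j using that by (rule lift_Suc_mono_le)
  show ?thesis
  proof (intro exI allI impI conjI)
    fix N assume N: "Suc (dimn n0) \<le> N"
    then show N0: "dimn 0 < N" using dimn_mono[of 0 n0] by simp
    fix M f assume M: "\<eta>' * real N \<le> real M" and f: "f \<in> recon_space w N" "norm f = 1"
    obtain n m where n: "N = dimn n + m" "1 \<le> m" "int m \<le> 2 ^ n * \<lceil>a\<rceil> + \<lceil>a\<rceil> - 1" by (rule dimn_partition[OF N0])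
    have "N \<le> dimn (Suc n)" using n(1,3) dimn_Suc[of n] by linarith
    then have nn: "n0 \<le> n" using N dimn_mono[of "Suc n" n0] by (cases "n0 \<le> n") auto
    have "\<epsilon> * (\<eta>' * real N) / 2 \<le> \<epsilon> * real M / 2" using M eps(1) by simp
    moreover have "\<epsilon> * (\<eta>' * (A * 2 ^ n)) / 2 \<le> \<epsilon> * (\<eta>' * real N) / 2"
      using dimn_ge[of n] n(1) \<eta> eps(1) by (intro divide_right_mono mult_left_mono) (auto simp: A_def)
    moreover have "\<epsilon> * (\<eta>' * (A * 2 ^ n)) / 2 = K2 * 2 ^ Suc n" by (simp add: K2_def q_def)
    ultimately have M1: "K2 * 2 ^ Suc n \<le> \<epsilon> * real M / 2" and MN: "\<epsilon> * (\<eta>' * real N) / 2 \<le> \<epsilon> * real M / 2" by linarith+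
    \<comment> \<open>For \<open>\<lceil>a\<rceil> = 1\<close> the dimension is exactly
      \<open>2 ^ n + m\<close>, so the reach of the samples can be followed through the
      level.\<close>
    have M2: "2 * K2 * (2 ^ n + real m) \<le> \<epsilon> * real M / 2" if one: "\<lceil>a\<rceil> = 1"
    proof -
      have "int (dimn n) = int (2 ^ n)" using dimn_eq[of n] one by simp
      then have "dimn n = 2 ^ n" by (simp only: of_nat_eq_iff)
      then have "real N = 2 ^ n + real m" using n(1) by simp
      then show ?thesis using MN by (simp add: K2_def q_def A_def one)
    qed
    show "c < energy M f"
      using f(1) unfolding n(1) recon_space_partial[OF n(3)] by (intro n0[OF nn n(3) M1 M2 _ f(2)])
  qed
qed

lemma continuous_on_energy: "continuous_on S (energy M)"
proof -
  have "continuous_on S (\<lambda>f. cinner f g)" for g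
  proof (rule continuous_onI)
    fix f :: L2 and e :: real assume "0 < e"
    show "\<exists>d>0. \<forall>f'\<in>S. dist f' f < d \<longrightarrow> dist (cinner f' g) (cinner f g) \<le> e"
    proof (intro exI[of _ "e / (norm g + 1)"] conjI ballI impI)
      show "0 < e / (norm g + 1)" using \<open>0 < e\<close> by (simp add: add_nonneg_pos)
      fix f' assume "dist f' f < e / (norm g + 1)"
      then have "norm (f' - f) * (norm g + 1) < e" by (simp add: dist_norm pos_less_divide_eq add_nonneg_pos)
      moreover have "dist (cinner f' g) (cinner f g) \<le> norm (f' - f) * norm g"
        unfolding dist_norm cinner_diff_left[symmetric] by (rule cauchy_schwarz)
      ultimately show "dist (cinner f' g) (cinner f g) \<le> e" using norm_ge_zero[of "f' - f"] unfolding distrib_left by linarith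
    qed
  qed
  then show ?thesis unfolding energy_def by (intro continuous_intros)
qed

text \<open>A strict bound for each vector survives in the infimum because the unit sphere is
  compact and the infimum is attained.\<close>

lemma subspace_cos_gt:
  assumes N: "dimn 0 < N" and gt: "\<And>f. f \<in> recon_space w N \<Longrightarrow> norm f = 1 \<Longrightarrow> c < energy M f"
  shows "sqrt c < subspace_cos w s N M"
proof -
  obtain n m where n: "N = dimn n + m" "1 \<le> m" "int m \<le> 2 ^ n * \<lceil>a\<rceil> + \<lceil>a\<rceil> - 1" by (rule dimn_partition[OF N])
  define S where "S = {f \<in> cspan (atom ` idx_partial n m). norm f = 1}"
  have S: "S = {f. f \<in> recon_space w N \<and> norm f = 1}" unfolding S_def n(1) recon_space_partial[OF n(3)] ..
  have "compact S" unfolding S_def by (rule compact_unit_sphere_span[OF atom_orthonormal]) simp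
  moreover have "\<phi> \<in> S"
  proof -
    have "Inl 0 \<in> idx_partial n m" using ceiling_a(1) by (auto simp: idx_partial_def idx_def)
    then have "atom (Inl 0) \<in> cspan (atom ` idx_partial n m)" by (intro L2.span_base imageI)
    then show ?thesis using norm_phi by (simp add: S_def)
  qed
  ultimately obtain f0 where f0: "f0 \<in> S" "\<And>f. f \<in> S \<Longrightarrow> energy M f0 \<le> energy M f"
    using continuous_attains_inf[of S "energy M"] continuous_on_energy by blast
  have P: "norm (orth_proj (sampling_space s M) f) = sqrt (energy M f)" for f
    unfolding sampling_space_def norm_orth_proj[OF s_orthonormal finite_sample_index] sample_norm_energy[symmetric] sample_norm_def ..
  have "sqrt c < sqrt (energy M f0)" using gt[of f0] f0(1) by (simp add: S)
  also have "\<dots> \<le> subspace_cos w s N M"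
    unfolding subspace_cos_def P
  proof (rule cInf_greatest)
    show "{sqrt (energy M f) |f. f \<in> recon_space w N \<and> norm f = 1} \<noteq> {}" using f0(1) by (auto simp: S)
  qed (use f0 in \<open>auto simp: S\<close>)
  finally show ?thesis .
qed

lemma stable_sampling_rate_le:
  assumes \<theta>: "1 < \<theta>" and N: "dimn 0 < N" and M: "1 \<le> M"
    and gt: "\<And>f. f \<in> recon_space w N \<Longrightarrow> norm f = 1 \<Longrightarrow> 1 / \<theta>\<^sup>2 < energy M f"
  shows "stable_sampling_rate w s N \<theta> \<le> M"
proof -
  have "sqrt (1 / \<theta>\<^sup>2) = 1 / \<theta>" using \<theta> by (simp add: real_sqrt_divide)
  then have C: "1 / \<theta> < subspace_cos w s N M" using subspace_cos_gt[OF N gt] by simp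
  moreover have "0 < 1 / \<theta>" using \<theta> by simp
  ultimately have C0: "0 < subspace_cos w s N M" by linarith
  then have "1 / subspace_cos w s N M < \<theta>" using C \<theta> by (simp add: field_simps)
  then have "1 / ereal (subspace_cos w s N M) < ereal \<theta>" using C0 by (simp add: one_ereal_def)
  then show ?thesis unfolding stable_sampling_rate_def using M by (intro Least_le) simp
qed

text \<open>Three slopes above the sampling ratio of the method: at \<open>\<eta>\<close> the
  hypothesis gives stability, at \<open>\<eta>1\<close> the inequality becomes strict, and between
  \<open>\<eta>1\<close> and \<open>\<eta>2\<close> there is room for an integer
  \<open>M\<close>.\<close>

theorem stable_sampling_ratio_le:
  assumes \<theta>: "1 < \<theta>"
    and stable: "\<forall>\<^sub>F N in sequentially. \<forall>f\<in>recon_space w N. norm f \<le> \<theta> * sample_norm s (\<Theta> N) f"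
  shows "stable_sampling_ratio w s \<theta> \<le> sampling_ratio \<Theta>"
proof (rule ccontr)
  assume "\<not> ?thesis"
  then have "sampling_ratio \<Theta> < stable_sampling_ratio w s \<theta>" by simp
  then obtain \<eta> where \<eta>: "sampling_ratio \<Theta> < ereal \<eta>" "ereal \<eta> < stable_sampling_ratio w s \<theta>" using ereal_dense2 by blast
  then obtain \<eta>2 where \<eta>2: "\<eta> < \<eta>2" "ereal \<eta>2 < stable_sampling_ratio w s \<theta>" using ereal_dense2[OF \<eta>(2)] by auto
  have "\<forall>\<^sub>F N in sequentially. ereal (real (\<Theta> N) / real N) < ereal \<eta>"
    using \<eta>(1) unfolding sampling_ratio_def by (rule Limsup_lessD)
  then have "\<forall>\<^sub>F N in sequentially. 1 \<le> N \<and> real (\<Theta> N) / real N < \<eta> \<and> (\<forall>f\<in>recon_space w N. norm f \<le> \<theta> * sample_norm s (\<Theta> N) f)"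
    using stable eventually_ge_at_top[of "1::nat"] by eventually_elim simp
  then obtain N0 where N0: "\<And>N. N0 \<le> N \<Longrightarrow> 1 \<le> N \<and> real (\<Theta> N) / real N < \<eta> \<and> (\<forall>f\<in>recon_space w N. norm f \<le> \<theta> * sample_norm s (\<Theta> N) f)"
    unfolding eventually_sequentially by blast
  have "0 \<le> real (\<Theta> N0) / real N0" by simp
  then have \<eta>0: "0 < \<eta>" using N0[of N0] by linarith
  have stable': "1 / \<theta>\<^sup>2 * (norm f)\<^sup>2 \<le> energy M f" if N: "N0 \<le> N" and M: "\<eta> * real N \<le> real M" and f: "f \<in> recon_space w N" for N M f
  proof -
    have "0 < real N" "real (\<Theta> N) / real N < \<eta>" using N0[OF N] by auto
    then have "real (\<Theta> N) < \<eta> * real N" by (simp add: pos_divide_less_eq)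
    then have "\<Theta> N \<le> M" using M by simp
    have "norm f \<le> \<theta> * sqrt (energy (\<Theta> N) f)" using N0[OF N] f unfolding sample_norm_energy by blast
    then have "(norm f)\<^sup>2 \<le> (\<theta> * sqrt (energy (\<Theta> N) f))\<^sup>2" by (intro power_mono) auto
    also have "\<dots> = \<theta>\<^sup>2 * energy (\<Theta> N) f" using energy_nonneg by (simp add: power_mult_distrib)
    also have "\<dots> \<le> \<theta>\<^sup>2 * energy M f" using energy_mono[OF \<open>\<Theta> N \<le> M\<close>] by (intro mult_left_mono) auto
    finally show ?thesis using \<theta> by (simp add: field_simps)
  qed
  define \<eta>1 where "\<eta>1 = (\<eta> + \<eta>2) / 2"
  have \<eta>1: "\<eta> < \<eta>1" "\<eta>1 < \<eta>2" using \<eta>2(1) by (auto simp: \<eta>1_def)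
  have "\<exists>N1. \<forall>N\<ge>N1. dimn 0 < N \<and>
      (\<forall>M f. \<eta>1 * real N \<le> real M \<longrightarrow> f \<in> recon_space w N \<longrightarrow> norm f = 1 \<longrightarrow> 1 / \<theta>\<^sup>2 < energy M f)"
  proof (rule strict_eventually[OF _ _ less_imp_le[OF \<eta>0] \<eta>1(1)])
    show "0 < 1 / \<theta>\<^sup>2" "1 / \<theta>\<^sup>2 < 1" using \<theta> by (auto simp: one_less_power)
  qed (rule stable')
  then obtain N1 where N1: "\<And>N. N1 \<le> N \<Longrightarrow> dimn 0 < N"
    "\<And>N M f. N1 \<le> N \<Longrightarrow> \<eta>1 * real N \<le> real M \<Longrightarrow> f \<in> recon_space w N \<Longrightarrow> norm f = 1 \<Longrightarrow> 1 / \<theta>\<^sup>2 < energy M f" by blast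
  \<comment> \<open>From here on the interval from \<open>\<eta>1 * N\<close> to
    \<open>\<eta>2 * N\<close> is longer than 1, so rounding down stays inside it, and
    \<open>M\<close> is positive.\<close>
  obtain N2 :: nat where N2: "1 / (\<eta>2 - \<eta>1) + 1 / \<eta>1 < real N2" using reals_Archimedean2 by blast
  have "real (stable_sampling_rate w s N \<theta>) / real N \<le> \<eta>2" if N: "max N1 N2 \<le> N" for N
  proof -
    have "0 < 1 / (\<eta>2 - \<eta>1)" "0 < 1 / \<eta>1" using \<eta>1 \<eta>0 by auto
    then have "1 / (\<eta>2 - \<eta>1) < real N" "1 / \<eta>1 < real N" using N2 N by linarith+
    then have big: "1 < (\<eta>2 - \<eta>1) * real N" "1 < \<eta>1 * real N"
      using \<eta>1 \<eta>0 by (simp_all add: pos_divide_less_eq mult.commute)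
    define M where "M = nat \<lfloor>\<eta>2 * real N\<rfloor>"
    have M: "real M \<le> \<eta>2 * real N" "\<eta>2 * real N - 1 \<le> real M"
      using big \<eta>1 \<eta>0 unfolding M_def by (simp add: of_nat_nat) linarith+
    have M1: "\<eta>1 * real N \<le> real M" using M(2) big(1) by (simp add: algebra_simps)
    then have "1 \<le> M" using big(2) by linarith
    then have "stable_sampling_rate w s N \<theta> \<le> M"
      using N by (intro stable_sampling_rate_le[OF \<theta> N1(1)] N1(2)[OF _ M1]) auto
    then have "real (stable_sampling_rate w s N \<theta>) \<le> \<eta>2 * real N" using M(1) by simp
    moreover have "0 < real N" using big(2) \<eta>1 \<eta>0 by (cases "N = 0") auto
    ultimately show ?thesis by (simp add: pos_divide_le_eq)
  qed
  then have "\<forall>\<^sub>F N in sequentially. ereal (real (stable_sampling_rate w s N \<theta>) / real N) \<le> ereal \<eta>2"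
    unfolding eventually_sequentially by (intro exI[of _ "max N1 N2"]) simp
  then have "stable_sampling_ratio w s \<theta> \<le> ereal \<eta>2"
    unfolding stable_sampling_ratio_def sampling_ratio_def by (rule Limsup_bounded)
  then show False using \<eta>2(2) by simp
qed

end

theorem corollary4p2:
  fixes V :: "int \<Rightarrow> L2 set" and \<phi> \<psi> :: L2 and a T1 T2 \<epsilon> \<theta> :: real
    and w :: "nat \<Rightarrow> L2" and s :: "int \<Rightarrow> L2"
    and \<Theta> :: "nat \<Rightarrow> nat" and G :: "nat \<Rightarrow> L2 \<Rightarrow> L2"
  assumes "multiresolution_analysis V \<phi>" and "associated_wavelet V \<psi>"
    and "a \<ge> 1" and "ess_support \<phi> = {0..a}" and "ess_support \<psi> = {0..a}"
    and "T1 \<ge> \<lceil>a\<rceil> - 1" and "T2 \<ge> 2 * \<lceil>a\<rceil> - 1"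
    and "0 < \<epsilon>" and "\<epsilon> \<le> 1 / (T1 + T2)"
    and w: "w = wavelet_seq \<phi> \<psi> a"
    and s: "s = fourier_atom T1 T2 \<epsilon>"
    and "reconstruction_method w s \<Theta> G" and "perfect w G"
    and "1 \<le> sampling_ratio \<Theta>" and "sampling_ratio \<Theta> < \<infinity>"
    and "1 < \<theta>"
    and "\<forall>\<^sub>F N in sequentially. condition_number s (\<Theta> N) (G N) \<le> ereal \<theta>"
  shows "stable_sampling_ratio w s \<theta> \<le> sampling_ratio \<Theta>"
proof -
  interpret generalized_sampling V \<phi> \<psi> a T1 T2 \<epsilon>
    by unfold_locales (use assms(1-9) in auto)
  have "\<forall>\<^sub>F N in sequentially. \<forall>f\<in>recon_space w N. norm f \<le> \<theta> * sample_norm s (\<Theta> N) f"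
    using assms(17) eventually_ge_at_top[of "1::nat"]
    by eventually_elim (use perfect_method_stable[OF assms(12,13)] in blast)
  then show ?thesis unfolding w s by (intro stable_sampling_ratio_le assms(16))
qed

end
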